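(* Let $T\in(0,\infty)$ and $u\in\mathbb{H}$. Choose \begin{align*} a_T=\;&6\langle\partial_1Y,\partial_1Y\rangle_T(\partial_1Y_T)^2+6\langle\partial_2Y,\partial_2Y\rangle_T(\partial_2Y_T)^2+2\langle\partial_2Y,\partial_2Y\rangle_T(\partial_1Y_T)^2\\ &+2\langle\partial_1Y,\partial_1Y\rangle_T(\partial_2Y_T)^2+4\langle\partial_1Y,\partial_2Y\rangle_T^2-3\langle\partial_1Y,\partial_1Y\rangle_T^2-3\langle\partial_2Y,\partial_2Y\rangle_T^2\\ &-2\langle\partial_1Y,\partial_1Y\rangle_T\langle\partial_2Y,\partial_2Y\rangle_T\\ &+8\int_0^T\!\!\int_0^s\partial_1Y_r\,d(\partial_2Y_r)\,d\langle\partial_1Y,\partial_2Y\rangle_s+8\int_0^T\!\!\int_0^s\partial_2Y_r\,d(\partial_1Y_r)\,d\langle\partial_1Y,\partial_2Y\rangle_s\\ &+8\int_0^T\!\!\int_0^s\partial_1Y_r\,d\langle\partial_2Y,\partial_2Y\rangle_r\,d(\partial_1Y_s)+8\int_0^T\!\!\int_0^s\langle\partial_2Y,\partial_2Y\rangle_r\,d(\partial_1Y_r)\,d(\partial_1Y_s)\\ &+8\int_0^T\!\!\int_0^s\partial_2Y_r\,d\langle\partial_1Y,\partial_1Y\rangle_r\,d(\partial_2Y_s)+8\int_0^T\!\!\int_0^s\langle\partial_1Y,\partial_1Y\rangle_r\,d(\partial_2Y_r)\,d(\partial_2Y_s), \end{align*} $$b_T=\begin{pmatrix}3\langle\partial_1Y,\partial_1Y\rangle_T\partial_1Y_T+2\langle\partial_1Y,\partial_2Y\rangle_T\partial_2Y_T+\langle\partial_2Y,\partial_2Y\rangle_T\partial_1Y_T\\3\langle\partial_2Y,\partial_2Y\rangle_T\partial_2Y_T+2\langle\partial_1Y,\partial_2Y\rangle_T\partial_1Y_T+\langle\partial_1Y,\partial_1Y\rangle_T\partial_2Y_T\end{pmatrix},$$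 $c_T:\mathbb{R}^2\to\mathbb{R}$, $$c_T((x_1,x_2))=6\langle\partial_1Y,\partial_1Y\rangle_Tx_1^2+6\langle\partial_2Y,\partial_2Y\rangle_Tx_2^2+2\langle\partial_1Y,\partial_1Y\rangle_Tx_2^2+2\langle\partial_2Y,\partial_2Y\rangle_Tx_1^2+8\langle\partial_1Y,\partial_2Y\rangle_Tx_1x_2,$$ and $d_T=\langle\partial_1Y,\partial_1Y\rangle_T+\langle\partial_2Y,\partial_2Y\rangle_T$. Then \begin{align*} &\int_{\mathbb{T}^2}|\nabla Y_T+\nabla Z_T(u)|^4-2|\nabla Y_T+\nabla Z_T(u)|^2-c_T(\nabla Z_T(u))-4b_T\cdot\nabla Z_T(u)-a_T+2d_T\,dx\\ &=\int_{\mathbb{T}^2}[\![\nabla Y_T^4]\!]+4[\![\nabla Y_T^3]\!]\cdot\nabla Z_T(u)+4\nabla Y_T\cdot(\nabla Z_T(u))^3+(\nabla Z_T(u))^4\\ &\quad+\sum_{i,j,k,l\in\{1,2\}}2(\delta_{ik}\delta_{jl}+\delta_{il}\delta_{jk}+\delta_{ij}\delta_{kl})[\![\partial_iY_T\partial_jY_T]\!]\,\partial_kZ_T(u)\,\partial_lZ_T(u)\\ &\quad-2[\![\nabla Y_T^2]\!]-4\nabla Y_T\cdot\nabla Z_T(u)-2(\nabla Z_T(u))^2\,dx. \end{align*} Moreover, if \begin{align*} \Phi_T(u):=\int_{\mathbb{T}^2}&4\nabla Y_T\cdot(\nabla Z_T(u))^3+4[\![\nabla Y_T^3]\!]\cdot\nabla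 Z_T(u)\\ &+\sum_{i,j,k,l\in\{1,2\}}2(\delta_{ik}\delta_{jl}+\delta_{il}\delta_{jk}+\delta_{ij}\delta_{kl})[\![\partial_iY_T\partial_jY_T]\!]\,\partial_kZ_T(u)\,\partial_lZ_T(u)\\ &-4\nabla Y_T\cdot\nabla Z_T(u)-2(\nabla Z_T(u))^2\,dx, \end{align*} then the functional \begin{align*} F_T(u):=\mathbb{E}\bigg[&f(Y_T+Z_T(u))+\int_{\mathbb{T}^2}|\nabla Y_T+\nabla Z_T(u)|^4-2|\nabla Y_T+\nabla Z_T(u)|^2\\ &-c_T(\nabla Z_T(u))-4b_T\cdot\nabla Z_T(u)-a_T+2d_T\,dx+\frac12\int_0^\infty\|u_s\|_{L^2}^2\,ds\bigg] \end{align*} has the representation $$F_T(u)=\mathbb{E}\left[f(Y_T+Z_T(u))+\Phi_T(u)+\|\nabla Z_T(u)\|_{L^4}^4+\frac12\int_0^\infty\|u_s\|_{L^2}^2\,ds\right].$$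
   Context: Setting (for the Hamiltonian $H(\varphi)=\int_{\mathbb{T}^2}|\nabla\varphi|^4-|\nabla\varphi|^2+|\Delta\varphi|^2\,dx$, written as $\int|\nabla\varphi|^4-2|\nabla\varphi|^2+|\nabla\varphi|^2+|\Delta\varphi|^2\,dx$): $\mathbb{T}^2=(\mathbb{R}/2\pi\mathbb{Z})^2$, with $dx$ normalized so that $(e^{i\langle\cdot,n\rangle})_{n\in\mathbb{Z}^2}$ is orthonormal in $L^2(\mathbb{T}^2)$ (so $\int_{\mathbb{T}^2}dx=1$). A dot over a function space denotes the subspace of zero-mean functions. For $v\in\mathbb{R}^2$ and $k\in\mathbb{N}$: $v^k=|v|^{k-1}v$ if $k$ is odd, $v^k=|v|^k$ if $k$ is even. $h(D)$ is the Fourier multiplier with symbol $h$. $\delta_{ij}$ is the Kronecker delta. Gaussian process: Let $\Omega=C(\mathbb{R}^+;\dot H^\alpha(\mathbb{T}^2))$, $\alpha<-1$, with the Borel $\sigma$-algebra and the Wiener measure $\mathbb{P}$ such that the canonical process is $X_t(x)=\sum_{n\in\mathbb{Z}^2\setminus\{0\}}e^{i\langle x,n\rangle}B^n_t$, with $\mathbb{C}$-valued Brownian motions $B^n$ ($\mathbb{E}|B^n_t|^2=t$), $\overline{B^n}=B^{-n}$, and $B^n,B^m$ independent for $m\neq\pm n$. Let $\zeta\in C^\infty(\mathbb{R}_+,[0,1])$ be decreasing with $\zeta(s)=1$ for $s\le\frac12$, $\zeta(s)=0$ for $s\ge1$; set $\zeta_t(x)=\zeta\big((1+|x|^2)^{1/2}/t\big)$,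 $\sigma_t(x)=\big(\frac{d}{dt}\zeta_t^2(x)\big)^{1/2}$, $J_t=\frac{\sigma_t(D)}{(|D|^2+|D|^4)^{1/2}}$, and $$Y_t=\int_0^tJ_s\,dX_s=\sum_{n\in\mathbb{Z}^2\setminus\{0\}}\int_0^t\frac{\sigma_s(n)}{(|n|^2+|n|^4)^{1/2}}e^{i\langle\cdot,n\rangle}\,dB^n_s.$$ For each fixed $x\in\mathbb{T}^2$, $\langle\partial_iY,\partial_jY\rangle_t$ is the quadratic covariation at time $t$ of the martingales $\partial_iY(x),\partial_jY(x)$ (it depends neither on $x$ nor on $\omega$); stochastic integrals are It\^o integrals, taken pointwise in $x$. Drifts: $\mathcal{H}=L^2([0,\infty);\dot L^2(\mathbb{T}^2))$; $\mathbb{H}$ is the space of $\dot L^2(\mathbb{T}^2)$-valued predictable processes whose trajectories lie a.s. in $\mathcal{H}$; $Z_T(u)=\int_0^TJ_tu_t\,dt$. $f$ is a real-valued continuous function with linear growth on $\mathscr{C}^{1-\kappa}(\mathbb{T}^2)$ ($\kappa>0$ fixed; $\mathscr{C}^\alpha$ is the closure of the smooth functions in the Besov space $B^\alpha_{\infty,\infty}(\mathbb{T}^2)$). Wick powers: $[\![\nabla Y_T^4]\!]:=(\nabla Y_T)^4-a_T$, $[\![\nabla Y_T^3]\!]:=(\nabla Y_T)^3-b_T$ with $a_T,b_T$ the expressions displayed in the claim, $[\![\partial_iY_T\partial_jY_T]\!]:=\partial_iY_T\partial_jY_T-\langle\partial_iY,\partial_jY\rangle_T$, and $[\![\nabla Y_T^2]\!]:=\sum_{i=1}^2[\![\partial_iY_T\partial_iY_T]\!]$.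 *)

theory Defs
  imports "HOL-Probability.Probability"
begin

section \<open>Functions and distributions on the torus\<close>

text \<open>
  Functions on the torus $(R/2\pi Z)^2$ are \<open>2\<pi>\<close>-periodic functions on \<open>real^2\<close>, integrated against the
  normalised Lebesgue measure of one period cell.  Spaces of functions and distributions are real.
  Elements of the spaces $\dot H^\alpha$ and $C^\alpha$, which may be genuine distributions, are
  represented by their families of Fourier coefficients \<open>int^2 \<Rightarrow> complex\<close>.
\<close>

definition torus :: "(real^2) measure" where
  "torus = uniform_measure lborel (cbox 0 (\<chi> i. 2 * pi))"

definition periodic :: "(real^2 \<Rightarrow> 'b) \<Rightarrow> bool" where
  "periodic g \<longleftrightarrow> (\<forall>x i. g (x + axis i (2 * pi)) = g x)"

definition rvec :: "int^2 \<Rightarrow> real^2" where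
  "rvec n = (\<chi> i. real_of_int (n $ i))"

definition fourier_mode :: "int^2 \<Rightarrow> real^2 \<Rightarrow> complex" where
  "fourier_mode n x = cis (x \<bullet> rvec n)"

definition fourier_coeff :: "(real^2 \<Rightarrow> real) \<Rightarrow> int^2 \<Rightarrow> complex" where
  "fourier_coeff g n = (\<integral>x. of_real (g x) * cnj (fourier_mode n x) \<partial>torus)"

text \<open>
  The operator $h(D)$ on real functions.  It is used only for even real symbols that vanish outside
  a finite set of frequencies, so the sum is finite and real.
\<close>

definition multiplier :: "(real^2 \<Rightarrow> real) \<Rightarrow> (real^2 \<Rightarrow> real) \<Rightarrow> real^2 \<Rightarrow> real" where
  "multiplier h v x =
     Re (\<Sum>\<^sub>\<infinity>n. of_real (h (rvec n)) * fourier_coeff v n * fourier_mode n x)"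

definition Lp_norm :: "real \<Rightarrow> (real^2 \<Rightarrow> 'b::real_normed_vector) \<Rightarrow> real" where
  "Lp_norm p g = (\<integral>x. norm (g x) powr p \<partial>torus) powr (1 / p)"

definition L2dot :: "(real^2 \<Rightarrow> real) set" where
  "L2dot = {v. periodic v \<and> v \<in> borel_measurable borel \<and>
               integrable torus (\<lambda>x. (v x)\<^sup>2) \<and> (\<integral>x. v x \<partial>torus) = 0}"

definition open_L2dot :: "(real^2 \<Rightarrow> real) set \<Rightarrow> bool" where
  "open_L2dot U \<longleftrightarrow> U \<subseteq> L2dot \<and>
     (\<forall>v\<in>U. \<exists>r>0. \<forall>w\<in>L2dot. Lp_norm 2 (\<lambda>x. w x - v x) < r \<longrightarrow> w \<in> U)"

definition pd :: "2 \<Rightarrow> (real^2 \<Rightarrow> real) \<Rightarrow> real^2 \<Rightarrow> real" where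
  "pd i g x = frechet_derivative g (at x) (axis i 1)"

definition grad :: "(real^2 \<Rightarrow> real) \<Rightarrow> real^2 \<Rightarrow> real^2" where
  "grad g x = (\<chi> i. pd i g x)"

definition smooth_torus :: "(real^2 \<Rightarrow> real) \<Rightarrow> bool" where
  "smooth_torus g \<longleftrightarrow> periodic g \<and> (\<forall>is. (foldr pd is g) differentiable_on UNIV)"

definition real_coeffs :: "(int^2 \<Rightarrow> complex) \<Rightarrow> bool" where
  "real_coeffs c \<longleftrightarrow> (\<forall>n. c (- n) = cnj (c n))"

definition Hdot :: "real \<Rightarrow> (int^2 \<Rightarrow> complex) set" where
  "Hdot \<alpha> = {c. real_coeffs c \<and> c 0 = 0 \<and>
                (\<lambda>n. norm (rvec n) powr (2 * \<alpha>) * (cmod (c n))\<^sup>2) summable_on UNIV}"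

definition Hdot_norm :: "real \<Rightarrow> (int^2 \<Rightarrow> complex) \<Rightarrow> real" where
  "Hdot_norm \<alpha> c = sqrt (\<Sum>\<^sub>\<infinity>n. norm (rvec n) powr (2 * \<alpha>) * (cmod (c n))\<^sup>2)"

text \<open>
  Only the values of a cutoff on the half-line matter; smoothness at 0 is implied by constancy near 0.
\<close>

definition cutoff :: "(real \<Rightarrow> real) \<Rightarrow> bool" where
  "cutoff \<zeta> \<longleftrightarrow>
     (\<forall>k. \<forall>s>0. ((deriv ^^ k) \<zeta>) field_differentiable (at s)) \<and>
     (\<forall>s\<ge>0. 0 \<le> \<zeta> s \<and> \<zeta> s \<le> 1) \<and>
     (\<forall>s t. 0 \<le> s \<longrightarrow> s \<le> t \<longrightarrow> \<zeta> t \<le> \<zeta> s) \<and>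
     (\<forall>s. 0 \<le> s \<longrightarrow> s \<le> 1/2 \<longrightarrow> \<zeta> s = 1) \<and>
     (\<forall>s\<ge>1. \<zeta> s = 0)"

text \<open>
  Littlewood--Paley decomposition generated by a radial cutoff \<open>\<theta>\<close>.  The block with natural number
  \<open>j\<close> is the usual block \<open>j - 1\<close>, which explains the weight in the Besov norm.  Different \<open>\<theta>\<close> give
  equivalent norms.
\<close>

definition lp_symbol :: "(real \<Rightarrow> real) \<Rightarrow> nat \<Rightarrow> real^2 \<Rightarrow> real" where
  "lp_symbol \<theta> j \<xi> = (if j = 0 then \<theta> (norm \<xi>)
                      else \<theta> (norm \<xi> / 2 ^ j) - \<theta> (norm \<xi> / 2 ^ (j - 1)))"

definition lp_block :: "(real \<Rightarrow> real) \<Rightarrow> nat \<Rightarrow> (int^2 \<Rightarrow> complex) \<Rightarrow> real^2 \<Rightarrow> complex" where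
  "lp_block \<theta> j c x = (\<Sum>\<^sub>\<infinity>n. of_real (lp_symbol \<theta> j (rvec n)) * c n * fourier_mode n x)"

definition besov_norm :: "(real \<Rightarrow> real) \<Rightarrow> real \<Rightarrow> (int^2 \<Rightarrow> complex) \<Rightarrow> ennreal" where
  "besov_norm \<theta> \<alpha> c =
     (SUP j. ennreal (2 powr (\<alpha> * (real j - 1))) * (SUP x. ennreal (cmod (lp_block \<theta> j c x))))"

definition besov_closure :: "(real \<Rightarrow> real) \<Rightarrow> real \<Rightarrow> (int^2 \<Rightarrow> complex) set" where
  "besov_closure \<theta> \<alpha> =
     {c. real_coeffs c \<and>
         (\<forall>\<epsilon>>0. \<exists>g. smooth_torus g \<and> besov_norm \<theta> \<alpha> (\<lambda>n. c n - fourier_coeff g n) < ennreal \<epsilon>)}"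

definition continuous_linear_growth ::
  "(real \<Rightarrow> real) \<Rightarrow> real \<Rightarrow> ((int^2 \<Rightarrow> complex) \<Rightarrow> real) \<Rightarrow> bool" where
  "continuous_linear_growth \<theta> \<alpha> f \<longleftrightarrow>
     (\<forall>c\<in>besov_closure \<theta> \<alpha>. \<forall>\<epsilon>>0. \<exists>\<delta>>0. \<forall>d\<in>besov_closure \<theta> \<alpha>.
        besov_norm \<theta> \<alpha> (\<lambda>n. d n - c n) < ennreal \<delta> \<longrightarrow> \<bar>f d - f c\<bar> < \<epsilon>) \<and>
     (\<exists>C. \<forall>c\<in>besov_closure \<theta> \<alpha>. \<bar>f c\<bar> \<le> C * (1 + enn2real (besov_norm \<theta> \<alpha> c)))"


section \<open>The Wiener measure on path space\<close>

text \<open>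
  A path \<open>\<omega>\<close> maps a time \<open>t \<ge> 0\<close> to the Fourier coefficients of \<open>X\<^sub>t\<close>, so the canonical Brownian
  motions are \<open>B\<^sup>n\<^sub>t(\<omega>) = \<omega> t n\<close>.  Path space carries the topology of locally uniform convergence.
\<close>

type_synonym path = "real \<Rightarrow> int^2 \<Rightarrow> complex"

definition path_space :: "real \<Rightarrow> path set" where
  "path_space \<alpha> =
     {\<omega> \<in> {0..} \<rightarrow>\<^sub>E Hdot \<alpha>.
        \<forall>t\<ge>0. \<forall>\<epsilon>>0. \<exists>\<delta>>0. \<forall>s\<ge>0. \<bar>s - t\<bar> < \<delta> \<longrightarrow> Hdot_norm \<alpha> (\<lambda>n. \<omega> s n - \<omega> t n) < \<epsilon>}"

definition open_paths :: "real \<Rightarrow> path set \<Rightarrow> bool" where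
  "open_paths \<alpha> U \<longleftrightarrow> U \<subseteq> path_space \<alpha> \<and>
     (\<forall>\<omega>\<in>U. \<exists>T>0. \<exists>\<epsilon>>0. \<forall>\<omega>'\<in>path_space \<alpha>.
        (\<forall>t\<in>{0..T}. Hdot_norm \<alpha> (\<lambda>n. \<omega>' t n - \<omega> t n) < \<epsilon>) \<longrightarrow> \<omega>' \<in> U)"

definition path_borel :: "real \<Rightarrow> path measure" where
  "path_borel \<alpha> = sigma (path_space \<alpha>) {U. open_paths \<alpha> U}"

definition brownian_motion :: "'w measure \<Rightarrow> (real \<Rightarrow> 'w \<Rightarrow> real) \<Rightarrow> bool" where
  "brownian_motion P b \<longleftrightarrow>
     (AE \<omega> in P. b 0 \<omega> = 0) \<and>
     (AE \<omega> in P. continuous_on {0..} (\<lambda>t. b t \<omega>)) \<and>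
     (\<forall>s t. 0 \<le> s \<longrightarrow> s < t \<longrightarrow>
        distributed P lborel (\<lambda>\<omega>. b t \<omega> - b s \<omega>) (normal_density 0 (sqrt (t - s)))) \<and>
     (\<forall>m (p :: nat \<Rightarrow> real). 0 \<le> p 0 \<longrightarrow> (\<forall>i<m. p i \<le> p (Suc i)) \<longrightarrow>
        prob_space.indep_vars P (\<lambda>_. borel) (\<lambda>i \<omega>. b (p (Suc i)) \<omega> - b (p i) \<omega>) {..<m})"

definition complex_brownian_motion :: "'w measure \<Rightarrow> (real \<Rightarrow> 'w \<Rightarrow> complex) \<Rightarrow> bool" where
  "complex_brownian_motion P B \<longleftrightarrow>
     brownian_motion P (\<lambda>t \<omega>. sqrt 2 * Re (B t \<omega>)) \<and>
     brownian_motion P (\<lambda>t \<omega>. sqrt 2 * Im (B t \<omega>)) \<and>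
     prob_space.indep_var P
       (Pi\<^sub>M {0..} (\<lambda>_. borel)) (\<lambda>\<omega>. \<lambda>t\<in>{0..}. Re (B t \<omega>))
       (Pi\<^sub>M {0..} (\<lambda>_. borel)) (\<lambda>\<omega>. \<lambda>t\<in>{0..}. Im (B t \<omega>))"

text \<open>
  The relation between the coefficients of \<open>n\<close> and \<open>-n\<close> is part of \<open>Hdot\<close>.  Independence is joint
  independence of the processes over any set of frequencies containing no pair \<open>n, -n\<close>.
\<close>

definition wiener_measure :: "real \<Rightarrow> path measure \<Rightarrow> bool" where
  "wiener_measure \<alpha> P \<longleftrightarrow>
     prob_space P \<and> space P = path_space \<alpha> \<and> sets P = sets (path_borel \<alpha>) \<and>
     (\<forall>n. n \<noteq> 0 \<longrightarrow> complex_brownian_motion P (\<lambda>t \<omega>. \<omega> t n)) \<and>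
     (\<forall>N. 0 \<notin> N \<longrightarrow> (\<forall>n\<in>N. - n \<notin> N) \<longrightarrow>
        prob_space.indep_vars P (\<lambda>_. Pi\<^sub>M {0..} (\<lambda>_. borel)) (\<lambda>n \<omega>. \<lambda>t\<in>{0..}. \<omega> t n) N)"

text \<open>
  The filtration of the canonical process, augmented by the null sets of \<open>P\<close>.
\<close>

definition canonical_filtration :: "path measure \<Rightarrow> real \<Rightarrow> path measure" where
  "canonical_filtration P t = sigma (space P)
     {A \<in> sets P. \<exists>B \<in> sigma_sets (space P)
                        {{\<omega> \<in> space P. \<omega> s n \<in> C} |s n C. 0 \<le> s \<and> s \<le> t \<and> C \<in> sets borel}.
        (A - B) \<union> (B - A) \<in> null_sets P}"

definition predictable_sigma :: "'w measure \<Rightarrow> (real \<Rightarrow> 'w measure) \<Rightarrow> (real \<times> 'w) measure" where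
  "predictable_sigma P F = sigma ({0..} \<times> space P)
     ({{0} \<times> A |A. A \<in> sets (F 0)} \<union> {{s<..t} \<times> A |s t A. 0 \<le> s \<and> s \<le> t \<and> A \<in> sets (F s)})"


section \<open>Stochastic and Stieltjes integrals\<close>

definition partition_of :: "real \<Rightarrow> real \<Rightarrow> nat \<Rightarrow> (nat \<Rightarrow> real) \<Rightarrow> bool" where
  "partition_of t \<delta> m p \<longleftrightarrow>
     p 0 = 0 \<and> p m = t \<and> (\<forall>i<m. p i \<le> p (Suc i) \<and> p (Suc i) - p i < \<delta>)"

text \<open>
  Riemann--Stieltjes integral of \<open>g\<close> against \<open>A\<close> over the interval from 0 to \<open>t\<close>.
\<close>

definition rs_integral :: "(real \<Rightarrow> real) \<Rightarrow> (real \<Rightarrow> real) \<Rightarrow> real \<Rightarrow> real" where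
  "rs_integral g A t = (THE I. \<forall>\<epsilon>>0. \<exists>\<delta>>0. \<forall>m p \<tau>.
     partition_of t \<delta> m p \<longrightarrow> (\<forall>i<m. \<tau> i \<in> {p i..p (Suc i)}) \<longrightarrow>
     \<bar>(\<Sum>i<m. g (\<tau> i) * (A (p (Suc i)) - A (p i))) - I\<bar> < \<epsilon>)"

text \<open>
  Quadratic covariation at time \<open>t\<close>: limit in probability of the sums of products of increments as
  the mesh tends to 0.  Probabilities are written as integrals of indicators because the processes
  below are defined by limits and derivatives and are measurable only up to null sets; the measure
  of a non-measurable set would be 0 by convention.
\<close>

definition quad_covariation ::
  "'w measure \<Rightarrow> (real \<Rightarrow> 'w \<Rightarrow> real) \<Rightarrow> (real \<Rightarrow> 'w \<Rightarrow> real) \<Rightarrow> real \<Rightarrow> ('w \<Rightarrow> real) \<Rightarrow> bool" where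
  "quad_covariation P M N t q \<longleftrightarrow>
     (\<forall>\<epsilon>>0. \<exists>\<delta>>0. \<forall>m p. partition_of t \<delta> m p \<longrightarrow>
        (\<integral>\<^sup>+\<omega>. indicator {\<omega>. \<bar>(\<Sum>i<m. (M (p (Suc i)) \<omega> - M (p i) \<omega>) *
                                    (N (p (Suc i)) \<omega> - N (p i) \<omega>)) - q \<omega>\<bar> > \<epsilon>} \<omega> \<partial>P)
          < ennreal \<epsilon>)"

text \<open>
  A simple process is the sum over \<open>i < m\<close> of \<open>\<xi> i\<close> times the indicator of the interval
  \<open>(p i, p (i+1)]\<close>, with \<open>\<xi> i\<close> bounded and known at time \<open>p i\<close>.
\<close>

definition simple_process ::
  "'w measure \<Rightarrow> (real \<Rightarrow> 'w measure) \<Rightarrow> nat \<Rightarrow> (nat \<Rightarrow> real) \<Rightarrow> (nat \<Rightarrow> 'w \<Rightarrow> real) \<Rightarrow> bool" where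
  "simple_process P F m p \<xi> \<longleftrightarrow> 0 \<le> p 0 \<and>
     (\<forall>i<m. p i \<le> p (Suc i) \<and> \<xi> i \<in> borel_measurable (F (p i)) \<and>
            (\<exists>C. \<forall>\<omega>\<in>space P. \<bar>\<xi> i \<omega>\<bar> \<le> C))"

definition simple_value :: "nat \<Rightarrow> (nat \<Rightarrow> real) \<Rightarrow> (nat \<Rightarrow> 'w \<Rightarrow> real) \<Rightarrow> real \<Rightarrow> 'w \<Rightarrow> real" where
  "simple_value m p \<xi> s \<omega> = (\<Sum>i<m. \<xi> i \<omega> * indicator {p i<..p (Suc i)} s)"

definition simple_integral ::
  "nat \<Rightarrow> (nat \<Rightarrow> real) \<Rightarrow> (nat \<Rightarrow> 'w \<Rightarrow> real) \<Rightarrow> (real \<Rightarrow> 'w \<Rightarrow> real) \<Rightarrow> real \<Rightarrow> 'w \<Rightarrow> real" where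
  "simple_integral m p \<xi> M t \<omega> =
     (\<Sum>i<m. \<xi> i \<omega> * (M (min (p (Suc i)) t) \<omega> - M (min (p i) t) \<omega>))"

text \<open>
  \<open>ito_integral P F M H I\<close>: the process \<open>I\<close> is a continuous version of the Ito integral
  $I_t = \int_0^t H_s\,dM_s$ of \<open>H\<close> against the continuous square-integrable martingale \<open>M\<close>, that is,
  the limit in $L^2(P)$ of integrals of simple processes which converge to \<open>H\<close> in
  $L^2(d\langle M,M\rangle \otimes P)$ on every \<open>[0,t]\<close>; \<open>A\<close> is the bracket of \<open>M\<close>, extended by
  its initial value to negative times.
\<close>

definition ito_integral ::
  "'w measure \<Rightarrow> (real \<Rightarrow> 'w measure) \<Rightarrow> (real \<Rightarrow> 'w \<Rightarrow> real) \<Rightarrow> (real \<Rightarrow> 'w \<Rightarrow> real)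
     \<Rightarrow> (real \<Rightarrow> 'w \<Rightarrow> real) \<Rightarrow> bool" where
  "ito_integral P F M H I \<longleftrightarrow>
     (\<forall>t\<ge>0. I t \<in> borel_measurable (F t)) \<and>
     (AE \<omega> in P. continuous_on {0..} (\<lambda>t. I t \<omega>)) \<and>
     (\<exists>A m p \<xi>.
        (\<forall>t\<ge>0. A t \<in> borel_measurable (F t) \<and> quad_covariation P M M t (A t)) \<and>
        (AE \<omega> in P. A 0 \<omega> = 0 \<and> continuous_on {0..} (\<lambda>t. A t \<omega>) \<and> mono_on {0..} (\<lambda>t. A t \<omega>)) \<and>
        (\<forall>k::nat. simple_process P F (m k) (p k) (\<xi> k)) \<and>
        (\<forall>t\<ge>0.
           (\<lambda>k. \<integral>\<^sup>+\<omega>. (\<integral>\<^sup>+s. ennreal ((simple_value (m k) (p k) (\<xi> k) s \<omega> - H s \<omega>)\<^sup>2)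
                                  * indicator {0..t} s
                             \<partial>interval_measure (\<lambda>s. A (max 0 s) \<omega>)) \<partial>P) \<longlonglongrightarrow> 0 \<and>
           (\<lambda>k. \<integral>\<^sup>+\<omega>. ennreal ((simple_integral (m k) (p k) (\<xi> k) M t \<omega> - I t \<omega>)\<^sup>2) \<partial>P)
              \<longlonglongrightarrow> 0))"


section \<open>The Gaussian process and the drift\<close>

text \<open>
  The value for \<open>t \<le> 0\<close> is the limit at \<open>t = 0\<close>, where division by zero would otherwise give 1.
\<close>

definition zeta_t :: "(real \<Rightarrow> real) \<Rightarrow> real \<Rightarrow> real^2 \<Rightarrow> real" where
  "zeta_t \<zeta> t \<xi> = (if t > 0 then \<zeta> (sqrt (1 + (norm \<xi>)\<^sup>2) / t) else 0)"

definition sigma_t :: "(real \<Rightarrow> real) \<Rightarrow> real \<Rightarrow> real^2 \<Rightarrow> real" where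
  "sigma_t \<zeta> t \<xi> = sqrt (deriv (\<lambda>s. (zeta_t \<zeta> s \<xi>)\<^sup>2) t)"

definition J_symbol :: "(real \<Rightarrow> real) \<Rightarrow> real \<Rightarrow> real^2 \<Rightarrow> real" where
  "J_symbol \<zeta> t \<xi> = sigma_t \<zeta> t \<xi> / sqrt ((norm \<xi>)\<^sup>2 + (norm \<xi>) ^ 4)"

text \<open>
  \<open>Y t \<omega> x\<close> is $Y_t(x)$, where \<open>W n\<close> is a version of the complex stochastic integral of the n-th
  mode.  For given \<open>t\<close>, almost surely only finitely many modes are nonzero, and the sum is real.
\<close>

definition gaussian_process ::
  "path measure \<Rightarrow> (real \<Rightarrow> real) \<Rightarrow> (real \<Rightarrow> path \<Rightarrow> real^2 \<Rightarrow> real) \<Rightarrow> bool" where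
  "gaussian_process P \<zeta> Y \<longleftrightarrow>
     (\<exists>W. (\<forall>n. n \<noteq> 0 \<longrightarrow>
              ito_integral P (canonical_filtration P) (\<lambda>t \<omega>. Re (\<omega> t n))
                (\<lambda>s \<omega>. J_symbol \<zeta> s (rvec n)) (\<lambda>t \<omega>. Re (W n t \<omega>)) \<and>
              ito_integral P (canonical_filtration P) (\<lambda>t \<omega>. Im (\<omega> t n))
                (\<lambda>s \<omega>. J_symbol \<zeta> s (rvec n)) (\<lambda>t \<omega>. Im (W n t \<omega>))) \<and>
          (\<forall>t\<ge>0. \<forall>\<omega>\<in>space P. \<forall>x. Y t \<omega> x = Re (\<Sum>\<^sub>\<infinity>n\<in>-{0}. fourier_mode n x * W n t \<omega>)))"

text \<open>
  The bracket of the i-th and j-th partial derivatives of \<open>Y\<close> at a point, as a number that depends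
  neither on the point nor on the path.
\<close>

definition bracket ::
  "'w measure \<Rightarrow> (real \<Rightarrow> 'w \<Rightarrow> real^2 \<Rightarrow> real) \<Rightarrow> 2 \<Rightarrow> 2 \<Rightarrow> real \<Rightarrow> real" where
  "bracket P Y i j t =
     (THE q. \<forall>x. quad_covariation P (\<lambda>s \<omega>. pd i (Y s \<omega>) x) (\<lambda>s \<omega>. pd j (Y s \<omega>) x) t (\<lambda>_. q))"

definition drift_space :: "path measure \<Rightarrow> (real \<Rightarrow> path \<Rightarrow> real^2 \<Rightarrow> real) set" where
  "drift_space P = {u.
     (\<forall>t\<ge>0. \<forall>\<omega>\<in>space P. u t \<omega> \<in> L2dot) \<and>
     (\<forall>U. open_L2dot U \<longrightarrow>
        {(t, \<omega>). t \<ge> 0 \<and> \<omega> \<in> space P \<and> u t \<omega> \<in> U}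
          \<in> sets (predictable_sigma P (canonical_filtration P))) \<and>
     (AE \<omega> in P. (\<integral>\<^sup>+t. ennreal ((Lp_norm 2 (u t \<omega>))\<^sup>2) * indicator {0..} t \<partial>lborel) < \<infinity>)}"

definition Z_drift ::
  "(real \<Rightarrow> real) \<Rightarrow> real \<Rightarrow> (real \<Rightarrow> 'w \<Rightarrow> real^2 \<Rightarrow> real) \<Rightarrow> 'w \<Rightarrow> real^2 \<Rightarrow> real" where
  "Z_drift \<zeta> T u \<omega> x = (LBINT t:{0..T}. multiplier (J_symbol \<zeta> t) (u t \<omega>) x)"


section \<open>Counterterms, Wick powers and the functionals\<close>

text \<open>
  Iterated stochastic integrals are determined only up to null sets for each \<open>x\<close>, so versions that
  are jointly measurable in \<open>x\<close> and \<open>\<omega>\<close> are needed for integrating over the torus.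
\<close>

definition ito_field ::
  "path measure \<Rightarrow> (real \<Rightarrow> path \<Rightarrow> real^2 \<Rightarrow> real) \<Rightarrow> 2 \<Rightarrow> (real^2 \<Rightarrow> real \<Rightarrow> path \<Rightarrow> real)
     \<Rightarrow> (real^2 \<Rightarrow> real \<Rightarrow> path \<Rightarrow> real) \<Rightarrow> bool" where
  "ito_field P Y j H I \<longleftrightarrow>
     (\<forall>x. ito_integral P (canonical_filtration P) (\<lambda>t \<omega>. pd j (Y t \<omega>) x) (H x) (I x)) \<and>
     (\<forall>t\<ge>0. (\<lambda>(x, \<omega>). I x t \<omega>) \<in> borel_measurable (borel \<Otimes>\<^sub>M P))"

text \<open>
  With $q_j$ the bracket of $\partial_j Y$ with itself, for distinct i and j:
  $K_{ij}(s) = \int_0^s \partial_i Y_r\,d(\partial_j Y_r)$,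
  $L_{ij}(T) = \int_0^T\int_0^s \partial_i Y_r\,dq_j(r)\,d(\partial_i Y_s)$,
  $N_{ij}(s) = \int_0^s q_j(r)\,d(\partial_i Y_r)$ and
  $Q_{ij}(T) = \int_0^T N_{ij}(s)\,d(\partial_i Y_s)$, each at a point \<open>x\<close>.
\<close>

type_synonym ito_family = "2 \<Rightarrow> 2 \<Rightarrow> real^2 \<Rightarrow> real \<Rightarrow> path \<Rightarrow> real"

definition iterated_integrals ::
  "path measure \<Rightarrow> (real \<Rightarrow> path \<Rightarrow> real^2 \<Rightarrow> real)
     \<Rightarrow> ito_family \<Rightarrow> ito_family \<Rightarrow> ito_family \<Rightarrow> ito_family \<Rightarrow> bool" where
  "iterated_integrals P Y K L N Q \<longleftrightarrow>
     (\<forall>i j. i \<noteq> j \<longrightarrow>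
        ito_field P Y j (\<lambda>x s \<omega>. pd i (Y s \<omega>) x) (K i j) \<and>
        ito_field P Y i (\<lambda>x s \<omega>. rs_integral (\<lambda>r. pd i (Y r \<omega>) x) (bracket P Y j j) s) (L i j) \<and>
        ito_field P Y i (\<lambda>x s \<omega>. bracket P Y j j s) (N i j) \<and>
        ito_field P Y i (N i j) (Q i j))"

definition a_T ::
  "path measure \<Rightarrow> (real \<Rightarrow> path \<Rightarrow> real^2 \<Rightarrow> real) \<Rightarrow> ito_family \<Rightarrow> ito_family \<Rightarrow> ito_family
     \<Rightarrow> real \<Rightarrow> path \<Rightarrow> real^2 \<Rightarrow> real" where
  "a_T P Y K L Q T \<omega> x =
     (let q = \<lambda>i j. bracket P Y i j T; y = grad (Y T \<omega>) x in
        6 * q 1 1 * (y $ 1)\<^sup>2 + 6 * q 2 2 * (y $ 2)\<^sup>2 + 2 * q 2 2 * (y $ 1)\<^sup>2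
        + 2 * q 1 1 * (y $ 2)\<^sup>2 + 4 * (q 1 2)\<^sup>2 - 3 * (q 1 1)\<^sup>2 - 3 * (q 2 2)\<^sup>2
        - 2 * q 1 1 * q 2 2
        + 8 * rs_integral (\<lambda>s. K 1 2 x s \<omega>) (bracket P Y 1 2) T
        + 8 * rs_integral (\<lambda>s. K 2 1 x s \<omega>) (bracket P Y 1 2) T
        + 8 * L 1 2 x T \<omega> + 8 * Q 1 2 x T \<omega>
        + 8 * L 2 1 x T \<omega> + 8 * Q 2 1 x T \<omega>)"

definition b_T ::
  "path measure \<Rightarrow> (real \<Rightarrow> path \<Rightarrow> real^2 \<Rightarrow> real) \<Rightarrow> real \<Rightarrow> path \<Rightarrow> real^2 \<Rightarrow> real^2" where
  "b_T P Y T \<omega> x =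
     (let q = \<lambda>i j. bracket P Y i j T; y = grad (Y T \<omega>) x in
        vector [3 * q 1 1 * y $ 1 + 2 * q 1 2 * y $ 2 + q 2 2 * y $ 1,
                3 * q 2 2 * y $ 2 + 2 * q 1 2 * y $ 1 + q 1 1 * y $ 2])"

definition c_T ::
  "path measure \<Rightarrow> (real \<Rightarrow> path \<Rightarrow> real^2 \<Rightarrow> real) \<Rightarrow> real \<Rightarrow> real^2 \<Rightarrow> real" where
  "c_T P Y T v =
     (let q = \<lambda>i j. bracket P Y i j T in
        6 * q 1 1 * (v $ 1)\<^sup>2 + 6 * q 2 2 * (v $ 2)\<^sup>2 + 2 * q 1 1 * (v $ 2)\<^sup>2
        + 2 * q 2 2 * (v $ 1)\<^sup>2 + 8 * q 1 2 * v $ 1 * v $ 2)"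

definition d_T :: "path measure \<Rightarrow> (real \<Rightarrow> path \<Rightarrow> real^2 \<Rightarrow> real) \<Rightarrow> real \<Rightarrow> real" where
  "d_T P Y T = bracket P Y 1 1 T + bracket P Y 2 2 T"

definition vec_cube :: "real^2 \<Rightarrow> real^2" where
  "vec_cube v = (norm v)\<^sup>2 *\<^sub>R v"

definition wick4 ::
  "path measure \<Rightarrow> (real \<Rightarrow> path \<Rightarrow> real^2 \<Rightarrow> real) \<Rightarrow> ito_family \<Rightarrow> ito_family \<Rightarrow> ito_family
     \<Rightarrow> real \<Rightarrow> path \<Rightarrow> real^2 \<Rightarrow> real" where
  "wick4 P Y K L Q T \<omega> x = norm (grad (Y T \<omega>) x) ^ 4 - a_T P Y K L Q T \<omega> x"

definition wick3 ::
  "path measure \<Rightarrow> (real \<Rightarrow> path \<Rightarrow> real^2 \<Rightarrow> real) \<Rightarrow> real \<Rightarrow> path \<Rightarrow> real^2 \<Rightarrow> real^2" where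
  "wick3 P Y T \<omega> x = vec_cube (grad (Y T \<omega>) x) - b_T P Y T \<omega> x"

definition wick2 ::
  "path measure \<Rightarrow> (real \<Rightarrow> path \<Rightarrow> real^2 \<Rightarrow> real) \<Rightarrow> 2 \<Rightarrow> 2 \<Rightarrow> real \<Rightarrow> path \<Rightarrow> real^2 \<Rightarrow> real" where
  "wick2 P Y i j T \<omega> x = pd i (Y T \<omega>) x * pd j (Y T \<omega>) x - bracket P Y i j T"

definition wick2_trace ::
  "path measure \<Rightarrow> (real \<Rightarrow> path \<Rightarrow> real^2 \<Rightarrow> real) \<Rightarrow> real \<Rightarrow> path \<Rightarrow> real^2 \<Rightarrow> real" where
  "wick2_trace P Y T \<omega> x = (\<Sum>i\<in>UNIV. wick2 P Y i i T \<omega> x)"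

abbreviation delta :: "2 \<Rightarrow> 2 \<Rightarrow> real" where
  "delta i j \<equiv> of_bool (i = j)"

text \<open>In the following definitions \<open>z\<close> stands for the function $Z_T(u)$ for a given path.\<close>

definition wick2_term ::
  "path measure \<Rightarrow> (real \<Rightarrow> path \<Rightarrow> real^2 \<Rightarrow> real) \<Rightarrow> real \<Rightarrow> path \<Rightarrow> (real^2 \<Rightarrow> real)
     \<Rightarrow> real^2 \<Rightarrow> real" where
  "wick2_term P Y T \<omega> z x =
     (\<Sum>i\<in>UNIV. \<Sum>j\<in>UNIV. \<Sum>k\<in>UNIV. \<Sum>l\<in>UNIV.
        2 * (delta i k * delta j l + delta i l * delta j k + delta i j * delta k l)
          * wick2 P Y i j T \<omega> x * pd k z x * pd l z x)"

definition renormalised_energy ::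
  "path measure \<Rightarrow> (real \<Rightarrow> path \<Rightarrow> real^2 \<Rightarrow> real) \<Rightarrow> ito_family \<Rightarrow> ito_family \<Rightarrow> ito_family
     \<Rightarrow> real \<Rightarrow> path \<Rightarrow> (real^2 \<Rightarrow> real) \<Rightarrow> real" where
  "renormalised_energy P Y K L Q T \<omega> z =
     (\<integral>x. norm (grad (Y T \<omega>) x + grad z x) ^ 4 - 2 * (norm (grad (Y T \<omega>) x + grad z x))\<^sup>2
          - c_T P Y T (grad z x) - 4 * (b_T P Y T \<omega> x \<bullet> grad z x)
          - a_T P Y K L Q T \<omega> x + 2 * d_T P Y T \<partial>torus)"

definition Phi_T ::
  "path measure \<Rightarrow> (real \<Rightarrow> path \<Rightarrow> real^2 \<Rightarrow> real) \<Rightarrow> real \<Rightarrow> path \<Rightarrow> (real^2 \<Rightarrow> real) \<Rightarrow> real" where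
  "Phi_T P Y T \<omega> z =
     (\<integral>x. 4 * (grad (Y T \<omega>) x \<bullet> vec_cube (grad z x)) + 4 * (wick3 P Y T \<omega> x \<bullet> grad z x)
          + wick2_term P Y T \<omega> z x
          - 4 * (grad (Y T \<omega>) x \<bullet> grad z x) - 2 * (norm (grad z x))\<^sup>2 \<partial>torus)"

text \<open>
  Expectations are extended real numbers: the drift need not have moments, so the expectations below
  may be infinite, where the Bochner integral would be 0 by convention.
\<close>

definition expect :: "'w measure \<Rightarrow> ('w \<Rightarrow> real) \<Rightarrow> ereal" where
  "expect P X = enn2ereal (\<integral>\<^sup>+\<omega>. ennreal (X \<omega>) \<partial>P) - enn2ereal (\<integral>\<^sup>+\<omega>. ennreal (- X \<omega>) \<partial>P)"

definition drift_energy :: "(real \<Rightarrow> 'w \<Rightarrow> real^2 \<Rightarrow> real) \<Rightarrow> 'w \<Rightarrow> real" where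
  "drift_energy u \<omega> = (LBINT s:{0..}. (Lp_norm 2 (u s \<omega>))\<^sup>2)"

definition F_T ::
  "path measure \<Rightarrow> (real \<Rightarrow> real) \<Rightarrow> ((int^2 \<Rightarrow> complex) \<Rightarrow> real) \<Rightarrow> (real \<Rightarrow> path \<Rightarrow> real^2 \<Rightarrow> real)
     \<Rightarrow> ito_family \<Rightarrow> ito_family \<Rightarrow> ito_family \<Rightarrow> real \<Rightarrow> (real \<Rightarrow> path \<Rightarrow> real^2 \<Rightarrow> real) \<Rightarrow> ereal" where
  "F_T P \<zeta> f Y K L Q T u =
     expect P (\<lambda>\<omega>. f (fourier_coeff (\<lambda>x. Y T \<omega> x + Z_drift \<zeta> T u \<omega> x))
                   + renormalised_energy P Y K L Q T \<omega> (Z_drift \<zeta> T u \<omega>)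
                   + 1/2 * drift_energy u \<omega>)"

end

theory Submission
  imports Defs
begin

text \<open>
  The symbols are radial and the lattice is symmetric under exchange of the coordinates, so the bracket
  of \<open>\<partial>\<^sub>i Y\<close> and \<open>\<partial>\<^sub>j Y\<close> is $q\delta_{ij}$.  Hence the integrals against the mixed
  bracket vanish, and the identity between the integrands is polynomial algebra.  For the second claim
  it remains to drop the Wick terms that do not contain the drift.  Their mean vanishes at every point
  \<open>x\<close>, by the second and fourth moments of the Gaussian gradient and because the iterated Ito
  integrals are centred, and $L^2$ bounds uniform in \<open>x\<close> permit Fubini.  The other terms need not be
  integrable, but they agree almost surely with measurable functions of finitely many Fourier modes,
  and a centred integrable term can be removed from their extended expectation.
\<close>

section \<open>Gaussian martingales\<close>

text \<open>The obstacle is that the definitions only characterise their objects. A bracket is a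
  limit in probability selected by a description operator, so both existence and uniqueness must be
  shown; an Ito integral is any process reached by some simple processes, relative to some version
  of the bracket; and the integrands come without joint measurability. Hence everything passes
  through one notion: a process whose increments have, conditionally on the past, the characteristic
  function exp(-\<theta>^2 (V t - V s) / 2) with a deterministic V. This yields the law and the
  independence of the increments, forces every version of the bracket to equal V t - V 0, and
  survives L1 limits. It is verified for the components of the Brownian modes, for combinations of
  their integrals over half of the lattice (the other half is conjugate), and for directional
  derivatives of Y at a point. The set of active frequencies grows with time, so these derivatives
  occur both with a fixed and with a running cutoff.\<close>

definition bracket_measure :: "(real \<Rightarrow> real) \<Rightarrow> real measure" where
  "bracket_measure V = interval_measure (\<lambda>s. V (max 0 s))"

text \<open>Scaling a standard normal variable, instead of using a density, includes v = 0, where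
  the law is a point mass. This case occurs because a bracket may be constant on an
  interval.\<close>

definition normal_law :: "real \<Rightarrow> real measure" where
  "normal_law v = distr std_normal_distribution borel (\<lambda>z. sqrt v * z)"

lemma real_distribution_normal_law: "real_distribution (normal_law v)"
proof -
  interpret N: real_distribution std_normal_distribution by (rule real_dist_normal_dist)
  show ?thesis unfolding normal_law_def by (rule N.real_distribution_distr) simp
qed

lemma char_normal_law:
  assumes "0 \<le> v" shows "char (normal_law v) \<theta> = exp (- \<theta>\<^sup>2 * v / 2)"
proof -
  have "char (normal_law v) \<theta> = char std_normal_distribution (\<theta> * sqrt v)"
    unfolding char_def normal_law_def by (subst integral_distr) (simp_all add: mult.assoc)
  also have "\<dots> = exp (- \<theta>\<^sup>2 * v / 2)"
    using assms by (simp add: char_std_normal_distribution power_mult_distrib)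
  finally show ?thesis .
qed

text \<open>The single identity \<open>char_incr\<close> says that an increment is independent of
  the past and is centred Gaussian with variance \<open>V t - V s\<close>. In this form the property
  passes to limits of increments, which is how stochastic integrals inherit it.\<close>

locale gauss_martingale = prob_space P for P :: "'w measure" +
  fixes F :: "real \<Rightarrow> 'w measure" and M :: "real \<Rightarrow> 'w \<Rightarrow> real" and V :: "real \<Rightarrow> real"
  assumes space_filt: "0 \<le> t \<Longrightarrow> space (F t) = space P"
    and sets_filt: "0 \<le> t \<Longrightarrow> sets (F t) \<subseteq> sets P"
    and mono_filt: "0 \<le> s \<Longrightarrow> s \<le> t \<Longrightarrow> sets (F s) \<subseteq> sets (F t)"
    and adapted: "0 \<le> t \<Longrightarrow> M t \<in> borel_measurable (F t)"
    and V_mono: "0 \<le> s \<Longrightarrow> s \<le> t \<Longrightarrow> V s \<le> V t"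
    and V_cont: "continuous_on {0..} V"
    and char_incr: "0 \<le> s \<Longrightarrow> s \<le> t \<Longrightarrow> A \<in> sets (F s) \<Longrightarrow>
      (CLINT \<omega>|P. indicator A \<omega> * iexp (\<theta> * (M t \<omega> - M s \<omega>)))
        = prob A * exp (- \<theta>\<^sup>2 * (V t - V s) / 2)"
begin

lemma filt_measurable:
  assumes "0 \<le> s" "s \<le> t" "X \<in> measurable (F s) N"
  shows "X \<in> measurable (F t) N"
proof -
  have "space (F s) = space (F t)" using space_filt[of s] space_filt[of t] assms by auto
  then have "measurable (F s) N \<subseteq> measurable (F t) N"
    using mono_filt[OF assms(1,2)] by (intro measurable_mono) auto
  with assms show ?thesis by auto
qed

lemma filt_measurable_P:
  assumes "0 \<le> s" "X \<in> measurable (F s) N"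
  shows "X \<in> measurable P N"
proof -
  have "measurable (F s) N \<subseteq> measurable P N"
    using sets_filt[OF assms(1)] space_filt[OF assms(1)] by (intro measurable_mono) auto
  with assms show ?thesis by auto
qed

lemma M_measurable: "0 \<le> t \<Longrightarrow> M t \<in> borel_measurable P"
  using adapted filt_measurable_P by blast

lemma incr_measurable: "0 \<le> s \<Longrightarrow> s \<le> t \<Longrightarrow> (\<lambda>\<omega>. M t \<omega> - M s \<omega>) \<in> borel_measurable P"
  using M_measurable by (intro borel_measurable_diff) auto

text \<open>Conditioning on an event of \<open>F s\<close> does not change the characteristic
  function of the increment. The conditional law is thus the same for all such events, and
  comparison with the whole space gives independence from the past.\<close>

lemma law_incr_on:
  assumes st: "0 \<le> s" "s \<le> t" and A: "A \<in> sets (F s)" and pos: "prob A > 0"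
  shows "distr (uniform_measure P A) borel (\<lambda>\<omega>. M t \<omega> - M s \<omega>) = normal_law (V t - V s)"
proof (rule Levy_uniqueness)
  have AP: "A \<in> sets P" using A sets_filt st by auto
  interpret U: prob_space "uniform_measure P A"
    by (rule prob_space_uniform_measure) (use pos in \<open>auto simp: emeasure_eq_measure\<close>)
  show "real_distribution (distr (uniform_measure P A) borel (\<lambda>\<omega>. M t \<omega> - M s \<omega>))"
    using incr_measurable[OF st] by (intro U.real_distribution_distr) simp
  show "real_distribution (normal_law (V t - V s))" by (rule real_distribution_normal_law)
  show "char (distr (uniform_measure P A) borel (\<lambda>\<omega>. M t \<omega> - M s \<omega>)) = char (normal_law (V t - V s))"
  proof
    fix \<theta>
    have m: "(\<lambda>\<omega>. M t \<omega> - M s \<omega>) \<in> measurable (uniform_measure P A) borel"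
      using incr_measurable[OF st] by simp
    have m2: "(\<lambda>\<omega>. M t \<omega> - M s \<omega>) \<in> measurable P borel" using incr_measurable[OF st] .
    have ud: "uniform_measure P A = density P (\<lambda>\<omega>. ennreal (indicator A \<omega> / prob A))"
      unfolding uniform_measure_def using pos AP
      by (intro density_cong) (auto simp: emeasure_eq_measure indicator_def divide_ennreal simp flip: ennreal_1)
    have "char (distr (uniform_measure P A) borel (\<lambda>\<omega>. M t \<omega> - M s \<omega>)) \<theta>
      = (CLINT \<omega>|uniform_measure P A. iexp (\<theta> * (M t \<omega> - M s \<omega>)))"
      unfolding char_def using m by (subst integral_distr) auto
    also have "\<dots> = (CLINT \<omega>|P. (indicator A \<omega> / prob A) *\<^sub>R iexp (\<theta> * (M t \<omega> - M s \<omega>)))"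
      unfolding ud
    proof (rule integral_density)
      show "(\<lambda>\<omega>. iexp (\<theta> * (M t \<omega> - M s \<omega>))) \<in> borel_measurable P"
        using m2 by measurable
    qed (use AP in auto)
    also have "\<dots> = (CLINT \<omega>|P. (indicator A \<omega> * iexp (\<theta> * (M t \<omega> - M s \<omega>))) / prob A)"
      by (intro Bochner_Integration.integral_cong) (auto simp: scaleR_conv_of_real indicator_def)
    also have "\<dots> = exp (- \<theta>\<^sup>2 * (V t - V s) / 2)"
      using char_incr[OF st A, of \<theta>] pos by simp
    finally show "char (distr (uniform_measure P A) borel (\<lambda>\<omega>. M t \<omega> - M s \<omega>)) \<theta>
      = char (normal_law (V t - V s)) \<theta>"
      using char_normal_law[of "V t - V s" \<theta>] V_mono[OF st] by simp
  qed
qed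

lemma space_in_filt: "0 \<le> s \<Longrightarrow> space P \<in> sets (F s)"
  using sets.top[of "F s"] space_filt[of s] by simp

lemma uniform_measure_space: "uniform_measure P (space P) = P"
proof (rule measure_eqI)
  fix A assume "A \<in> sets (uniform_measure P (space P))"
  then show "emeasure (uniform_measure P (space P)) A = emeasure P A"
    by (simp add: emeasure_space_1 sets.Int_space_eq1 divide_ennreal_def)
qed simp

lemma law_incr:
  assumes "0 \<le> s" "s \<le> t"
  shows "distr P borel (\<lambda>\<omega>. M t \<omega> - M s \<omega>) = normal_law (V t - V s)"
  using law_incr_on[OF assms space_in_filt[OF assms(1)]] by (simp add: uniform_measure_space prob_space)

lemma prob_incr_Int:
  assumes st: "0 \<le> s" "s \<le> t" and A: "A \<in> sets (F s)" and B: "B \<in> sets borel"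
  shows "prob (A \<inter> ((\<lambda>\<omega>. M t \<omega> - M s \<omega>) -` B \<inter> space P))
    = prob A * prob ((\<lambda>\<omega>. M t \<omega> - M s \<omega>) -` B \<inter> space P)"
proof (cases "prob A = 0")
  case True
  then have "prob (A \<inter> ((\<lambda>\<omega>. M t \<omega> - M s \<omega>) -` B \<inter> space P)) \<le> 0"
    using A sets_filt[OF st(1)] finite_measure_mono[of _ A] by (metis Int_lower1 subsetD)
  with True show ?thesis by (simp add: measure_le_0_iff)
next
  case False
  then have pos: "prob A > 0" by (simp add: zero_less_measure_iff)
  let ?C = "(\<lambda>\<omega>. M t \<omega> - M s \<omega>) -` B \<inter> space P"
  have AP: "A \<in> sets P" using A sets_filt st by auto
  have CP: "?C \<in> sets P" using incr_measurable[OF st] B by (rule measurable_sets)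
  have m: "(\<lambda>\<omega>. M t \<omega> - M s \<omega>) \<in> measurable (uniform_measure P A) borel"
    using incr_measurable[OF st] by simp
  have "measure (distr (uniform_measure P A) borel (\<lambda>\<omega>. M t \<omega> - M s \<omega>)) B
    = measure (distr P borel (\<lambda>\<omega>. M t \<omega> - M s \<omega>)) B"
    using law_incr_on[OF st A pos] law_incr[OF st] by simp
  then have "measure (uniform_measure P A) ?C = prob ?C"
    using m incr_measurable[OF st] B by (simp add: measure_distr)
  moreover have "measure (uniform_measure P A) ?C = prob (A \<inter> ?C) / prob A"
    by (rule measure_uniform_measure) (use pos AP CP in \<open>auto simp: emeasure_eq_measure\<close>)
  ultimately show ?thesis
    using pos by (simp add: field_simps)
qed

lemma indep_incr:
  assumes st: "0 \<le> s" "s \<le> t" and \<xi>: "\<xi> \<in> borel_measurable (F s)"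
  shows "indep_var borel \<xi> borel (\<lambda>\<omega>. M t \<omega> - M s \<omega>)"
  unfolding indep_var_eq
proof (intro conjI)
  show "\<xi> \<in> borel_measurable P" using \<xi> st filt_measurable_P by blast
  show "(\<lambda>\<omega>. M t \<omega> - M s \<omega>) \<in> borel_measurable P" using incr_measurable[OF st] .
  show "indep_set (sigma_sets (space P) {\<xi> -` A \<inter> space P |A. A \<in> sets borel})
     (sigma_sets (space P) {(\<lambda>\<omega>. M t \<omega> - M s \<omega>) -` A \<inter> space P |A. A \<in> sets borel})"
  proof (rule indep_set_sigma_sets)
    show "Int_stable {\<xi> -` A \<inter> space P |A. A \<in> sets borel}"
      unfolding Int_stable_def by (auto, rule_tac x="A \<inter> Aa" in exI) auto
    show "Int_stable {(\<lambda>\<omega>. M t \<omega> - M s \<omega>) -` A \<inter> space P |A. A \<in> sets borel}"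
      unfolding Int_stable_def by (auto, rule_tac x="A \<inter> Aa" in exI) auto
    have sub: "\<xi> -` A \<inter> space P \<in> sets (F s)" if "A \<in> sets borel" for A
      using measurable_sets[OF \<xi> that] space_filt[OF st(1)] by simp
    show "indep_set {\<xi> -` A \<inter> space P |A. A \<in> sets borel}
      {(\<lambda>\<omega>. M t \<omega> - M s \<omega>) -` A \<inter> space P |A. A \<in> sets borel}"
    proof (rule indep_setI)
      show "{\<xi> -` A \<inter> space P |A. A \<in> sets borel} \<subseteq> events"
        using sub sets_filt[OF st(1)] by blast
      show "{(\<lambda>\<omega>. M t \<omega> - M s \<omega>) -` A \<inter> space P |A. A \<in> sets borel} \<subseteq> events"
        using measurable_sets[OF incr_measurable[OF st]] by auto
      fix a b assume "a \<in> {\<xi> -` A \<inter> space P |A. A \<in> sets borel}"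
        "b \<in> {(\<lambda>\<omega>. M t \<omega> - M s \<omega>) -` A \<inter> space P |A. A \<in> sets borel}"
      then obtain A B where "a = \<xi> -` A \<inter> space P" "b = (\<lambda>\<omega>. M t \<omega> - M s \<omega>) -` B \<inter> space P"
        "A \<in> sets borel" "B \<in> sets borel" by auto
      then show "prob (a \<inter> b) = prob a * prob b"
        using prob_incr_Int[OF st sub] by simp
    qed
  qed
qed

lemma incr_moments:
  assumes st: "0 \<le> s" "s \<le> t"
  shows "integrable P (\<lambda>\<omega>. (M t \<omega> - M s \<omega>) ^ k)"
    and "(\<integral>\<omega>. (M t \<omega> - M s \<omega>) \<partial>P) = 0"
    and "(\<integral>\<omega>. (M t \<omega> - M s \<omega>)\<^sup>2 \<partial>P) = V t - V s"
    and "(\<integral>\<omega>. (M t \<omega> - M s \<omega>) ^ 4 \<partial>P) = 3 * (V t - V s)\<^sup>2"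
proof -
  let ?D = "\<lambda>\<omega>. M t \<omega> - M s \<omega>"
  let ?v = "V t - V s"
  note m = incr_measurable[OF st]
  have v: "0 \<le> ?v" using V_mono[OF st] by simp
  have i: "integrable (distr P borel ?D) (\<lambda>x. x ^ k)" for k
    unfolding law_incr[OF st] normal_law_def
    by (subst integrable_distr_eq) (auto simp: power_mult_distrib intro!:
      integrable_std_normal_distribution_moment)
  then show "integrable P (\<lambda>\<omega>. ?D \<omega> ^ k)"
    using m by (subst (asm) integrable_distr_eq) auto
  have e: "(\<integral>\<omega>. ?D \<omega> ^ k \<partial>P) = sqrt ?v ^ k * (LINT x|std_normal_distribution. x ^ k)" for k
  proof -
    have "(\<integral>\<omega>. ?D \<omega> ^ k \<partial>P) = (LINT x|distr P borel ?D. x ^ k)"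
      using m by (subst integral_distr) auto
    also have "\<dots> = (LINT x|std_normal_distribution. (sqrt ?v * x) ^ k)"
      unfolding law_incr[OF st] normal_law_def by (subst integral_distr) auto
    finally show ?thesis by (simp add: power_mult_distrib)
  qed
  show "(\<integral>\<omega>. ?D \<omega> \<partial>P) = 0"
    using e[of 1] integral_std_normal_distribution_moment_odd[of 1] by simp
  show "(\<integral>\<omega>. (?D \<omega>)\<^sup>2 \<partial>P) = ?v"
    using e[of 2] std_normal_distribution_even_moments(1)[of 1] v by simp
  have "sqrt ?v ^ 4 = ?v\<^sup>2"
    using v by (simp add: power4_eq_xxxx power2_eq_square mult.assoc)
  then show "(\<integral>\<omega>. ?D \<omega> ^ 4 \<partial>P) = 3 * ?v\<^sup>2"
    using e[of 4] std_normal_distribution_even_moments(1)[of 2] by (simp add: fact_numeral)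
qed

text \<open>All powers of the increment are integrable, and independence makes the product with an
  integrable \<xi> integrable again. The exponents 1 and 2 give the martingale property and the
  variance of an increment given the past.\<close>

lemma indep_incr_power:
  assumes st: "0 \<le> s" "s \<le> t" and \<xi>: "\<xi> \<in> borel_measurable (F s)" and i: "integrable P \<xi>"
  shows "integrable P (\<lambda>\<omega>. \<xi> \<omega> * (M t \<omega> - M s \<omega>) ^ k)"
    and "(\<integral>\<omega>. \<xi> \<omega> * (M t \<omega> - M s \<omega>) ^ k \<partial>P) = (\<integral>\<omega>. \<xi> \<omega> \<partial>P) * (\<integral>\<omega>. (M t \<omega> - M s \<omega>) ^ k \<partial>P)"
proof -
  have "indep_var borel (id \<circ> \<xi>) borel ((\<lambda>x. x ^ k) \<circ> (\<lambda>\<omega>. M t \<omega> - M s \<omega>))"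
    by (rule indep_var_compose[OF indep_incr[OF st \<xi>]]) auto
  then have *: "indep_var borel \<xi> borel (\<lambda>\<omega>. (M t \<omega> - M s \<omega>) ^ k)" by (simp add: comp_def)
  show "integrable P (\<lambda>\<omega>. \<xi> \<omega> * (M t \<omega> - M s \<omega>) ^ k)"
    by (rule indep_var_integrable[OF * i incr_moments(1)[OF st]])
  show "(\<integral>\<omega>. \<xi> \<omega> * (M t \<omega> - M s \<omega>) ^ k \<partial>P) = (\<integral>\<omega>. \<xi> \<omega> \<partial>P) * (\<integral>\<omega>. (M t \<omega> - M s \<omega>) ^ k \<partial>P)"
    by (rule indep_var_lebesgue_integral[OF * i incr_moments(1)[OF st]])
qed

lemma indep_incr_0:
  assumes "0 \<le> s" "s \<le> t" "\<xi> \<in> borel_measurable (F s)" "integrable P \<xi>"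
  shows "integrable P (\<lambda>\<omega>. \<xi> \<omega> * (M t \<omega> - M s \<omega>))"
    and "(\<integral>\<omega>. \<xi> \<omega> * (M t \<omega> - M s \<omega>) \<partial>P) = 0"
  using indep_incr_power[OF assms, of 1] incr_moments(2)[OF assms(1,2)] by auto

lemma indep_incr_2:
  assumes "0 \<le> s" "s \<le> t" "\<xi> \<in> borel_measurable (F s)" "integrable P \<xi>"
  shows "integrable P (\<lambda>\<omega>. \<xi> \<omega> * (M t \<omega> - M s \<omega>)\<^sup>2)"
    and "(\<integral>\<omega>. \<xi> \<omega> * (M t \<omega> - M s \<omega>)\<^sup>2 \<partial>P) = (\<integral>\<omega>. \<xi> \<omega> \<partial>P) * (V t - V s)"
  using indep_incr_power[OF assms, of 2] incr_moments(3)[OF assms(1,2)] by auto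

end

section \<open>Quadratic covariation\<close>

lemma partition_of_mono:
  assumes "partition_of t \<delta> m p" "i \<le> j" "j \<le> m"
  shows "p i \<le> p j"
  using assms(2,3)
proof (induction j rule: dec_induct)
  case (step n)
  then have "p n \<le> p (Suc n)" using assms(1) by (auto simp: partition_of_def)
  with step show ?case by auto
qed simp

lemma partition_of_bounds:
  assumes "partition_of t \<delta> m p" "i \<le> m"
  shows "0 \<le> p i" "p i \<le> t"
  using partition_of_mono[OF assms(1), of 0 i] partition_of_mono[OF assms(1), of i m] assms
  by (auto simp: partition_of_def)

lemma partition_of_exists:
  assumes "0 \<le> t" "0 < \<delta>"
  shows "\<exists>m p. partition_of t \<delta> m p"
proof -
  obtain m :: nat where m: "real m > t / \<delta>" using reals_Archimedean2 by blast
  then have "0 < real m" using assms by (smt (verit) divide_nonneg_pos)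
  then have "partition_of t \<delta> m (\<lambda>i. real i * t / real m)"
    using m assms unfolding partition_of_def
    by (auto simp: field_simps intro!: mult_nonneg_nonneg mult_right_mono)
  then show ?thesis by blast
qed

text \<open>Chebyshev's inequality. A second moment below \<epsilon> * \<epsilon>^2 is requested:
  the factor \<epsilon>^2 is the squared threshold and the remaining \<epsilon> is the admissible
  probability.\<close>

lemma quad_covariation_if_L2:
  assumes M: "\<And>s. 0 \<le> s \<Longrightarrow> M s \<in> borel_measurable P"
    and N: "\<And>s. 0 \<le> s \<Longrightarrow> N s \<in> borel_measurable P" and q: "q \<in> borel_measurable P"
    and L2: "\<And>\<epsilon>. 0 < \<epsilon> \<Longrightarrow> \<exists>\<delta>>0. \<forall>m p. partition_of t \<delta> m p \<longrightarrow>
      (\<integral>\<^sup>+\<omega>. ennreal (((\<Sum>i<m. (M (p (Suc i)) \<omega> - M (p i) \<omega>) * (N (p (Suc i)) \<omega> - N (p i) \<omega>)) - q \<omega>)\<^sup>2) \<partial>P)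
        < ennreal \<epsilon>"
  shows "quad_covariation P M N t q"
  unfolding quad_covariation_def
proof (intro allI impI)
  fix \<epsilon> :: real assume e: "0 < \<epsilon>"
  obtain \<delta> where d: "\<delta> > 0" "\<And>m p. partition_of t \<delta> m p \<Longrightarrow>
      (\<integral>\<^sup>+\<omega>. ennreal (((\<Sum>i<m. (M (p (Suc i)) \<omega> - M (p i) \<omega>) * (N (p (Suc i)) \<omega> - N (p i) \<omega>)) - q \<omega>)\<^sup>2) \<partial>P)
        < ennreal (\<epsilon> * \<epsilon>\<^sup>2)"
    using L2[of "\<epsilon> * \<epsilon>\<^sup>2"] e by auto
  show "\<exists>\<delta>>0. \<forall>m p. partition_of t \<delta> m p \<longrightarrow>
        (\<integral>\<^sup>+\<omega>. indicator {\<omega>. \<bar>(\<Sum>i<m. (M (p (Suc i)) \<omega> - M (p i) \<omega>) *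
             (N (p (Suc i)) \<omega> - N (p i) \<omega>)) - q \<omega>\<bar> > \<epsilon>} \<omega> \<partial>P) < ennreal \<epsilon>"
  proof (intro exI[of _ \<delta>] conjI allI impI d(1))
    fix m p assume pt: "partition_of t \<delta> m p"
    define X where "X = (\<lambda>\<omega>. (\<Sum>i<m. (M (p (Suc i)) \<omega> - M (p i) \<omega>) * (N (p (Suc i)) \<omega> - N (p i) \<omega>)) - q \<omega>)"
    have X: "X \<in> borel_measurable P"
      unfolding X_def using partition_of_bounds(1)[OF pt]
      by (intro borel_measurable_diff borel_measurable_sum borel_measurable_times M N q) auto
    have "(\<integral>\<^sup>+\<omega>. indicator {\<omega>. \<bar>X \<omega>\<bar> > \<epsilon>} \<omega> \<partial>P) \<le> (\<integral>\<^sup>+\<omega>. ennreal (1 / \<epsilon>\<^sup>2) * ennreal ((X \<omega>)\<^sup>2) \<partial>P)"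
    proof (intro nn_integral_mono)
      fix \<omega>
      have "1 \<le> 1 / \<epsilon>\<^sup>2 * (X \<omega>)\<^sup>2" if "\<bar>X \<omega>\<bar> > \<epsilon>"
        using that e power_mono[of \<epsilon> "\<bar>X \<omega>\<bar>" 2] by (simp add: field_simps)
      then show "indicator {\<omega>. \<bar>X \<omega>\<bar> > \<epsilon>} \<omega> \<le> ennreal (1 / \<epsilon>\<^sup>2) * ennreal ((X \<omega>)\<^sup>2)"
        by (auto simp: indicator_def simp flip: ennreal_mult ennreal_1 intro!: ennreal_leI)
    qed
    also have "\<dots> = ennreal (1 / \<epsilon>\<^sup>2) * (\<integral>\<^sup>+\<omega>. ennreal ((X \<omega>)\<^sup>2) \<partial>P)"
      using X by (intro nn_integral_cmult) auto
    also have "\<dots> < ennreal (1 / \<epsilon>\<^sup>2) * ennreal (\<epsilon> * \<epsilon>\<^sup>2)"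
      using d(2)[OF pt] e unfolding X_def by (intro ennreal_mult_strict_left_mono) auto
    also have "\<dots> = ennreal \<epsilon>" using e by (simp flip: ennreal_mult)
    finally show "(\<integral>\<^sup>+\<omega>. indicator {\<omega>. \<bar>(\<Sum>i<m. (M (p (Suc i)) \<omega> - M (p i) \<omega>) *
             (N (p (Suc i)) \<omega> - N (p i) \<omega>)) - q \<omega>\<bar> > \<epsilon>} \<omega> \<partial>P) < ennreal \<epsilon>"
      unfolding X_def .
  qed
qed

text \<open>A partition sum evaluates the processes at finitely many times only, so equality outside
  a null set that depends on the time is enough.\<close>

lemma quad_covariation_cong_AE:
  assumes M: "\<And>s. 0 \<le> s \<Longrightarrow> s \<le> t \<Longrightarrow> AE \<omega> in P. M s \<omega> = M' s \<omega>"
    and N: "\<And>s. 0 \<le> s \<Longrightarrow> s \<le> t \<Longrightarrow> AE \<omega> in P. N s \<omega> = N' s \<omega>"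
  shows "quad_covariation P M N t q \<longleftrightarrow> quad_covariation P M' N' t q"
proof -
  have "(\<integral>\<^sup>+\<omega>. indicator {\<omega>. \<bar>(\<Sum>i<m. (M (p (Suc i)) \<omega> - M (p i) \<omega>) *
                                    (N (p (Suc i)) \<omega> - N (p i) \<omega>)) - q \<omega>\<bar> > \<epsilon>} \<omega> \<partial>P)
    = (\<integral>\<^sup>+\<omega>. indicator {\<omega>. \<bar>(\<Sum>i<m. (M' (p (Suc i)) \<omega> - M' (p i) \<omega>) *
                                    (N' (p (Suc i)) \<omega> - N' (p i) \<omega>)) - q \<omega>\<bar> > \<epsilon>} \<omega> \<partial>P)"
    if pt: "partition_of t \<delta> m p" for \<delta> m p \<epsilon>
  proof (rule nn_integral_cong_AE)
    have "AE \<omega> in P. \<forall>i\<in>{..m}. M (p i) \<omega> = M' (p i) \<omega> \<and> N (p i) \<omega> = N' (p i) \<omega>"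
      using partition_of_bounds[OF pt] by (intro AE_finite_allI) (auto intro!: AE_conjI M N)
    then show "AE \<omega> in P. (indicator {\<omega>. \<bar>(\<Sum>i<m. (M (p (Suc i)) \<omega> - M (p i) \<omega>) *
                                    (N (p (Suc i)) \<omega> - N (p i) \<omega>)) - q \<omega>\<bar> > \<epsilon>} \<omega> :: ennreal)
     = indicator {\<omega>. \<bar>(\<Sum>i<m. (M' (p (Suc i)) \<omega> - M' (p i) \<omega>) *
                                    (N' (p (Suc i)) \<omega> - N' (p i) \<omega>)) - q \<omega>\<bar> > \<epsilon>} \<omega>"
    proof eventually_elim
      case (elim \<omega>)
      then have "(\<Sum>i<m. (M (p (Suc i)) \<omega> - M (p i) \<omega>) * (N (p (Suc i)) \<omega> - N (p i) \<omega>))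
       = (\<Sum>i<m. (M' (p (Suc i)) \<omega> - M' (p i) \<omega>) * (N' (p (Suc i)) \<omega> - N' (p i) \<omega>))"
        by (intro sum.cong) auto
      then show ?case by (simp add: indicator_def)
    qed
  qed
  then have "(\<forall>m p. partition_of t \<delta> m p \<longrightarrow> (\<integral>\<^sup>+\<omega>. indicator {\<omega>. \<bar>(\<Sum>i<m. (M (p (Suc i)) \<omega> - M (p i) \<omega>) *
           (N (p (Suc i)) \<omega> - N (p i) \<omega>)) - q \<omega>\<bar> > \<epsilon>} \<omega> \<partial>P) < ennreal \<epsilon>)
     \<longleftrightarrow> (\<forall>m p. partition_of t \<delta> m p \<longrightarrow> (\<integral>\<^sup>+\<omega>. indicator {\<omega>. \<bar>(\<Sum>i<m. (M' (p (Suc i)) \<omega> - M' (p i) \<omega>) *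
           (N' (p (Suc i)) \<omega> - N' (p i) \<omega>)) - q \<omega>\<bar> > \<epsilon>} \<omega> \<partial>P) < ennreal \<epsilon>)" for \<epsilon> \<delta>
    by (intro all_cong1 imp_cong) auto
  then show ?thesis unfolding quad_covariation_def by simp
qed

text \<open>One partition fine enough for both limits serves as a common approximation: if the two
  limits differ by more than 2 * \<epsilon>, one of them is further than \<epsilon> from the sum,
  which has probability at most 2 * \<epsilon>.\<close>

lemma (in prob_space) quad_covariation_unique:
  assumes t: "0 \<le> t" and M: "\<And>s. 0 \<le> s \<Longrightarrow> s \<le> t \<Longrightarrow> X s \<in> borel_measurable M"
    and N: "\<And>s. 0 \<le> s \<Longrightarrow> s \<le> t \<Longrightarrow> N s \<in> borel_measurable M"
    and q: "q \<in> borel_measurable M" "q' \<in> borel_measurable M"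
    and qc: "quad_covariation M X N t q" "quad_covariation M X N t q'"
  shows "AE \<omega> in M. q \<omega> = q' \<omega>"
proof -
  have small: "emeasure M {\<omega>\<in>space M. \<bar>q \<omega> - q' \<omega>\<bar> > 2 * \<epsilon>} \<le> ennreal (2 * \<epsilon>)" if e: "0 < \<epsilon>" for \<epsilon>
  proof -
    let ?S = "\<lambda>m p \<omega>. (\<Sum>i<m. (X (p (Suc i)) \<omega> - X (p i) \<omega>) * (N (p (Suc i)) \<omega> - N (p i) \<omega>))"
    obtain \<delta> where d: "\<delta> > 0" "\<And>m p. partition_of t \<delta> m p \<Longrightarrow>
        (\<integral>\<^sup>+\<omega>. indicator {\<omega>. \<bar>?S m p \<omega> - q \<omega>\<bar> > \<epsilon>} \<omega> \<partial>M) < ennreal \<epsilon>"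
      using qc(1) e unfolding quad_covariation_def by blast
    obtain \<delta>' where d': "\<delta>' > 0" "\<And>m p. partition_of t \<delta>' m p \<Longrightarrow>
        (\<integral>\<^sup>+\<omega>. indicator {\<omega>. \<bar>?S m p \<omega> - q' \<omega>\<bar> > \<epsilon>} \<omega> \<partial>M) < ennreal \<epsilon>"
      using qc(2) e unfolding quad_covariation_def by blast
    obtain m p where "partition_of t (min \<delta> \<delta>') m p"
      using partition_of_exists[OF t, of "min \<delta> \<delta>'"] d d' by auto
    then have pt: "partition_of t \<delta> m p" "partition_of t \<delta>' m p" by (auto simp: partition_of_def)
    have S[measurable]: "?S m p \<in> borel_measurable M"
      using partition_of_bounds[OF pt(1)]
      by (intro borel_measurable_sum borel_measurable_times borel_measurable_diff M N) auto
    note q[measurable]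
    let ?A = "{\<omega>\<in>space M. \<bar>?S m p \<omega> - q \<omega>\<bar> > \<epsilon>}" and ?B = "{\<omega>\<in>space M. \<bar>?S m p \<omega> - q' \<omega>\<bar> > \<epsilon>}"
    have A: "emeasure M ?A \<le> ennreal \<epsilon>"
    proof -
      have "emeasure M ?A = (\<integral>\<^sup>+\<omega>. indicator ?A \<omega> \<partial>M)" by (subst nn_integral_indicator) auto
      also have "\<dots> = (\<integral>\<^sup>+\<omega>. indicator {\<omega>. \<bar>?S m p \<omega> - q \<omega>\<bar> > \<epsilon>} \<omega> \<partial>M)"
        by (intro nn_integral_cong) (auto simp: indicator_def)
      finally show ?thesis using d(2)[OF pt(1)] by simp
    qed
    have B: "emeasure M ?B \<le> ennreal \<epsilon>"
    proof -
      have "emeasure M ?B = (\<integral>\<^sup>+\<omega>. indicator ?B \<omega> \<partial>M)" by (subst nn_integral_indicator) auto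
      also have "\<dots> = (\<integral>\<^sup>+\<omega>. indicator {\<omega>. \<bar>?S m p \<omega> - q' \<omega>\<bar> > \<epsilon>} \<omega> \<partial>M)"
        by (intro nn_integral_cong) (auto simp: indicator_def)
      finally show ?thesis using d'(2)[OF pt(2)] by simp
    qed
    have "emeasure M {\<omega>\<in>space M. \<bar>q \<omega> - q' \<omega>\<bar> > 2 * \<epsilon>} \<le> emeasure M (?A \<union> ?B)"
      by (intro emeasure_mono) auto
    also have "\<dots> \<le> emeasure M ?A + emeasure M ?B" by (intro emeasure_subadditive) auto
    also have "\<dots> \<le> ennreal \<epsilon> + ennreal \<epsilon>" by (intro add_mono A B)
    also have "\<dots> = ennreal (2 * \<epsilon>)" using e by (simp flip: ennreal_plus)
    finally show ?thesis .
  qed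
  have "AE \<omega> in M. \<not> \<bar>q \<omega> - q' \<omega>\<bar> > 2 / real (Suc n)" for n
  proof -
    note q[measurable]
    let ?E = "{\<omega>\<in>space M. \<bar>q \<omega> - q' \<omega>\<bar> > 2 / real (Suc n)}"
    have "emeasure M ?E \<le> 0 + ennreal \<epsilon>" if e: "0 < \<epsilon>" for \<epsilon>
    proof -
      \<comment> \<open>The first argument bounds the probability by \<epsilon>, the second keeps
        the threshold below the fixed gap 2 / (n + 1).\<close>
      let ?\<epsilon> = "min (\<epsilon> / 2) (1 / real (Suc n))"
      have "emeasure M ?E \<le> emeasure M {\<omega>\<in>space M. \<bar>q \<omega> - q' \<omega>\<bar> > 2 * ?\<epsilon>}"
      proof (intro emeasure_mono)
        have "2 * ?\<epsilon> \<le> 2 / real (Suc n)" by (simp add: min_le_iff_disj)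
        then show "?E \<subseteq> {\<omega>\<in>space M. \<bar>q \<omega> - q' \<omega>\<bar> > 2 * ?\<epsilon>}" by auto
      qed auto
      also have "\<dots> \<le> ennreal (2 * ?\<epsilon>)" using e by (intro small) auto
      also have "\<dots> \<le> ennreal \<epsilon>" using e by (intro ennreal_leI) auto
      finally show ?thesis by simp
    qed
    then have "emeasure M ?E \<le> 0" by (rule ennreal_le_epsilon)
    then show ?thesis by (intro AE_I[of _ _ ?E]) auto
  qed
  then have "AE \<omega> in M. \<forall>n. \<not> \<bar>q \<omega> - q' \<omega>\<bar> > 2 / real (Suc n)" by (simp add: AE_all_countable)
  then show ?thesis
  proof eventually_elim
    case (elim \<omega>)
    show ?case
    proof (rule ccontr)
      assume "q \<omega> \<noteq> q' \<omega>"
      then obtain n where "inverse (real (Suc n)) < \<bar>q \<omega> - q' \<omega>\<bar> / 2"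
        using reals_Archimedean[of "\<bar>q \<omega> - q' \<omega>\<bar> / 2"] by auto
      then show False using elim[rule_format, of n] by (simp add: field_simps)
    qed
  qed
qed

section \<open>Quadratic variation of Gaussian martingales and polarisation\<close>

context gauss_martingale
begin

text \<open>The compensated squares of successive increments are uncorrelated, so their second
  moments add up. Each contributes 3 v^2 - 2 v^2 + v^2 = 2 v^2, where v is the increment of
  \<open>V\<close> and 3 v^2 the fourth moment.\<close>

lemma square_incr_sum:
  assumes "0 \<le> p 0" "\<And>i. i < m \<Longrightarrow> p i \<le> p (Suc i)"
  defines "S \<equiv> \<lambda>m \<omega>. (\<Sum>i<m. (M (p (Suc i)) \<omega> - M (p i) \<omega>)\<^sup>2 - (V (p (Suc i)) - V (p i)))"
  shows "0 \<le> p m \<and> S m \<in> borel_measurable (F (p m)) \<and> integrable P (\<lambda>\<omega>. (S m \<omega>)\<^sup>2)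
    \<and> (\<integral>\<omega>. (S m \<omega>)\<^sup>2 \<partial>P) = (\<Sum>i<m. 2 * (V (p (Suc i)) - V (p i))\<^sup>2)"
  using assms(2)
proof (induction m)
  case 0
  then show ?case using assms(1) by (simp add: S_def)
next
  case (Suc m)
  let ?D = "\<lambda>\<omega>. M (p (Suc m)) \<omega> - M (p m) \<omega>" and ?v = "V (p (Suc m)) - V (p m)"
  have IH: "0 \<le> p m" "S m \<in> borel_measurable (F (p m))" "integrable P (\<lambda>\<omega>. (S m \<omega>)\<^sup>2)"
    "(\<integral>\<omega>. (S m \<omega>)\<^sup>2 \<partial>P) = (\<Sum>i<m. 2 * (V (p (Suc i)) - V (p i))\<^sup>2)" using Suc by auto
  have le: "p m \<le> p (Suc m)" using Suc by auto
  have SP: "S m \<in> borel_measurable P" using filt_measurable_P IH by blast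
  have Si: "integrable P (S m)" by (rule square_integrable_imp_integrable[OF SP IH(3)])
  have SS: "S (Suc m) \<omega> = S m \<omega> + ((?D \<omega>)\<^sup>2 - ?v)" for \<omega> by (simp add: S_def)
  have eq: "(S (Suc m) \<omega>)\<^sup>2 = (S m \<omega>)\<^sup>2 + (2 * (S m \<omega> * (?D \<omega>)\<^sup>2) - 2 * ?v * S m \<omega>)
      + (?D \<omega> ^ 4 - 2 * ?v * (?D \<omega>)\<^sup>2 + ?v\<^sup>2)" for \<omega>
    unfolding SS by (simp add: power2_eq_square power4_eq_xxxx algebra_simps)
  note i2 = indep_incr_2[OF IH(1) le IH(2) Si]
  note mo = incr_moments[OF IH(1) le]
  have meas: "S (Suc m) \<in> borel_measurable (F (p (Suc m)))"
  proof -
    have "0 \<le> p (Suc m)" using IH(1) le by simp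
    then have [measurable]: "M (p (Suc m)) \<in> borel_measurable (F (p (Suc m)))" by (rule adapted)
    have [measurable]: "M (p m) \<in> borel_measurable (F (p (Suc m)))" "S m \<in> borel_measurable (F (p (Suc m)))"
      by (auto intro!: filt_measurable[OF IH(1) le] adapted IH)
    have "S (Suc m) = (\<lambda>\<omega>. S m \<omega> + ((?D \<omega>)\<^sup>2 - ?v))" using SS by blast
    then show ?thesis by simp
  qed
  have int: "integrable P (\<lambda>\<omega>. (S (Suc m) \<omega>)\<^sup>2)"
    unfolding eq using IH(3) i2(1) mo(1) Si
    by (intro Bochner_Integration.integrable_add Bochner_Integration.integrable_diff integrable_mult_right) auto
  have "(\<integral>\<omega>. (S (Suc m) \<omega>)\<^sup>2 \<partial>P) = (\<integral>\<omega>. (S m \<omega>)\<^sup>2 \<partial>P) + (2 * (\<integral>\<omega>. S m \<omega> * (?D \<omega>)\<^sup>2 \<partial>P) - 2 * ?v * (\<integral>\<omega>. S m \<omega> \<partial>P))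
     + ((\<integral>\<omega>. ?D \<omega> ^ 4 \<partial>P) - 2 * ?v * (\<integral>\<omega>. (?D \<omega>)\<^sup>2 \<partial>P) + ?v\<^sup>2)"
    unfolding eq using IH(3) i2(1) mo(1) Si by (simp add: prob_space)
  also have "\<dots> = (\<Sum>i<m. 2 * (V (p (Suc i)) - V (p i))\<^sup>2) + 2 * ?v\<^sup>2"
    unfolding IH(4) i2(2) mo(3,4) by (simp add: power2_eq_square algebra_simps)
  finally show ?case using meas int IH(1) le by auto
qed

text \<open>The variance is the sum of 2 v^2 over the cells. It is at most twice the largest v times
  the total increase of \<open>V\<close>, and the largest v is small by uniform continuity.\<close>

lemma quadratic_variation_L2:
  assumes t: "0 \<le> t" and e: "0 < (\<epsilon>::real)"
  shows "\<exists>\<delta>>0. \<forall>m p. partition_of t \<delta> m p \<longrightarrow>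
    (\<integral>\<^sup>+\<omega>. ennreal (((\<Sum>i<m. (M (p (Suc i)) \<omega> - M (p i) \<omega>)\<^sup>2) - (V t - V 0))\<^sup>2) \<partial>P) < ennreal \<epsilon>"
proof -
  \<comment> \<open>Chosen so that 2 * \<eta> * (V t - V 0) stays below \<epsilon>; adding 1 guards
    against a vanishing increase of \<open>V\<close>.\<close>
  define \<eta> where "\<eta> = \<epsilon> / (2 * (V t - V 0 + 1))"
  have V0: "0 \<le> V t - V 0" using V_mono[of 0 t] t by simp
  have eta: "0 < \<eta>" unfolding \<eta>_def using V0 e by simp
  have "uniformly_continuous_on {0..t} V"
    by (rule compact_uniformly_continuous) (auto intro: continuous_on_subset[OF V_cont])
  then obtain \<delta> where d: "\<delta> > 0" "\<And>a b. a \<in> {0..t} \<Longrightarrow> b \<in> {0..t} \<Longrightarrow> dist b a < \<delta> \<Longrightarrow> dist (V b) (V a) < \<eta>"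
    unfolding uniformly_continuous_on_def using eta by metis
  show ?thesis
  proof (intro exI[of _ \<delta>] conjI allI impI d(1))
    fix m p assume pt: "partition_of t \<delta> m p"
    have p: "0 \<le> p 0" "\<And>i. i < m \<Longrightarrow> p i \<le> p (Suc i)" using pt by (auto simp: partition_of_def)
    define dV where "dV i = V (p (Suc i)) - V (p i)" for i
    have dV0: "0 \<le> dV i" if "i < m" for i
      using V_mono partition_of_bounds[OF pt, of i] p(2)[OF that] that by (auto simp: dV_def)
    have dV1: "dV i < \<eta>" if "i < m" for i
      using d(2)[of "p i" "p (Suc i)"] partition_of_bounds[OF pt, of i] partition_of_bounds[OF pt,
        of "Suc i"] pt that p(2)[OF that]
      by (auto simp: dV_def dist_real_def partition_of_def)
    have tele: "(\<Sum>i<m. dV i) = V t - V 0"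
      using pt sum_lessThan_telescope[of "\<lambda>i. V (p i)" m] by (simp add: dV_def partition_of_def)
    let ?S = "\<lambda>\<omega>. (\<Sum>i<m. (M (p (Suc i)) \<omega> - M (p i) \<omega>)\<^sup>2) - (V t - V 0)"
    have S: "?S \<omega> = (\<Sum>i<m. (M (p (Suc i)) \<omega> - M (p i) \<omega>)\<^sup>2 - (V (p (Suc i)) - V (p i)))" for \<omega>
      using tele by (simp add: sum_subtractf dV_def)
    note sis = square_incr_sum[of p m, OF p]
    have nn: "(\<integral>\<^sup>+\<omega>. ennreal ((?S \<omega>)\<^sup>2) \<partial>P) = ennreal (\<integral>\<omega>. (?S \<omega>)\<^sup>2 \<partial>P)"
      unfolding S using sis by (intro nn_integral_eq_integral) auto
    have "(\<integral>\<omega>. (?S \<omega>)\<^sup>2 \<partial>P) = (\<Sum>i<m. 2 * (dV i * dV i))"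
      unfolding S using sis by (simp add: dV_def power2_eq_square)
    also have "\<dots> \<le> (\<Sum>i<m. 2 * (\<eta> * dV i))"
      using dV0 dV1 by (intro sum_mono mult_left_mono mult_right_mono) (auto intro: less_imp_le)
    also have "\<dots> = 2 * \<eta> * (V t - V 0)"
      unfolding tele[symmetric] by (simp add: sum_distrib_left mult.assoc)
    also have "\<dots> < \<epsilon>"
      unfolding \<eta>_def using V0 e by (simp add: field_simps)
    finally have "(\<integral>\<omega>. (?S \<omega>)\<^sup>2 \<partial>P) < \<epsilon>" .
    then show "(\<integral>\<^sup>+\<omega>. ennreal ((?S \<omega>)\<^sup>2) \<partial>P) < ennreal \<epsilon>"
      unfolding nn using e by (simp add: ennreal_lessI)
  qed
qed

lemma quadratic_variation:
  assumes "0 \<le> t"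
  shows "quad_covariation P M M t (\<lambda>_. V t - V 0)"
  by (rule quad_covariation_if_L2)
    (use quadratic_variation_L2[OF assms] M_measurable in \<open>auto simp: power2_eq_square\<close>)

end

text \<open>A product of increments is a quarter of the difference of the squares of the increments
  of \<open>M + N\<close> and \<open>M - N\<close>. Both are assumed to be Gaussian martingales, so
  no joint statement about \<open>M\<close> and \<open>N\<close> enters.\<close>

lemma quad_covariation_polarization:
  assumes A: "gauss_martingale P F (\<lambda>s \<omega>. M s \<omega> + N s \<omega>) V"
    and B: "gauss_martingale P F (\<lambda>s \<omega>. M s \<omega> - N s \<omega>) V'"
    and M: "\<And>s. 0 \<le> s \<Longrightarrow> M s \<in> borel_measurable P" and N: "\<And>s. 0 \<le> s \<Longrightarrow> N s \<in> borel_measurable P"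
    and t: "0 \<le> t"
  shows "quad_covariation P M N t (\<lambda>_. ((V t - V 0) - (V' t - V' 0)) / 4)"
proof (rule quad_covariation_if_L2)
  fix \<epsilon> :: real assume e: "0 < \<epsilon>"
  interpret A: gauss_martingale P F "\<lambda>s \<omega>. M s \<omega> + N s \<omega>" V by (rule A)
  interpret B: gauss_martingale P F "\<lambda>s \<omega>. M s \<omega> - N s \<omega>" V' by (rule B)
  let ?SA = "\<lambda>m p \<omega>. (\<Sum>i<m. (M (p (Suc i)) \<omega> + N (p (Suc i)) \<omega> - (M (p i) \<omega> + N (p i) \<omega>))\<^sup>2) - (V t - V 0)"
  let ?SB = "\<lambda>m p \<omega>. (\<Sum>i<m. (M (p (Suc i)) \<omega> - N (p (Suc i)) \<omega> - (M (p i) \<omega> - N (p i) \<omega>))\<^sup>2) - (V' t - V' 0)"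
  let ?S = "\<lambda>m p \<omega>. (\<Sum>i<m. (M (p (Suc i)) \<omega> - M (p i) \<omega>) * (N (p (Suc i)) \<omega> - N (p i) \<omega>)) - ((V t - V 0)
    - (V' t - V' 0)) / 4"
  obtain \<delta> where d: "\<delta> > 0" "\<And>m p. partition_of t \<delta> m p \<Longrightarrow> (\<integral>\<^sup>+\<omega>. ennreal ((?SA m p \<omega>)\<^sup>2) \<partial>P) < ennreal (\<epsilon> / 2)"
    using A.quadratic_variation_L2[OF t, of "\<epsilon> / 2"] e by auto
  obtain \<delta>' where d': "\<delta>' > 0" "\<And>m p. partition_of t \<delta>' m p \<Longrightarrow> (\<integral>\<^sup>+\<omega>. ennreal ((?SB m p \<omega>)\<^sup>2) \<partial>P) < ennreal (\<epsilon> / 2)"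
    using B.quadratic_variation_L2[OF t, of "\<epsilon> / 2"] e by auto
  show "\<exists>\<delta>>0. \<forall>m p. partition_of t \<delta> m p \<longrightarrow> (\<integral>\<^sup>+\<omega>. ennreal ((?S m p \<omega>)\<^sup>2) \<partial>P) < ennreal \<epsilon>"
  proof (intro exI[of _ "min \<delta> \<delta>'"] conjI allI impI)
    fix m p assume "partition_of t (min \<delta> \<delta>') m p"
    then have pt: "partition_of t \<delta> m p" "partition_of t \<delta>' m p" by (auto simp: partition_of_def)
    have meas: "?SA m p \<in> borel_measurable P" "?SB m p \<in> borel_measurable P"
      using partition_of_bounds[OF pt(1)]
      by (auto intro!: borel_measurable_sum borel_measurable_power borel_measurable_diff borel_measurable_add M N)
    have S: "?S m p \<omega> = (?SA m p \<omega> - ?SB m p \<omega>) / 4" for \<omega>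
    proof -
      have "4 * (\<Sum>i<m. (M (p (Suc i)) \<omega> - M (p i) \<omega>) * (N (p (Suc i)) \<omega> - N (p i) \<omega>))
        = (\<Sum>i<m. (M (p (Suc i)) \<omega> + N (p (Suc i)) \<omega> - (M (p i) \<omega> + N (p i) \<omega>))\<^sup>2)
        - (\<Sum>i<m. (M (p (Suc i)) \<omega> - N (p (Suc i)) \<omega> - (M (p i) \<omega> - N (p i) \<omega>))\<^sup>2)"
        unfolding sum_distrib_left sum_subtractf[symmetric]
        by (intro sum.cong) (auto simp: power2_eq_square algebra_simps)
      moreover have "x - (v - w) / 4 = (A - v - (B - w)) / 4" if "4 * x = A - B" for x v w A B :: real
        using that by (simp add: field_simps)
      ultimately show ?thesis by blast
    qed
    have "(\<integral>\<^sup>+\<omega>. ennreal ((?S m p \<omega>)\<^sup>2) \<partial>P) \<le> (\<integral>\<^sup>+\<omega>. ennreal (1/2) * (ennreal ((?SA m p \<omega>)\<^sup>2)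
      + ennreal ((?SB m p \<omega>)\<^sup>2)) \<partial>P)"
    proof (intro nn_integral_mono)
      fix \<omega>
      have "(?S m p \<omega>)\<^sup>2 \<le> 1/2 * ((?SA m p \<omega>)\<^sup>2 + (?SB m p \<omega>)\<^sup>2)"
      proof -
        \<comment> \<open>The generous constant 1/2 leaves room: two errors of at most \<epsilon> /
          2 combine to \<epsilon> / 2, which is strictly below \<epsilon>.\<close>
        have "((x - y) / 4)\<^sup>2 \<le> 1/2 * (x\<^sup>2 + y\<^sup>2)" for x y :: real
        proof -
          have "1/2 * (x\<^sup>2 + y\<^sup>2) - ((x - y) / 4)\<^sup>2 = (6 * (x\<^sup>2 + y\<^sup>2) + (x + y)\<^sup>2) / 16"
            by (simp add: power2_eq_square field_simps)
          also have "\<dots> \<ge> 0" by simp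
          finally show ?thesis by simp
        qed
        then show ?thesis unfolding S .
      qed
      then show "ennreal ((?S m p \<omega>)\<^sup>2) \<le> ennreal (1/2) * (ennreal ((?SA m p \<omega>)\<^sup>2) + ennreal ((?SB m p \<omega>)\<^sup>2))"
        by (subst ennreal_plus[symmetric], simp, simp, subst ennreal_mult[symmetric], simp, simp, intro
          ennreal_leI)
    qed
    also have "\<dots> = ennreal (1/2) * ((\<integral>\<^sup>+\<omega>. ennreal ((?SA m p \<omega>)\<^sup>2) \<partial>P) + (\<integral>\<^sup>+\<omega>. ennreal ((?SB m p \<omega>)\<^sup>2) \<partial>P))"
      using meas by (subst nn_integral_cmult, measurable, subst nn_integral_add, measurable)
    also have "\<dots> \<le> ennreal (1/2) * (ennreal (\<epsilon> / 2) + ennreal (\<epsilon> / 2))"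
      using d(2)[OF pt(1)] d'(2)[OF pt(2)] by (intro mult_left_mono add_mono) (auto intro: less_imp_le)
    also have "\<dots> = ennreal (1/2 * (\<epsilon> / 2 + \<epsilon> / 2))"
      using e ennreal_plus[of "\<epsilon> / 2" "\<epsilon> / 2"] ennreal_mult[of "1/2" "\<epsilon> / 2 + \<epsilon> / 2"] by simp
    also have "\<dots> < ennreal \<epsilon>" using e by (intro ennreal_lessI) auto
    finally show "(\<integral>\<^sup>+\<omega>. ennreal ((?S m p \<omega>)\<^sup>2) \<partial>P) < ennreal \<epsilon>" .
  qed (use d d' in auto)
qed (use M N in auto)

section \<open>The bracket as a measure, and the Ito isometry\<close>

lemma sets_bracket_measure [simp, measurable_cong]: "sets (bracket_measure V) = sets borel"
  and space_bracket_measure [simp]: "space (bracket_measure V) = UNIV"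
  by (simp_all add: bracket_measure_def)

text \<open>Equality at all rational times holds outside one null set, and continuity extends it to
  all times.\<close>

lemma AE_eq_all_times:
  fixes X X' :: "real \<Rightarrow> 'a \<Rightarrow> real"
  assumes eq: "\<And>t. 0 \<le> t \<Longrightarrow> AE \<omega> in P. X t \<omega> = X' t \<omega>"
    and cont: "AE \<omega> in P. continuous_on {0..} (\<lambda>t. X t \<omega>)" "AE \<omega> in P. continuous_on {0..} (\<lambda>t. X' t \<omega>)"
  shows "AE \<omega> in P. \<forall>t\<ge>0. X t \<omega> = X' t \<omega>"
proof -
  have "AE \<omega> in P. \<forall>r\<in>\<rat>. 0 \<le> r \<longrightarrow> X r \<omega> = X' r \<omega>"
    by (rule AE_ball_countable[THEN iffD2, rule_format], rule countable_rat) (use eq in \<open>auto simp: AE_conj_iff\<close>)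
  with cont show ?thesis
  proof eventually_elim
    case (elim \<omega>)
    show ?case
    proof (intro allI impI)
      fix t :: real assume t: "0 \<le> t"
      \<comment> \<open>Rational approximation from above, so that the approximating times stay
        nonnegative, where the paths are continuous.\<close>
      let ?r = "\<lambda>n::nat. real_of_int \<lceil>t * real (Suc n)\<rceil> / real (Suc n)"
      have r0: "0 \<le> ?r n" for n
      proof -
        have "(0::real) \<le> t * real (Suc n)" using t by simp
        then show ?thesis by (simp add: ceiling_mono[of 0, simplified])
      qed
      have rt: "?r \<longlonglongrightarrow> t"
      proof (rule tendsto_sandwich)
        show "\<forall>\<^sub>F n in sequentially. t \<le> ?r n" by (simp add: field_simps)
        show "\<forall>\<^sub>F n in sequentially. ?r n \<le> t + 1 / real (Suc n)"
        proof (rule always_eventually, rule allI)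
          fix n
          have "real_of_int \<lceil>t * real (Suc n)\<rceil> \<le> t * real (Suc n) + 1" by (rule of_int_ceiling_le_add_one)
          then have "?r n \<le> (t * real (Suc n) + 1) / real (Suc n)" by (intro divide_right_mono) auto
          also have "\<dots> = t + 1 / real (Suc n)" by (simp add: add_divide_distrib)
          finally show "?r n \<le> t + 1 / real (Suc n)" .
        qed
        show "(\<lambda>n. t + 1 / real (Suc n)) \<longlonglongrightarrow> t"
          using tendsto_add[OF tendsto_const LIMSEQ_inverse_real_of_nat, of t] by (simp add: inverse_eq_divide)
      qed simp
      have "(\<lambda>n. X (?r n) \<omega>) \<longlonglongrightarrow> X t \<omega>"
        by (rule continuous_on_tendsto_compose[OF elim(1) rt]) (use t r0 in auto)
      moreover have "(\<lambda>n. X' (?r n) \<omega>) \<longlonglongrightarrow> X' t \<omega>"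
        by (rule continuous_on_tendsto_compose[OF elim(2) rt]) (use t r0 in auto)
      moreover have "X (?r n) \<omega> = X' (?r n) \<omega>" for n
        using elim(3) r0[of n] by (auto intro!: Rats_divide)
      ultimately show "X t \<omega> = X' t \<omega>" using LIMSEQ_unique by auto
    qed
  qed
qed

context gauss_martingale
begin

abbreviation "\<mu> \<equiv> bracket_measure V"

lemma V_ext_mono: "x \<le> y \<Longrightarrow> V (max 0 x) \<le> V (max 0 y)"
  by (rule V_mono) auto

lemma V_ext_cont: "continuous_on UNIV (\<lambda>s. V (max 0 s))"
  by (rule continuous_on_compose2[OF V_cont]) (auto intro!: continuous_intros)

lemma V_ext_right_cont: "continuous (at_right a) (\<lambda>s. V (max 0 s))"
  using V_ext_cont by (auto simp: continuous_on_eq_continuous_at intro: continuous_at_imp_continuous_at_within)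

lemma sigma_finite_bracket: "sigma_finite_measure \<mu>"
  unfolding bracket_measure_def
  by (rule sigma_finite_interval_measure[OF V_ext_mono V_ext_right_cont])

lemma emeasure_bracket_Ioc: "a \<le> b \<Longrightarrow> emeasure \<mu> {a<..b} = ennreal (V (max 0 b) - V (max 0 a))"
  unfolding bracket_measure_def by (rule emeasure_interval_measure_Ioc[OF _ V_ext_mono V_ext_right_cont])

lemma measure_bracket_Ioc: "0 \<le> a \<Longrightarrow> a \<le> b \<Longrightarrow> measure \<mu> {a<..b} = V b - V a"
  using emeasure_bracket_Ioc[of a b] V_mono[of a b] by (simp add: measure_def max_def)

text \<open>The closed interval is enlarged to one that is open at -1. The extension of
  \<open>V\<close> is constant on negative times, so the enlargement carries no further
  mass.\<close>

lemma emeasure_bracket_Icc_le: "0 \<le> t \<Longrightarrow> emeasure \<mu> {0..t} \<le> ennreal (V t - V 0)"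
proof -
  assume t: "0 \<le> t"
  have "emeasure \<mu> {0..t} \<le> emeasure \<mu> {-1<..t}" by (intro emeasure_mono) auto
  also have "\<dots> = ennreal (V t - V 0)" using emeasure_bracket_Ioc[of "-1" t] t by (simp add: max_def)
  finally show ?thesis .
qed

lemma finite_bracket_Ioc: "emeasure \<mu> {a<..b} < \<infinity>"
  using emeasure_bracket_Ioc[of a b] by (cases "a \<le> b") auto

lemma covariance_incr_le:
  assumes ab: "0 \<le> a" "a \<le> b" and cd: "a \<le> c" "c \<le> d"
    and \<xi>: "\<xi> \<in> borel_measurable (F a)" "\<And>\<omega>. \<omega> \<in> space P \<Longrightarrow> \<bar>\<xi> \<omega>\<bar> \<le> C"
    and \<eta>: "\<eta> \<in> borel_measurable (F c)" "\<And>\<omega>. \<omega> \<in> space P \<Longrightarrow> \<bar>\<eta> \<omega>\<bar> \<le> C'"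
  shows "integrable P (\<lambda>\<omega>. \<xi> \<omega> * (M b \<omega> - M a \<omega>) * (\<eta> \<omega> * (M d \<omega> - M c \<omega>)))
    \<and> (\<integral>\<omega>. \<xi> \<omega> * (M b \<omega> - M a \<omega>) * (\<eta> \<omega> * (M d \<omega> - M c \<omega>)) \<partial>P)
      = (\<integral>\<omega>. \<xi> \<omega> * \<eta> \<omega> \<partial>P) * measure \<mu> ({a<..b} \<inter> {c<..d})"
proof -
  have c0: "0 \<le> c" using ab cd by simp
  let ?\<zeta> = "\<lambda>\<omega>. \<xi> \<omega> * \<eta> \<omega>"
  have Fc: "\<xi> \<in> borel_measurable (F r)" "\<eta> \<in> borel_measurable (F r)" "?\<zeta> \<in> borel_measurable (F r)" if "c \<le> r" for r
  proof -
    show "\<xi> \<in> borel_measurable (F r)" "\<eta> \<in> borel_measurable (F r)"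
      using filt_measurable[OF ab(1) _ \<xi>(1), of r] filt_measurable[OF c0 _ \<eta>(1), of r] that cd by auto
    then show "?\<zeta> \<in> borel_measurable (F r)" by simp
  qed
  have zP: "?\<zeta> \<in> borel_measurable P" using filt_measurable_P[OF c0 Fc(3)] by simp
  have zb: "\<bar>?\<zeta> \<omega>\<bar> \<le> C * C'" if "\<omega> \<in> space P" for \<omega>
    unfolding abs_mult using \<xi>(2)[OF that] \<eta>(2)[OF that] by (intro mult_mono) auto
  have zi: "integrable P ?\<zeta>"
    by (rule integrable_const_bound[where B="C * C'"]) (use zb zP in auto)
  have zr: "integrable P (\<lambda>\<omega>. ?\<zeta> \<omega> * (M s \<omega> - M r \<omega>))" if "0 \<le> r" "r \<le> s" "c \<le> r" for r s
    by (rule indep_incr_0(1)[OF that(1,2) Fc(3)[OF that(3)] zi])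
  have \<xi>P: "\<xi> \<in> borel_measurable P" and \<eta>P: "\<eta> \<in> borel_measurable P"
    using filt_measurable_P[OF c0 Fc(1)] filt_measurable_P[OF c0 Fc(2)] by auto
  have zi0: "integrable P (\<lambda>\<omega>. ?\<zeta> \<omega> * (M s \<omega> - M r \<omega>))" if "0 \<le> r" "r \<le> s" for r s
  proof (rule Bochner_Integration.integrable_bound)
    show "integrable P (\<lambda>\<omega>. (C * C') * (M s \<omega> - M r \<omega>))"
      using incr_moments(1)[OF that, of 1] by simp
    show "(\<lambda>\<omega>. ?\<zeta> \<omega> * (M s \<omega> - M r \<omega>)) \<in> borel_measurable P"
      by (intro borel_measurable_times[OF zP] incr_measurable that)
    show "AE \<omega> in P. norm (?\<zeta> \<omega> * (M s \<omega> - M r \<omega>)) \<le> norm ((C * C') * (M s \<omega> - M r \<omega>))"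
    proof (rule AE_I2)
      fix \<omega> assume "\<omega> \<in> space P"
      from zb[OF this] show "norm (?\<zeta> \<omega> * (M s \<omega> - M r \<omega>)) \<le> norm ((C * C') * (M s \<omega> - M r \<omega>))"
        unfolding real_norm_def abs_mult[of "?\<zeta> \<omega>"] abs_mult[of "C * C'"] by (intro mult_right_mono) auto
    qed
  qed
  have cross: "integrable P (\<lambda>\<omega>. ?\<zeta> \<omega> * (M s \<omega> - M r \<omega>) * (M s' \<omega> - M r' \<omega>))
      \<and> (\<integral>\<omega>. ?\<zeta> \<omega> * (M s \<omega> - M r \<omega>) * (M s' \<omega> - M r' \<omega>) \<partial>P) = 0"
    if "0 \<le> r" "r \<le> s" "s \<le> r'" "c \<le> r'" "r' \<le> s'" for r s r' s'
  proof -
    have 1: "(\<lambda>\<omega>. ?\<zeta> \<omega> * (M s \<omega> - M r \<omega>)) \<in> borel_measurable (F r')"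
      using that by (intro borel_measurable_times borel_measurable_diff Fc filt_measurable[OF _ _ adapted]) auto
    have r0: "0 \<le> r'" using that by simp
    show ?thesis using indep_incr_0[OF r0 that(5) 1 zi0[OF that(1,2)]] by simp
  qed
  have sq: "integrable P (\<lambda>\<omega>. ?\<zeta> \<omega> * (M s \<omega> - M c \<omega>)\<^sup>2)
      \<and> (\<integral>\<omega>. ?\<zeta> \<omega> * (M s \<omega> - M c \<omega>)\<^sup>2 \<partial>P) = (\<integral>\<omega>. ?\<zeta> \<omega> \<partial>P) * (V s - V c)" if "c \<le> s" for s
    using indep_incr_2[OF c0 that Fc(3)[OF order_refl] zi] by simp
  \<comment> \<open>The second interval starts no earlier than the first: it is disjoint from it,
    overlaps it to the right, or lies inside it.\<close>
  consider "b \<le> c" | "c \<le> b" "b \<le> d" | "d \<le> b" "c \<le> b" by linarith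
  then show ?thesis
  proof cases
    case 1
    then have e: "{a<..b} \<inter> {c<..d} = {}" by auto
    have "(\<lambda>\<omega>. \<xi> \<omega> * (M b \<omega> - M a \<omega>) * (\<eta> \<omega> * (M d \<omega> - M c \<omega>)))
      = (\<lambda>\<omega>. ?\<zeta> \<omega> * (M b \<omega> - M a \<omega>) * (M d \<omega> - M c \<omega>))" by (simp add: mult_ac)
    then show ?thesis unfolding e using cross[OF ab 1 order_refl cd(2)] by simp
  next
    case 2
    then have e: "{a<..b} \<inter> {c<..d} = {c<..b}" using cd by auto
    have eq: "(\<lambda>\<omega>. \<xi> \<omega> * (M b \<omega> - M a \<omega>) * (\<eta> \<omega> * (M d \<omega> - M c \<omega>)))
      = (\<lambda>\<omega>. ?\<zeta> \<omega> * (M c \<omega> - M a \<omega>) * (M d \<omega> - M c \<omega>) + ?\<zeta> \<omega> * (M b \<omega> - M c \<omega>)\<^sup>2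
          + ?\<zeta> \<omega> * (M b \<omega> - M c \<omega>) * (M d \<omega> - M b \<omega>))" by (simp add: algebra_simps power2_eq_square)
    show ?thesis
      unfolding eq e measure_bracket_Ioc[OF c0 2(1)]
      using cross[OF ab(1) cd(1) order_refl order_refl cd(2)] cross[OF c0 2(1) order_refl 2(1) 2(2)] sq[OF 2(1)]
      by simp
  next
    case 3
    then have e: "{a<..b} \<inter> {c<..d} = {c<..d}" using cd by auto
    have eq: "(\<lambda>\<omega>. \<xi> \<omega> * (M b \<omega> - M a \<omega>) * (\<eta> \<omega> * (M d \<omega> - M c \<omega>)))
      = (\<lambda>\<omega>. ?\<zeta> \<omega> * (M c \<omega> - M a \<omega>) * (M d \<omega> - M c \<omega>) + ?\<zeta> \<omega> * (M d \<omega> - M c \<omega>)\<^sup>2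
          + ?\<zeta> \<omega> * (M d \<omega> - M c \<omega>) * (M b \<omega> - M d \<omega>))" by (simp add: algebra_simps power2_eq_square)
    show ?thesis
      unfolding eq e measure_bracket_Ioc[OF c0 cd(2)]
      using cross[OF ab(1) cd(1) order_refl order_refl cd(2)] cross[OF c0 cd(2) order_refl cd(2) 3(1)] sq[OF cd(2)]
      by simp
  qed
qed

lemma covariance_incr:
  assumes "0 \<le> a" "a \<le> b" "0 \<le> c" "c \<le> d"
    and "\<xi> \<in> borel_measurable (F a)" "\<And>\<omega>. \<omega> \<in> space P \<Longrightarrow> \<bar>\<xi> \<omega>\<bar> \<le> C"
    and "\<eta> \<in> borel_measurable (F c)" "\<And>\<omega>. \<omega> \<in> space P \<Longrightarrow> \<bar>\<eta> \<omega>\<bar> \<le> C'"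
  shows "integrable P (\<lambda>\<omega>. \<xi> \<omega> * (M b \<omega> - M a \<omega>) * (\<eta> \<omega> * (M d \<omega> - M c \<omega>)))
    \<and> (\<integral>\<omega>. \<xi> \<omega> * (M b \<omega> - M a \<omega>) * (\<eta> \<omega> * (M d \<omega> - M c \<omega>)) \<partial>P)
      = (\<integral>\<omega>. \<xi> \<omega> * \<eta> \<omega> \<partial>P) * measure \<mu> ({a<..b} \<inter> {c<..d})"
proof (cases "a \<le> c")
  case True
  show ?thesis by (rule covariance_incr_le[OF assms(1,2) True assms(4-8)])
next
  case False
  then have "c \<le> a" by simp
  from covariance_incr_le[OF assms(3,4) this assms(2,7,8,5,6)]
  show ?thesis by (simp add: mult_ac Int_commute)
qed

text \<open>Both squares are expanded into double sums. Their terms agree because the covariance of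
  two weighted increments is the mean of the product of the weights times the measure of the
  intersection. The intervals may overlap and carry any finite index set.\<close>

lemma isometry:
  fixes \<xi> :: "'i \<Rightarrow> 'w \<Rightarrow> real"
  assumes I: "finite I" and ab: "\<And>i. i \<in> I \<Longrightarrow> 0 \<le> a i \<and> a i \<le> b i"
    and \<xi>: "\<And>i. i \<in> I \<Longrightarrow> \<xi> i \<in> borel_measurable (F (a i))"
      "\<And>i \<omega>. i \<in> I \<Longrightarrow> \<omega> \<in> space P \<Longrightarrow> \<bar>\<xi> i \<omega>\<bar> \<le> C i"
  shows "(\<integral>\<^sup>+\<omega>. ennreal ((\<Sum>i\<in>I. \<xi> i \<omega> * (M (b i) \<omega> - M (a i) \<omega>))\<^sup>2) \<partial>P)
    = (\<integral>\<^sup>+\<omega>. (\<integral>\<^sup>+s. ennreal ((\<Sum>i\<in>I. \<xi> i \<omega> * indicator {a i<..b i} s)\<^sup>2) \<partial>\<mu>) \<partial>P)"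
proof -
  let ?m = "\<lambda>i j. measure \<mu> ({a i<..b i} \<inter> {a j<..b j})"
  let ?T = "\<lambda>i j \<omega>. \<xi> i \<omega> * (M (b i) \<omega> - M (a i) \<omega>) * (\<xi> j \<omega> * (M (b j) \<omega> - M (a j) \<omega>))"
  have c: "integrable P (?T i j) \<and> (\<integral>\<omega>. ?T i j \<omega> \<partial>P) = (\<integral>\<omega>. \<xi> i \<omega> * \<xi> j \<omega> \<partial>P) * ?m i j"
    if "i \<in> I" "j \<in> I" for i j
    using ab[OF that(1)] ab[OF that(2)] \<xi>(1)[OF that(1)] \<xi>(1)[OF that(2)] \<xi>(2)[OF that(1)] \<xi>(2)[OF that(2)]
    by (intro covariance_incr) auto
  have xi_int: "integrable P (\<lambda>\<omega>. \<xi> i \<omega> * \<xi> j \<omega>)" if "i \<in> I" "j \<in> I" for i j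
  proof (rule integrable_const_bound[where B="C i * C j"])
    show "AE \<omega> in P. norm (\<xi> i \<omega> * \<xi> j \<omega>) \<le> C i * C j"
    proof (rule AE_I2)
      fix \<omega> assume w: "\<omega> \<in> space P"
      show "norm (\<xi> i \<omega> * \<xi> j \<omega>) \<le> C i * C j"
        unfolding real_norm_def abs_mult using \<xi>(2)[OF that(1) w] \<xi>(2)[OF that(2) w] by (intro mult_mono) auto
    qed
    show "(\<lambda>\<omega>. \<xi> i \<omega> * \<xi> j \<omega>) \<in> borel_measurable P"
      using filt_measurable_P \<xi>(1) ab that by (intro borel_measurable_times) blast+
  qed
  have sq: "(\<Sum>i\<in>I. f i)\<^sup>2 = (\<Sum>i\<in>I. \<Sum>j\<in>I. f i * f j)" for f :: "'i \<Rightarrow> real"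
    unfolding power2_eq_square sum_product ..
  have "integrable P (\<lambda>\<omega>. (\<Sum>i\<in>I. \<xi> i \<omega> * (M (b i) \<omega> - M (a i) \<omega>))\<^sup>2)"
    unfolding sq using c by (intro Bochner_Integration.integrable_sum) blast
  then have "(\<integral>\<^sup>+\<omega>. ennreal ((\<Sum>i\<in>I. \<xi> i \<omega> * (M (b i) \<omega> - M (a i) \<omega>))\<^sup>2) \<partial>P)
    = ennreal (\<integral>\<omega>. (\<Sum>i\<in>I. \<xi> i \<omega> * (M (b i) \<omega> - M (a i) \<omega>))\<^sup>2 \<partial>P)"
    by (intro nn_integral_eq_integral) auto
  also have "(\<integral>\<omega>. (\<Sum>i\<in>I. \<xi> i \<omega> * (M (b i) \<omega> - M (a i) \<omega>))\<^sup>2 \<partial>P)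
    = (\<Sum>i\<in>I. \<Sum>j\<in>I. (\<integral>\<omega>. \<xi> i \<omega> * \<xi> j \<omega> \<partial>P) * ?m i j)"
    unfolding sq using c by (subst Bochner_Integration.integral_sum, fastforce intro:
      Bochner_Integration.integrable_sum,
      intro sum.cong refl, subst Bochner_Integration.integral_sum) auto
  also have "\<dots> = (\<integral>\<omega>. (\<Sum>i\<in>I. \<Sum>j\<in>I. \<xi> i \<omega> * \<xi> j \<omega> * ?m i j) \<partial>P)"
    using xi_int by (subst Bochner_Integration.integral_sum, fastforce intro: Bochner_Integration.integrable_sum,
      intro sum.cong refl, subst Bochner_Integration.integral_sum) auto
  finally have L: "(\<integral>\<^sup>+\<omega>. ennreal ((\<Sum>i\<in>I. \<xi> i \<omega> * (M (b i) \<omega> - M (a i) \<omega>))\<^sup>2) \<partial>P)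
    = ennreal (\<integral>\<omega>. (\<Sum>i\<in>I. \<Sum>j\<in>I. \<xi> i \<omega> * \<xi> j \<omega> * ?m i j) \<partial>P)" .
  have inner: "(\<integral>\<^sup>+s. ennreal ((\<Sum>i\<in>I. \<xi> i \<omega> * indicator {a i<..b i} s)\<^sup>2) \<partial>\<mu>)
      = ennreal (\<Sum>i\<in>I. \<Sum>j\<in>I. \<xi> i \<omega> * \<xi> j \<omega> * ?m i j)"
    and inner0: "0 \<le> (\<Sum>i\<in>I. \<Sum>j\<in>I. \<xi> i \<omega> * \<xi> j \<omega> * ?m i j)" for \<omega>
  proof -
    have ii: "integrable \<mu> (indicat_real ({a i<..b i} \<inter> {a j<..b j}))" for i j
    proof (rule integrable_real_indicator)
      have "emeasure \<mu> ({a i<..b i} \<inter> {a j<..b j}) \<le> emeasure \<mu> {a i<..b i}" by (intro emeasure_mono) auto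
      also have "\<dots> < \<infinity>" by (rule finite_bracket_Ioc)
      finally show "emeasure \<mu> ({a i<..b i} \<inter> {a j<..b j}) < \<infinity>" .
    qed simp
    have e: "(\<Sum>i\<in>I. \<xi> i \<omega> * indicator {a i<..b i} s)\<^sup>2
      = (\<Sum>i\<in>I. \<Sum>j\<in>I. \<xi> i \<omega> * \<xi> j \<omega> * indicat_real ({a i<..b i} \<inter> {a j<..b j}) s)" for s
      unfolding sq by (intro sum.cong refl) (auto simp: indicator_def)
    have int: "integrable \<mu> (\<lambda>s. (\<Sum>i\<in>I. \<xi> i \<omega> * indicator {a i<..b i} s)\<^sup>2)"
      unfolding e using ii by (intro Bochner_Integration.integrable_sum integrable_mult_right) auto
    have i: "(\<integral>s. (\<Sum>i\<in>I. \<xi> i \<omega> * indicator {a i<..b i} s)\<^sup>2 \<partial>\<mu>) = (\<Sum>i\<in>I. \<Sum>j\<in>I. \<xi> i \<omega> * \<xi> j \<omega> * ?m i j)"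
      unfolding e using ii by (subst Bochner_Integration.integral_sum, fastforce intro:
        Bochner_Integration.integrable_sum,
      intro sum.cong refl, subst Bochner_Integration.integral_sum) auto
    show "0 \<le> (\<Sum>i\<in>I. \<Sum>j\<in>I. \<xi> i \<omega> * \<xi> j \<omega> * ?m i j)" unfolding i[symmetric] by simp
    show "(\<integral>\<^sup>+s. ennreal ((\<Sum>i\<in>I. \<xi> i \<omega> * indicator {a i<..b i} s)\<^sup>2) \<partial>\<mu>)
      = ennreal (\<Sum>i\<in>I. \<Sum>j\<in>I. \<xi> i \<omega> * \<xi> j \<omega> * ?m i j)"
      unfolding i[symmetric] using int by (intro nn_integral_eq_integral) auto
  qed
  show ?thesis
    unfolding L inner using xi_int inner0
    by (intro nn_integral_eq_integral[symmetric] Bochner_Integration.integrable_sum integrable_mult_left) auto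
qed

text \<open>The definition of the Ito integral allows any continuous version of the bracket.
  Uniqueness of the covariation at each time and continuity force it to be deterministic, so the
  random Stieltjes measure in that definition becomes the fixed measure
  \<open>\<mu>\<close>.\<close>

lemma bracket_process_eq:
  assumes A: "\<And>t. 0 \<le> t \<Longrightarrow> A t \<in> borel_measurable P" "\<And>t. 0 \<le> t \<Longrightarrow> quad_covariation P M M t (A t)"
    and cont: "AE \<omega> in P. continuous_on {0..} (\<lambda>t. A t \<omega>)"
  shows "AE \<omega> in P. \<forall>t\<ge>0. A t \<omega> = V t - V 0"
proof -
  show ?thesis
  proof (rule AE_eq_all_times[OF _ cont])
    fix t :: real assume t: "0 \<le> t"
    show "AE \<omega> in P. A t \<omega> = V t - V 0"
      by (rule quad_covariation_unique[OF t M_measurable M_measurable A(1)[OF t] _ A(2)[OF t]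
        quadratic_variation[OF t]]) auto
  qed (auto intro!: continuous_intros V_cont)
qed

end

section \<open>Stochastic integrals\<close>

lemma simple_process_mono:
  assumes "simple_process P F m p \<xi>" "i \<le> j" "j \<le> m"
  shows "p i \<le> p j"
  using assms(2,3)
proof (induction j rule: dec_induct)
  case (step n)
  then have "p n \<le> p (Suc n)" using assms(1) by (auto simp: simple_process_def)
  with step show ?case by auto
qed simp

lemma simple_process_nonneg:
  assumes "simple_process P F m p \<xi>" "i \<le> m"
  shows "0 \<le> p i"
  using simple_process_mono[OF assms(1), of 0 i] assms by (auto simp: simple_process_def)

lemma ennreal_square_add_le:
  "ennreal ((x + y)\<^sup>2) \<le> 2 * ennreal (x\<^sup>2) + 2 * ennreal (y\<^sup>2)" for x y :: real
proof -
  have "(x + y)\<^sup>2 \<le> 2 * x\<^sup>2 + 2 * y\<^sup>2"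
    using sum_squares_bound[of x y] by (simp add: power2_sum)
  then have "ennreal ((x + y)\<^sup>2) \<le> ennreal (2 * x\<^sup>2 + 2 * y\<^sup>2)" by (rule ennreal_leI)
  then show ?thesis by (simp add: ennreal_plus ennreal_mult)
qed

lemma nn_integral_square_add_le:
  fixes f g :: "'a \<Rightarrow> real"
  assumes [measurable]: "f \<in> borel_measurable M" "g \<in> borel_measurable M"
  shows "(\<integral>\<^sup>+x. ennreal ((f x + g x)\<^sup>2) \<partial>M) \<le> 2 * (\<integral>\<^sup>+x. ennreal ((f x)\<^sup>2) \<partial>M) + 2 * (\<integral>\<^sup>+x. ennreal ((g x)\<^sup>2) \<partial>M)"
proof -
  have "(\<integral>\<^sup>+x. ennreal ((f x + g x)\<^sup>2) \<partial>M) \<le> (\<integral>\<^sup>+x. 2 * ennreal ((f x)\<^sup>2) + 2 * ennreal ((g x)\<^sup>2) \<partial>M)"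
    by (intro nn_integral_mono ennreal_square_add_le)
  also have "\<dots> = 2 * (\<integral>\<^sup>+x. ennreal ((f x)\<^sup>2) \<partial>M) + 2 * (\<integral>\<^sup>+x. ennreal ((g x)\<^sup>2) \<partial>M)"
    by (simp add: nn_integral_add nn_integral_cmult)
  finally show ?thesis .
qed

text \<open>The factors 2 and 4 arise from applying the bound 2 x^2 + 2 y^2 for a squared sum twice:
  once for the distance of the integral to a simple integral, once for the distance of the
  integrands.\<close>

lemma ennreal_le_if_le_null_sequences:
  fixes a b c :: ennreal
  assumes le: "\<And>k. a \<le> 2 * e1 k + 4 * e2 k + c" and "e1 \<longlonglongrightarrow> 0" "e2 \<longlonglongrightarrow> 0"
  shows "a \<le> c"
proof -
  have "(\<lambda>k. 2 * e1 k + 4 * e2 k + c) \<longlonglongrightarrow> 2 * 0 + 4 * 0 + c"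
    by (intro tendsto_add tendsto_const ennreal_tendsto_cmult assms) auto
  then show ?thesis using le by (intro LIMSEQ_le_const[of _ c]) auto
qed

section \<open>Simple processes integrated against a Gaussian martingale\<close>

context gauss_martingale
begin

text \<open>An interval that starts after \<open>t\<close> is truncated to the empty interval at
  \<open>t\<close>, but its coefficient is known only later. Setting the coefficient to 0 keeps it
  measurable at the truncated left end point without changing the integral.\<close>

definition simple_coeff where
  "simple_coeff p \<xi> t i \<omega> = (if p i \<le> t then \<xi> i \<omega> else (0::real))"
    for p :: "nat \<Rightarrow> real" and \<xi> :: "nat \<Rightarrow> 'w \<Rightarrow> real"

lemma simple_integral_eq:
  assumes "simple_process P F m p \<xi>"
  shows "simple_integral m p \<xi> M t \<omega>
    = (\<Sum>i<m. simple_coeff p \<xi> t i \<omega> * (M (min (p (Suc i)) t) \<omega> - M (min (p i) t) \<omega>))"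
  unfolding simple_integral_def simple_coeff_def
proof (rule sum.cong)
  fix i assume "i \<in> {..<m}"
  then have "p i \<le> p (Suc i)" using simple_process_mono[OF assms, of i "Suc i"] by simp
  then show "\<xi> i \<omega> * (M (min (p (Suc i)) t) \<omega> - M (min (p i) t) \<omega>)
    = (if p i \<le> t then \<xi> i \<omega> else 0) * (M (min (p (Suc i)) t) \<omega> - M (min (p i) t) \<omega>)" by (auto simp: min_def)
qed simp

lemma simple_value_eq:
  assumes "simple_process P F m p \<xi>"
  shows "simple_value m p \<xi> s \<omega> * indicator {0..t} s
    = (\<Sum>i<m. simple_coeff p \<xi> t i \<omega> * indicator {min (p i) t<..min (p (Suc i)) t} s)"
  unfolding simple_value_def simple_coeff_def sum_distrib_right
proof (rule sum.cong)
  fix i assume "i \<in> {..<m}"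
  then have "0 \<le> p i" using simple_process_nonneg[OF assms, of i] by simp
  then show "\<xi> i \<omega> * indicator {p i<..p (Suc i)} s * indicator {0..t} s
    = (if p i \<le> t then \<xi> i \<omega> else 0) * indicator {min (p i) t<..min (p (Suc i)) t} s"
    by (auto simp: indicator_def min_def)
qed simp

lemma simple_coeff_props:
  assumes sp: "simple_process P F m p \<xi>" and t: "0 \<le> t" and i: "i < m"
  shows "0 \<le> min (p i) t \<and> min (p i) t \<le> min (p (Suc i)) t"
    and "simple_coeff p \<xi> t i \<in> borel_measurable (F (min (p i) t))"
    and "\<exists>C. \<forall>\<omega>\<in>space P. \<bar>simple_coeff p \<xi> t i \<omega>\<bar> \<le> C"
proof -
  show "0 \<le> min (p i) t \<and> min (p i) t \<le> min (p (Suc i)) t"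
    using simple_process_nonneg[OF sp, of i] simple_process_mono[OF sp, of i "Suc i"] i t by auto
  have "\<xi> i \<in> borel_measurable (F (p i))" using sp i by (auto simp: simple_process_def)
  then show "simple_coeff p \<xi> t i \<in> borel_measurable (F (min (p i) t))"
    unfolding simple_coeff_def[abs_def] by (cases "p i \<le> t") (auto simp: min_def)
  obtain C where "\<forall>\<omega>\<in>space P. \<bar>\<xi> i \<omega>\<bar> \<le> C" using sp i by (auto simp: simple_process_def)
  then have "\<forall>\<omega>\<in>space P. \<bar>simple_coeff p \<xi> t i \<omega>\<bar> \<le> max C 0" by (auto simp: simple_coeff_def)
  then show "\<exists>C. \<forall>\<omega>\<in>space P. \<bar>simple_coeff p \<xi> t i \<omega>\<bar> \<le> C" by blast
qed

lemma simple_process_measurable: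
  assumes sp: "simple_process P F m p \<xi>" and i: "i < m"
  shows "\<xi> i \<in> borel_measurable P"
  using filt_measurable_P[OF simple_process_nonneg[OF sp, of i]] sp i by (auto simp: simple_process_def)

lemma simple_integral_measurable:
  assumes sp: "simple_process P F m p \<xi>" and t: "0 \<le> t"
  shows "simple_integral m p \<xi> M t \<in> borel_measurable P"
  unfolding simple_integral_def[abs_def] using simple_process_nonneg[OF sp] t
  by (intro borel_measurable_sum borel_measurable_times borel_measurable_diff M_measurable
      simple_process_measurable[OF sp]) auto

lemma simple_value_measurable:
  assumes sp: "simple_process P F m p \<xi>"
  shows "(\<lambda>(\<omega>, s). simple_value m p \<xi> s \<omega>) \<in> borel_measurable (P \<Otimes>\<^sub>M borel)"
proof -
  have "(\<lambda>x. \<Sum>i<m. \<xi> i (fst x) * indicator {p i<..p (Suc i)} (snd x)) \<in> borel_measurable (P \<Otimes>\<^sub>M borel)"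
  proof (intro borel_measurable_sum borel_measurable_times)
    fix i assume "i \<in> {..<m}"
    then have [measurable]: "\<xi> i \<in> borel_measurable P" using simple_process_measurable[OF sp] by auto
    show "(\<lambda>x. \<xi> i (fst x)) \<in> borel_measurable (P \<Otimes>\<^sub>M borel)" by measurable
    show "(\<lambda>x. indicat_real {p i<..p (Suc i)} (snd x)) \<in> borel_measurable (P \<Otimes>\<^sub>M borel)" by measurable
  qed
  then show ?thesis unfolding simple_value_def by (simp add: case_prod_beta')
qed

lemma simple_integral_expectation:
  assumes sp: "simple_process P F m p \<xi>" and t: "0 \<le> t"
  shows "integrable P (simple_integral m p \<xi> M t)" and "(\<integral>\<omega>. simple_integral m p \<xi> M t \<omega> \<partial>P) = 0"
proof -
  have *: "integrable P (\<lambda>\<omega>. simple_coeff p \<xi> t i \<omega> * (M (min (p (Suc i)) t) \<omega> - M (min (p i) t) \<omega>)) \<and>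
    (\<integral>\<omega>. simple_coeff p \<xi> t i \<omega> * (M (min (p (Suc i)) t) \<omega> - M (min (p i) t) \<omega>) \<partial>P) = 0" if i: "i < m" for i
  proof -
    note c = simple_coeff_props[OF sp t i]
    obtain C where C: "\<forall>\<omega>\<in>space P. \<bar>simple_coeff p \<xi> t i \<omega>\<bar> \<le> C" using c(3) by blast
    have "integrable P (simple_coeff p \<xi> t i)"
      by (rule integrable_const_bound[where B=C]) (use C filt_measurable_P[OF _ c(2)] c(1) in auto)
    then show ?thesis using indep_incr_0[OF _ _ c(2)] c(1) by blast
  qed
  have e: "simple_integral m p \<xi> M t = (\<lambda>\<omega>. \<Sum>i<m. simple_coeff p \<xi> t i \<omega> * (M (min (p (Suc i)) t) \<omega>
    - M (min (p i) t) \<omega>))"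
    using simple_integral_eq[OF sp] by blast
  show "integrable P (simple_integral m p \<xi> M t)"
    unfolding e by (intro Bochner_Integration.integrable_sum) (use * in auto)
  show "(\<integral>\<omega>. simple_integral m p \<xi> M t \<omega> \<partial>P) = 0"
    unfolding e by (subst Bochner_Integration.integral_sum) (use * in auto)
qed

text \<open>The difference of a simple integral and a deterministic step integral is read as one
  family of weighted increments, indexed by the disjoint sum of both index sets, so that the
  isometry applies without merging partitions.\<close>

lemma simple_isometry:
  fixes c :: "'j \<Rightarrow> real"
  assumes sp: "simple_process P F m p \<xi>" and t: "0 \<le> t" and J: "finite J" "\<And>j. j \<in> J \<Longrightarrow> 0 \<le> a j \<and> a j \<le> b j"
  shows "(\<integral>\<^sup>+\<omega>. ennreal ((simple_integral m p \<xi> M t \<omega> - (\<Sum>j\<in>J. c j * (M (b j) \<omega> - M (a j) \<omega>)))\<^sup>2) \<partial>P)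
    = (\<integral>\<^sup>+\<omega>. (\<integral>\<^sup>+s. ennreal ((simple_value m p \<xi> s \<omega> * indicator {0..t} s - (\<Sum>j\<in>J. c j * indicator {a
      j<..b j} s))\<^sup>2) \<partial>\<mu>) \<partial>P)"
proof -
  let ?I = "{..<m} <+> J"
  let ?\<xi> = "case_sum (simple_coeff p \<xi> t) (\<lambda>j \<omega>. - c j)"
  let ?a = "case_sum (\<lambda>i. min (p i) t) a" and ?b = "case_sum (\<lambda>i. min (p (Suc i)) t) b"
  obtain C where C: "\<And>i \<omega>. i < m \<Longrightarrow> \<omega> \<in> space P \<Longrightarrow> \<bar>simple_coeff p \<xi> t i \<omega>\<bar> \<le> C i"
    using simple_coeff_props(3)[OF sp t] by metis
  have "(\<integral>\<^sup>+\<omega>. ennreal ((\<Sum>i\<in>?I. ?\<xi> i \<omega> * (M (?b i) \<omega> - M (?a i) \<omega>))\<^sup>2) \<partial>P)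
    = (\<integral>\<^sup>+\<omega>. (\<integral>\<^sup>+s. ennreal ((\<Sum>i\<in>?I. ?\<xi> i \<omega> * indicator {?a i<..?b i} s)\<^sup>2) \<partial>\<mu>) \<partial>P)"
    by (rule isometry[where C="case_sum C (\<lambda>j. \<bar>c j\<bar>)"])
      (use J simple_coeff_props(1,2)[OF sp t] C in \<open>auto split: sum.splits\<close>)
  moreover have "(\<Sum>i\<in>?I. ?\<xi> i \<omega> * (M (?b i) \<omega> - M (?a i) \<omega>))
      = simple_integral m p \<xi> M t \<omega> - (\<Sum>j\<in>J. c j * (M (b j) \<omega> - M (a j) \<omega>))" for \<omega>
    unfolding simple_integral_eq[OF sp] using J(1)
    by (simp only: sum.Plus finite_lessThan o_def sum.case mult_minus_left sum_negf diff_conv_add_uminus)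
  moreover have "(\<Sum>i\<in>?I. ?\<xi> i \<omega> * indicator {?a i<..?b i} s)
      = simple_value m p \<xi> s \<omega> * indicator {0..t} s - (\<Sum>j\<in>J. c j * indicator {a j<..b j} s)" for \<omega> s
    unfolding simple_value_eq[OF sp] using J(1)
    by (simp only: sum.Plus finite_lessThan o_def sum.case mult_minus_left sum_negf diff_conv_add_uminus)
  ultimately show ?thesis by (simp only:)
qed

end

text \<open>The integrator \<open>N\<close> agrees with the Gaussian martingale \<open>M\<close>
  almost surely at each time. This accommodates pointwise derivatives of the field, which are only
  almost surely equal to finite sums of modes.\<close>

locale ito_setup = gauss_martingale +
  fixes N H I :: "real \<Rightarrow> 'a \<Rightarrow> real"
  assumes ito: "ito_integral P F N H I"
    and AE_eq: "\<And>t. 0 \<le> t \<Longrightarrow> AE \<omega> in P. N t \<omega> = M t \<omega>"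
begin

lemma I_measurable: "0 \<le> t \<Longrightarrow> I t \<in> borel_measurable P"
  using ito filt_measurable_P unfolding ito_integral_def by blast

lemma ito_approximation:
  obtains m p \<xi> where "\<And>k::nat. simple_process P F (m k) (p k) (\<xi> k)"
    and "\<And>t. 0 \<le> t \<Longrightarrow> (\<lambda>k. \<integral>\<^sup>+\<omega>. (\<integral>\<^sup>+s. ennreal ((simple_value (m k) (p k) (\<xi> k) s \<omega> - H s \<omega>)\<^sup>2)
          * indicator {0..t} s \<partial>\<mu>) \<partial>P) \<longlonglongrightarrow> 0"
    and "\<And>t. 0 \<le> t \<Longrightarrow> (\<lambda>k. \<integral>\<^sup>+\<omega>. ennreal ((simple_integral (m k) (p k) (\<xi> k) M t \<omega> - I t \<omega>)\<^sup>2) \<partial>P) \<longlonglongrightarrow> 0"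
proof -
  obtain A m p \<xi> where A: "\<And>t. 0 \<le> t \<Longrightarrow> A t \<in> borel_measurable (F t)" "\<And>t. 0 \<le> t \<Longrightarrow> quad_covariation P N N t (A t)"
    and Ac: "AE \<omega> in P. A 0 \<omega> = 0 \<and> continuous_on {0..} (\<lambda>t. A t \<omega>) \<and> mono_on {0..} (\<lambda>t. A t \<omega>)"
    and sp: "\<And>k::nat. simple_process P F (m k) (p k) (\<xi> k)"
    and l1: "\<And>t. 0 \<le> t \<Longrightarrow> (\<lambda>k. \<integral>\<^sup>+\<omega>. (\<integral>\<^sup>+s. ennreal ((simple_value (m k) (p k) (\<xi> k) s \<omega> - H s \<omega>)\<^sup>2)
          * indicator {0..t} s \<partial>interval_measure (\<lambda>s. A (max 0 s) \<omega>)) \<partial>P) \<longlonglongrightarrow> 0"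
    and l2: "\<And>t. 0 \<le> t \<Longrightarrow> (\<lambda>k. \<integral>\<^sup>+\<omega>. ennreal ((simple_integral (m k) (p k) (\<xi> k) N t \<omega> - I t \<omega>)\<^sup>2) \<partial>P) \<longlonglongrightarrow> 0"
    using ito unfolding ito_integral_def by blast
  have "AE \<omega> in P. \<forall>t\<ge>0. A t \<omega> = V t - V 0"
  proof (rule bracket_process_eq)
    show "A t \<in> borel_measurable P" if "0 \<le> t" for t using A(1)[OF that] filt_measurable_P[OF that] by blast
    show "quad_covariation P M M t (A t)" if "0 \<le> t" for t
      using A(2)[OF that] quad_covariation_cong_AE[where M=N and N=N and M'=M and N'=M, OF AE_eq AE_eq] by blast
    show "AE \<omega> in P. continuous_on {0..} (\<lambda>t. A t \<omega>)" using Ac by auto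
  qed
  \<comment> \<open>The constant \<open>V 0\<close> disappears because an interval measure depends
    on increments only.\<close>
  then have im: "AE \<omega> in P. interval_measure (\<lambda>s. A (max 0 s) \<omega>) = \<mu>"
    by eventually_elim (simp add: bracket_measure_def interval_measure_def)
  show ?thesis
  proof (rule that[OF sp])
    fix t :: real assume t: "0 \<le> t"
    have "(\<integral>\<^sup>+\<omega>. (\<integral>\<^sup>+s. ennreal ((simple_value (m k) (p k) (\<xi> k) s \<omega> - H s \<omega>)\<^sup>2)
          * indicator {0..t} s \<partial>interval_measure (\<lambda>s. A (max 0 s) \<omega>)) \<partial>P)
      = (\<integral>\<^sup>+\<omega>. (\<integral>\<^sup>+s. ennreal ((simple_value (m k) (p k) (\<xi> k) s \<omega> - H s \<omega>)\<^sup>2)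
          * indicator {0..t} s \<partial>\<mu>) \<partial>P)" for k
      by (intro nn_integral_cong_AE) (use im in eventually_elim, simp)
    then show "(\<lambda>k. \<integral>\<^sup>+\<omega>. (\<integral>\<^sup>+s. ennreal ((simple_value (m k) (p k) (\<xi> k) s \<omega> - H s \<omega>)\<^sup>2)
          * indicator {0..t} s \<partial>\<mu>) \<partial>P) \<longlonglongrightarrow> 0" using l1[OF t] by simp
    have "(\<integral>\<^sup>+\<omega>. ennreal ((simple_integral (m k) (p k) (\<xi> k) N t \<omega> - I t \<omega>)\<^sup>2) \<partial>P)
      = (\<integral>\<^sup>+\<omega>. ennreal ((simple_integral (m k) (p k) (\<xi> k) M t \<omega> - I t \<omega>)\<^sup>2) \<partial>P)" for k
    proof (rule nn_integral_cong_AE)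
      have "AE \<omega> in P. \<forall>i\<in>{..m k}. N (min (p k i) t) \<omega> = M (min (p k i) t) \<omega>"
        using simple_process_nonneg[OF sp[of k]] t by (intro AE_finite_allI AE_eq) auto
      then show "AE \<omega> in P. ennreal ((simple_integral (m k) (p k) (\<xi> k) N t \<omega> - I t \<omega>)\<^sup>2)
        = ennreal ((simple_integral (m k) (p k) (\<xi> k) M t \<omega> - I t \<omega>)\<^sup>2)"
      proof eventually_elim
        case (elim \<omega>)
        then have "simple_integral (m k) (p k) (\<xi> k) N t \<omega> = simple_integral (m k) (p k) (\<xi> k) M t \<omega>"
          unfolding simple_integral_def by (intro sum.cong) auto
        then show ?case by simp
      qed
    qed
    then show "(\<lambda>k. \<integral>\<^sup>+\<omega>. ennreal ((simple_integral (m k) (p k) (\<xi> k) M t \<omega> - I t \<omega>)\<^sup>2) \<partial>P) \<longlonglongrightarrow> 0"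
      using l2[OF t] by simp
  qed
qed

text \<open>The integrand \<open>H\<close> need not be jointly measurable, so the bound is stated
  through a measurable majorant \<open>G\<close>. One factor 2 comes from replacing the integral by
  a simple one, the other from comparing the simple process with \<open>G\<close>.\<close>

lemma ito_L2_bound:
  assumes t: "0 \<le> t" and G[measurable]: "case_prod G \<in> borel_measurable (P \<Otimes>\<^sub>M borel)"
    and HG: "AE \<omega> in P. \<forall>s\<in>{0..t}. \<bar>H s \<omega>\<bar> \<le> G \<omega> s"
  shows "(\<integral>\<^sup>+\<omega>. ennreal ((I t \<omega>)\<^sup>2) \<partial>P) \<le> 4 * (\<integral>\<^sup>+\<omega>. (\<integral>\<^sup>+s. ennreal ((G \<omega> s)\<^sup>2) * indicator {0..t} s \<partial>\<mu>) \<partial>P)"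
proof -
  obtain m p \<xi> where sp: "\<And>k::nat. simple_process P F (m k) (p k) (\<xi> k)"
    and l1: "\<And>t. 0 \<le> t \<Longrightarrow> (\<lambda>k. \<integral>\<^sup>+\<omega>. (\<integral>\<^sup>+s. ennreal ((simple_value (m k) (p k) (\<xi> k) s \<omega> - H s \<omega>)\<^sup>2)
          * indicator {0..t} s \<partial>\<mu>) \<partial>P) \<longlonglongrightarrow> 0"
    and l2: "\<And>t. 0 \<le> t \<Longrightarrow> (\<lambda>k. \<integral>\<^sup>+\<omega>. ennreal ((simple_integral (m k) (p k) (\<xi> k) M t \<omega> - I t \<omega>)\<^sup>2) \<partial>P) \<longlonglongrightarrow> 0"
    by (rule ito_approximation) blast
  interpret mu: sigma_finite_measure \<mu> by (rule sigma_finite_bracket)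
  have sets_eq: "sets (P \<Otimes>\<^sub>M \<mu>) = sets (P \<Otimes>\<^sub>M borel)" by (intro sets_pair_measure_cong) auto
  show ?thesis
  proof (rule ennreal_le_if_le_null_sequences[OF _ l2[OF t] l1[OF t]])
    fix k
    let ?S = "simple_integral (m k) (p k) (\<xi> k) M t" and ?v = "simple_value (m k) (p k) (\<xi> k)"
    note [measurable] = simple_integral_measurable[OF sp t, of k] I_measurable[OF t]
    have v[measurable]: "(\<lambda>(\<omega>, s). ?v s \<omega>) \<in> borel_measurable (P \<Otimes>\<^sub>M borel)"
      by (rule simple_value_measurable[OF sp])
    have pm[measurable]: "(\<lambda>\<omega>. \<integral>\<^sup>+s. f \<omega> s \<partial>\<mu>) \<in> borel_measurable P"
      if "case_prod f \<in> borel_measurable (P \<Otimes>\<^sub>M borel)" for f :: "_ \<Rightarrow> _ \<Rightarrow> ennreal"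
      using that by (intro mu.borel_measurable_nn_integral) (simp add: measurable_cong_sets[OF sets_eq refl])
    \<comment> \<open>A measurable substitute for the approximation error: since \<bar>H\<bar> is at
      most \<open>G\<close>, this excess is at most \<bar>v - H\<bar>, whose integral tends to
      0.\<close>
    let ?D = "\<lambda>\<omega> s. max 0 (\<bar>?v s \<omega>\<bar> - G \<omega> s)"
    have "(\<integral>\<^sup>+\<omega>. ennreal ((?S \<omega>)\<^sup>2) \<partial>P) = (\<integral>\<^sup>+\<omega>. (\<integral>\<^sup>+s. ennreal ((?v s \<omega> * indicator {0..t} s)\<^sup>2) \<partial>\<mu>) \<partial>P)"
      using simple_isometry[OF sp t, of "{}"] by simp
    also have "\<dots> \<le> (\<integral>\<^sup>+\<omega>. (\<integral>\<^sup>+s. 2 * (ennreal ((?D \<omega> s)\<^sup>2) * indicator {0..t} s)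
      + 2 * (ennreal ((G \<omega> s)\<^sup>2) * indicator {0..t} s) \<partial>\<mu>) \<partial>P)"
    proof (intro nn_integral_mono)
      fix \<omega> s
      have "(?v s \<omega>)\<^sup>2 \<le> (?D \<omega> s + \<bar>G \<omega> s\<bar>)\<^sup>2" by (subst abs_le_square_iff[symmetric]) auto
      then have "ennreal ((?v s \<omega>)\<^sup>2) \<le> ennreal ((?D \<omega> s + \<bar>G \<omega> s\<bar>)\<^sup>2)" by (rule ennreal_leI)
      also note ennreal_square_add_le
      finally have "ennreal ((?v s \<omega>)\<^sup>2) \<le> 2 * ennreal ((?D \<omega> s)\<^sup>2) + 2 * ennreal ((G \<omega> s)\<^sup>2)"
        by (simp only: power2_abs)
      then show "ennreal ((?v s \<omega> * indicator {0..t} s)\<^sup>2)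
        \<le> 2 * (ennreal ((?D \<omega> s)\<^sup>2) * indicator {0..t} s) + 2 * (ennreal ((G \<omega> s)\<^sup>2) * indicator {0..t} s)"
        by (auto simp: indicator_def)
    qed
    also have "\<dots> = (\<integral>\<^sup>+\<omega>. 2 * (\<integral>\<^sup>+s. ennreal ((?D \<omega> s)\<^sup>2) * indicator {0..t} s \<partial>\<mu>)
      + 2 * (\<integral>\<^sup>+s. ennreal ((G \<omega> s)\<^sup>2) * indicator {0..t} s \<partial>\<mu>) \<partial>P)"
    proof (intro nn_integral_cong)
      fix \<omega> assume w: "\<omega> \<in> space P"
      have [measurable]: "G \<omega> \<in> borel_measurable borel" "(\<lambda>s. ?v s \<omega>) \<in> borel_measurable borel"
        using measurable_Pair2[OF G w] measurable_Pair2[OF v w] by simp_all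
      show "(\<integral>\<^sup>+s. 2 * (ennreal ((?D \<omega> s)\<^sup>2) * indicator {0..t} s)
        + 2 * (ennreal ((G \<omega> s)\<^sup>2) * indicator {0..t} s) \<partial>\<mu>)
       = 2 * (\<integral>\<^sup>+s. ennreal ((?D \<omega> s)\<^sup>2) * indicator {0..t} s \<partial>\<mu>) + 2 * (\<integral>\<^sup>+s. ennreal ((G \<omega> s)\<^sup>2) *
         indicator {0..t} s \<partial>\<mu>)"
        by (simp add: nn_integral_add nn_integral_cmult)
    qed
    also have "\<dots> = 2 * (\<integral>\<^sup>+\<omega>. (\<integral>\<^sup>+s. ennreal ((?D \<omega> s)\<^sup>2) * indicator {0..t} s \<partial>\<mu>) \<partial>P)
      + 2 * (\<integral>\<^sup>+\<omega>. (\<integral>\<^sup>+s. ennreal ((G \<omega> s)\<^sup>2) * indicator {0..t} s \<partial>\<mu>) \<partial>P)"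
      by (simp add: nn_integral_add nn_integral_cmult)
    also have "(\<integral>\<^sup>+\<omega>. (\<integral>\<^sup>+s. ennreal ((?D \<omega> s)\<^sup>2) * indicator {0..t} s \<partial>\<mu>) \<partial>P)
      \<le> (\<integral>\<^sup>+\<omega>. (\<integral>\<^sup>+s. ennreal ((?v s \<omega> - H s \<omega>)\<^sup>2) * indicator {0..t} s \<partial>\<mu>) \<partial>P)"
    proof (rule nn_integral_mono_AE)
      show "AE \<omega> in P. (\<integral>\<^sup>+s. ennreal ((?D \<omega> s)\<^sup>2) * indicator {0..t} s \<partial>\<mu>)
        \<le> (\<integral>\<^sup>+s. ennreal ((?v s \<omega> - H s \<omega>)\<^sup>2) * indicator {0..t} s \<partial>\<mu>)"
        using HG
      proof eventually_elim
        case (elim \<omega>)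
        show ?case
        proof (intro nn_integral_mono)
          fix s
          have "(?D \<omega> s)\<^sup>2 \<le> (?v s \<omega> - H s \<omega>)\<^sup>2" if "s \<in> {0..t}"
            using elim[rule_format, OF that] by (subst abs_le_square_iff[symmetric]) auto
          then show "ennreal ((?D \<omega> s)\<^sup>2) * indicator {0..t} s \<le> ennreal ((?v s \<omega> - H s \<omega>)\<^sup>2) * indicator {0..t} s"
            by (auto simp: indicator_def intro: ennreal_leI)
        qed
      qed
    qed
    finally have S: "(\<integral>\<^sup>+\<omega>. ennreal ((?S \<omega>)\<^sup>2) \<partial>P)
      \<le> 2 * (\<integral>\<^sup>+\<omega>. (\<integral>\<^sup>+s. ennreal ((?v s \<omega> - H s \<omega>)\<^sup>2) * indicator {0..t} s \<partial>\<mu>) \<partial>P)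
      + 2 * (\<integral>\<^sup>+\<omega>. (\<integral>\<^sup>+s. ennreal ((G \<omega> s)\<^sup>2) * indicator {0..t} s \<partial>\<mu>) \<partial>P)"
      by (simp add: mult_left_mono add_right_mono)
    have "(\<integral>\<^sup>+\<omega>. ennreal ((I t \<omega>)\<^sup>2) \<partial>P) = (\<integral>\<^sup>+\<omega>. ennreal (((I t \<omega> - ?S \<omega>) + ?S \<omega>)\<^sup>2) \<partial>P)" by simp
    also have "\<dots> \<le> 2 * (\<integral>\<^sup>+\<omega>. ennreal ((I t \<omega> - ?S \<omega>)\<^sup>2) \<partial>P) + 2 * (\<integral>\<^sup>+\<omega>. ennreal ((?S \<omega>)\<^sup>2) \<partial>P)"
      by (intro nn_integral_square_add_le) measurable
    also have "\<dots> \<le> 2 * (\<integral>\<^sup>+\<omega>. ennreal ((I t \<omega> - ?S \<omega>)\<^sup>2) \<partial>P)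
       + 2 * (2 * (\<integral>\<^sup>+\<omega>. (\<integral>\<^sup>+s. ennreal ((?v s \<omega> - H s \<omega>)\<^sup>2) * indicator {0..t} s \<partial>\<mu>) \<partial>P)
      + 2 * (\<integral>\<^sup>+\<omega>. (\<integral>\<^sup>+s. ennreal ((G \<omega> s)\<^sup>2) * indicator {0..t} s \<partial>\<mu>) \<partial>P))"
      by (intro add_left_mono mult_left_mono S) auto
    finally show "(\<integral>\<^sup>+\<omega>. ennreal ((I t \<omega>)\<^sup>2) \<partial>P) \<le> 2 * (\<integral>\<^sup>+\<omega>. ennreal ((?S \<omega> - I t \<omega>)\<^sup>2) \<partial>P)
       + 4 * (\<integral>\<^sup>+\<omega>. (\<integral>\<^sup>+s. ennreal ((?v s \<omega> - H s \<omega>)\<^sup>2) * indicator {0..t} s \<partial>\<mu>) \<partial>P)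
      + 4 * (\<integral>\<^sup>+\<omega>. (\<integral>\<^sup>+s. ennreal ((G \<omega> s)\<^sup>2) * indicator {0..t} s \<partial>\<mu>) \<partial>P)"
      by (simp add: distrib_left mult.assoc[symmetric] add.assoc power2_commute)
  qed
qed

text \<open>For a deterministic integrand the distance to a step integral is controlled by the
  distance of the integrands in L2 of the bracket. Only simple integrals are compared by the
  isometry; the approximations hidden in the definition of the Ito integral supply the passage to
  the limit.\<close>

lemma ito_deterministic_approx:
  fixes c :: "'j \<Rightarrow> real"
  assumes t: "0 \<le> t" and J: "finite J" "\<And>j. j \<in> J \<Longrightarrow> 0 \<le> a j \<and> a j \<le> b j"
    and H: "\<And>s \<omega>. H s \<omega> = h s" and h[measurable]: "h \<in> borel_measurable borel"
  shows "(\<integral>\<^sup>+\<omega>. ennreal ((I t \<omega> - (\<Sum>j\<in>J. c j * (M (b j) \<omega> - M (a j) \<omega>)))\<^sup>2) \<partial>P)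
    \<le> 4 * (\<integral>\<^sup>+s. ennreal ((h s * indicator {0..t} s - (\<Sum>j\<in>J. c j * indicator {a j<..b j} s))\<^sup>2) \<partial>\<mu>)"
    (is "(\<integral>\<^sup>+\<omega>. ennreal ((I t \<omega> - ?R \<omega>)\<^sup>2) \<partial>P) \<le> 4 * (\<integral>\<^sup>+s. ennreal ((?h s - ?r s)\<^sup>2) \<partial>\<mu>)")
proof -
  obtain m p \<xi> where sp: "\<And>k::nat. simple_process P F (m k) (p k) (\<xi> k)"
    and l1: "\<And>t. 0 \<le> t \<Longrightarrow> (\<lambda>k. \<integral>\<^sup>+\<omega>. (\<integral>\<^sup>+s. ennreal ((simple_value (m k) (p k) (\<xi> k) s \<omega> - H s \<omega>)\<^sup>2)
          * indicator {0..t} s \<partial>\<mu>) \<partial>P) \<longlonglongrightarrow> 0"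
    and l2: "\<And>t. 0 \<le> t \<Longrightarrow> (\<lambda>k. \<integral>\<^sup>+\<omega>. ennreal ((simple_integral (m k) (p k) (\<xi> k) M t \<omega> - I t \<omega>)\<^sup>2) \<partial>P) \<longlonglongrightarrow> 0"
    by (rule ito_approximation) blast
  interpret mu: sigma_finite_measure \<mu> by (rule sigma_finite_bracket)
  have sets_eq: "sets (P \<Otimes>\<^sub>M \<mu>) = sets (P \<Otimes>\<^sub>M borel)" by (intro sets_pair_measure_cong) auto
  show ?thesis
  proof (rule ennreal_le_if_le_null_sequences[OF _ l2[OF t] l1[OF t]])
    fix k
    let ?S = "simple_integral (m k) (p k) (\<xi> k) M t" and ?v = "simple_value (m k) (p k) (\<xi> k)"
    note [measurable] = simple_integral_measurable[OF sp t, of k] I_measurable[OF t]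
    have v[measurable]: "(\<lambda>(\<omega>, s). ?v s \<omega>) \<in> borel_measurable (P \<Otimes>\<^sub>M borel)"
      by (rule simple_value_measurable[OF sp])
    have pm[measurable]: "(\<lambda>\<omega>. \<integral>\<^sup>+s. f \<omega> s \<partial>\<mu>) \<in> borel_measurable P"
      if "case_prod f \<in> borel_measurable (P \<Otimes>\<^sub>M borel)" for f :: "_ \<Rightarrow> _ \<Rightarrow> ennreal"
      using that by (intro mu.borel_measurable_nn_integral) (simp add: measurable_cong_sets[OF sets_eq refl])
    have R[measurable]: "?R \<in> borel_measurable P"
      by (intro borel_measurable_sum borel_measurable_times borel_measurable_diff M_measurable)
        (use J(2) in force)+
    have "(\<integral>\<^sup>+\<omega>. ennreal ((?S \<omega> - ?R \<omega>)\<^sup>2) \<partial>P)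
      = (\<integral>\<^sup>+\<omega>. (\<integral>\<^sup>+s. ennreal ((?v s \<omega> * indicator {0..t} s - ?r s)\<^sup>2) \<partial>\<mu>) \<partial>P)"
      using simple_isometry[OF sp t J] by simp
    also have "\<dots> \<le> (\<integral>\<^sup>+\<omega>. (\<integral>\<^sup>+s. 2 * (ennreal ((?v s \<omega> - h s)\<^sup>2) * indicator {0..t} s)
      + 2 * ennreal ((?h s - ?r s)\<^sup>2) \<partial>\<mu>) \<partial>P)"
    proof (intro nn_integral_mono)
      fix \<omega> s
      have "ennreal ((?v s \<omega> * indicator {0..t} s - ?r s)\<^sup>2)
        \<le> 2 * ennreal (((?v s \<omega> - h s) * indicator {0..t} s)\<^sup>2) + 2 * ennreal ((?h s - ?r s)\<^sup>2)"
        using ennreal_square_add_le[of "(?v s \<omega> - h s) * indicator {0..t} s" "?h s - ?r s"]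
          by (simp add: algebra_simps)
      then show "ennreal ((?v s \<omega> * indicator {0..t} s - ?r s)\<^sup>2)
        \<le> 2 * (ennreal ((?v s \<omega> - h s)\<^sup>2) * indicator {0..t} s) + 2 * ennreal ((?h s - ?r s)\<^sup>2)"
        by (cases "s \<in> {0..t}") auto
    qed
    also have "\<dots> = (\<integral>\<^sup>+\<omega>. 2 * (\<integral>\<^sup>+s. ennreal ((?v s \<omega> - h s)\<^sup>2) * indicator {0..t} s \<partial>\<mu>)
      + 2 * (\<integral>\<^sup>+s. ennreal ((?h s - ?r s)\<^sup>2) \<partial>\<mu>) \<partial>P)"
    proof (intro nn_integral_cong)
      fix \<omega> assume w: "\<omega> \<in> space P"
      have [measurable]: "(\<lambda>s. ?v s \<omega>) \<in> borel_measurable borel"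
        using measurable_Pair2[OF v w] by simp_all
      show "(\<integral>\<^sup>+s. 2 * (ennreal ((?v s \<omega> - h s)\<^sup>2) * indicator {0..t} s) + 2 * ennreal ((?h s - ?r s)\<^sup>2) \<partial>\<mu>)
       = 2 * (\<integral>\<^sup>+s. ennreal ((?v s \<omega> - h s)\<^sup>2) * indicator {0..t} s \<partial>\<mu>) + 2 * (\<integral>\<^sup>+s. ennreal ((?h s - ?r s)\<^sup>2) \<partial>\<mu>)"
        by (subst nn_integral_add, measurable) (simp add: nn_integral_cmult)
    qed
    also have "\<dots> = 2 * (\<integral>\<^sup>+\<omega>. (\<integral>\<^sup>+s. ennreal ((?v s \<omega> - h s)\<^sup>2) * indicator {0..t} s \<partial>\<mu>) \<partial>P)
      + 2 * (\<integral>\<^sup>+s. ennreal ((?h s - ?r s)\<^sup>2) \<partial>\<mu>)"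
      by (simp add: nn_integral_add nn_integral_cmult emeasure_space_1)
    finally have S: "(\<integral>\<^sup>+\<omega>. ennreal ((?S \<omega> - ?R \<omega>)\<^sup>2) \<partial>P)
      \<le> 2 * (\<integral>\<^sup>+\<omega>. (\<integral>\<^sup>+s. ennreal ((?v s \<omega> - h s)\<^sup>2) * indicator {0..t} s \<partial>\<mu>) \<partial>P)
      + 2 * (\<integral>\<^sup>+s. ennreal ((?h s - ?r s)\<^sup>2) \<partial>\<mu>)" .
    have "(\<integral>\<^sup>+\<omega>. ennreal ((I t \<omega> - ?R \<omega>)\<^sup>2) \<partial>P) = (\<integral>\<^sup>+\<omega>. ennreal (((I t \<omega> - ?S \<omega>) + (?S \<omega> - ?R \<omega>))\<^sup>2) \<partial>P)" by simp
    also have "\<dots> \<le> 2 * (\<integral>\<^sup>+\<omega>. ennreal ((I t \<omega> - ?S \<omega>)\<^sup>2) \<partial>P) + 2 * (\<integral>\<^sup>+\<omega>. ennreal ((?S \<omega> - ?R \<omega>)\<^sup>2) \<partial>P)"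
      by (intro nn_integral_square_add_le) measurable
    also have "\<dots> \<le> 2 * (\<integral>\<^sup>+\<omega>. ennreal ((I t \<omega> - ?S \<omega>)\<^sup>2) \<partial>P)
       + 2 * (2 * (\<integral>\<^sup>+\<omega>. (\<integral>\<^sup>+s. ennreal ((?v s \<omega> - h s)\<^sup>2) * indicator {0..t} s \<partial>\<mu>) \<partial>P)
      + 2 * (\<integral>\<^sup>+s. ennreal ((?h s - ?r s)\<^sup>2) \<partial>\<mu>))"
      by (intro add_left_mono mult_left_mono S) auto
    finally show "(\<integral>\<^sup>+\<omega>. ennreal ((I t \<omega> - ?R \<omega>)\<^sup>2) \<partial>P) \<le> 2 * (\<integral>\<^sup>+\<omega>. ennreal ((?S \<omega> - I t \<omega>)\<^sup>2) \<partial>P)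
       + 4 * (\<integral>\<^sup>+\<omega>. (\<integral>\<^sup>+s. ennreal ((?v s \<omega> - H s \<omega>)\<^sup>2) * indicator {0..t} s \<partial>\<mu>) \<partial>P)
      + 4 * (\<integral>\<^sup>+s. ennreal ((?h s - ?r s)\<^sup>2) \<partial>\<mu>)"
      unfolding H by (simp add: distrib_left mult.assoc[symmetric] add.assoc power2_commute)
  qed
qed

text \<open>Simple integrals are square integrable and centred, and both properties pass to the L2
  limit.\<close>

lemma ito_mean_zero:
  assumes t: "0 \<le> t"
  shows "integrable P (\<lambda>\<omega>. (I t \<omega>)\<^sup>2)" and "integrable P (I t)" and "(\<integral>\<omega>. I t \<omega> \<partial>P) = 0"
proof -
  obtain m p \<xi> where sp: "\<And>k::nat. simple_process P F (m k) (p k) (\<xi> k)"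
    and l2: "\<And>t. 0 \<le> t \<Longrightarrow> (\<lambda>k. \<integral>\<^sup>+\<omega>. ennreal ((simple_integral (m k) (p k) (\<xi> k) M t \<omega> - I t \<omega>)\<^sup>2) \<partial>P) \<longlonglongrightarrow> 0"
    by (rule ito_approximation) blast
  let ?S = "\<lambda>k. simple_integral (m k) (p k) (\<xi> k) M t"
  note [measurable] = simple_integral_measurable[OF sp t] I_measurable[OF t]
  have S2: "(\<integral>\<^sup>+\<omega>. ennreal ((?S k \<omega>)\<^sup>2) \<partial>P) < \<infinity>" for k
  proof -
    obtain C where C: "\<And>i \<omega>. i < m k \<Longrightarrow> \<omega> \<in> space P \<Longrightarrow> \<bar>simple_coeff (p k) (\<xi> k) t i \<omega>\<bar> \<le> C i"
      using simple_coeff_props(3)[OF sp[of k] t] by metis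
    have "integrable P (\<lambda>\<omega>. (?S k \<omega>)\<^sup>2)"
      unfolding simple_integral_eq[OF sp] power2_eq_square sum_product
    proof (intro Bochner_Integration.integrable_sum)
      fix i j assume ij: "i \<in> {..<m k}" "j \<in> {..<m k}"
      show "integrable P (\<lambda>\<omega>. simple_coeff (p k) (\<xi> k) t i \<omega> * (M (min (p k (Suc i)) t) \<omega> - M (min (p k i) t) \<omega>) *
            (simple_coeff (p k) (\<xi> k) t j \<omega> * (M (min (p k (Suc j)) t) \<omega> - M (min (p k j) t) \<omega>)))"
        by (rule covariance_incr[THEN conjunct1, of _ _ _ _ _ "C i" _ "C j"])
          (use ij C simple_coeff_props(1,2)[OF sp t] in auto)
    qed
    then show ?thesis by (subst nn_integral_eq_integral) auto
  qed
  have fin: "(\<integral>\<^sup>+\<omega>. ennreal ((I t \<omega>)\<^sup>2) \<partial>P) < \<infinity>"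
  proof -
    have "eventually (\<lambda>k. (\<integral>\<^sup>+\<omega>. ennreal ((?S k \<omega> - I t \<omega>)\<^sup>2) \<partial>P) < 1) sequentially"
      using l2[OF t] by (rule order_tendstoD(2)) simp
    then obtain k where k: "(\<integral>\<^sup>+\<omega>. ennreal ((?S k \<omega> - I t \<omega>)\<^sup>2) \<partial>P) < 1" by (auto simp: eventually_sequentially)
    have "(\<integral>\<^sup>+\<omega>. ennreal ((I t \<omega>)\<^sup>2) \<partial>P) = (\<integral>\<^sup>+\<omega>. ennreal (((I t \<omega> - ?S k \<omega>) + ?S k \<omega>)\<^sup>2) \<partial>P)" by simp
    also have "\<dots> \<le> 2 * (\<integral>\<^sup>+\<omega>. ennreal ((I t \<omega> - ?S k \<omega>)\<^sup>2) \<partial>P) + 2 * (\<integral>\<^sup>+\<omega>. ennreal ((?S k \<omega>)\<^sup>2) \<partial>P)"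
      by (intro nn_integral_square_add_le) measurable
    also have "\<dots> < \<infinity>"
      using k S2[of k] less_trans[OF k, of top]
      by (simp add: power2_commute ennreal_mult_less_top)
    finally show ?thesis .
  qed
  show I2: "integrable P (\<lambda>\<omega>. (I t \<omega>)\<^sup>2)" by (rule integrableI_nonneg) (use fin in auto)
  show I1: "integrable P (I t)" by (rule square_integrable_imp_integrable[OF _ I2]) measurable
  have "ennreal ((\<integral>\<omega>. I t \<omega> \<partial>P)\<^sup>2) \<le> 0"
  proof (rule LIMSEQ_le_const[OF l2[OF t]], intro exI[of _ 0] allI impI)
    fix k
    note si = simple_integral_expectation[OF sp t, of k]
    show "ennreal ((\<integral>\<omega>. I t \<omega> \<partial>P)\<^sup>2) \<le> (\<integral>\<^sup>+\<omega>. ennreal ((?S k \<omega> - I t \<omega>)\<^sup>2) \<partial>P)"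
    proof (cases "(\<integral>\<^sup>+\<omega>. ennreal ((?S k \<omega> - I t \<omega>)\<^sup>2) \<partial>P) < \<infinity>")
      case True
      then have i: "integrable P (\<lambda>\<omega>. (?S k \<omega> - I t \<omega>)\<^sup>2)" by (intro integrableI_nonneg) auto
      \<comment> \<open>The simple integral is centred, so nonnegativity of this variance bounds the
        squared mean of the limit by the L2 error.\<close>
      have "variance (\<lambda>\<omega>. ?S k \<omega> - I t \<omega>) = (\<integral>\<omega>. (?S k \<omega> - I t \<omega>)\<^sup>2 \<partial>P) - (\<integral>\<omega>. I t \<omega> \<partial>P)\<^sup>2"
        using si I1 by (subst variance_eq[OF _ i]) auto
      then have "(\<integral>\<omega>. I t \<omega> \<partial>P)\<^sup>2 \<le> (\<integral>\<omega>. (?S k \<omega> - I t \<omega>)\<^sup>2 \<partial>P)"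
        using variance_positive[of "\<lambda>\<omega>. ?S k \<omega> - I t \<omega>"] by simp
      then show ?thesis using i by (subst nn_integral_eq_integral) (auto intro: ennreal_leI)
    next
      case False
      then have "(\<integral>\<^sup>+\<omega>. ennreal ((?S k \<omega> - I t \<omega>)\<^sup>2) \<partial>P) = \<infinity>" by (simp add: less_top[symmetric])
      then show ?thesis by simp
    qed
  qed
  then show "(\<integral>\<omega>. I t \<omega> \<partial>P) = 0" by (simp add: ennreal_eq_0_iff)
qed

end

section \<open>Brownian motion under the Wiener measure\<close>

definition preimages :: "'w measure \<Rightarrow> ('w \<Rightarrow> 'b) \<Rightarrow> 'b measure \<Rightarrow> 'w set set" where
  "preimages P X N = {X -` C \<inter> space P |C. C \<in> sets N}"

lemma preimagesI: "C \<in> sets N \<Longrightarrow> X -` C \<inter> space P \<in> preimages P X N"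
  by (auto simp: preimages_def)

lemma Int_stable_preimages: "Int_stable (preimages P X N)"
proof (rule Int_stableI)
  fix a b assume "a \<in> preimages P X N" "b \<in> preimages P X N"
  then obtain A B where "a = X -` A \<inter> space P" "b = X -` B \<inter> space P" "A \<in> sets N" "B \<in> sets N"
    by (auto simp: preimages_def)
  then have "a \<inter> b = X -` (A \<inter> B) \<inter> space P" "A \<inter> B \<in> sets N" by auto
  then show "a \<inter> b \<in> preimages P X N" by (simp only: preimagesI)
qed

lemma preimages_comp:
  assumes "g \<in> measurable N N'" "X \<in> space P \<rightarrow> space N" "\<And>\<omega>. \<omega> \<in> space P \<Longrightarrow> Y \<omega> = g (X \<omega>)"
  shows "preimages P Y N' \<subseteq> preimages P X N"
proof
  fix a assume "a \<in> preimages P Y N'"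
  then obtain C where C: "C \<in> sets N'" "a = Y -` C \<inter> space P" by (auto simp: preimages_def)
  then have "a = X -` (g -` C \<inter> space N) \<inter> space P" using assms(2,3) by auto
  then show "a \<in> preimages P X N" using measurable_sets[OF assms(1) C(1)] by (simp only: preimagesI)
qed

lemma preimages_subset_events: "X \<in> measurable P N \<Longrightarrow> preimages P X N \<subseteq> sets P"
  by (auto simp: preimages_def)

lemma preimages_finite_INT:
  assumes "finite K" "K \<noteq> {}" "\<And>k. k \<in> K \<Longrightarrow> A k \<in> preimages P X N"
  shows "(\<Inter>k\<in>K. A k) \<in> preimages P X N"
  using assms
proof (induction K rule: finite_ne_induct)
  case (insert k K)
  then have "A k \<inter> (\<Inter>k\<in>K. A k) \<in> preimages P X N"
    using Int_stableD[OF Int_stable_preimages] by (metis insertCI)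
  then show ?case by simp
qed auto

section \<open>Independence of the past and the increments of a Brownian motion\<close>

context prob_space
begin

text \<open>Independence between groups and independence inside each group combine. The probability
  of a finite intersection factorises over the groups, because the part of the intersection
  belonging to group i is again an event of \<open>S i\<close>, and then inside each group.\<close>

lemma indep_sets_hierarchy:
  fixes E :: "'b \<Rightarrow> 'c \<Rightarrow> 'a set set"
  assumes S: "indep_sets S I"
    and E: "\<And>i. i \<in> I \<Longrightarrow> indep_sets (E i) K"
    and sub: "\<And>i k. i \<in> I \<Longrightarrow> k \<in> K \<Longrightarrow> E i k \<subseteq> S i"
    and clos: "\<And>i (J :: 'c set) A. i \<in> I \<Longrightarrow> finite J \<Longrightarrow> J \<noteq> {} \<Longrightarrow> (\<And>k. k \<in> J \<Longrightarrow> A k \<in> S i) \<Longrightarrow> (\<Inter>k\<in>J. A k) \<in> S i"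
  shows "indep_sets (\<lambda>(i, k). E i k) (I \<times> K)"
proof (rule indep_setsI)
  fix x assume x: "x \<in> I \<times> K"
  have "S (fst x) \<subseteq> events" using S x by (auto simp: indep_sets_def)
  then show "(case x of (i, k) \<Rightarrow> E i k) \<subseteq> events" using sub x by force
next
  fix A :: "'b \<times> 'c \<Rightarrow> 'a set" and J
  assume J: "J \<noteq> {}" "J \<subseteq> I \<times> K" "finite J" and A: "\<forall>j\<in>J. A j \<in> (case j of (i, k) \<Rightarrow> E i k)"
  let ?I = "fst ` J" and ?K = "\<lambda>i. {k. (i, k) \<in> J}"
  have JS: "J = Sigma ?I ?K" by force
  have fK: "finite (?K i)" for i
    by (rule finite_subset[of _ "snd ` J"]) (use J in force)+
  have I: "finite ?I" "?I \<noteq> {}" "?I \<subseteq> I" using J by auto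
  have neK: "?K i \<noteq> {}" if "i \<in> ?I" for i using that by auto
  have inS: "(\<Inter>k\<in>?K i. A (i, k)) \<in> S i" if "i \<in> ?I" for i
  proof (rule clos)
    show "i \<in> I" using that I by auto
    show "finite (?K i)" "?K i \<noteq> {}" using fK neK that by auto
    fix k assume "k \<in> ?K i"
    then show "A (i, k) \<in> S i" using A J(2) sub by fastforce
  qed
  have "(\<Inter>j\<in>J. A j) = (\<Inter>i\<in>?I. \<Inter>k\<in>?K i. A (i, k))"
    by (subst (1) JS) auto
  also have "prob \<dots> = (\<Prod>i\<in>?I. prob (\<Inter>k\<in>?K i. A (i, k)))"
    by (rule indep_setsD[OF S I(3,2,1)]) (use inS in blast)
  also have "\<dots> = (\<Prod>i\<in>?I. \<Prod>k\<in>?K i. prob (A (i, k)))"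
  proof (rule prod.cong[OF refl])
    fix i assume i: "i \<in> ?I"
    then have "i \<in> I" using I by auto
    from indep_setsD[OF E[OF this] _ neK[OF i] fK[of i], of "\<lambda>k. A (i, k)"]
    show "prob (\<Inter>k\<in>?K i. A (i, k)) = (\<Prod>k\<in>?K i. prob (A (i, k)))"
      using A J(2) by fastforce
  qed
  also have "\<dots> = (\<Prod>j\<in>J. prob (A j))"
    by (subst prod.Sigma[OF I(1)]) (use fK JS in auto)
  finally show "prob (\<Inter>j\<in>J. A j) = (\<Prod>j\<in>J. prob (A j))" .
qed

text \<open>Brownian motion is given by independence of successive increments only. Values at
  finitely many past times are telescoping sums of earlier increments, up to the null set where the
  path does not start at 0, hence independent of the increment from \<open>s\<close> to
  \<open>t\<close>.\<close>

lemma brownian_past_cylinder: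
  assumes bm: "brownian_motion M b" and meas: "\<And>t. 0 \<le> t \<Longrightarrow> b t \<in> borel_measurable M"
    and st: "0 \<le> s" "s \<le> t" and R: "finite R" "R \<subseteq> {0..s}" and C: "\<And>r. r \<in> R \<Longrightarrow> C r \<in> sets borel"
    and D: "D \<in> sets borel"
  shows "prob ((\<Inter>r\<in>R. b r -` C r) \<inter> ((\<lambda>\<omega>. b t \<omega> - b s \<omega>) -` D) \<inter> space M)
    = prob ((\<Inter>r\<in>R. b r -` C r) \<inter> space M) * prob (((\<lambda>\<omega>. b t \<omega> - b s \<omega>) -` D) \<inter> space M)"
proof -
  \<comment> \<open>Adjoining 0 makes the telescoping sums start at the origin. Adjoining
    \<open>s\<close> makes the last listed time equal to \<open>s\<close>, so that the next
    increment, up to \<open>t\<close>, is the one of interest.\<close>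
  define xs where "xs = sorted_list_of_set (R \<union> {0, s})"
  define p where "p i = (if i < length xs then xs ! i else t)" for i
  have set_xs: "set xs = R \<union> {0, s}" unfolding xs_def using R(1) by (intro set_sorted_list_of_set) auto
  have sorted: "sorted xs" and "distinct xs" by (auto simp: xs_def)
  define l where "l = length xs - 1"
  have len: "length xs = Suc l"
    using set_xs by (cases xs) (auto simp: l_def)
  have mono: "p i \<le> p j" if "i \<le> j" "j \<le> l" for i j
    using that sorted len by (auto simp: p_def sorted_iff_nth_mono)
  have idx: "\<exists>j\<le>l. p j = r" if "r \<in> R \<union> {0, s}" for r
  proof -
    from that obtain j where "j < length xs" "xs ! j = r" using set_xs by (metis in_set_conv_nth)
    then show ?thesis using len by (intro exI[of _ j]) (auto simp: p_def)
  qed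
  have range: "p i \<in> R \<union> {0, s}" if "i \<le> l" for i
    using that len set_xs nth_mem[of i xs] by (auto simp: p_def)
  have p0: "p 0 = 0"
  proof -
    obtain j where j: "j \<le> l" "p j = 0" using idx[of 0] by auto
    have "p 0 \<in> {0..s}" using range[of 0] R(2) st by auto
    then show ?thesis using mono[of 0 j] j by auto
  qed
  have pl: "p l = s"
  proof -
    obtain j where j: "j \<le> l" "p j = s" using idx[of s] by auto
    have "p l \<in> {0..s}" using range[of l] R(2) st by auto
    then show ?thesis using mono[of j l] j by auto
  qed
  have pSl: "p (Suc l) = t" by (simp add: p_def len)
  have pnn: "0 \<le> p i" if "i \<le> Suc l" for i
    using that mono[of 0 i] p0 pSl st by (cases "i = Suc l") auto
  let ?X = "\<lambda>i \<omega>. b (p (Suc i)) \<omega> - b (p i) \<omega>"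
  have "\<forall>i<Suc l. p i \<le> p (Suc i)" using mono pl pSl st by (auto simp: less_Suc_eq)
  then have ind: "indep_vars (\<lambda>_. borel) ?X {..<Suc l}"
    using bm[unfolded brownian_motion_def, THEN conjunct2, THEN conjunct2, THEN conjunct2, rule_format,
      of p "Suc l"] p0
    by simp
  have b0: "AE \<omega> in M. b 0 \<omega> = 0" using bm by (simp add: brownian_motion_def)
  have iv: "indep_var (PiM {..<l} (\<lambda>_. borel)) (\<lambda>\<omega>. \<lambda>i\<in>{..<l}. ?X i \<omega>) (PiM {l} (\<lambda>_. borel)) (\<lambda>\<omega>. \<lambda>i\<in>{l}. ?X i \<omega>)"
    by (rule indep_var_restrict[OF ind]) auto
  obtain j where j: "\<And>r. r \<in> R \<Longrightarrow> j r \<le> l \<and> p (j r) = r" using idx by (metis UnI1)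
  define A where "A = {f \<in> space (PiM {..<l} (\<lambda>_. borel)). \<forall>r\<in>R. (\<Sum>i<j r. f i) \<in> C r}"
  have A: "A \<in> sets (PiM {..<l} (\<lambda>_. borel))"
    unfolding A_def
  proof (rule sets.sets_Collect_finite_All[OF _ R(1)])
    fix r assume r: "r \<in> R"
    have "(\<lambda>f. \<Sum>i<j r. f i) \<in> borel_measurable (PiM {..<l} (\<lambda>_. borel :: real measure))"
      using j[OF r] by (intro borel_measurable_sum measurable_component_singleton) auto
    from measurable_sets[OF this C[OF r]]
    show "{f \<in> space (PiM {..<l} (\<lambda>_. borel)). (\<Sum>i<j r. f i) \<in> C r} \<in> sets (PiM {..<l} (\<lambda>_. borel))"
      by (simp add: vimage_def Int_def conj_commute)
  qed
  define B where "B = (\<lambda>f. f l) -` D \<inter> space (PiM {l} (\<lambda>_. borel :: real measure))"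
  have B: "B \<in> sets (PiM {l} (\<lambda>_. borel))"
    unfolding B_def by (rule measurable_sets[OF _ D]) simp
  let ?X1 = "\<lambda>\<omega>. \<lambda>i\<in>{..<l}. ?X i \<omega>" and ?X2 = "\<lambda>\<omega>. \<lambda>i\<in>{l}. ?X i \<omega>"
  have A_iff: "?X1 \<omega> \<in> A \<longleftrightarrow> (\<forall>r\<in>R. b r \<omega> \<in> C r)" if "b 0 \<omega> = 0" for \<omega>
  proof -
    have "(\<Sum>i<j r. ?X1 \<omega> i) = b r \<omega>" if r: "r \<in> R" for r
    proof -
      have "(\<Sum>i<j r. ?X1 \<omega> i) = (\<Sum>i<j r. b (p (Suc i)) \<omega> - b (p i) \<omega>)"
        using j[OF r] by (intro sum.cong) auto
      also have "\<dots> = b (p (j r)) \<omega> - b (p 0) \<omega>" by (rule sum_lessThan_telescope)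
      also have "\<dots> = b r \<omega>" using j[OF r] p0 that \<open>b 0 \<omega> = 0\<close> by simp
      finally show ?thesis .
    qed
    then show ?thesis by (auto simp: A_def space_PiM)
  qed
  have B_iff: "?X2 \<omega> \<in> B \<longleftrightarrow> b t \<omega> - b s \<omega> \<in> D" for \<omega>
    by (auto simp: B_def space_PiM pl pSl)
  have m1: "?X1 \<in> measurable M (PiM {..<l} (\<lambda>_. borel))" and m2: "?X2 \<in> measurable M (PiM {l} (\<lambda>_. borel))"
    using iv by (auto simp: indep_var_eq)
  have ev1: "(\<Inter>r\<in>R. b r -` C r) \<inter> space M \<in> events"
  proof -
    have e: "(\<Inter>r\<in>R. b r -` C r) \<inter> space M = {\<omega> \<in> space M. \<forall>r\<in>R. b r \<omega> \<in> C r}" by auto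
    show ?thesis unfolding e
    proof (rule sets.sets_Collect_finite_All[OF _ R(1)])
      fix r assume "r \<in> R"
      then show "{\<omega> \<in> space M. b r \<omega> \<in> C r} \<in> events"
        using measurable_sets[OF meas[of r] C[of r]] R(2) by (auto simp: vimage_def Int_def conj_commute)
    qed
  qed
  have ev2: "((\<lambda>\<omega>. b t \<omega> - b s \<omega>) -` D) \<inter> space M \<in> events"
    using st meas by (intro measurable_sets[OF _ D] borel_measurable_diff) auto
  have ev12: "(\<Inter>r\<in>R. b r -` C r) \<inter> ((\<lambda>\<omega>. b t \<omega> - b s \<omega>) -` D) \<inter> space M \<in> events"
  proof -
    have "(\<Inter>r\<in>R. b r -` C r) \<inter> ((\<lambda>\<omega>. b t \<omega> - b s \<omega>) -` D) \<inter> space M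
      = ((\<Inter>r\<in>R. b r -` C r) \<inter> space M) \<inter> (((\<lambda>\<omega>. b t \<omega> - b s \<omega>) -` D) \<inter> space M)" by auto
    then show ?thesis using ev1 ev2 by auto
  qed
  have 1: "prob ((\<Inter>r\<in>R. b r -` C r) \<inter> space M) = prob (?X1 -` A \<inter> space M)"
    using b0 by (intro finite_measure_eq_AE ev1 measurable_sets[OF m1 A], eventually_elim) (use A_iff in auto)
  have 2: "prob (((\<lambda>\<omega>. b t \<omega> - b s \<omega>) -` D) \<inter> space M) = prob (?X2 -` B \<inter> space M)"
    by (rule arg_cong[where f=prob]) (use B_iff in blast)
  have 3: "prob ((\<Inter>r\<in>R. b r -` C r) \<inter> ((\<lambda>\<omega>. b t \<omega> - b s \<omega>) -` D) \<inter> space M)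
    = prob ((\<lambda>\<omega>. (?X1 \<omega>, ?X2 \<omega>)) -` (A \<times> B) \<inter> space M)"
  proof (rule finite_measure_eq_AE[OF _ ev12])
    have "(\<lambda>\<omega>. (?X1 \<omega>, ?X2 \<omega>)) -` (A \<times> B) \<inter> space M = (?X1 -` A \<inter> space M) \<inter> (?X2 -` B \<inter> space M)" by auto
    then show "(\<lambda>\<omega>. (?X1 \<omega>, ?X2 \<omega>)) -` (A \<times> B) \<inter> space M \<in> events"
      using measurable_sets[OF m1 A] measurable_sets[OF m2 B] by auto
    show "AE \<omega> in M. (\<omega> \<in> (\<Inter>r\<in>R. b r -` C r) \<inter> ((\<lambda>\<omega>. b t \<omega> - b s \<omega>) -` D) \<inter> space M)
      = (\<omega> \<in> (\<lambda>\<omega>. (?X1 \<omega>, ?X2 \<omega>)) -` (A \<times> B) \<inter> space M)"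
      using b0
    proof eventually_elim
      case (elim \<omega>)
      show ?case unfolding Int_iff vimage_eq mem_Times_iff fst_conv snd_conv A_iff[OF elim] B_iff by auto
    qed
  qed
  show ?thesis unfolding 1 2 3 by (rule indep_varD[OF iv A B])
qed

text \<open>Finite-dimensional cylinders are stable under intersection and generate the past, so
  independence extends from them to the generated \<sigma>-algebra.\<close>

lemma brownian_past_indep:
  assumes bm: "brownian_motion M b" and meas: "\<And>t. 0 \<le> t \<Longrightarrow> b t \<in> borel_measurable M"
    and st: "0 \<le> s" "s \<le> t"
  shows "indep_set (sigma_sets (space M) (\<Union>r\<in>{0..s}. preimages M (b r) borel))
    (preimages M (\<lambda>\<omega>. b t \<omega> - b s \<omega>) borel)"
proof -
  define E where "E = {(\<Inter>r\<in>R. b r -` C r) \<inter> space M |R C. finite R \<and> R \<subseteq> {0..s} \<and> (\<forall>r\<in>R. C r \<in> sets borel)}"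
  have "indep_set (sigma_sets (space M) E) (sigma_sets (space M) (preimages M (\<lambda>\<omega>. b t \<omega> - b s \<omega>) borel))"
  proof (rule indep_set_sigma_sets[OF _ _ Int_stable_preimages])
    show "Int_stable E"
    proof (rule Int_stableI)
      fix x y assume "x \<in> E" "y \<in> E"
      then obtain R C R' C' where x: "x = (\<Inter>r\<in>R. b r -` C r) \<inter> space M" "finite R" "R
        \<subseteq> {0..s}" "\<forall>r\<in>R. C r \<in> sets borel"
        and y: "y = (\<Inter>r\<in>R'. b r -` C' r) \<inter> space M" "finite R'" "R' \<subseteq> {0..s}" "\<forall>r\<in>R'. C' r \<in> sets borel"
        unfolding E_def by blast
      \<comment> \<open>Conditions at a time constrained by only one of the cylinders are padded
        with \<open>UNIV\<close>.\<close>
      let ?C = "\<lambda>r. (if r \<in> R then C r else UNIV) \<inter> (if r \<in> R' then C' r else UNIV)"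
      have "x \<inter> y = (\<Inter>r\<in>R \<union> R'. b r -` ?C r) \<inter> space M"
        unfolding x(1) y(1) by (auto split: if_splits)
      moreover have "\<forall>r\<in>R \<union> R'. ?C r \<in> sets borel" using x(4) y(4) by auto
      ultimately show "x \<inter> y \<in> E" unfolding E_def using x(2,3) y(2,3)
        by (intro CollectI exI[of _ "R \<union> R'"] exI[of _ ?C]) auto
    qed
    show "indep_set E (preimages M (\<lambda>\<omega>. b t \<omega> - b s \<omega>) borel)"
    proof (rule indep_setI)
      show "E \<subseteq> events"
      proof
        fix x assume "x \<in> E"
        then obtain R C where x: "x = (\<Inter>r\<in>R. b r -` C r) \<inter> space M" "finite R" "R \<subseteq> {0..s}" "\<forall>r\<in>R. C r
          \<in> sets borel"
          unfolding E_def by blast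
        have e: "x = {\<omega> \<in> space M. \<forall>r\<in>R. b r \<omega> \<in> C r}" unfolding x(1) by auto
        show "x \<in> events" unfolding e
        proof (rule sets.sets_Collect_finite_All[OF _ x(2)])
          fix r assume "r \<in> R"
          then show "{\<omega> \<in> space M. b r \<omega> \<in> C r} \<in> events"
            using measurable_sets[OF meas[of r], of "C r"] x(3,4) by (auto simp: vimage_def Int_def conj_commute)
        qed
      qed
      show "preimages M (\<lambda>\<omega>. b t \<omega> - b s \<omega>) borel \<subseteq> events"
        using st meas by (intro preimages_subset_events borel_measurable_diff) auto
      fix x y assume "x \<in> E" "y \<in> preimages M (\<lambda>\<omega>. b t \<omega> - b s \<omega>) borel"
      then obtain R C D where x: "x = (\<Inter>r\<in>R. b r -` C r) \<inter> space M" "finite R" "R \<subseteq> {0..s}" "\<And>r. r\<in>R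
        \<Longrightarrow> C r \<in> sets borel"
        and y: "y = (\<lambda>\<omega>. b t \<omega> - b s \<omega>) -` D \<inter> space M" "D \<in> sets borel"
        unfolding E_def preimages_def by blast
      have "x \<inter> y = (\<Inter>r\<in>R. b r -` C r) \<inter> ((\<lambda>\<omega>. b t \<omega> - b s \<omega>) -` D) \<inter> space M"
        unfolding x(1) y(1) by auto
      then show "prob (x \<inter> y) = prob x * prob y"
        using brownian_past_cylinder[OF bm meas st x(2,3,4) y(2)] unfolding x(1) y(1) by simp
    qed
  qed
  moreover have "sigma_sets (space M) (\<Union>r\<in>{0..s}. preimages M (b r) borel) \<subseteq> sigma_sets (space M) E"
  proof (rule sigma_sets_subseteq)
    show "(\<Union>r\<in>{0..s}. preimages M (b r) borel) \<subseteq> E"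
    proof
      fix x assume "x \<in> (\<Union>r\<in>{0..s}. preimages M (b r) borel)"
      then obtain r C where "x = b r -` C \<inter> space M" "r \<in> {0..s}" "C \<in> sets borel" by (auto simp: preimages_def)
      then show "x \<in> E" unfolding E_def by (intro CollectI exI[of _ "{r}"] exI[of _ "\<lambda>_. C"]) auto
    qed
  qed
  ultimately show ?thesis
    unfolding indep_sets2_eq by (meson sigma_sets.Basic subset_iff)
qed

lemma brownian_char:
  assumes bm: "brownian_motion M b" and meas: "\<And>t. 0 \<le> t \<Longrightarrow> b t \<in> borel_measurable M" and st: "0 \<le> s" "s \<le> t"
  shows "(CLINT \<omega>|M. iexp (\<theta> * (b t \<omega> - b s \<omega>))) = exp (- \<theta>\<^sup>2 * (t - s) / 2)"
\<comment> \<open>The law of an increment is prescribed by a density for s < t only; a zero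
  increment is treated directly.\<close>
proof (cases "s = t")
  case True
  then show ?thesis by (simp add: prob_space)
next
  case False
  then have lt: "s < t" using st by simp
  let ?\<sigma> = "sqrt (t - s)"
  have "distributed M lborel (\<lambda>\<omega>. b t \<omega> - b s \<omega>) (normal_density 0 ?\<sigma>)"
    using bm lt st(1) unfolding brownian_motion_def by blast
  then have "distributed M lborel (\<lambda>\<omega>. (b t \<omega> - b s \<omega> - 0) / ?\<sigma>) std_normal_density"
    using lt by (subst normal_standard_normal_convert[symmetric]) auto
  then have d: "distr M lborel (\<lambda>\<omega>. (b t \<omega> - b s \<omega>) / ?\<sigma>) = std_normal_distribution"
    by (simp add: distributed_def)
  have [measurable]: "(\<lambda>\<omega>. b t \<omega> - b s \<omega>) \<in> borel_measurable M"
    using st meas by (intro borel_measurable_diff) auto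
  have "(CLINT \<omega>|M. iexp (\<theta> * (b t \<omega> - b s \<omega>))) = (CLINT \<omega>|M. iexp ((\<theta> * ?\<sigma>) * ((b t \<omega> - b s \<omega>) / ?\<sigma>)))"
    using lt by simp
  also have "\<dots> = (CLINT x|distr M lborel (\<lambda>\<omega>. (b t \<omega> - b s \<omega>) / ?\<sigma>). iexp ((\<theta> * ?\<sigma>) * x))"
    by (rule integral_distr[symmetric]) auto
  also have "\<dots> = char std_normal_distribution (\<theta> * ?\<sigma>)"
    unfolding d char_def by simp
  also have "\<dots> = exp (- \<theta>\<^sup>2 * (t - s) / 2)"
    using lt by (simp add: char_std_normal_distribution power_mult_distrib)
  finally show ?thesis .
qed

end

text \<open>One representative of each pair n, -n. The coefficients at n and -n are conjugate, so
  independence of the modes can hold only over such a choice.\<close>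

definition half :: "(int^2) set \<Rightarrow> bool" where
  "half H \<longleftrightarrow> 0 \<notin> H \<and> (\<forall>n\<in>H. - n \<notin> H) \<and> (\<forall>n. n \<noteq> 0 \<longrightarrow> n \<in> H \<or> - n \<in> H)"

definition half_space :: "(int^2) set" where
  "half_space = {n. 0 < n $ 1 \<or> (n $ 1 = 0 \<and> 0 < n $ 2)}"

text \<open>Both the lexicographically positive half and its mirror image are recorded, so that
  every nonzero frequency belongs to a half for which the modes are independent.\<close>

lemma half_half_space: "half half_space" "half (uminus ` half_space)"
proof -
  show h: "half half_space"
    unfolding half_def half_space_def by (auto simp: vec_eq_iff forall_2)
  have "n \<in> uminus ` half_space \<longleftrightarrow> - n \<in> half_space" for n
    by (metis add.inverse_inverse imageE imageI)
  with h show "half (uminus ` half_space)" unfolding half_def by auto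
qed

text \<open>\<open>True\<close> selects the real part and \<open>False\<close> the imaginary part.
  Each has variance t / 2 at time t, so it is a standard Brownian motion divided by the square root
  of 2.\<close>

definition bm_component :: "(int^2) \<times> bool \<Rightarrow> real \<Rightarrow> path \<Rightarrow> real" where
  "bm_component nc t \<omega> = (if snd nc then Re (\<omega> t (fst nc)) else Im (\<omega> t (fst nc)))"

locale wiener =
  fixes \<alpha> :: real and P :: "path measure"
  assumes wiener: "wiener_measure \<alpha> P"
begin

sublocale prob_space P using wiener by (simp add: wiener_measure_def)

abbreviation "Filt \<equiv> canonical_filtration P"

lemma space_P: "space P = path_space \<alpha>" using wiener by (simp add: wiener_measure_def)

lemma path_conj: "\<omega> \<in> space P \<Longrightarrow> 0 \<le> t \<Longrightarrow> \<omega> t (- n) = cnj (\<omega> t n)"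
  and path_zero: "\<omega> \<in> space P \<Longrightarrow> 0 \<le> t \<Longrightarrow> \<omega> t 0 = 0"
  unfolding space_P path_space_def by (auto simp: PiE_def Pi_def Hdot_def real_coeffs_def)

lemma cbm: "n \<noteq> 0 \<Longrightarrow> complex_brownian_motion P (\<lambda>t \<omega>. \<omega> t n)"
  using wiener by (simp add: wiener_measure_def)

lemma component_bm: "fst nc \<noteq> 0 \<Longrightarrow> brownian_motion P (\<lambda>t \<omega>. sqrt 2 * bm_component nc t \<omega>)"
  using cbm[of "fst nc"] by (cases "snd nc") (auto simp: complex_brownian_motion_def bm_component_def)

lemma component_measurable:
  assumes n: "fst nc \<noteq> 0" and t: "0 \<le> t"
  shows "bm_component nc t \<in> borel_measurable P"
proof -
  have "(\<lambda>\<omega>. \<lambda>t\<in>{0..}. Re (\<omega> t (fst nc))) \<in> measurable P (Pi\<^sub>M {0..} (\<lambda>_. borel))"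
    "(\<lambda>\<omega>. \<lambda>t\<in>{0..}. Im (\<omega> t (fst nc))) \<in> measurable P (Pi\<^sub>M {0..} (\<lambda>_. borel))"
    using cbm[OF n] unfolding complex_brownian_motion_def indep_var_eq by auto
  from this[THEN measurable_compose, OF measurable_component_singleton[of t]] t
  show ?thesis unfolding bm_component_def[abs_def] by (cases "snd nc") auto
qed

lemma path_measurable: "0 \<le> t \<Longrightarrow> (\<lambda>\<omega>. \<omega> t n) \<in> borel_measurable P"
proof (cases "n = 0")
  case True
  assume t: "0 \<le> t"
  have "(\<lambda>\<omega>. \<omega> t n) \<in> borel_measurable P \<longleftrightarrow> (\<lambda>_. 0 :: complex) \<in> borel_measurable P"
    by (rule measurable_cong) (use True path_zero t in auto)
  then show ?thesis by simp
next
  case False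
  assume t: "0 \<le> t"
  have "(\<lambda>\<omega>. Complex (bm_component (n, True) t \<omega>) (bm_component (n, False) t \<omega>)) \<in> borel_measurable P"
    using component_measurable[of "(n, True)" t] component_measurable[of "(n, False)" t] False t
    by (simp add: borel_measurable_complex_iff)
  then show ?thesis by (simp add: bm_component_def)
qed

end

section \<open>Independence of the augmented filtration from later increments\<close>

context wiener
begin

definition path_gen :: "real \<Rightarrow> path set set" where
  "path_gen s = {{\<omega> \<in> space P. \<omega> r n \<in> C} |r n C. 0 \<le> r \<and> r \<le> s \<and> C \<in> sets borel}"

definition augmented :: "path set set \<Rightarrow> path set set" where
  "augmented G = {A \<in> sets P. \<exists>B\<in>G. (A - B) \<union> (B - A) \<in> null_sets P}"

lemma Filt_eq: "Filt s = sigma (space P) (augmented (sigma_sets (space P) (path_gen s)))"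
  unfolding canonical_filtration_def path_gen_def augmented_def ..

lemma space_Filt [simp]: "space (Filt s) = space P"
  unfolding Filt_eq by (rule space_measure_of) (auto simp: augmented_def dest: sets.sets_into_space)

lemma sets_Filt: "sets (Filt s) = sigma_sets (space P) (augmented (sigma_sets (space P) (path_gen s)))"
  unfolding Filt_eq by (rule sets_measure_of) (auto simp: augmented_def dest: sets.sets_into_space)

lemma sets_Filt_subset: "sets (Filt s) \<subseteq> sets P"
  unfolding sets_Filt by (rule sets.sigma_sets_subset) (auto simp: augmented_def)

lemma Filt_mono: "s \<le> t \<Longrightarrow> sets (Filt s) \<subseteq> sets (Filt t)"
proof -
  assume "s \<le> t"
  then have "path_gen s \<subseteq> path_gen t" by (fastforce simp: path_gen_def)
  then have "sigma_sets (space P) (path_gen s) \<subseteq> sigma_sets (space P) (path_gen t)" by (rule sigma_sets_mono')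
  then have "augmented (sigma_sets (space P) (path_gen s)) \<subseteq> augmented (sigma_sets (space P) (path_gen t))"
    by (auto simp: augmented_def)
  then show ?thesis unfolding sets_Filt by (rule sigma_sets_mono')
qed

lemma path_gen_in_Filt: "path_gen s \<subseteq> sets (Filt s)"
proof
  fix A assume A: "A \<in> path_gen s"
  then obtain r n C where "A = (\<lambda>\<omega>. \<omega> r n) -` C \<inter> space P" "0 \<le> r" "C \<in> sets borel"
    unfolding path_gen_def by blast
  then have "A \<in> sets P" using measurable_sets[OF path_measurable] by auto
  then have "A \<in> augmented (sigma_sets (space P) (path_gen s))"
    unfolding augmented_def using A by (intro CollectI conjI bexI[of _ A] sigma_sets.Basic) auto
  then show "A \<in> sets (Filt s)" unfolding sets_Filt by (rule sigma_sets.Basic)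
qed

lemma path_measurable_Filt:
  assumes "0 \<le> r" "r \<le> s"
  shows "(\<lambda>\<omega>. \<omega> r n) \<in> borel_measurable (Filt s)"
proof (rule measurableI)
  fix C :: "complex set" assume "C \<in> sets borel"
  then have "(\<lambda>\<omega>. \<omega> r n) -` C \<inter> space P \<in> path_gen s" using assms unfolding path_gen_def by blast
  then show "(\<lambda>\<omega>. \<omega> r n) -` C \<inter> space (Filt s) \<in> sets (Filt s)" using path_gen_in_Filt by auto
qed simp

lemma component_Filt:
  assumes "0 \<le> r" "r \<le> s"
  shows "bm_component nc r \<in> borel_measurable (Filt s)"
  using path_measurable_Filt[OF assms, of "fst nc"] unfolding bm_component_def[abs_def]
  by (cases "snd nc") auto

definition paths_of :: "(int^2) \<times> bool \<Rightarrow> path set set" where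
  "paths_of nc = preimages P (\<lambda>\<omega>. \<lambda>t\<in>{0..}. bm_component nc t \<omega>) (Pi\<^sub>M {0..} (\<lambda>_. borel))"

text \<open>Two levels of independence are combined: between frequencies, and between the real and
  imaginary part of one frequency. The Wiener measure provides each of them separately.\<close>

lemma indep_paths_of:
  assumes H: "half H"
  shows "indep_sets paths_of (H \<times> UNIV)"
proof -
  let ?S = "\<lambda>n. preimages P (\<lambda>\<omega>. \<lambda>t\<in>{0..}. \<omega> t n) (Pi\<^sub>M {0..} (\<lambda>_. borel))"
  have iv: "indep_vars (\<lambda>_. Pi\<^sub>M {0..} (\<lambda>_. borel)) (\<lambda>n \<omega>. \<lambda>t\<in>{0..}. \<omega> t n) H"
    using wiener[unfolded wiener_measure_def, THEN conjunct2, THEN conjunct2, THEN conjunct2, THEN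
      conjunct2, rule_format, of H] H
    by (simp add: half_def)
  have "indep_sets (\<lambda>(n, c). paths_of (n, c)) (H \<times> UNIV)"
  proof (rule indep_sets_hierarchy)
    show "indep_sets ?S H" using iv unfolding indep_vars_def2 preimages_def by auto
    fix n assume n: "n \<in> H"
    then have n0: "n \<noteq> 0" using H by (auto simp: half_def)
    have "indep_vars (case_bool (Pi\<^sub>M {0..} (\<lambda>_. borel)) (Pi\<^sub>M {0..} (\<lambda>_. borel)))
      (case_bool (\<lambda>\<omega>. \<lambda>t\<in>{0..}. Re (\<omega> t n)) (\<lambda>\<omega>. \<lambda>t\<in>{0..}. Im (\<omega> t n))) UNIV"
      using cbm[OF n0] unfolding complex_brownian_motion_def indep_var_def by blast
    then have "indep_sets (\<lambda>i. {case_bool (\<lambda>\<omega>. \<lambda>t\<in>{0..}. Re (\<omega> t n)) (\<lambda>\<omega>. \<lambda>t\<in>{0..}. Im (\<omega> t n)) i -` A \<inter>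
      space P |A.
          A \<in> sets (case i of True \<Rightarrow> Pi\<^sub>M {0..} (\<lambda>_. borel) | False \<Rightarrow> Pi\<^sub>M {0..} (\<lambda>_. borel))}) UNIV"
      unfolding indep_vars_def2 by blast
    then show "indep_sets (\<lambda>c. paths_of (n, c)) UNIV"
      by (rule indep_sets_mono_sets) (auto simp: paths_of_def preimages_def bm_component_def split: bool.splits)
  next
    fix n c
    show "paths_of (n, c) \<subseteq> ?S n"
      unfolding paths_of_def
    proof (rule preimages_comp)
      let ?g = "\<lambda>f. \<lambda>t\<in>{0..}. if c then Re (f t :: complex) else Im (f t)"
      show "?g \<in> measurable (Pi\<^sub>M {0..} (\<lambda>_. borel)) (Pi\<^sub>M {0..} (\<lambda>_. borel))"
        by (intro measurable_restrict) (cases c; simp)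
    qed (auto simp: space_PiM bm_component_def)
  next
    fix n and J :: "bool set" and A :: "bool \<Rightarrow> path set"
    assume "finite J" "J \<noteq> {}" "\<And>k. k \<in> J \<Longrightarrow> A k \<in> ?S n"
    then show "(\<Inter>k\<in>J. A k) \<in> ?S n" by (rule preimages_finite_INT)
  qed
  then show ?thesis by simp
qed

definition past_sets :: "real \<Rightarrow> (int^2) \<times> bool \<Rightarrow> path set set" where
  "past_sets s nc = sigma_sets (space P) (\<Union>r\<in>{0..s}. preimages P (bm_component nc r) borel)"

definition incr_sets :: "real \<Rightarrow> real \<Rightarrow> (int^2) \<times> bool \<Rightarrow> path set set" where
  "incr_sets s t nc = preimages P (\<lambda>\<omega>. bm_component nc t \<omega> - bm_component nc s \<omega>) borel"

text \<open>The same two-level argument with components as groups: inside one component, the past is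
  independent of the increment, and both are events of the whole path of that component.\<close>

lemma indep_past_incr:
  assumes H: "half H" and st: "0 \<le> s" "s \<le> t"
  shows "indep_sets (\<lambda>(nc, k). if k then past_sets s nc else incr_sets s t nc) ((H \<times> UNIV) \<times> UNIV)"
proof (rule indep_sets_hierarchy[OF indep_paths_of[OF H]])
  fix nc :: "(int^2) \<times> bool" assume "nc \<in> H \<times> UNIV"
  then have n0: "fst nc \<noteq> 0" using H by (auto simp: half_def)
  let ?b = "\<lambda>t \<omega>. sqrt 2 * bm_component nc t \<omega>"
  have i: "indep_set (sigma_sets (space P) (\<Union>r\<in>{0..s}. preimages P (?b r) borel))
    (preimages P (\<lambda>\<omega>. ?b t \<omega> - ?b s \<omega>) borel)"
    by (rule brownian_past_indep[OF component_bm[OF n0] _ st]) (use component_measurable[OF n0] in auto)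
  have "preimages P (bm_component nc r) borel \<subseteq> preimages P (?b r) borel" for r
    by (rule preimages_comp[where g="\<lambda>x. x / sqrt 2"]) auto
  then have 1: "past_sets s nc \<subseteq> sigma_sets (space P) (\<Union>r\<in>{0..s}. preimages P (?b r) borel)"
    unfolding past_sets_def by (intro sigma_sets_mono') blast
  have 2: "incr_sets s t nc \<subseteq> preimages P (\<lambda>\<omega>. ?b t \<omega> - ?b s \<omega>) borel"
    unfolding incr_sets_def by (rule preimages_comp[where g="\<lambda>x. x / sqrt 2"]) (auto simp: diff_divide_distrib)
  show "indep_sets (\<lambda>k. if k then past_sets s nc else incr_sets s t nc) UNIV"
    using i unfolding indep_set_def
    by (rule indep_sets_mono_sets) (use 1 2 in \<open>auto split: bool.splits\<close>)
next
  fix nc :: "(int^2) \<times> bool" and k :: bool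
  let ?X = "\<lambda>\<omega>. \<lambda>t\<in>{0..}. bm_component nc t \<omega>"
  have X: "?X \<in> space P \<rightarrow> space (Pi\<^sub>M {0..} (\<lambda>_. borel))" by (auto simp: space_PiM)
  have sub: "preimages P (bm_component nc r) borel \<subseteq> paths_of nc" if "r \<in> {0..s}" for r
    unfolding paths_of_def by (rule preimages_comp[where g="\<lambda>f. f r"]) (use that X in auto)
  have va: "paths_of nc = sets (vimage_algebra (space P) ?X (Pi\<^sub>M {0..} (\<lambda>_. borel)))"
    unfolding paths_of_def preimages_def sets_vimage_algebra2[OF X] ..
  have "(\<Union>r\<in>{0..s}. preimages P (bm_component nc r) borel)
    \<subseteq> sets (vimage_algebra (space P) ?X (Pi\<^sub>M {0..} (\<lambda>_. borel)))"
    using sub unfolding va by blast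
  from sets.sigma_sets_subset[OF this] have "past_sets s nc \<subseteq> paths_of nc"
    unfolding past_sets_def va by simp
  moreover have "incr_sets s t nc \<subseteq> paths_of nc"
    unfolding paths_of_def incr_sets_def
    by (rule preimages_comp[where g="\<lambda>f. f t - f s"]) (use st X in auto)
  ultimately show "(if k then past_sets s nc else incr_sets s t nc) \<subseteq> paths_of nc" by simp
next
  fix nc and J :: "bool set" and A :: "bool \<Rightarrow> path set"
  assume "finite J" "J \<noteq> {}" "\<And>k. k \<in> J \<Longrightarrow> A k \<in> paths_of nc"
  then show "(\<Inter>k\<in>J. A k) \<in> paths_of nc" unfolding paths_of_def by (rule preimages_finite_INT)
qed

text \<open>The index \<open>None\<close> collects the pasts of all components into one
  \<sigma>-algebra, and each \<open>Some nc\<close> carries a single increment. This gives mutual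
  independence, which is stronger than independence of the history from each increment
  separately.\<close>

lemma indep_history_incr:
  assumes H: "half H" and st: "0 \<le> s" "s \<le> t"
  shows "indep_sets (case_option (sigma_sets (space P) (\<Union>nc\<in>H \<times> UNIV. past_sets s nc)) (incr_sets s t))
    (insert None (Some ` (H \<times> UNIV)))"
proof -
  let ?E = "\<lambda>(nc, k). if k then past_sets s nc else incr_sets s t nc"
  let ?I = "\<lambda>j. case j of None \<Rightarrow> (H \<times> UNIV) \<times> {True} | Some nc \<Rightarrow> {(nc, False)}"
  have "indep_sets (\<lambda>j. sigma_sets (space P) (\<Union>i\<in>?I j. ?E i)) (insert None (Some ` (H \<times> UNIV)))"
  proof (rule indep_sets_collect_sigma)
    show "indep_sets ?E (\<Union>j\<in>insert None (Some ` (H \<times> UNIV)). ?I j)"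
      by (rule indep_sets_mono_index[OF _ indep_past_incr[OF H st]]) auto
    show "disjoint_family_on ?I (insert None (Some ` (H \<times> UNIV)))"
      by (auto simp: disjoint_family_on_def)
    have ip: "Int_stable (past_sets s nc)" for nc
    proof -
      have "(\<Union>r\<in>{0..s}. preimages P (bm_component nc r) borel) \<subseteq> Pow (space P)" by (auto simp: preimages_def)
      then interpret sigma_algebra "space P" "past_sets s nc"
        unfolding past_sets_def by (rule sigma_algebra_sigma_sets)
      show ?thesis by (rule Int_stableI) auto
    qed
    then show "Int_stable (?E i)" for i
      by (cases i) (auto simp: incr_sets_def Int_stable_preimages)
  qed
  then show ?thesis
  proof (rule indep_sets_mono_sets)
    fix j
    have e: "(\<Union>i\<in>(H \<times> UNIV) \<times> {True}. ?E i) = (\<Union>nc\<in>H \<times> UNIV. past_sets s nc)"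
    proof -
      have "(\<Union>i\<in>A \<times> {True}. g i) = (\<Union>nc\<in>A. g (nc, True))" for A and g :: "((int^2) \<times> bool) \<times> bool \<Rightarrow> path set set"
        by blast
      from this[of ?E "H \<times> UNIV"] show ?thesis by (simp only: prod.case if_True)
    qed
    show "case_option (sigma_sets (space P) (\<Union>nc\<in>H \<times> UNIV. past_sets s nc)) (incr_sets s t) j
      \<subseteq> sigma_sets (space P) (\<Union>i\<in>?I j. ?E i)"
    proof (cases j)
      case None
      show ?thesis unfolding None option.case e by simp
    qed (auto intro: sigma_sets.Basic)
  qed
qed

text \<open>A half of the lattice determines the whole path: the coefficient at 0 vanishes, and the
  one at a frequency of the opposite half is a conjugate.\<close>

lemma path_gen_history:
  assumes H: "half H"
  shows "sigma_sets (space P) (path_gen s) \<subseteq> sigma_sets (space P) (\<Union>nc\<in>H \<times> UNIV. past_sets s nc)"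
proof -
  let ?G = "\<Union>nc\<in>H \<times> UNIV. past_sets s nc"
  have "past_sets s nc \<subseteq> Pow (space P)" for nc
  proof -
    have "(\<Union>r\<in>{0..s}. preimages P (bm_component nc r) borel) \<subseteq> Pow (space P)" by (auto simp: preimages_def)
    from sigma_sets_into_sp[OF this] show ?thesis unfolding past_sets_def by blast
  qed
  then have GP: "?G \<subseteq> Pow (space P)" by blast
  let ?M = "sigma (space P) ?G"
  have sM: "sets ?M = sigma_sets (space P) ?G" "space ?M = space P" using GP by auto
  have comp: "bm_component (n, c) r \<in> borel_measurable ?M" if "n \<in> H" "0 \<le> r" "r \<le> s" for n c r
  proof (rule measurableI)
    fix C :: "real set" assume "C \<in> sets borel"
    then have "bm_component (n, c) r -` C \<inter> space P \<in> past_sets s (n, c)"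
      unfolding past_sets_def using that by (intro sigma_sets.Basic UN_I[of r] preimagesI) auto
    then show "bm_component (n, c) r -` C \<inter> space ?M \<in> sets ?M"
      unfolding sM using that(1) by (intro sigma_sets.Basic) auto
  qed simp
  have cH: "(\<lambda>\<omega>. \<omega> r n) \<in> borel_measurable ?M" if "n \<in> H" "0 \<le> r" "r \<le> s" for n r
  proof -
    have "(\<lambda>\<omega>. Complex (bm_component (n, True) r \<omega>) (bm_component (n, False) r \<omega>)) \<in> borel_measurable ?M"
      using comp[OF that] by (simp add: borel_measurable_complex_iff)
    then show ?thesis by (simp add: bm_component_def)
  qed
  have c: "(\<lambda>\<omega>. \<omega> r n) \<in> borel_measurable ?M" if r: "0 \<le> r" "r \<le> s" for n r
  proof -
    consider "n = 0" | "n \<in> H" | "- n \<in> H" using H unfolding half_def by blast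
    then show ?thesis
    proof cases
      case 1
      have "(\<lambda>\<omega>. \<omega> r n) \<in> borel_measurable ?M \<longleftrightarrow> (\<lambda>_. 0 :: complex) \<in> borel_measurable ?M"
        by (rule measurable_cong) (use 1 path_zero r in \<open>auto simp: sM(2)\<close>)
      then show ?thesis by simp
    next
      case 2
      then show ?thesis using cH r by blast
    next
      case 3
      have "(\<lambda>\<omega>. \<omega> r n) \<in> borel_measurable ?M \<longleftrightarrow> (\<lambda>\<omega>. cnj (\<omega> r (- n))) \<in> borel_measurable ?M"
        by (rule measurable_cong) (use r in \<open>auto simp: sM(2) path_conj\<close>)
      moreover have "(\<lambda>\<omega>. cnj (\<omega> r (- n))) \<in> borel_measurable ?M"
        using cH[OF 3 r] by (simp add: borel_measurable_complex_iff)
      ultimately show ?thesis by simp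
    qed
  qed
  have "path_gen s \<subseteq> sets ?M"
  proof
    fix A assume "A \<in> path_gen s"
    then obtain r n C where "A = (\<lambda>\<omega>. \<omega> r n) -` C \<inter> space ?M" "0 \<le> r" "r \<le> s" "C \<in> sets borel"
      unfolding path_gen_def sM(2) by blast
    then show "A \<in> sets ?M" using measurable_sets[OF c] by auto
  qed
  then have "sigma_sets (space ?M) (path_gen s) \<subseteq> sets ?M" by (rule sets.sigma_sets_subset)
  then show ?thesis unfolding sM .
qed

text \<open>Modification by null sets does not change probabilities, so the factorisation carries
  over to the augmented events. They are stable under intersection, so independence extends to the
  \<sigma>-algebra they generate.\<close>

lemma indep_Filt_incr:
  assumes H: "half H" and st: "0 \<le> s" "s \<le> t"
  shows "indep_sets (case_option (sets (Filt s)) (incr_sets s t)) (insert None (Some ` (H \<times> UNIV)))"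
proof -
  let ?G = "sigma_sets (space P) (path_gen s)"
  let ?J = "insert None (Some ` (H \<times> (UNIV :: bool set)))"
  have ind: "indep_sets (case_option ?G (incr_sets s t)) ?J"
    by (rule indep_sets_mono_sets[OF indep_history_incr[OF H st]])
      (use path_gen_history[OF H] in \<open>auto split: option.splits\<close>)
  have GP: "?G \<subseteq> sets P" and IP: "\<And>nc. nc \<in> H \<times> UNIV \<Longrightarrow> incr_sets s t nc \<subseteq> sets P"
  proof -
    have *: "\<forall>j\<in>?J. case_option ?G (incr_sets s t) j \<subseteq> events"
      by (rule conjunct1[OF ind[unfolded indep_sets_def]])
    show "?G \<subseteq> sets P" using bspec[OF *, of None] by simp
    fix nc assume "nc \<in> H \<times> (UNIV :: bool set)"
    then show "incr_sets s t nc \<subseteq> sets P" using bspec[OF *, of "Some nc"] by auto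
  qed
  have aug: "indep_sets (case_option (augmented ?G) (incr_sets s t)) ?J"
  proof (rule indep_setsI)
    fix j assume "j \<in> ?J"
    then show "case_option (augmented ?G) (incr_sets s t) j \<subseteq> events"
      using IP by (auto simp: augmented_def split: option.splits)
  next
    fix A J assume J: "J \<noteq> {}" "J \<subseteq> ?J" "finite J" and A: "\<forall>j\<in>J. A j
      \<in> case_option (augmented ?G) (incr_sets s t) j"
    have "\<exists>B0. None \<in> J \<longrightarrow> B0 \<in> ?G \<and> (A None - B0) \<union> (B0 - A None) \<in> null_sets P"
    proof (cases "None \<in> J")
      case True
      then have "A None \<in> augmented ?G" using A by (metis option.case(1))
      then show ?thesis by (auto simp: augmented_def)
    qed simp
    \<comment> \<open>Only the event attached to \<open>None\<close> is replaced by an unaugmented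
      one; the increment events remain unchanged.\<close>
    then obtain B0 where B0: "None \<in> J \<Longrightarrow> B0 \<in> ?G \<and> (A None - B0) \<union> (B0 - A None) \<in> null_sets P" by blast
    define B where "B j = (if j = None then B0 else A j)" for j
    have B: "B j \<in> case_option ?G (incr_sets s t) j" if "j \<in> J" for j
      using bspec[OF A that] B0 that unfolding B_def by (cases j) auto
    have ev: "A j \<in> events" "B j \<in> events" if "j \<in> J" for j
      using bspec[OF A that] B[OF that] GP IP that J(2) by (cases j; force simp: augmented_def)+
    have AB: "AE \<omega> in P. (\<omega> \<in> A j) = (\<omega> \<in> B j)" if "j \<in> J" for j
    proof (cases "j = None")
      case True
      then have "(A None - B0) \<union> (B0 - A None) \<in> null_sets P" using B0 that by auto
      then have "AE \<omega> in P. \<omega> \<notin> (A None - B0) \<union> (B0 - A None)" by (rule AE_not_in)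
      then have "AE \<omega> in P. (\<omega> \<in> A None) = (\<omega> \<in> B None)" by eventually_elim (auto simp: B_def)
      with True show ?thesis by simp
    next
      case False
      then obtain nc where "j = Some nc" by auto
      then show ?thesis by (simp add: B_def)
    qed
    have p: "prob (A j) = prob (B j)" if "j \<in> J" for j
      using that by (intro finite_measure_eq_AE AB ev)
    have "AE \<omega> in P. \<forall>j\<in>J. (\<omega> \<in> A j) = (\<omega> \<in> B j)" by (rule AE_finite_allI[OF J(3) AB])
    then have "prob (\<Inter>j\<in>J. A j) = prob (\<Inter>j\<in>J. B j)"
      by (intro finite_measure_eq_AE sets.finite_INT J ev) auto
    also have "\<dots> = (\<Prod>j\<in>J. prob (B j))" by (rule indep_setsD[OF ind J(2,1,3)]) (use B in blast)
    finally show "prob (\<Inter>j\<in>J. A j) = (\<Prod>j\<in>J. prob (A j))" using p by simp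
  qed
  have "indep_sets (\<lambda>j. sigma_sets (space P) (case_option (augmented ?G) (incr_sets s t) j)) ?J"
  proof (rule indep_sets_sigma[OF aug])
    fix j :: "((int^2) \<times> bool) option"
    have "Int_stable (augmented ?G)"
    proof (rule Int_stableI)
      fix a b assume "a \<in> augmented ?G" "b \<in> augmented ?G"
      then obtain a' b' where *: "a \<in> events" "b \<in> events" "a' \<in> ?G" "b' \<in> ?G"
        "(a - a') \<union> (a' - a) \<in> null_sets P" "(b - b') \<union> (b' - b) \<in> null_sets P" by (auto simp: augmented_def)
      have "path_gen s \<subseteq> Pow (space P)" by (auto simp: path_gen_def)
      then interpret sigma_algebra "space P" ?G by (rule sigma_algebra_sigma_sets)
      have ab: "a' \<inter> b' \<in> ?G" using * by auto
      have "((a - a') \<union> (a' - a)) \<union> ((b - b') \<union> (b' - b)) \<in> null_sets P" using *(5,6) by (rule null_sets.Un)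
      then have "(a \<inter> b - a' \<inter> b') \<union> (a' \<inter> b' - a \<inter> b) \<in> null_sets P"
        by (rule null_sets_subset) (use * ab GP in auto)
      then show "a \<inter> b \<in> augmented ?G" unfolding augmented_def using * ab by auto
    qed
    then show "Int_stable (case_option (augmented ?G) (incr_sets s t) j)"
      by (cases j) (auto simp: incr_sets_def Int_stable_preimages)
  qed
  then show ?thesis
    by (rule indep_sets_mono_sets) (auto simp: sets_Filt split: option.splits intro: sigma_sets.Basic)
qed

lemma component_char:
  assumes n: "fst nc \<noteq> 0" and st: "0 \<le> s" "s \<le> t"
  shows "(CLINT \<omega>|P. iexp (\<theta> * (bm_component nc t \<omega> - bm_component nc s \<omega>))) = exp (- \<theta>\<^sup>2 * (t - s) / 4)"
proof -
  have "(CLINT \<omega>|P. iexp ((\<theta> / sqrt 2) * (sqrt 2 * bm_component nc t \<omega> - sqrt 2 * bm_component nc s \<omega>)))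
    = exp (- (\<theta> / sqrt 2)\<^sup>2 * (t - s) / 2)"
    by (rule brownian_char[OF component_bm[OF n] _ st]) (use component_measurable[OF n] in auto)
  moreover have "(\<theta> / sqrt 2) * (sqrt 2 * x - sqrt 2 * y) = \<theta> * (x - y)" for x y
    by (simp add: field_simps)
  moreover have "- (\<theta> / sqrt 2)\<^sup>2 * (t - s) / 2 = - \<theta>\<^sup>2 * (t - s) / 4"
    by (simp add: power_divide)
  ultimately show ?thesis by (simp only:)
qed

text \<open>The factor \<xi> may be complex. In the induction along a time grid it is the product of
  the exponentials of all earlier increments, so the components factorise jointly at every stage.
  The divisor 4 reflects the variance (t - s) / 2 of a component.\<close>

lemma char_given_past:
  assumes H: "half H" and st: "0 \<le> s" "s \<le> t" and C: "finite C" "C \<subseteq> H \<times> UNIV"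
    and \<xi>: "\<xi> \<in> borel_measurable (Filt s)" "integrable P \<xi>"
  shows "(CLINT \<omega>|P. \<xi> \<omega> * (\<Prod>nc\<in>C. iexp (\<theta> nc * (bm_component nc t \<omega> - bm_component nc s \<omega>))))
    = (CLINT \<omega>|P. \<xi> \<omega>) * (\<Prod>nc\<in>C. exp (- (\<theta> nc)\<^sup>2 * (t - s) / 4))"
proof -
  let ?X = "case_option \<xi> (\<lambda>nc \<omega>. iexp (\<theta> nc * (bm_component nc t \<omega> - bm_component nc s \<omega>)))"
  let ?J = "insert None (Some ` C)"
  have n0: "fst nc \<noteq> 0" if "nc \<in> C" for nc using that C(2) H by (auto simp: half_def)
  have rv: "random_variable borel (?X j)" if j: "j \<in> ?J" for j
  proof (cases j)
    case None
    have "measurable (Filt s) borel \<subseteq> (measurable P borel :: (path \<Rightarrow> complex) set)"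
      using sets_Filt_subset by (intro measurable_mono) auto
    then show ?thesis using None \<xi>(1) by auto
  next
    case (Some nc)
    then have [measurable]: "bm_component nc t \<in> borel_measurable P" "bm_component nc s \<in> borel_measurable P"
      using j n0 component_measurable st by auto
    show ?thesis using Some by simp
  qed
  have iv: "indep_vars (\<lambda>_. borel) ?X ?J"
    unfolding indep_vars_def2
  proof (intro conjI ballI rv)
    have "indep_sets (case_option (sets (Filt s)) (incr_sets s t)) ?J"
      by (rule indep_sets_mono_index[OF _ indep_Filt_incr[OF H st]]) (use C in auto)
    then show "indep_sets (\<lambda>j. {?X j -` A \<inter> space P |A. A \<in> sets borel}) ?J"
    proof (rule indep_sets_mono_sets)
      fix j
      show "{?X j -` A \<inter> space P |A. A \<in> sets borel} \<subseteq> case_option (sets (Filt s)) (incr_sets s t) j"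
      proof (cases j)
        case None
        then show ?thesis using measurable_sets[OF \<xi>(1)] by auto
      next
        case (Some nc)
        have "preimages P (\<lambda>\<omega>. iexp (\<theta> nc * (bm_component nc t \<omega> - bm_component nc s \<omega>))) borel \<subseteq> incr_sets s t nc"
          unfolding incr_sets_def by (rule preimages_comp[where g="\<lambda>x. iexp (\<theta> nc * x)"]) auto
        then show ?thesis using Some by (auto simp: preimages_def)
      qed
    qed
  qed
  have ii: "integrable P (?X j)" if "j \<in> ?J" for j
  proof (cases j)
    case (Some nc)
    then show ?thesis using rv[OF that]
      by (intro integrable_const_bound[where B=1]) (auto simp: norm_exp_eq_Re)
  qed (use \<xi> in auto)
  have "finite ?J" using C(1) by simp
  from indep_vars_lebesgue_integral[OF this iv ii]
  have "(CLINT \<omega>|P. (\<Prod>j\<in>?J. ?X j \<omega>)) = (\<Prod>j\<in>?J. CLINT \<omega>|P. ?X j \<omega>)" .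
  moreover have "(\<Prod>j\<in>?J. ?X j \<omega>) = \<xi> \<omega> * (\<Prod>nc\<in>C. iexp (\<theta> nc * (bm_component nc t \<omega> - bm_component nc s \<omega>)))" for \<omega>
    using C(1) by (subst prod.insert) (auto simp: prod.reindex)
  moreover have "(\<Prod>j\<in>?J. CLINT \<omega>|P. ?X j \<omega>)
    = (CLINT \<omega>|P. \<xi> \<omega>) * (\<Prod>nc\<in>C. CLINT \<omega>|P. iexp (\<theta> nc * (bm_component nc t \<omega> - bm_component nc s \<omega>)))"
    using C(1) by (subst prod.insert) (auto simp: prod.reindex)
  moreover have "(\<Prod>nc\<in>C. CLINT \<omega>|P. iexp (\<theta> nc * (bm_component nc t \<omega> - bm_component nc s \<omega>)))
    = (\<Prod>nc\<in>C. exp (- (\<theta> nc)\<^sup>2 * (t - s) / 4))"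
    unfolding of_real_prod using component_char[OF n0 st] by (intro prod.cong) auto
  ultimately show ?thesis by (simp only: of_real_prod)
qed

lemma component_gauss_martingale:
  assumes n: "fst nc \<noteq> 0"
  shows "gauss_martingale P Filt (bm_component nc) (\<lambda>t. t / 2)"
proof
  fix s t \<theta> :: real and A assume st: "0 \<le> s" "s \<le> t" and A: "A \<in> sets (Filt s)"
  \<comment> \<open>The half depends on the frequency: the standard one or its mirror image.\<close>
  obtain H where H: "half H" "fst nc \<in> H"
    using half_half_space n unfolding half_def by (metis add.inverse_inverse imageI)
  have AP: "A \<in> events" using A sets_Filt_subset by blast
  have "(CLINT \<omega>|P. indicator A \<omega> * (\<Prod>nc\<in>{nc}. iexp (\<theta> * (bm_component nc t \<omega> - bm_component nc s \<omega>))))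
    = (CLINT \<omega>|P. indicator A \<omega>) * (\<Prod>nc\<in>{nc}. exp (- \<theta>\<^sup>2 * (t - s) / 4))"
  proof (rule char_given_past[OF H(1) st])
    show "(\<lambda>\<omega>. indicator A \<omega> :: complex) \<in> borel_measurable (Filt s)" using A by simp
    show "integrable P (\<lambda>\<omega>. indicator A \<omega> :: complex)"
      by (rule integrable_const_bound[where B=1]) (use AP in \<open>auto simp: indicator_def\<close>)
  qed (use H(2) in \<open>auto simp: mem_Times_iff\<close>)
  moreover have "(CLINT \<omega>|P. indicator A \<omega>) = prob A"
  proof -
    have "(CLINT \<omega>|P. indicator A \<omega>) = (CLINT \<omega>|P. of_real (indicator A \<omega>))"
      by (intro Bochner_Integration.integral_cong) (auto simp: indicator_def)
    also have "\<dots> = of_real (\<integral>\<omega>. indicator A \<omega> \<partial>P)" by (rule integral_complex_of_real)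
    finally show ?thesis using AP by simp
  qed
  ultimately show "(CLINT \<omega>|P. indicator A \<omega> * iexp (\<theta> * (bm_component nc t \<omega> - bm_component nc s \<omega>)))
      = prob A * exp (- \<theta>\<^sup>2 * (t / 2 - s / 2) / 2)"
    by (simp add: field_simps)
qed (use Filt_mono sets_Filt_subset component_Filt in \<open>auto intro!: continuous_intros\<close>)

end

section \<open>The modes of the Gaussian field\<close>

text \<open>Below the time sqrt (1 + \<bar>\<xi>\<bar>^2) the argument of the cutoff exceeds 1, so
  the function vanishes near the given time; for nonpositive times it is 0 by its definition. The
  second formula thus also covers the region where the first would divide by 0.\<close>

lemma deriv_zeta_sq:
  assumes c: "cutoff \<zeta>"
  shows "s > 0 \<Longrightarrow> deriv (\<lambda>s. (zeta_t \<zeta> s \<xi>)\<^sup>2) s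
      = 2 * \<zeta> (sqrt (1 + (norm \<xi>)\<^sup>2) / s) * deriv \<zeta> (sqrt (1 + (norm \<xi>)\<^sup>2) / s) * (- sqrt (1 + (norm \<xi>)\<^sup>2) / s\<^sup>2)"
    and "s < sqrt (1 + (norm \<xi>)\<^sup>2) \<Longrightarrow> deriv (\<lambda>s. (zeta_t \<zeta> s \<xi>)\<^sup>2) s = 0"
proof -
  define r where "r = sqrt (1 + (norm \<xi>)\<^sup>2)"
  have r: "r > 0" unfolding r_def by (simp add: add_pos_nonneg)
  show "deriv (\<lambda>s. (zeta_t \<zeta> s \<xi>)\<^sup>2) s = 2 * \<zeta> (r / s) * deriv \<zeta> (r / s) * (- r / s\<^sup>2)" if s: "s > 0" for s
  proof (rule DERIV_imp_deriv)
    have "((deriv ^^ 0) \<zeta>) field_differentiable (at (r / s))"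
      using c r s unfolding cutoff_def by (metis divide_pos_pos)
    then have d: "(\<zeta> has_field_derivative deriv \<zeta> (r / s)) (at (r / s))"
      by (simp add: field_differentiable_derivI)
    have q: "((\<lambda>s. r / s) has_field_derivative (- r / s\<^sup>2)) (at s)"
      using s by (auto intro!: derivative_eq_intros simp: power2_eq_square)
    have "((\<lambda>s. \<zeta> (r / s)) has_field_derivative (deriv \<zeta> (r / s) * (- r / s\<^sup>2))) (at s)"
      by (rule DERIV_chain2[OF d q])
    then have "((\<lambda>s. (\<zeta> (r / s))\<^sup>2) has_field_derivative (2 * \<zeta> (r / s) * deriv \<zeta> (r / s) * (- r / s\<^sup>2))) (at s)"
      by (rule DERIV_cong[OF DERIV_power]) (simp add: mult_ac)
    moreover have "eventually (\<lambda>s. 0 < s) (nhds s)"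
      using eventually_nhds_in_open[of "{0<..}" s] s by simp
    then have "eventually (\<lambda>s. (zeta_t \<zeta> s \<xi>)\<^sup>2 = (\<zeta> (r / s))\<^sup>2) (nhds s)"
      by eventually_elim (simp add: zeta_t_def r_def)
    from DERIV_cong_ev[OF refl this refl] calculation
    show "((\<lambda>s. (zeta_t \<zeta> s \<xi>)\<^sup>2) has_field_derivative (2 * \<zeta> (r / s) * deriv \<zeta> (r / s) * (- r / s\<^sup>2))) (at s)"
      by blast
  qed
  show "deriv (\<lambda>s. (zeta_t \<zeta> s \<xi>)\<^sup>2) s = 0" if s: "s < r" for s
  proof (rule DERIV_imp_deriv)
    have "eventually (\<lambda>s. s < r) (nhds s)" using eventually_nhds_in_open[of "{..<r}" s] s by simp
    then have "eventually (\<lambda>s. (zeta_t \<zeta> s \<xi>)\<^sup>2 = 0) (nhds s)"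
    proof eventually_elim
      case (elim s)
      show ?case
      proof (cases "s > 0")
        case True
        then have "1 \<le> r / s" using elim by simp
        then have "\<zeta> (r / s) = 0" using c unfolding cutoff_def by blast
        then show ?thesis by (simp add: zeta_t_def r_def)
      qed (simp add: zeta_t_def)
    qed
    from DERIV_cong_ev[OF refl this refl]
    show "((\<lambda>s. (zeta_t \<zeta> s \<xi>)\<^sup>2) has_field_derivative 0) (at s)" by simp
  qed
qed

text \<open>A mode is silent until time norm \<xi>, slightly earlier than its true onset sqrt (1 +
  \<bar>\<xi>\<bar>^2). The simpler threshold suffices to leave only finitely many modes at each
  time.\<close>

lemma J_symbol_eq_0: "cutoff \<zeta> \<Longrightarrow> s \<le> norm \<xi> \<Longrightarrow> J_symbol \<zeta> s \<xi> = 0"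
proof -
  assume c: "cutoff \<zeta>" and s: "s \<le> norm \<xi>"
  have "norm \<xi> < sqrt (1 + (norm \<xi>)\<^sup>2)" by (rule real_less_rsqrt) simp
  then show ?thesis using deriv_zeta_sq(2)[OF c, of s \<xi>] s by (simp add: J_symbol_def sigma_t_def)
qed

lemma J_symbol_0 [simp]: "J_symbol \<zeta> s 0 = 0"
  by (simp add: J_symbol_def)

lemma J_symbol_cong: "norm \<xi> = norm \<eta> \<Longrightarrow> J_symbol \<zeta> s \<xi> = J_symbol \<zeta> s \<eta>"
proof -
  assume e: "norm \<xi> = norm \<eta>"
  then have "zeta_t \<zeta> s \<xi> = zeta_t \<zeta> s \<eta>" for s by (simp add: zeta_t_def)
  with e show ?thesis by (simp add: J_symbol_def sigma_t_def)
qed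

text \<open>Two overlapping open sets cover the line: on the positive times the derivative has an
  explicit continuous formula, and before the onset of the mode it is 0.\<close>

lemma continuous_J_symbol:
  assumes c: "cutoff \<zeta>"
  shows "continuous_on A (\<lambda>s. J_symbol \<zeta> s \<xi>)"
proof -
  define r where "r = sqrt (1 + (norm \<xi>)\<^sup>2)"
  have r: "r > 0" unfolding r_def by (simp add: add_pos_nonneg)
  let ?D = "\<lambda>s. deriv (\<lambda>s. (zeta_t \<zeta> s \<xi>)\<^sup>2) s"
  have fd: "\<zeta> field_differentiable (at x)" "deriv \<zeta> field_differentiable (at x)" if "x > 0" for x
    using c that unfolding cutoff_def
      by (metis funpow_0, metis funpow_0 funpow.simps(2) comp_apply id_apply One_nat_def)
  have c1: "continuous_on {0<..} \<zeta>" "continuous_on {0<..} (deriv \<zeta>)"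
    by (auto intro!: continuous_at_imp_continuous_on field_differentiable_imp_continuous_at fd)
  have "continuous_on {0<..} ?D"
  proof (subst continuous_on_cong[OF refl])
    show "?D s = 2 * \<zeta> (r / s) * deriv \<zeta> (r / s) * (- r / s\<^sup>2)" if "s \<in> {0<..}" for s
      using deriv_zeta_sq(1)[OF c, of s \<xi>] that by (simp add: r_def)
    show "continuous_on {0<..} (\<lambda>s. 2 * \<zeta> (r / s) * deriv \<zeta> (r / s) * (- r / s\<^sup>2))"
      by (intro continuous_intros continuous_on_compose2[OF c1(1)] continuous_on_compose2[OF c1(2)])
        (use r in auto)
  qed
  moreover have "continuous_on {..<r} ?D"
    by (subst continuous_on_cong[OF refl, of _ _ "\<lambda>_. 0"]) (use deriv_zeta_sq(2)[OF c] in \<open>auto simp: r_def\<close>)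
  ultimately have "continuous_on ({0<..} \<union> {..<r}) ?D"
    by (intro continuous_on_open_Un) auto
  moreover have "{0<..} \<union> {..<r} = UNIV" using r by auto
  ultimately have "continuous_on UNIV ?D" by simp
  then have "continuous_on UNIV (\<lambda>s. J_symbol \<zeta> s \<xi>)"
    unfolding J_symbol_def sigma_t_def divide_inverse
    by (intro continuous_on_mult_right continuous_on_real_sqrt)
  then show ?thesis by (rule continuous_on_subset) auto
qed

lemma J_symbol_measurable [measurable]: "cutoff \<zeta> \<Longrightarrow> (\<lambda>s. J_symbol \<zeta> s \<xi>) \<in> borel_measurable borel"
  by (rule borel_measurable_continuous_onI) (rule continuous_J_symbol)

section \<open>Uniform grids and Riemann sums\<close>

definition grid :: "real \<Rightarrow> real \<Rightarrow> nat \<Rightarrow> nat \<Rightarrow> real" where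
  "grid a b k i = a + real i * ((b - a) / real (Suc k))"

text \<open>The index \<open>k\<close> stands for k + 1 cells, so the mesh never involves a division
  by 0 and the right end point is always a grid point.\<close>

lemma grid_0 [simp]: "grid a b k 0 = a" and grid_Suc [simp]: "grid a b k (Suc k) = b"
proof -
  show "grid a b k 0 = a" by (simp add: grid_def)
  have "real (Suc k) * ((b - a) / real (Suc k)) = b - a"
    by (rule nonzero_mult_div_cancel_left[THEN trans[OF times_divide_eq_right]]) simp
  then show "grid a b k (Suc k) = b"
    by (simp only: grid_def add_diff_cancel_left' diff_add_cancel add.commute[of a])
qed

lemma grid_diff: "grid a b k (Suc i) - grid a b k i = (b - a) / real (Suc k)"
proof -
  have "(a + (1 + x) * d) - (a + x * d) = d" for x d :: real by (simp add: algebra_simps)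
  then show ?thesis by (simp only: grid_def of_nat_Suc[of i])
qed

lemma grid_mono: "a \<le> b \<Longrightarrow> i \<le> j \<Longrightarrow> grid a b k i \<le> grid a b k j"
  unfolding grid_def by (intro add_left_mono mult_right_mono) auto

lemma grid_bounds: "a \<le> b \<Longrightarrow> i \<le> Suc k \<Longrightarrow> a \<le> grid a b k i \<and> grid a b k i \<le> b"
  using grid_mono[of a b 0 i k] grid_mono[of a b i "Suc k" k] by simp

lemma grid_uniform:
  fixes f :: "real \<Rightarrow> real"
  assumes ab: "a \<le> b" and f: "continuous_on {a..b} f" and e: "0 < \<epsilon>"
  shows "\<exists>K. \<forall>k\<ge>K. \<forall>i\<le>k. \<forall>s\<in>{grid a b k i..grid a b k (Suc i)}. \<bar>f s - f (grid a b k i)\<bar> \<le> \<epsilon>"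
proof -
  have "uniformly_continuous_on {a..b} f" using f by (intro compact_uniformly_continuous) auto
  then obtain \<delta> where d: "\<delta> > 0" "\<And>x y. x \<in> {a..b} \<Longrightarrow> y \<in> {a..b} \<Longrightarrow> dist y x < \<delta> \<Longrightarrow> dist (f y) (f x) < \<epsilon>"
    using e unfolding uniformly_continuous_on_def by metis
  obtain K :: nat where K: "real K > (b - a) / \<delta>" using reals_Archimedean2 by blast
  show ?thesis
  proof (intro exI[of _ K] allI impI ballI)
    fix k i s assume k: "K \<le> k" "i \<le> k" and s: "s \<in> {grid a b k i..grid a b k (Suc i)}"
    have "(b - a) / \<delta> < real (Suc k)" using K k by simp
    then have "(b - a) / real (Suc k) < \<delta>" using d(1) by (simp add: field_simps)
    then have "dist s (grid a b k i) < \<delta>" using s grid_diff[of a b k i] by (simp add: dist_real_def)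
    moreover have "grid a b k i \<in> {a..b}" "s \<in> {a..b}"
      using s grid_bounds[OF ab, of i k] grid_bounds[OF ab, of "Suc i" k] k by auto
    ultimately show "\<bar>f s - f (grid a b k i)\<bar> \<le> \<epsilon>" using d(2)[of "grid a b k i" s] by (simp add: dist_real_def)
  qed
qed

text \<open>The half-open cells are disjoint, so errors do not accumulate. The points
  \<open>q\<close> need not be equidistant: the lemma serves uniform grids as well as arbitrary
  partitions of Stieltjes integrals.\<close>

lemma step_approx:
  fixes f :: "real \<Rightarrow> real"
  assumes "\<And>i. i < m \<Longrightarrow> q i \<le> q (Suc i)" and "\<And>i s. i < m \<Longrightarrow> s \<in> {q i<..q (Suc i)} \<Longrightarrow> \<bar>f s - c i\<bar> \<le> \<epsilon>"
  shows "q 0 \<le> q m \<and> \<bar>f s * indicator {q 0<..q m} s - (\<Sum>i<m. c i * indicator {q i<..q (Suc i)} s)\<bar>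
    \<le> \<epsilon> * indicator {q 0<..q m} s"
  using assms
proof (induction m)
  case (Suc m)
  then have IH: "q 0 \<le> q m" "\<bar>f s * indicator {q 0<..q m} s - (\<Sum>i<m. c i * indicator {q i<..q (Suc i)}
    s)\<bar> \<le> \<epsilon> * indicator {q 0<..q m} s"
    by auto
  have m: "q m \<le> q (Suc m)" using Suc by auto
  have e: "indicator {q 0<..q (Suc m)} s = indicat_real {q 0<..q m} s + indicator {q m<..q (Suc m)} s"
    using IH(1) m by (auto simp: indicator_def)
  have "\<bar>f s * indicator {q m<..q (Suc m)} s - c m * indicator {q m<..q (Suc m)} s\<bar>
    \<le> \<epsilon> * indicator {q m<..q (Suc m)} s"
    using Suc(3)[of m s] by (auto simp: indicator_def)
  then show ?case using IH m unfolding e sum.lessThan_Suc by (auto simp: algebra_simps abs_le_iff)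
qed auto

lemma riemann_sum_tendsto:
  fixes f :: "real \<Rightarrow> real"
  assumes ab: "a \<le> b" and f: "continuous_on {a..b} f"
  shows "(\<lambda>k. \<Sum>i<Suc k. f (grid a b k i) * (grid a b k (Suc i) - grid a b k i)) \<longlonglongrightarrow> integral {a..b} f"
proof (rule LIMSEQ_I)
  fix e :: real assume e: "0 < e"
  define \<epsilon> where "\<epsilon> = e / (2 * (b - a + 1))"
  have \<epsilon>: "0 < \<epsilon>" using e ab by (simp add: \<epsilon>_def)
  obtain K where K: "\<And>k i s. k \<ge> K \<Longrightarrow> i \<le> k \<Longrightarrow> s \<in> {grid a b k i..grid a b k (Suc i)} \<Longrightarrow> \<bar>f s - f (grid a b k i)\<bar> \<le> \<epsilon>"
    using grid_uniform[OF ab f \<epsilon>] by blast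
  show "\<exists>K. \<forall>k\<ge>K. norm ((\<Sum>i<Suc k. f (grid a b k i) * (grid a b k (Suc i) - grid a b k i))
    - integral {a..b} f) < e"
  proof (intro exI[of _ K] allI impI)
    fix k assume k: "K \<le> k"
    let ?q = "grid a b k"
    have int: "f integrable_on {x..y}" if "a \<le> x" "y \<le> b" for x y
      by (rule integrable_continuous_real) (rule continuous_on_subset[OF f], use that in auto)
    have "\<bar>(\<Sum>i<m. f (?q i) * (?q (Suc i) - ?q i)) - integral {a..?q m} f\<bar> \<le> \<epsilon> * (?q m - a)" if "m \<le> Suc k" for m
      using that
    proof (induction m)
      case (Suc m)
      have qm: "a \<le> ?q m" "?q m \<le> ?q (Suc m)" "?q (Suc m) \<le> b"
        using grid_bounds[OF ab, of m k] grid_bounds[OF ab, of "Suc m" k] grid_mono[OF ab, of m "Suc m"]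
          Suc by auto
      have comb: "integral {a..?q (Suc m)} f = integral {a..?q m} f + integral {?q m..?q (Suc m)} f"
        using qm by (intro Henstock_Kurzweil_Integration.integral_combine[symmetric] int) auto
      have "f (?q m) * (?q (Suc m) - ?q m) - integral {?q m..?q (Suc m)} f
        = integral {?q m..?q (Suc m)} (\<lambda>s. f (?q m) - f s)"
        using qm int[of "?q m" "?q (Suc m)"]
        by (subst Henstock_Kurzweil_Integration.integral_diff) (auto intro!: integrable_continuous_real)
      moreover have "norm (integral {?q m..?q (Suc m)} (\<lambda>s. f (?q m) - f s)) \<le> \<epsilon> * (?q (Suc m) - ?q m)"
      proof (rule integral_bound[OF qm(2)])
        show "continuous_on {?q m..?q (Suc m)} (\<lambda>s. f (?q m) - f s)"
          using qm by (intro continuous_intros continuous_on_subset[OF f]) auto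
        show "\<And>s. s \<in> {?q m..?q (Suc m)} \<Longrightarrow> norm (f (?q m) - f s) \<le> \<epsilon>"
          using K[OF k, of m] Suc.prems by (auto simp: abs_minus_commute)
      qed
      ultimately have "\<bar>f (?q m) * (?q (Suc m) - ?q m) - integral {?q m..?q (Suc m)} f\<bar>
        \<le> \<epsilon> * (?q (Suc m) - ?q m)" by simp
      moreover have "\<epsilon> * (?q (Suc m) - a) = \<epsilon> * (?q m - a) + \<epsilon> * (?q (Suc m) - ?q m)" by (simp add: algebra_simps)
      ultimately show ?case using Suc.IH Suc.prems unfolding comb sum.lessThan_Suc by linarith
    qed (simp add: )
    from this[of "Suc k"] have "\<bar>(\<Sum>i<Suc k. f (?q i) * (?q (Suc i) - ?q i)) - integral {a..b} f\<bar> \<le> \<epsilon> * (b - a)"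
      by (simp del: sum.lessThan_Suc)
    also have "\<dots> < e"
    proof -
      have "e * (b - a) < e * (2 * (b - a + 1))" using e ab by (intro mult_strict_left_mono) auto
      moreover have "0 < 2 * (b - a + 1)" using ab by simp
      ultimately have "e * (b - a) / (2 * (b - a + 1)) < e" by (simp only: pos_divide_less_eq)
      then show ?thesis unfolding \<epsilon>_def by simp
    qed
    finally show "norm ((\<Sum>i<Suc k. f (?q i) * (?q (Suc i) - ?q i)) - integral {a..b} f) < e" by simp
  qed
qed


text \<open>The elementary bound \<bar>x\<bar> \<le> r / 2 + x^2 / r takes the place of the
  Cauchy-Schwarz inequality; a second moment below r * r / 4 then makes the total at most 3 r /
  4.\<close>

lemma (in prob_space) L1_null_if_L2_null:
  assumes X: "\<And>k. X k \<in> borel_measurable M"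
    and l: "(\<lambda>k. \<integral>\<^sup>+\<omega>. ennreal ((X k \<omega>)\<^sup>2) \<partial>M) \<longlonglongrightarrow> 0"
  shows "(\<lambda>k. \<integral>\<^sup>+\<omega>. ennreal \<bar>X k \<omega>\<bar> \<partial>M) \<longlonglongrightarrow> 0"
proof (rule tendsto_zero_ennreal)
  fix r :: real assume r: "0 < r"
  have "eventually (\<lambda>k. (\<integral>\<^sup>+\<omega>. ennreal ((X k \<omega>)\<^sup>2) \<partial>M) < ennreal (r * r / 4)) sequentially"
    using l by (rule order_tendstoD(2)) (use r in simp)
  then show "eventually (\<lambda>k. (\<integral>\<^sup>+\<omega>. ennreal \<bar>X k \<omega>\<bar> \<partial>M) < ennreal r) sequentially"
  proof eventually_elim
    case (elim k)
    note X[of k, measurable]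
    have "(\<integral>\<^sup>+\<omega>. ennreal \<bar>X k \<omega>\<bar> \<partial>M) \<le> (\<integral>\<^sup>+\<omega>. ennreal (r / 2) + ennreal (1 / r) * ennreal ((X k \<omega>)\<^sup>2) \<partial>M)"
    proof (rule nn_integral_mono)
      fix \<omega>
      have "0 \<le> (\<bar>X k \<omega>\<bar> - r / 2)\<^sup>2" by simp
      then have "\<bar>X k \<omega>\<bar> * r \<le> (X k \<omega>)\<^sup>2 + r * r / 4" by (simp add: power2_diff power2_eq_square algebra_simps)
      then have "\<bar>X k \<omega>\<bar> \<le> r / 4 + 1 / r * (X k \<omega>)\<^sup>2" using r by (simp add: field_simps)
      then have "\<bar>X k \<omega>\<bar> \<le> r / 2 + 1 / r * (X k \<omega>)\<^sup>2" using r by linarith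
      then have "ennreal \<bar>X k \<omega>\<bar> \<le> ennreal (r / 2 + 1 / r * (X k \<omega>)\<^sup>2)" by (rule ennreal_leI)
      also have "\<dots> = ennreal (r / 2) + ennreal (1 / r * (X k \<omega>)\<^sup>2)" using r by (intro ennreal_plus) auto
      also have "ennreal (1 / r * (X k \<omega>)\<^sup>2) = ennreal (1 / r) * ennreal ((X k \<omega>)\<^sup>2)" using r
        by (intro ennreal_mult) auto
      finally show "ennreal \<bar>X k \<omega>\<bar> \<le> ennreal (r / 2) + ennreal (1 / r) * ennreal ((X k \<omega>)\<^sup>2)" .
    qed
    also have "\<dots> = ennreal (r / 2) + ennreal (1 / r) * (\<integral>\<^sup>+\<omega>. ennreal ((X k \<omega>)\<^sup>2) \<partial>M)"
      by (simp add: nn_integral_add nn_integral_cmult emeasure_space_1)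
    also have "\<dots> \<le> ennreal (r / 2) + ennreal (1 / r) * ennreal (r * r / 4)"
      using elim by (intro add_left_mono mult_left_mono) auto
    also have "ennreal (1 / r) * ennreal (r * r / 4) = ennreal (1 / r * (r * r / 4))"
      using r by (intro ennreal_mult[symmetric]) auto
    also have "ennreal (r / 2) + ennreal (1 / r * (r * r / 4)) = ennreal (r / 2 + 1 / r * (r * r / 4))"
      using r by (intro ennreal_plus[symmetric]) auto
    also have "\<dots> < ennreal r" using r by (intro ennreal_lessI) auto
    finally show ?case .
  qed
qed

locale gauss_process = wiener +
  fixes \<zeta> :: "real \<Rightarrow> real" and W :: "int^2 \<Rightarrow> real \<Rightarrow> path \<Rightarrow> complex"
  assumes cutoff: "cutoff \<zeta>"
    and W_Re: "n \<noteq> 0 \<Longrightarrow> ito_integral P Filt (\<lambda>t \<omega>. Re (\<omega> t n)) (\<lambda>s \<omega>. J_symbol \<zeta> s (rvec n)) (\<lambda>t \<omega>. Re (W n t \<omega>))"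
    and W_Im: "n \<noteq> 0 \<Longrightarrow> ito_integral P Filt (\<lambda>t \<omega>. Im (\<omega> t n)) (\<lambda>s \<omega>. J_symbol \<zeta> s (rvec n)) (\<lambda>t \<omega>. Im (W n t \<omega>))"
begin

definition Wc :: "(int^2) \<times> bool \<Rightarrow> real \<Rightarrow> path \<Rightarrow> real" where
  "Wc nc t \<omega> = (if snd nc then Re (W (fst nc) t \<omega>) else Im (W (fst nc) t \<omega>))"

abbreviation J :: "int^2 \<Rightarrow> real \<Rightarrow> real" where "J n s \<equiv> J_symbol \<zeta> s (rvec n)"

lemma ito_W:
  assumes "fst nc \<noteq> 0"
  shows "ito_setup P Filt (bm_component nc) (\<lambda>t. t / 2) (bm_component nc) (\<lambda>s \<omega>. J (fst nc) s) (Wc nc)"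
proof -
  interpret gauss_martingale P Filt "bm_component nc" "\<lambda>t. t / 2" by (rule component_gauss_martingale[OF assms])
  show ?thesis
  proof
    have "bm_component nc = (\<lambda>t \<omega>. if snd nc then Re (\<omega> t (fst nc)) else Im (\<omega> t (fst nc)))"
      "Wc nc = (\<lambda>t \<omega>. if snd nc then Re (W (fst nc) t \<omega>) else Im (W (fst nc) t \<omega>))"
      by (auto simp: bm_component_def Wc_def fun_eq_iff)
    then show "ito_integral P Filt (bm_component nc) (\<lambda>s \<omega>. J (fst nc) s) (Wc nc)"
      using W_Re[OF assms] W_Im[OF assms] by (cases "snd nc") simp_all
  qed simp
qed

lemma Wc_Filt: "fst nc \<noteq> 0 \<Longrightarrow> 0 \<le> t \<Longrightarrow> Wc nc t \<in> borel_measurable (Filt t)"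
  using ito_setup.ito[OF ito_W] unfolding ito_integral_def by blast

lemma Wc_measurable: "fst nc \<noteq> 0 \<Longrightarrow> 0 \<le> t \<Longrightarrow> Wc nc t \<in> borel_measurable P"
  using ito_setup.I_measurable[OF ito_W] by blast

lemma Wc_continuous: "fst nc \<noteq> 0 \<Longrightarrow> AE \<omega> in P. continuous_on {0..} (\<lambda>t. Wc nc t \<omega>)"
  using ito_setup.ito[OF ito_W] unfolding ito_integral_def by blast

definition riemann :: "(int^2) \<times> bool \<Rightarrow> real \<Rightarrow> real \<Rightarrow> nat \<Rightarrow> path \<Rightarrow> real" where
  "riemann nc a b k \<omega> = (\<Sum>i<Suc k. J (fst nc) (grid a b k i) * (bm_component nc (grid a b k (Suc i)) \<omega>
    - bm_component nc (grid a b k i) \<omega>))"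

lemma riemann_measurable:
  assumes "fst nc \<noteq> 0" "0 \<le> a" "a \<le> b"
  shows "riemann nc a b k \<in> borel_measurable P"
proof -
  have "0 \<le> grid a b k i" if "i \<le> Suc k" for i using grid_bounds[of a b i k] assms that by simp
  then show ?thesis unfolding riemann_def[abs_def]
    by (intro borel_measurable_sum borel_measurable_times borel_measurable_diff component_measurable assms) auto
qed

text \<open>The Ito integrals are taken from time 0. Adjacent grids on [0, a] and [a, b] therefore
  approximate the integral up to \<open>b\<close>, while the first grid alone approximates the one
  up to \<open>a\<close>; the increment is then approximated by the second grid.\<close>

lemma Wc_L2_approx:
  assumes n: "fst nc \<noteq> 0" and ab: "0 \<le> a" "a \<le> b" and e: "0 < \<epsilon>"
  shows "\<exists>K. \<forall>k\<ge>K. (\<integral>\<^sup>+\<omega>. ennreal ((Wc nc b \<omega> - (riemann nc 0 a k \<omega> + riemann nc a b k \<omega>))\<^sup>2) \<partial>P) \<le> ennreal \<epsilon>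
    \<and> (\<integral>\<^sup>+\<omega>. ennreal ((Wc nc a \<omega> - riemann nc 0 a k \<omega>)\<^sup>2) \<partial>P) \<le> ennreal \<epsilon>"
proof -
  interpret ito_setup P Filt "bm_component nc" "\<lambda>t. t / 2" "bm_component nc" "\<lambda>s \<omega>. J (fst nc) s" "Wc nc"
    by (rule ito_W[OF n])
  let ?f = "J (fst nc)"
  \<comment> \<open>The bracket of a component is t / 2, so the error bound is 4 * \<eta>^2 * t / 2
    = \<epsilon> * t / (b + 1), which is below \<epsilon>.\<close>
  define \<eta> where "\<eta> = sqrt (\<epsilon> / (2 * (b + 1)))"
  have \<eta>: "0 < \<eta>" using e ab by (simp add: \<eta>_def)
  have cont: "continuous_on A ?f" for A by (rule continuous_J_symbol[OF cutoff])
  obtain K1 where K1: "\<And>k i s. k \<ge> K1 \<Longrightarrow> i \<le> k \<Longrightarrow> s \<in> {grid 0 a k i..grid 0 a k (Suc i)}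
    \<Longrightarrow> \<bar>?f s - ?f (grid 0 a k i)\<bar> \<le> \<eta>"
    using grid_uniform[OF ab(1) cont \<eta>] by blast
  obtain K2 where K2: "\<And>k i s. k \<ge> K2 \<Longrightarrow> i \<le> k \<Longrightarrow> s \<in> {grid a b k i..grid a b k (Suc i)}
    \<Longrightarrow> \<bar>?f s - ?f (grid a b k i)\<bar> \<le> \<eta>"
    using grid_uniform[OF ab(2) cont \<eta>] by blast
  \<comment> \<open>The symbol vanishes at time 0, so closed and half-open intervals at 0 may be
    exchanged.\<close>
  have f0: "?f 0 = 0" by (rule J_symbol_eq_0[OF cutoff]) simp
  have small: "4 * (\<integral>\<^sup>+s. ennreal ((\<eta> * indicator {0..t} s)\<^sup>2) \<partial>\<mu>) \<le> ennreal \<epsilon>" if t: "0 \<le> t" "t \<le> b" for t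
  proof -
    have "4 * (\<integral>\<^sup>+s. ennreal ((\<eta> * indicator {0..t} s)\<^sup>2) \<partial>\<mu>) = 4 * (\<integral>\<^sup>+s. ennreal (\<eta>\<^sup>2) * indicator {0..t} s \<partial>\<mu>)"
      by (intro arg_cong2[where f="(*)"] nn_integral_cong refl) (auto simp: indicator_def)
    also have "\<dots> = 4 * (ennreal (\<eta>\<^sup>2) * emeasure \<mu> {0..t})" by (simp add: nn_integral_cmult)
    also have "\<dots> \<le> 4 * (ennreal (\<eta>\<^sup>2) * ennreal (t / 2))"
      using emeasure_bracket_Icc_le[OF t(1)] by (intro mult_left_mono) auto
    also have "\<dots> = ennreal (4 * (\<eta>\<^sup>2 * (t / 2)))"
    proof -
      have "ennreal (4 * (\<eta>\<^sup>2 * (t / 2))) = ennreal 4 * ennreal (\<eta>\<^sup>2 * (t / 2))"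
        by (rule ennreal_mult) (use t in auto)
      also have "ennreal (\<eta>\<^sup>2 * (t / 2)) = ennreal (\<eta>\<^sup>2) * ennreal (t / 2)"
        by (rule ennreal_mult) (use t in auto)
      finally show ?thesis by (simp only: ennreal_numeral)
    qed
    also have "\<dots> \<le> ennreal \<epsilon>"
    proof (rule ennreal_leI)
      have "4 * (\<eta>\<^sup>2 * (t / 2)) = \<epsilon> * (t / (b + 1))" using e ab by (simp add: \<eta>_def field_simps)
      also have "\<dots> \<le> \<epsilon> * 1" using e t by (intro mult_left_mono) (auto simp: field_simps)
      finally show "4 * (\<eta>\<^sup>2 * (t / 2)) \<le> \<epsilon>" by simp
    qed
    finally show ?thesis .
  qed
  show ?thesis
  proof (intro exI[of _ "max K1 K2"] allI impI)
    fix k assume k: "max K1 K2 \<le> k"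
    let ?q1 = "grid 0 a k" and ?q2 = "grid a b k"
    let ?s1 = "\<lambda>s. \<Sum>i<Suc k. ?f (?q1 i) * indicator {?q1 i<..?q1 (Suc i)} s"
    let ?s2 = "\<lambda>s. \<Sum>i<Suc k. ?f (?q2 i) * indicator {?q2 i<..?q2 (Suc i)} s"
    have st1: "\<bar>?f s * indicator {0<..a} s - ?s1 s\<bar> \<le> \<eta> * indicator {0<..a} s" for s
      using step_approx[of "Suc k" ?q1 ?f "\<lambda>i. ?f (?q1 i)" \<eta> s] K1[of k] k grid_mono[OF ab(1)] by auto
    have st2: "\<bar>?f s * indicator {a<..b} s - ?s2 s\<bar> \<le> \<eta> * indicator {a<..b} s" for s
      using step_approx[of "Suc k" ?q2 ?f "\<lambda>i. ?f (?q2 i)" \<eta> s] K2[of k] k grid_mono[OF ab(2)] by auto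
    have i1: "?f s * indicator {0..a} s = ?f s * indicator {0<..a} s" for s using f0 ab
      by (auto simp: indicator_def)
    have i2: "?f s * indicator {0..b} s = ?f s * indicator {0<..a} s + ?f s * indicator {a<..b} s" for s
      using f0 ab by (auto simp: indicator_def)
    have i3: "\<eta> * indicator {0<..a} s + \<eta> * indicator {a<..b} s \<le> \<eta> * indicator {0..b} s" for s
      using \<eta> ab by (auto simp: indicator_def)
    have i4: "\<eta> * indicator {0<..a} s \<le> \<eta> * indicator {0..a} s" for s using \<eta> by (auto simp: indicator_def)
    have q1: "0 \<le> ?q1 i" "?q1 i \<le> ?q1 (Suc i)" if "i < Suc k" for i
      using grid_bounds[OF ab(1), of i k] grid_mono[OF ab(1), of i "Suc i" k] that by auto
    have q2: "0 \<le> ?q2 i" "?q2 i \<le> ?q2 (Suc i)" if "i < Suc k" for i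
      using grid_bounds[OF ab(2), of i k] grid_mono[OF ab(2), of i "Suc i" k] that ab by auto
    have "(\<integral>\<^sup>+\<omega>. ennreal ((Wc nc a \<omega> - riemann nc 0 a k \<omega>)\<^sup>2) \<partial>P)
      \<le> 4 * (\<integral>\<^sup>+s. ennreal ((?f s * indicator {0..a} s - ?s1 s)\<^sup>2) \<partial>\<mu>)"
      unfolding riemann_def by (rule ito_deterministic_approx[OF ab(1)]) (use q1 J_symbol_measurable[OF
        cutoff] in auto)
    also have "\<dots> \<le> 4 * (\<integral>\<^sup>+s. ennreal ((\<eta> * indicator {0..a} s)\<^sup>2) \<partial>\<mu>)"
    proof (intro mult_left_mono nn_integral_mono ennreal_leI)
      fix s
      have "\<bar>?f s * indicator {0..a} s - ?s1 s\<bar> \<le> \<bar>\<eta> * indicator {0..a} s\<bar>" using st1[of s] i4[of s]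
        unfolding i1 by linarith
      then show "(?f s * indicator {0..a} s - ?s1 s)\<^sup>2 \<le> (\<eta> * indicator {0..a} s)\<^sup>2"
        by (simp only: abs_le_square_iff)
    qed simp
    also have "\<dots> \<le> ennreal \<epsilon>" by (rule small) (use ab in auto)
    finally have A: "(\<integral>\<^sup>+\<omega>. ennreal ((Wc nc a \<omega> - riemann nc 0 a k \<omega>)\<^sup>2) \<partial>P) \<le> ennreal \<epsilon>" .
    let ?J = "{..<Suc k} <+> {..<Suc k}"
    let ?c = "case_sum (\<lambda>i. ?f (?q1 i)) (\<lambda>i. ?f (?q2 i))"
    let ?a = "case_sum ?q1 ?q2" and ?b = "case_sum (\<lambda>i. ?q1 (Suc i)) (\<lambda>i. ?q2 (Suc i))"
    have r: "(\<Sum>j\<in>?J. ?c j * (bm_component nc (?b j) \<omega> - bm_component nc (?a j) \<omega>))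
      = riemann nc 0 a k \<omega> + riemann nc a b k \<omega>" for \<omega>
      unfolding riemann_def by (simp only: sum.Plus finite_lessThan o_def sum.case)
    have s: "(\<Sum>j\<in>?J. ?c j * indicator {?a j<..?b j} s) = ?s1 s + ?s2 s" for s
      by (simp only: sum.Plus finite_lessThan o_def sum.case)
    have "(\<integral>\<^sup>+\<omega>. ennreal ((Wc nc b \<omega> - (\<Sum>j\<in>?J. ?c j * (bm_component nc (?b j) \<omega>
      - bm_component nc (?a j) \<omega>)))\<^sup>2) \<partial>P)
      \<le> 4 * (\<integral>\<^sup>+s. ennreal ((?f s * indicator {0..b} s - (\<Sum>j\<in>?J. ?c j * indicator {?a j<..?b j} s))\<^sup>2) \<partial>\<mu>)"
      by (rule ito_deterministic_approx) (use q1 q2 ab J_symbol_measurable[OF cutoff] in \<open>auto split: sum.splits\<close>)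
    also have "\<dots> \<le> 4 * (\<integral>\<^sup>+s. ennreal ((\<eta> * indicator {0..b} s)\<^sup>2) \<partial>\<mu>)"
      unfolding s
    proof (intro mult_left_mono nn_integral_mono ennreal_leI)
      fix s
      have "\<bar>?f s * indicator {0..b} s - (?s1 s + ?s2 s)\<bar> \<le> \<bar>\<eta> * indicator {0..b} s\<bar>"
        using st1[of s] st2[of s] i3[of s] unfolding i2 by linarith
      then show "(?f s * indicator {0..b} s - (?s1 s + ?s2 s))\<^sup>2 \<le> (\<eta> * indicator {0..b} s)\<^sup>2"
        by (simp only: abs_le_square_iff)
    qed simp
    also have "\<dots> \<le> ennreal \<epsilon>" by (rule small) (use ab in auto)
    finally show "(\<integral>\<^sup>+\<omega>. ennreal ((Wc nc b \<omega> - (riemann nc 0 a k \<omega> + riemann nc a b k \<omega>))\<^sup>2) \<partial>P) \<le> ennreal \<epsilon>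
      \<and> (\<integral>\<^sup>+\<omega>. ennreal ((Wc nc a \<omega> - riemann nc 0 a k \<omega>)\<^sup>2) \<partial>P) \<le> ennreal \<epsilon>"
      using A unfolding r by blast
  qed
qed

text \<open>The difference of the two L2 approximations cancels the grid before \<open>a\<close>.
  Convergence in L1 is the form needed for characteristic functions, because exp(i x) is Lipschitz
  in x.\<close>

lemma Wc_L1_approx:
  assumes n: "fst nc \<noteq> 0" and ab: "0 \<le> a" "a \<le> b"
  shows "(\<lambda>k. \<integral>\<^sup>+\<omega>. ennreal \<bar>(Wc nc b \<omega> - Wc nc a \<omega>) - riemann nc a b k \<omega>\<bar> \<partial>P) \<longlonglongrightarrow> 0"
proof (rule L1_null_if_L2_null)
  have b0: "0 \<le> b" using ab by simp
  note [measurable] = Wc_measurable[OF n b0] Wc_measurable[OF n ab(1)] riemann_measurable[OF n ab]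
    riemann_measurable[OF n order_refl ab(1)]
  show "(\<lambda>\<omega>. (Wc nc b \<omega> - Wc nc a \<omega>) - riemann nc a b k \<omega>) \<in> borel_measurable P" for k by measurable
  show "(\<lambda>k. \<integral>\<^sup>+\<omega>. ennreal (((Wc nc b \<omega> - Wc nc a \<omega>) - riemann nc a b k \<omega>)\<^sup>2) \<partial>P) \<longlonglongrightarrow> 0"
  proof (rule tendsto_zero_ennreal)
    fix r :: real assume r: "0 < r"
    obtain K where K: "\<And>k. k \<ge> K \<Longrightarrow> (\<integral>\<^sup>+\<omega>. ennreal ((Wc nc b \<omega> - (riemann nc 0 a k \<omega>
      + riemann nc a b k \<omega>))\<^sup>2) \<partial>P) \<le> ennreal (r / 8)
      \<and> (\<integral>\<^sup>+\<omega>. ennreal ((Wc nc a \<omega> - riemann nc 0 a k \<omega>)\<^sup>2) \<partial>P) \<le> ennreal (r / 8)"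
      using Wc_L2_approx[OF n ab, of "r / 8"] r by auto
    have "(\<integral>\<^sup>+\<omega>. ennreal (((Wc nc b \<omega> - Wc nc a \<omega>) - riemann nc a b k \<omega>)\<^sup>2) \<partial>P) < ennreal r" if k: "k \<ge> K" for k
    proof -
      have "(\<integral>\<^sup>+\<omega>. ennreal (((Wc nc b \<omega> - Wc nc a \<omega>) - riemann nc a b k \<omega>)\<^sup>2) \<partial>P)
        = (\<integral>\<^sup>+\<omega>. ennreal (((Wc nc b \<omega> - (riemann nc 0 a k \<omega> + riemann nc a b k \<omega>)) + (riemann nc 0 a k \<omega>
          - Wc nc a \<omega>))\<^sup>2) \<partial>P)"
        by (intro nn_integral_cong arg_cong[where f=ennreal] arg_cong[where f="\<lambda>x. x\<^sup>2"]) simp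
      also have "\<dots> \<le> 2 * (\<integral>\<^sup>+\<omega>. ennreal ((Wc nc b \<omega> - (riemann nc 0 a k \<omega> + riemann nc a b k \<omega>))\<^sup>2) \<partial>P)
         + 2 * (\<integral>\<^sup>+\<omega>. ennreal ((riemann nc 0 a k \<omega> - Wc nc a \<omega>)\<^sup>2) \<partial>P)"
        by (rule nn_integral_square_add_le) measurable
      also have "\<dots> \<le> 2 * ennreal (r / 8) + 2 * ennreal (r / 8)"
        using K[OF k] by (intro add_mono mult_left_mono) (auto simp: power2_commute)
      also have "\<dots> = ennreal (2 * (r / 8) + 2 * (r / 8))"
      proof -
        have "ennreal (2 * (r / 8)) = ennreal 2 * ennreal (r / 8)" by (rule ennreal_mult) (use r in auto)
        moreover have "ennreal (2 * (r / 8) + 2 * (r / 8)) = ennreal (2 * (r / 8)) + ennreal (2 * (r / 8))"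
          by (rule ennreal_plus) (use r in auto)
        ultimately show ?thesis by (simp only: ennreal_numeral)
      qed
      also have "\<dots> < ennreal r" using r by (intro ennreal_lessI) auto
      finally show ?thesis .
    qed
    then show "\<forall>\<^sub>F k in sequentially. (\<integral>\<^sup>+\<omega>. ennreal (((Wc nc b \<omega> - Wc nc a \<omega>)
      - riemann nc a b k \<omega>)\<^sup>2) \<partial>P) < ennreal r"
      unfolding eventually_sequentially by blast
  qed
qed

text \<open>The integrand is 0 up to time norm n, so the empty step function is an exact
  approximation.\<close>

lemma Wc_eq_0:
  assumes n: "fst nc \<noteq> 0" and t: "0 \<le> t" "t \<le> norm (rvec (fst nc))"
  shows "AE \<omega> in P. Wc nc t \<omega> = 0"
proof -
  interpret ito_setup P Filt "bm_component nc" "\<lambda>t. t / 2" "bm_component nc" "\<lambda>s \<omega>. J (fst nc) s" "Wc nc"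
    by (rule ito_W[OF n])
  note [measurable] = Wc_measurable[OF n t(1)]
  have z: "J (fst nc) s * indicator {0..t} s = 0" for s
    using J_symbol_eq_0[OF cutoff, of s "rvec (fst nc)"] t by (auto simp: indicator_def)
  have "(\<integral>\<^sup>+\<omega>. ennreal ((Wc nc t \<omega> - (\<Sum>j\<in>({}::nat set). 0 * (bm_component nc 0 \<omega> - bm_component nc 0 \<omega>)))\<^sup>2) \<partial>P)
    \<le> 4 * (\<integral>\<^sup>+s. ennreal ((J (fst nc) s * indicator {0..t} s - (\<Sum>j\<in>({}::nat set). 0 * indicator {0<..0} s))\<^sup>2) \<partial>\<mu>)"
    by (rule ito_deterministic_approx[OF t(1)]) (use J_symbol_measurable[OF cutoff] in auto)
  then have "(\<integral>\<^sup>+\<omega>. ennreal ((Wc nc t \<omega>)\<^sup>2) \<partial>P) = 0" using z by (simp del: mult_eq_0_iff)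
  then have "AE \<omega> in P. ennreal ((Wc nc t \<omega>)\<^sup>2) = 0" by (subst (asm) nn_integral_0_iff_AE) auto
  then show ?thesis by eventually_elim (simp add: ennreal_eq_0_iff)
qed

text \<open>Conjugacy of the Brownian modes holds for every path, so the Riemann sums at n and -n
  agree exactly up to the sign. The integrals inherit this almost surely, by the triangle inequality
  and L1 convergence.\<close>

lemma Wc_uminus:
  assumes n: "n \<noteq> 0" and t: "0 \<le> t"
  shows "AE \<omega> in P. Wc (- n, c) t \<omega> = (if c then 1 else -1) * Wc (n, c) t \<omega>"
proof -
  let ?s = "(if c then 1 else -1) :: real"
  have n1: "fst (n, c) \<noteq> 0" and n2: "fst (- n, c) \<noteq> 0" using n by auto
  have nrm: "J (- n) s = J n s" for s by (intro J_symbol_cong) (simp add: rvec_def norm_vec_def)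
  have r: "riemann (- n, c) 0 t k \<omega> = ?s * riemann (n, c) 0 t k \<omega>" if w: "\<omega> \<in> space P" for k \<omega>
  proof -
    have b: "bm_component (- n, c) s \<omega> = ?s * bm_component (n, c) s \<omega>" if "0 \<le> s" for s
      using path_conj[OF w that, of n] by (auto simp: bm_component_def)
    have q: "0 \<le> grid 0 t k i" if "i \<le> Suc k" for i using grid_bounds[OF t, of i k] that by simp
    show ?thesis unfolding riemann_def fst_conv nrm sum_distrib_left
      by (intro sum.cong) (auto simp: b q right_diff_distrib)
  qed
  have z: "AE \<omega> in P. Wc (n, c) 0 \<omega> = 0" "AE \<omega> in P. Wc (- n, c) 0 \<omega> = 0"
    using Wc_eq_0[OF n1, of 0] Wc_eq_0[OF n2, of 0] by auto
  note [measurable] = Wc_measurable[OF n1 t] Wc_measurable[OF n2 t] Wc_measurable[OF n1 order_refl]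
    Wc_measurable[OF n2 order_refl]
    riemann_measurable[OF n1 order_refl t] riemann_measurable[OF n2 order_refl t]
  have "(\<integral>\<^sup>+\<omega>. ennreal \<bar>Wc (- n, c) t \<omega> - ?s * Wc (n, c) t \<omega>\<bar> \<partial>P) \<le> 0"
  proof (rule LIMSEQ_le_const)
    show "(\<lambda>k. (\<integral>\<^sup>+\<omega>. ennreal \<bar>(Wc (- n, c) t \<omega> - Wc (- n, c) 0 \<omega>) - riemann (- n, c) 0 t k \<omega>\<bar> \<partial>P)
       + (\<integral>\<^sup>+\<omega>. ennreal \<bar>(Wc (n, c) t \<omega> - Wc (n, c) 0 \<omega>) - riemann (n, c) 0 t k \<omega>\<bar> \<partial>P)) \<longlonglongrightarrow> 0"
      using tendsto_add[OF Wc_L1_approx[OF n2 order_refl t] Wc_L1_approx[OF n1 order_refl t]] by simp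
    show "\<exists>N. \<forall>k\<ge>N. (\<integral>\<^sup>+\<omega>. ennreal \<bar>Wc (- n, c) t \<omega> - ?s * Wc (n, c) t \<omega>\<bar> \<partial>P)
      \<le> (\<integral>\<^sup>+\<omega>. ennreal \<bar>(Wc (- n, c) t \<omega> - Wc (- n, c) 0 \<omega>) - riemann (- n, c) 0 t k \<omega>\<bar> \<partial>P)
       + (\<integral>\<^sup>+\<omega>. ennreal \<bar>(Wc (n, c) t \<omega> - Wc (n, c) 0 \<omega>) - riemann (n, c) 0 t k \<omega>\<bar> \<partial>P)"
    proof (intro exI[of _ 0] allI impI)
      fix k
      have "(\<integral>\<^sup>+\<omega>. ennreal \<bar>Wc (- n, c) t \<omega> - ?s * Wc (n, c) t \<omega>\<bar> \<partial>P)
        \<le> (\<integral>\<^sup>+\<omega>. ennreal \<bar>(Wc (- n, c) t \<omega> - Wc (- n, c) 0 \<omega>) - riemann (- n, c) 0 t k \<omega>\<bar>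
          + ennreal \<bar>(Wc (n, c) t \<omega> - Wc (n, c) 0 \<omega>) - riemann (n, c) 0 t k \<omega>\<bar> \<partial>P)"
      proof (rule nn_integral_mono_AE)
        show "AE \<omega> in P. ennreal \<bar>Wc (- n, c) t \<omega> - ?s * Wc (n, c) t \<omega>\<bar>
          \<le> ennreal \<bar>(Wc (- n, c) t \<omega> - Wc (- n, c) 0 \<omega>) - riemann (- n, c) 0 t k \<omega>\<bar>
          + ennreal \<bar>(Wc (n, c) t \<omega> - Wc (n, c) 0 \<omega>) - riemann (n, c) 0 t k \<omega>\<bar>"
          using z AE_space
        proof eventually_elim
          case (elim \<omega>)
          have "\<bar>Wc (- n, c) t \<omega> - ?s * Wc (n, c) t \<omega>\<bar>
            \<le> \<bar>(Wc (- n, c) t \<omega> - Wc (- n, c) 0 \<omega>) - riemann (- n, c) 0 t k \<omega>\<bar>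
            + \<bar>(Wc (n, c) t \<omega> - Wc (n, c) 0 \<omega>) - riemann (n, c) 0 t k \<omega>\<bar>"
            unfolding elim(1,2) r[OF elim(3)] by (cases c) auto
          from ennreal_leI[OF this] show ?case by (subst (asm) ennreal_plus) auto
        qed
      qed
      also have "\<dots> = (\<integral>\<^sup>+\<omega>. ennreal \<bar>(Wc (- n, c) t \<omega> - Wc (- n, c) 0 \<omega>) - riemann (- n, c) 0 t k \<omega>\<bar> \<partial>P)
       + (\<integral>\<^sup>+\<omega>. ennreal \<bar>(Wc (n, c) t \<omega> - Wc (n, c) 0 \<omega>) - riemann (n, c) 0 t k \<omega>\<bar> \<partial>P)"
        by (rule nn_integral_add) measurable
      finally show "(\<integral>\<^sup>+\<omega>. ennreal \<bar>Wc (- n, c) t \<omega> - ?s * Wc (n, c) t \<omega>\<bar> \<partial>P) \<le> \<dots>" .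
    qed
  qed
  then have "(\<integral>\<^sup>+\<omega>. ennreal \<bar>Wc (- n, c) t \<omega> - ?s * Wc (n, c) t \<omega>\<bar> \<partial>P) = 0" by simp
  then have "AE \<omega> in P. ennreal \<bar>Wc (- n, c) t \<omega> - ?s * Wc (n, c) t \<omega>\<bar> = 0"
    by (subst (asm) nn_integral_0_iff_AE) auto
  then show ?thesis by eventually_elim (auto simp: ennreal_eq_0_iff)
qed

end

section \<open>Gaussian law of linear combinations of the modes\<close>

context gauss_process
begin

text \<open>The variance of the real and of the imaginary part of the n-th integral; the factor 1/2
  is that of a component of a complex Brownian motion.\<close>

definition vol :: "int^2 \<Rightarrow> real \<Rightarrow> real" where
  "vol n t = integral {0..t} (\<lambda>s. (J n s)\<^sup>2) / 2"

lemma J_sq_cont: "continuous_on A (\<lambda>s. (J n s)\<^sup>2)"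
  by (intro continuous_on_power continuous_J_symbol[OF cutoff])

lemma vol_diff: "0 \<le> s \<Longrightarrow> s \<le> t \<Longrightarrow> vol n t - vol n s = integral {s..t} (\<lambda>s. (J n s)\<^sup>2) / 2"
proof -
  assume st: "0 \<le> s" "s \<le> t"
  have "(\<lambda>s. (J n s)\<^sup>2) integrable_on {0..t}" by (rule integrable_continuous_real[OF J_sq_cont])
  from Henstock_Kurzweil_Integration.integral_combine[OF st this]
  show ?thesis unfolding vol_def by (simp add: field_simps)
qed

lemma vol_mono: "0 \<le> s \<Longrightarrow> s \<le> t \<Longrightarrow> vol n s \<le> vol n t"
proof -
  assume st: "0 \<le> s" "s \<le> t"
  have "0 \<le> integral {s..t} (\<lambda>s. (J n s)\<^sup>2)"
    by (rule Henstock_Kurzweil_Integration.integral_nonneg[OF integrable_continuous_real[OF J_sq_cont]]) simp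
  then show ?thesis using vol_diff[OF st, where n=n] by simp
qed

lemma vol_0 [simp]: "vol n 0 = 0"
  by (simp add: vol_def)

lemma vol_cong: "norm (rvec n) = norm (rvec m) \<Longrightarrow> vol n t = vol m t"
  unfolding vol_def using J_symbol_cong[of "rvec n" "rvec m"] by simp

lemma vol_eq_0: "t \<le> norm (rvec n) \<Longrightarrow> vol n t = 0"
proof -
  assume t: "t \<le> norm (rvec n)"
  have "integral {0..t} (\<lambda>s. (J n s)\<^sup>2) = integral {0..t} (\<lambda>s. 0)"
    by (rule Henstock_Kurzweil_Integration.integral_cong) (use t J_symbol_eq_0[OF cutoff] in auto)
  then show ?thesis by (simp add: vol_def)
qed

lemma vol_cont: "continuous_on {0..} (vol n)"
  unfolding continuous_on_eq_continuous_within
proof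
  fix t :: real assume t: "t \<in> {0..}"
  have "((\<lambda>x. integral {0..x} (\<lambda>s. (J n s)\<^sup>2)) has_real_derivative (J n t)\<^sup>2) (at t within {0..t + 1})"
    by (rule integral_has_real_derivative[OF J_sq_cont]) (use t in auto)
  then have "continuous (at t within {0..t + 1}) (\<lambda>x. integral {0..x} (\<lambda>s. (J n s)\<^sup>2))"
    by (rule DERIV_continuous)
  moreover have "at t within {0..t + 1} = at t within {0..}"
    by (rule at_within_nhd[of t "{..<t + 1}"]) auto
  ultimately have "continuous (at t within {0..}) (\<lambda>x. integral {0..x} (\<lambda>s. (J n s)\<^sup>2))" by simp
  then show "continuous (at t within {0..}) (vol n)"
    unfolding vol_def[abs_def] by (intro continuous_intros) auto
qed

text \<open>The exponentials are peeled off from the last time backwards: the product over the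
  earlier cells is known at the start of the last cell and is bounded, so it can play the role of
  the past factor.\<close>

lemma char_step:
  fixes \<theta> :: "(int^2) \<times> bool \<Rightarrow> nat \<Rightarrow> real"
  assumes H: "half H" and C: "finite C" "C \<subseteq> H \<times> UNIV"
    and q: "0 \<le> q 0" "\<And>i. i < m \<Longrightarrow> q i \<le> q (Suc i)"
    and \<xi>: "\<xi> \<in> borel_measurable (Filt (q 0))" "\<And>\<omega>. norm (\<xi> \<omega>) \<le> 1"
  defines "\<Xi> \<equiv> \<lambda>m \<omega>. \<xi> \<omega> * (\<Prod>i<m. \<Prod>nc\<in>C. iexp (\<theta> nc i * (bm_component nc (q (Suc i)) \<omega>
    - bm_component nc (q i) \<omega>)))"
  shows "0 \<le> q m \<and> \<Xi> m \<in> borel_measurable (Filt (q m)) \<and>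
    (CLINT \<omega>|P. \<Xi> m \<omega>) = (CLINT \<omega>|P. \<xi> \<omega>) * (\<Prod>i<m. \<Prod>nc\<in>C. exp (- (\<theta> nc i)\<^sup>2 * (q (Suc i) - q i) / 4))"
  using q(2)
proof (induction m)
  case 0
  then show ?case using q(1) \<xi>(1) by (simp add: \<Xi>_def)
next
  case (Suc m)
  then have IH: "0 \<le> q m" "\<Xi> m \<in> borel_measurable (Filt (q m))"
    "(CLINT \<omega>|P. \<Xi> m \<omega>) = (CLINT \<omega>|P. \<xi> \<omega>) * (\<Prod>i<m. \<Prod>nc\<in>C. exp (- (\<theta> nc i)\<^sup>2 * (q (Suc i) - q i) / 4))"
    and le: "q m \<le> q (Suc m)" by auto
  let ?E = "\<lambda>\<omega>. \<Prod>nc\<in>C. iexp (\<theta> nc m * (bm_component nc (q (Suc m)) \<omega> - bm_component nc (q m) \<omega>))"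
  have S: "\<Xi> (Suc m) \<omega> = \<Xi> m \<omega> * ?E \<omega>" for \<omega> by (simp add: \<Xi>_def mult.assoc)
  have MF: "measurable (Filt (q m)) borel \<subseteq> (measurable (Filt (q (Suc m))) borel :: (path \<Rightarrow> complex) set)"
    using Filt_mono[OF le] by (intro measurable_mono) auto
  have MP: "measurable (Filt (q m)) borel \<subseteq> (measurable P borel :: (path \<Rightarrow> complex) set)"
    using sets_Filt_subset by (intro measurable_mono) auto
  have "?E \<in> borel_measurable (Filt (q (Suc m)))"
  proof (rule borel_measurable_prod)
    fix nc
    have [measurable]: "bm_component nc (q (Suc m)) \<in> borel_measurable (Filt (q (Suc m)))"
      "bm_component nc (q m) \<in> borel_measurable (Filt (q (Suc m)))"
      using component_Filt IH(1) le by auto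
    show "(\<lambda>\<omega>. iexp (\<theta> nc m * (bm_component nc (q (Suc m)) \<omega> - bm_component nc (q m) \<omega>)))
      \<in> borel_measurable (Filt (q (Suc m)))"
      by measurable
  qed
  moreover have "\<Xi> m \<in> borel_measurable (Filt (q (Suc m)))" using IH(2) MF by blast
  ultimately have meas: "\<Xi> (Suc m) \<in> borel_measurable (Filt (q (Suc m)))"
    unfolding S[abs_def] by (intro borel_measurable_times)
  have i: "integrable P (\<Xi> m)"
  proof (rule integrable_const_bound[where B=1])
    show "\<Xi> m \<in> borel_measurable P" using IH(2) MP by blast
    show "AE \<omega> in P. norm (\<Xi> m \<omega>) \<le> 1"
    proof (rule AE_I2)
      fix \<omega>
      have "norm (\<Prod>i<m. \<Prod>nc\<in>C. iexp (\<theta> nc i * (bm_component nc (q (Suc i)) \<omega> - bm_component nc (q i) \<omega>))) = 1"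
        unfolding prod_norm[symmetric] by (intro prod.neutral ballI) (simp add: norm_exp_eq_Re)
      then show "norm (\<Xi> m \<omega>) \<le> 1" using \<xi>(2)[of \<omega>] unfolding \<Xi>_def norm_mult by simp
    qed
  qed
  have "(CLINT \<omega>|P. \<Xi> (Suc m) \<omega>) = (CLINT \<omega>|P. \<Xi> m \<omega>) * (\<Prod>nc\<in>C. exp (- (\<theta> nc m)\<^sup>2 * (q (Suc m) - q m) / 4))"
    unfolding S using char_given_past[OF H IH(1) le C IH(2) i, of "\<lambda>nc. \<theta> nc m"] by simp
  then show ?case using meas IH(1,3) le by (simp add: mult.assoc)
qed

definition comb :: "((int^2) \<times> bool) set \<Rightarrow> ((int^2) \<times> bool \<Rightarrow> real) \<Rightarrow> real \<Rightarrow> path \<Rightarrow> real" where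
  "comb C a t \<omega> = (\<Sum>nc\<in>C. a nc * Wc nc t \<omega>)"

definition comb_var :: "((int^2) \<times> bool) set \<Rightarrow> ((int^2) \<times> bool \<Rightarrow> real) \<Rightarrow> real \<Rightarrow> real" where
  "comb_var C a t = (\<Sum>nc\<in>C. (a nc)\<^sup>2 * vol (fst nc) t)"

lemma comb_measurable:
  assumes "half H" "C \<subseteq> H \<times> UNIV" "0 \<le> t"
  shows "comb C a t \<in> borel_measurable P" and "comb C a t \<in> borel_measurable (Filt t)"
  unfolding comb_def[abs_def] using assms
  by (auto intro!: borel_measurable_sum borel_measurable_times Wc_measurable Wc_Filt simp: half_def)

text \<open>Exchanging the sums over components and grid cells turns the combination of Riemann sums
  into successive increments with deterministic weights.\<close>

lemma char_riemann:
  assumes H: "half H" and C: "finite C" "C \<subseteq> H \<times> UNIV" and st: "0 \<le> s" "s \<le> t" and A: "A \<in> sets (Filt s)"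
  shows "(CLINT \<omega>|P. indicator A \<omega> * iexp (\<theta> * (\<Sum>nc\<in>C. a nc * riemann nc s t k \<omega>)))
    = prob A * exp (- \<theta>\<^sup>2 / 4 * (\<Sum>nc\<in>C. (a nc)\<^sup>2 * (\<Sum>i<Suc k. (J (fst nc) (grid s t k i))\<^sup>2 * (grid s t
      k (Suc i) - grid s t k i))))"
proof -
  let ?q = "grid s t k"
  let ?\<theta> = "\<lambda>nc i. \<theta> * a nc * J (fst nc) (?q i)"
  have AP: "A \<in> sets P" using A sets_Filt_subset by blast
  have "(CLINT \<omega>|P. indicator A \<omega> * (\<Prod>i<Suc k. \<Prod>nc\<in>C. iexp (?\<theta> nc i * (bm_component nc (?q (Suc i)) \<omega>
    - bm_component nc (?q i) \<omega>))))
    = (CLINT \<omega>|P. indicator A \<omega>) * (\<Prod>i<Suc k. \<Prod>nc\<in>C. exp (- (?\<theta> nc i)\<^sup>2 * (?q (Suc i) - ?q i) / 4))"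
  proof (rule char_step[THEN conjunct2, THEN conjunct2, OF H C])
    show "0 \<le> ?q 0" using st by simp
    show "?q i \<le> ?q (Suc i)" for i by (rule grid_mono[OF st(2)]) simp
    show "(\<lambda>\<omega>. indicator A \<omega> :: complex) \<in> borel_measurable (Filt (?q 0))" using A by simp
    show "norm (indicator A \<omega> :: complex) \<le> 1" for \<omega> by (auto simp: indicator_def)
  qed
  moreover have "(\<Prod>i<Suc k. \<Prod>nc\<in>C. iexp (?\<theta> nc i * (bm_component nc (?q (Suc i)) \<omega> - bm_component nc (?q i) \<omega>)))
     = iexp (\<theta> * (\<Sum>nc\<in>C. a nc * riemann nc s t k \<omega>))" for \<omega>
  proof -
    have "\<theta> * (\<Sum>nc\<in>C. a nc * riemann nc s t k \<omega>)
      = (\<Sum>i<Suc k. \<Sum>nc\<in>C. ?\<theta> nc i * (bm_component nc (?q (Suc i)) \<omega> - bm_component nc (?q i) \<omega>))"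
      unfolding riemann_def sum_distrib_left by (subst sum.swap) (simp only: mult.assoc)
    then show ?thesis
      by (simp only: of_real_sum sum_distrib_left exp_sum[OF finite_lessThan] exp_sum[OF C(1)])
  qed
  moreover have "(\<Prod>i<Suc k. \<Prod>nc\<in>C. exp (- (?\<theta> nc i)\<^sup>2 * (?q (Suc i) - ?q i) / 4))
     = exp (- \<theta>\<^sup>2 / 4 * (\<Sum>nc\<in>C. (a nc)\<^sup>2 * (\<Sum>i<Suc k. (J (fst nc) (?q i))\<^sup>2 * (?q (Suc i) - ?q i))))"
  proof -
    have "- \<theta>\<^sup>2 / 4 * (\<Sum>nc\<in>C. (a nc)\<^sup>2 * (\<Sum>i<Suc k. (J (fst nc) (?q i))\<^sup>2 * (?q (Suc i) - ?q i)))
      = (\<Sum>i<Suc k. \<Sum>nc\<in>C. - (?\<theta> nc i)\<^sup>2 * (?q (Suc i) - ?q i) / 4)"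
      unfolding sum_distrib_left by (subst sum.swap) (intro sum.cong refl, simp add: power_mult_distrib)
    then show ?thesis
      by (simp only: exp_sum[OF finite_lessThan] exp_sum[OF C(1)])
  qed
  moreover have "(CLINT \<omega>|P. indicator A \<omega>) = prob A"
  proof -
    have "(CLINT \<omega>|P. indicator A \<omega>) = (CLINT \<omega>|P. of_real (indicator A \<omega>))"
      by (intro Bochner_Integration.integral_cong) (auto simp: indicator_def)
    also have "\<dots> = of_real (\<integral>\<omega>. indicator A \<omega> \<partial>P)" by (rule integral_complex_of_real)
    finally show ?thesis using AP by simp
  qed
  ultimately show ?thesis by (simp only: of_real_mult)
qed

text \<open>The characteristic function of the Riemann sums is known exactly. On the left it
  converges because the sums converge in L1, on the right because the exponents are Riemann sums of
  the squared symbols. The modes are restricted to one half of the lattice, where they are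
  independent.\<close>

lemma comb_gauss_martingale:
  assumes H: "half H" and C: "finite C" "C \<subseteq> H \<times> UNIV"
  shows "gauss_martingale P Filt (comb C a) (comb_var C a)"
proof
  fix s t \<theta> :: real and A assume st: "0 \<le> s" "s \<le> t" and A: "A \<in> sets (Filt s)"
  have t0: "0 \<le> t" using st by simp
  have AP: "A \<in> sets P" using A sets_Filt_subset by blast
  have n0: "fst nc \<noteq> 0" if "nc \<in> C" for nc using that C(2) H by (auto simp: half_def)
  let ?X = "\<lambda>\<omega>. comb C a t \<omega> - comb C a s \<omega>" and ?R = "\<lambda>k \<omega>. \<Sum>nc\<in>C. a nc * riemann nc s t k \<omega>"
  have X[measurable]: "?X \<in> borel_measurable P"
    using comb_measurable(1)[OF H C(2) t0] comb_measurable(1)[OF H C(2) st(1)] by simp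
  have R[measurable]: "?R k \<in> borel_measurable P" for k
    by (intro borel_measurable_sum borel_measurable_times riemann_measurable n0 st) auto
  have XR: "(\<lambda>k. \<integral>\<^sup>+\<omega>. ennreal \<bar>?X \<omega> - ?R k \<omega>\<bar> \<partial>P) \<longlonglongrightarrow> 0"
  proof (rule tendsto_sandwich[OF _ _ tendsto_const])
    let ?e = "\<lambda>nc k. \<integral>\<^sup>+\<omega>. ennreal \<bar>(Wc nc t \<omega> - Wc nc s \<omega>) - riemann nc s t k \<omega>\<bar> \<partial>P"
    show "(\<lambda>k. \<Sum>nc\<in>C. ennreal \<bar>a nc\<bar> * ?e nc k) \<longlonglongrightarrow> 0"
    proof -
      have "(\<lambda>k. \<Sum>nc\<in>C. ennreal \<bar>a nc\<bar> * ?e nc k) \<longlonglongrightarrow> (\<Sum>nc\<in>C. ennreal \<bar>a nc\<bar> * 0)"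
        by (intro tendsto_sum ennreal_tendsto_cmult Wc_L1_approx n0 st) auto
      then show ?thesis by simp
    qed
    show "\<forall>\<^sub>F k in sequentially. (\<integral>\<^sup>+\<omega>. ennreal \<bar>?X \<omega> - ?R k \<omega>\<bar> \<partial>P) \<le> (\<Sum>nc\<in>C. ennreal \<bar>a nc\<bar> * ?e nc k)"
    proof (rule always_eventually, rule allI)
      fix k
      have "(\<integral>\<^sup>+\<omega>. ennreal \<bar>?X \<omega> - ?R k \<omega>\<bar> \<partial>P) \<le> (\<integral>\<^sup>+\<omega>. (\<Sum>nc\<in>C. ennreal \<bar>a nc\<bar> * ennreal \<bar>(Wc nc t \<omega>
        - Wc nc s \<omega>) - riemann nc s t k \<omega>\<bar>) \<partial>P)"
      proof (rule nn_integral_mono)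
        fix \<omega>
        have 1: "?X \<omega> - ?R k \<omega> = (\<Sum>nc\<in>C. a nc * ((Wc nc t \<omega> - Wc nc s \<omega>) - riemann nc s t k \<omega>))"
          unfolding comb_def sum_subtractf[symmetric] by (intro sum.cong) (auto simp: algebra_simps)
        have "\<bar>?X \<omega> - ?R k \<omega>\<bar> \<le> (\<Sum>nc\<in>C. \<bar>a nc\<bar> * \<bar>(Wc nc t \<omega> - Wc nc s \<omega>) - riemann nc s t k \<omega>\<bar>)"
          unfolding 1 abs_mult[symmetric] by (rule sum_abs)
        then have "ennreal \<bar>?X \<omega> - ?R k \<omega>\<bar> \<le> ennreal (\<Sum>nc\<in>C. \<bar>a nc\<bar> * \<bar>(Wc nc t \<omega> - Wc nc s \<omega>)
          - riemann nc s t k \<omega>\<bar>)"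
          by (rule ennreal_leI)
        also have "\<dots> = (\<Sum>nc\<in>C. ennreal (\<bar>a nc\<bar> * \<bar>(Wc nc t \<omega> - Wc nc s \<omega>) - riemann nc s t k \<omega>\<bar>))"
          by (rule sum_ennreal[symmetric]) simp
        also have "\<dots> = (\<Sum>nc\<in>C. ennreal \<bar>a nc\<bar> * ennreal \<bar>(Wc nc t \<omega> - Wc nc s \<omega>) - riemann nc s t k \<omega>\<bar>)"
          by (intro sum.cong refl ennreal_mult) auto
        finally show "ennreal \<bar>?X \<omega> - ?R k \<omega>\<bar> \<le> \<dots>" .
      qed
      also have "\<dots> = (\<Sum>nc\<in>C. \<integral>\<^sup>+\<omega>. ennreal \<bar>a nc\<bar> * ennreal \<bar>(Wc nc t \<omega> - Wc nc s \<omega>) - riemann nc s t k \<omega>\<bar> \<partial>P)"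
      proof (rule nn_integral_sum)
        fix nc assume "nc \<in> C"
        note [measurable] = Wc_measurable[OF n0[OF this] t0] Wc_measurable[OF n0[OF this] st(1)]
          riemann_measurable[OF n0[OF this] st]
        show "(\<lambda>\<omega>. ennreal \<bar>a nc\<bar> * ennreal \<bar>(Wc nc t \<omega> - Wc nc s \<omega>) - riemann nc s t k \<omega>\<bar>)
          \<in> borel_measurable P" by measurable
      qed
      also have "\<dots> = (\<Sum>nc\<in>C. ennreal \<bar>a nc\<bar> * ?e nc k)"
      proof (intro sum.cong refl nn_integral_cmult)
        fix nc assume "nc \<in> C"
        note [measurable] = Wc_measurable[OF n0[OF this] t0] Wc_measurable[OF n0[OF this] st(1)]
          riemann_measurable[OF n0[OF this] st]
        show "(\<lambda>\<omega>. ennreal \<bar>(Wc nc t \<omega> - Wc nc s \<omega>) - riemann nc s t k \<omega>\<bar>) \<in> borel_measurable P" by measurable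
      qed
      finally show "(\<integral>\<^sup>+\<omega>. ennreal \<bar>?X \<omega> - ?R k \<omega>\<bar> \<partial>P) \<le> (\<Sum>nc\<in>C. ennreal \<bar>a nc\<bar> * ?e nc k)" .
    qed
  qed auto
  have lim1: "(\<lambda>k. CLINT \<omega>|P. indicator A \<omega> * iexp (\<theta> * ?R k \<omega>)) \<longlonglongrightarrow> (CLINT \<omega>|P. indicator A \<omega> * iexp (\<theta> * ?X \<omega>))"
  proof (rule tendsto_L1_int)
    have *: "integrable P (\<lambda>\<omega>. indicator A \<omega> * iexp (\<theta> * g \<omega>))" if [measurable]: "g \<in> borel_measurable P" for g
    proof (rule integrable_const_bound[where B=1])
      have [measurable]: "A \<in> sets P" by fact
      show "(\<lambda>\<omega>. indicator A \<omega> * iexp (\<theta> * g \<omega>)) \<in> borel_measurable P" by measurable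
    qed (auto simp: norm_mult norm_exp_eq_Re indicator_def)
    show "integrable P (\<lambda>\<omega>. indicator A \<omega> * iexp (\<theta> * ?R k \<omega>))" for k by (rule *[OF R])
    show "integrable P (\<lambda>\<omega>. indicator A \<omega> * iexp (\<theta> * ?X \<omega>))" by (rule *[OF X])
    have bnd: "(\<integral>\<^sup>+\<omega>. ennreal (norm (indicator A \<omega> * iexp (\<theta> * ?R k \<omega>) - indicator A \<omega> * iexp (\<theta> * ?X \<omega>))) \<partial>P)
      \<le> ennreal \<bar>\<theta>\<bar> * (\<integral>\<^sup>+\<omega>. ennreal \<bar>?X \<omega> - ?R k \<omega>\<bar> \<partial>P)" for k
    proof -
      have "(\<integral>\<^sup>+\<omega>. ennreal (norm (indicator A \<omega> * iexp (\<theta> * ?R k \<omega>) - indicator A \<omega> * iexp (\<theta> * ?X \<omega>))) \<partial>P)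
        \<le> (\<integral>\<^sup>+\<omega>. ennreal \<bar>\<theta>\<bar> * ennreal \<bar>?X \<omega> - ?R k \<omega>\<bar> \<partial>P)"
      proof (rule nn_integral_mono)
        fix \<omega>
        \<comment> \<open>The Lipschitz bound that converts L1 convergence of the sums into
          convergence of the characteristic functions.\<close>
        have "norm (iexp x - iexp y) \<le> \<bar>x - y\<bar>" for x y :: real
        proof -
          have "iexp x - iexp y = iexp y * (iexp (x - y) - 1)" by (simp add: right_diff_distrib exp_diff)
          moreover have "norm (iexp (x - y) - 1) \<le> \<bar>x - y\<bar>" using iexp_approx1[of "x - y" 0] by simp
          ultimately show ?thesis by (simp add: norm_mult norm_exp_eq_Re)
        qed
        from this[of "\<theta> * ?R k \<omega>" "\<theta> * ?X \<omega>"]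
        have "norm (iexp (\<theta> * ?R k \<omega>) - iexp (\<theta> * ?X \<omega>)) \<le> \<bar>\<theta>\<bar> * \<bar>?X \<omega> - ?R k \<omega>\<bar>"
          by (simp only: right_diff_distrib[symmetric] abs_mult abs_minus_commute)
        then have "norm (indicator A \<omega> * iexp (\<theta> * ?R k \<omega>) - indicator A \<omega> * iexp (\<theta> * ?X \<omega>))
          \<le> \<bar>\<theta>\<bar> * \<bar>?X \<omega> - ?R k \<omega>\<bar>"
          by (cases "\<omega> \<in> A") auto
        from ennreal_leI[OF this]
        show "ennreal (norm (indicator A \<omega> * iexp (\<theta> * ?R k \<omega>) - indicator A \<omega> * iexp (\<theta> * ?X \<omega>)))
          \<le> ennreal \<bar>\<theta>\<bar> * ennreal \<bar>?X \<omega> - ?R k \<omega>\<bar>"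
          by (subst (asm) ennreal_mult) auto
      qed
      also have "\<dots> = ennreal \<bar>\<theta>\<bar> * (\<integral>\<^sup>+\<omega>. ennreal \<bar>?X \<omega> - ?R k \<omega>\<bar> \<partial>P)" by (rule nn_integral_cmult) measurable
      finally show ?thesis .
    qed
    have lm: "(\<lambda>k. ennreal \<bar>\<theta>\<bar> * (\<integral>\<^sup>+\<omega>. ennreal \<bar>?X \<omega> - ?R k \<omega>\<bar> \<partial>P)) \<longlonglongrightarrow> 0"
      using ennreal_tendsto_cmult[OF _ XR, of "ennreal \<bar>\<theta>\<bar>"] by simp
    show "(\<lambda>k. \<integral>\<^sup>+\<omega>. ennreal (norm (indicator A \<omega> * iexp (\<theta> * ?R k \<omega>) - indicator A \<omega> * iexp (\<theta> * ?X \<omega>))) \<partial>P) \<longlonglongrightarrow> 0"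
      by (rule tendsto_sandwich[OF _ _ tendsto_const lm]) (use bnd in auto)
  qed
  have lim2: "(\<lambda>k. CLINT \<omega>|P. indicator A \<omega> * iexp (\<theta> * ?R k \<omega>))
    \<longlonglongrightarrow> prob A * exp (- \<theta>\<^sup>2 / 4 * (\<Sum>nc\<in>C. (a nc)\<^sup>2 * integral {s..t} (\<lambda>r. (J (fst nc) r)\<^sup>2)))"
    unfolding char_riemann[OF H C st A]
    by (intro tendsto_of_real tendsto_mult tendsto_const tendsto_exp tendsto_sum riemann_sum_tendsto[OF
      st(2)] J_sq_cont)
  \<comment> \<open>The variance carries half the integral of the squared symbol, which turns the
    divisor 4 into the divisor 2 of a Gaussian exponent.\<close>
  have e: "- \<theta>\<^sup>2 / 4 * (\<Sum>nc\<in>C. (a nc)\<^sup>2 * integral {s..t} (\<lambda>r. (J (fst nc) r)\<^sup>2))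
    = - \<theta>\<^sup>2 * (comb_var C a t - comb_var C a s) / 2"
  proof -
    have I: "integral {s..t} (\<lambda>r. (J n r)\<^sup>2) = 2 * (vol n t - vol n s)" for n using vol_diff[OF st,
      where n=n] by simp
    have "(\<Sum>nc\<in>C. (a nc)\<^sup>2 * integral {s..t} (\<lambda>r. (J (fst nc) r)\<^sup>2)) = 2 * (comb_var C a t - comb_var C a s)"
      unfolding I comb_var_def sum_subtractf[symmetric] sum_distrib_left
        by (intro sum.cong) (auto simp: algebra_simps)
    then show ?thesis by simp
  qed
  show "(CLINT \<omega>|P. indicator A \<omega> * iexp (\<theta> * (comb C a t \<omega> - comb C a s \<omega>)))
      = prob A * exp (- \<theta>\<^sup>2 * (comb_var C a t - comb_var C a s) / 2)"
    using LIMSEQ_unique[OF lim1 lim2] unfolding e .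
next
  show "continuous_on {0..} (comb_var C a)"
    unfolding comb_var_def[abs_def] by (intro continuous_intros vol_cont)
qed (use Filt_mono sets_Filt_subset comb_measurable(2)[OF H C(2)] vol_mono in
    \<open>auto simp: comb_var_def intro!: sum_mono mult_left_mono\<close>)

end

section \<open>The gradient of the Gaussian field\<close>

text \<open>The frequencies that can be active by time R. The inequality is strict because a mode
  still vanishes at time norm n.\<close>

definition freqs :: "real \<Rightarrow> (int^2) set" where
  "freqs R = {n. n \<noteq> 0 \<and> norm (rvec n) < R}"

lemma rvec_nth [simp]: "rvec n $ i = of_int (n $ i)"
  by (simp add: rvec_def)

lemma rvec_uminus: "rvec (- n) = - rvec n"
  by (simp add: vec_eq_iff)

lemma rvec_0 [simp]: "rvec 0 = 0"
  by (simp add: vec_eq_iff)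

lemma norm_rvec_sq: "(norm (rvec n))\<^sup>2 = (of_int (n $ 1))\<^sup>2 + (of_int (n $ 2))\<^sup>2"
  unfolding power2_norm_eq_inner by (simp add: inner_vec_def UNIV_2 power2_eq_square)

lemma finite_freqs: "finite (freqs R)"
proof -
  let ?K = "\<lceil>\<bar>R\<bar>\<rceil>"
  have "freqs R \<subseteq> (\<lambda>(a, b). vector [a, b]) ` ({-?K..?K} \<times> {-?K..?K})"
  proof
    fix n assume "n \<in> freqs R"
    then have nR: "norm (rvec n) < R" by (simp add: freqs_def)
    have "n $ i \<in> {-?K..?K}" for i
    proof -
      have "\<bar>real_of_int (n $ i)\<bar> < R" using component_le_norm_cart[of "rvec n" i] nR by simp
      then have "\<bar>real_of_int (n $ i)\<bar> \<le> of_int ?K" by linarith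
      then show ?thesis by (simp add: abs_le_iff)
    qed
    moreover have "n = vector [n $ 1, n $ 2]" by (simp add: vec_eq_iff forall_2)
    ultimately show "n \<in> (\<lambda>(a, b). vector [a, b]) ` ({-?K..?K} \<times> {-?K..?K})" by force
  qed
  then show ?thesis by (rule finite_subset) auto
qed

lemma freqs_uminus: "uminus ` freqs R = freqs R"
proof -
  have "- n \<in> freqs R" if "n \<in> freqs R" for n using that by (simp add: freqs_def rvec_uminus)
  then show ?thesis by (force intro: image_eqI[of _ uminus "- _"])
qed

lemma sum_freqs_half:
  fixes g :: "int^2 \<Rightarrow> real"
  assumes "\<And>n. g (- n) = g n"
  shows "(\<Sum>n\<in>freqs R. g n) = 2 * (\<Sum>n\<in>freqs R \<inter> half_space. g n)"
proof -
  have h: "half half_space" by (rule half_half_space)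
  have "freqs R = (freqs R \<inter> half_space) \<union> uminus ` (freqs R \<inter> half_space)"
  proof -
    have "n \<in> uminus ` (freqs R \<inter> half_space)" if "n \<in> freqs R" "n \<notin> half_space" for n
    proof -
      have "- n \<in> freqs R \<inter> half_space" using that h freqs_uminus[of R]
        by (auto simp: half_def freqs_def rvec_uminus)
      then show ?thesis by (metis add.inverse_inverse imageI)
    qed
    moreover have "uminus ` (freqs R \<inter> half_space) \<subseteq> freqs R" using freqs_uminus[of R] by blast
    ultimately show ?thesis by blast
  qed
  moreover have "(freqs R \<inter> half_space) \<inter> uminus ` (freqs R \<inter> half_space) = {}" using h by (auto simp: half_def)
  ultimately have "(\<Sum>n\<in>freqs R. g n) = (\<Sum>n\<in>freqs R \<inter> half_space. g n) + (\<Sum>n\<in>uminus ` (freqs R \<inter> half_space). g n)"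
    using finite_freqs[of R] by (metis finite_Int finite_imageI sum.union_disjoint)
  also have "(\<Sum>n\<in>uminus ` (freqs R \<inter> half_space). g n) = (\<Sum>n\<in>freqs R \<inter> half_space. g n)"
    by (subst sum.reindex) (auto simp: assms inj_on_def)
  finally show ?thesis by simp
qed

text \<open>Exchanging the coordinates equates the two diagonal sums, and reflecting the second
  coordinate cancels the mixed sum. The quadratic form in \<open>l\<close> is therefore a multiple
  of its squared length.\<close>

lemma sum_freqs_isotropic:
  fixes v :: "int^2 \<Rightarrow> real" and l :: "real^2"
  assumes v: "\<And>n m. norm (rvec n) = norm (rvec m) \<Longrightarrow> v n = v m"
  shows "(\<Sum>n\<in>freqs R. (l \<bullet> rvec n)\<^sup>2 * v n) = (l \<bullet> l) * (\<Sum>n\<in>freqs R. (of_int (n $ 1))\<^sup>2 * v n)"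
proof -
  let ?sw = "\<lambda>n :: int^2. vector [n $ 2, n $ 1] :: int^2" and ?rf = "\<lambda>n :: int^2. vector [n $ 1,
    - (n $ 2)] :: int^2"
  have nsw: "norm (rvec (?sw n)) = norm (rvec n)" and nrf: "norm (rvec (?rf n)) = norm (rvec n)" for n
    by (rule power2_eq_imp_eq; simp add: norm_rvec_sq)+
  have z: "n = 0 \<longleftrightarrow> n $ 1 = 0 \<and> n $ 2 = 0" for n :: "int^2" by (simp add: vec_eq_iff forall_2)
  have bsw: "bij_betw ?sw (freqs R) (freqs R)"
    by (rule bij_betwI[of _ _ _ ?sw]) (auto simp: freqs_def nsw z vec_eq_iff forall_2)
  have brf: "bij_betw ?rf (freqs R) (freqs R)"
    by (rule bij_betwI[of _ _ _ ?rf]) (auto simp: freqs_def nrf z vec_eq_iff forall_2)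
  have s22: "(\<Sum>n\<in>freqs R. (of_int (n $ 2))\<^sup>2 * v n) = (\<Sum>n\<in>freqs R. (of_int (n $ 1))\<^sup>2 * v n)"
    by (subst sum.reindex_bij_betw[OF bsw, symmetric]) (simp add: v[OF nsw])
  have "(\<Sum>n\<in>freqs R. of_int (n $ 1) * of_int (n $ 2) * v n)
    = - (\<Sum>n\<in>freqs R. of_int (n $ 1) * of_int (n $ 2) * v n)"
    by (subst sum.reindex_bij_betw[OF brf, symmetric]) (simp add: v[OF nrf] sum_negf)
  then have s12: "(\<Sum>n\<in>freqs R. of_int (n $ 1) * of_int (n $ 2) * v n) = 0" by simp
  have "(l \<bullet> rvec n)\<^sup>2 * v n = (l $ 1)\<^sup>2 * ((of_int (n $ 1))\<^sup>2 * v n) + 2 * (l $ 1) * (l $ 2) * (of_int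
    (n $ 1) * of_int (n $ 2) * v n)
      + (l $ 2)\<^sup>2 * ((of_int (n $ 2))\<^sup>2 * v n)" for n
    by (simp add: inner_vec_def UNIV_2 power2_eq_square algebra_simps)
  then have "(\<Sum>n\<in>freqs R. (l \<bullet> rvec n)\<^sup>2 * v n) = (l $ 1)\<^sup>2 * (\<Sum>n\<in>freqs R. (of_int (n $ 1))\<^sup>2 * v n)
     + 2 * (l $ 1) * (l $ 2) * (\<Sum>n\<in>freqs R. of_int (n $ 1) * of_int (n $ 2) * v n) + (l $ 2)\<^sup>2 *
       (\<Sum>n\<in>freqs R. (of_int (n $ 2))\<^sup>2 * v n)"
    by (simp only: sum.distrib sum_distrib_left)
  then show ?thesis unfolding s22 s12 by (simp add: inner_vec_def UNIV_2 power2_eq_square algebra_simps)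
qed

definition trig_poly :: "(int^2) set \<Rightarrow> (int^2 \<Rightarrow> complex) \<Rightarrow> real^2 \<Rightarrow> real" where
  "trig_poly N c x = Re (\<Sum>n\<in>N. c n * fourier_mode n x)"

lemma trig_poly_eq: "trig_poly N c x = (\<Sum>n\<in>N. Re (c n) * cos (x \<bullet> rvec n) - Im (c n) * sin (x \<bullet> rvec n))"
  by (simp add: trig_poly_def fourier_mode_def)

lemma trig_poly_has_derivative:
  "(trig_poly N c has_derivative (\<lambda>h. \<Sum>n\<in>N. - (h \<bullet> rvec n) * (Re (c n) * sin (x \<bullet> rvec n)
    + Im (c n) * cos (x \<bullet> rvec n)))) (at x)"
  unfolding trig_poly_eq[abs_def]
  by (auto intro!: derivative_eq_intros sum.cong simp: fun_eq_iff algebra_simps)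

lemma pd_trig_poly: "pd j (trig_poly N c) = trig_poly N (\<lambda>n. \<i> * of_int (n $ j) * c n)"
proof
  fix x
  have "frechet_derivative (trig_poly N c) (at x)
    = (\<lambda>h. \<Sum>n\<in>N. - (h \<bullet> rvec n) * (Re (c n) * sin (x \<bullet> rvec n) + Im (c n) * cos (x \<bullet> rvec n)))"
    by (rule frechet_derivative_at[symmetric]) (rule trig_poly_has_derivative)
  then show "pd j (trig_poly N c) x = trig_poly N (\<lambda>n. \<i> * of_int (n $ j) * c n) x"
    unfolding pd_def trig_poly_eq by (auto intro!: sum.cong simp: inner_axis' algebra_simps)
qed

lemma continuous_trig_poly: "continuous_on A (trig_poly N c)"
  unfolding trig_poly_eq[abs_def] by (intro continuous_intros)

lemma trig_poly_add: "trig_poly N c x + trig_poly N d x = trig_poly N (\<lambda>n. c n + d n) x"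
  by (simp add: trig_poly_def distrib_right sum.distrib)

lemma trig_poly_cong: "(\<And>n. n \<in> N \<Longrightarrow> c n = d n) \<Longrightarrow> trig_poly N c = trig_poly N d"
  unfolding trig_poly_def[abs_def] by (intro ext arg_cong[where f=Re] sum.cong) auto

section \<open>Almost sure regularity and directional derivatives\<close>

context gauss_process
begin

text \<open>Collects in one almost sure event, for all frequencies and all times, what makes the
  field a real trigonometric polynomial with continuous coefficients. Identities of functions of x
  and t can then be argued path by path.\<close>

definition regular :: "path \<Rightarrow> bool" where
  "regular \<omega> \<longleftrightarrow> \<omega> \<in> space P \<and> (\<forall>n. n \<noteq> 0 \<longrightarrow> (\<forall>t\<ge>0.
     (t \<le> norm (rvec n) \<longrightarrow> W n t \<omega> = 0) \<and> W (- n) t \<omega> = cnj (W n t \<omega>)) \<and> (\<forall>c. continuous_on {0..}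
       (\<lambda>t. Wc (n, c) t \<omega>)))"

lemma AE_regular: "AE \<omega> in P. regular \<omega>"
proof -
  have "AE \<omega> in P. \<forall>t\<ge>0. (t \<le> norm (rvec n) \<longrightarrow> Wc (n, c) t \<omega> = 0) \<and> Wc (- n, c) t \<omega>
    = (if c then 1 else -1) * Wc (n, c) t \<omega>
      \<and> continuous_on {0..} (\<lambda>t. Wc (n, c) t \<omega>)"
    if n: "n \<noteq> 0" for n c
  proof -
    let ?r = "norm (rvec n)"
    have c1: "AE \<omega> in P. continuous_on {0..} (\<lambda>t. Wc (n, c) t \<omega>)"
      and c2: "AE \<omega> in P. continuous_on {0..} (\<lambda>t. Wc (- n, c) t \<omega>)"
      using n by (auto intro!: Wc_continuous)
    \<comment> \<open>Stopping the time at norm n turns vanishing on a bounded interval into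
      vanishing at all times, so the continuity argument applies.\<close>
    have "AE \<omega> in P. \<forall>t\<ge>0. Wc (n, c) (min t ?r) \<omega> = 0"
    proof (rule AE_eq_all_times[where X'="\<lambda>_ _. 0"])
      show "AE \<omega> in P. Wc (n, c) (min t ?r) \<omega> = 0" if "0 \<le> t" for t
        using n that by (intro Wc_eq_0) auto
      show "AE \<omega> in P. continuous_on {0..} (\<lambda>t. Wc (n, c) (min t ?r) \<omega>)"
        using c1 by eventually_elim (auto intro!: continuous_intros elim: continuous_on_compose2)
    qed auto
    moreover have "AE \<omega> in P. \<forall>t\<ge>0. Wc (- n, c) t \<omega> = (if c then 1 else -1) * Wc (n, c) t \<omega>"
    proof (rule AE_eq_all_times[OF _ c2])
      show "AE \<omega> in P. continuous_on {0..} (\<lambda>t. (if c then 1 else -1) * Wc (n, c) t \<omega>)"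
        using c1 by eventually_elim (intro continuous_intros)
    qed (rule Wc_uminus[OF n])
    ultimately show ?thesis using c1
    proof eventually_elim
      case (elim \<omega>)
      have "Wc (n, c) t \<omega> = 0" if "0 \<le> t" "t \<le> ?r" for t
        using elim(1)[rule_format, OF that(1)] that(2) by simp
      then show ?case using elim(2,3) by blast
    qed
  qed
  note all_times = this
  have "AE \<omega> in P. \<forall>n c. n \<noteq> 0 \<longrightarrow> (\<forall>t\<ge>0. (t \<le> norm (rvec n) \<longrightarrow> Wc (n, c) t \<omega> = 0) \<and> Wc (- n, c) t \<omega>
    = (if c then 1 else -1) * Wc (n, c) t \<omega>
      \<and> continuous_on {0..} (\<lambda>t. Wc (n, c) t \<omega>))"
    unfolding AE_all_countable
  proof (intro allI)
    fix n c
    show "AE \<omega> in P. n \<noteq> 0 \<longrightarrow> (\<forall>t\<ge>0. (t \<le> norm (rvec n) \<longrightarrow> Wc (n, c) t \<omega> = 0) \<and> Wc (- n, c) t \<omega>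
      = (if c then 1 else -1) * Wc (n, c) t \<omega>
      \<and> continuous_on {0..} (\<lambda>t. Wc (n, c) t \<omega>))"
    proof (cases "n = 0")
      case False
      from all_times[OF this, of c] show ?thesis by eventually_elim blast
    qed simp
  qed
  then show ?thesis using AE_space
  proof eventually_elim
    case (elim \<omega>)
    have *: "(t \<le> norm (rvec n) \<longrightarrow> W n t \<omega> = 0) \<and> W (- n) t \<omega> = cnj (W n t \<omega>)" if "n \<noteq> 0" "0 \<le> t" for n t
      using elim(1)[rule_format, OF that, of True] elim(1)[rule_format, OF that, of False]
      by (simp add: Wc_def complex_eq_iff)
    have "continuous_on {0..} (\<lambda>t. Wc (n, c) t \<omega>)" if "n \<noteq> 0" for n c
      using elim(1)[rule_format, OF that, of 0 c] by simp
    with * elim(2) show ?case unfolding regular_def by blast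
  qed
qed

text \<open>The common bracket of the two partial derivatives of the field with frequencies cut off
  at R. It is written with the first coordinate, which isotropy permits.\<close>

definition qvar :: "real \<Rightarrow> real \<Rightarrow> real" where
  "qvar R t = 2 * (\<Sum>n\<in>freqs R. (of_int (n $ 1))\<^sup>2 * vol n t)"

lemma qvar_eq: "t \<le> R \<Longrightarrow> qvar R t = qvar t t"
  unfolding qvar_def
  by (intro arg_cong2[where f="(*)"] refl sum.mono_neutral_right finite_freqs)
    (auto simp: freqs_def intro!: vol_eq_0)

text \<open>The weight of a component of W_n in the derivative of the field in direction
  \<open>l\<close> at \<open>x\<close>. The conjugate modes at n and -n contribute equally, which
  accounts for the 2; differentiating the real part of W_n exp(i x n) produces the minus sign, the
  sine for the real and the cosine for the imaginary part.\<close>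

definition slope_coeff :: "real^2 \<Rightarrow> real^2 \<Rightarrow> (int^2) \<times> bool \<Rightarrow> real" where
  "slope_coeff l x nc = - 2 * (l \<bullet> rvec (fst nc)) * (if snd nc then sin (x \<bullet> rvec (fst nc)) else cos (x
    \<bullet> rvec (fst nc)))"

text \<open>With the cutoff R fixed in time this is a fixed finite combination of modes, so it is a
  Gaussian martingale by the results above and its paths are almost surely continuous.\<close>

definition slope_at :: "real \<Rightarrow> real^2 \<Rightarrow> real^2 \<Rightarrow> real \<Rightarrow> path \<Rightarrow> real" where
  "slope_at R l x = comb ((freqs R \<inter> half_space) \<times> UNIV) (slope_coeff l x)"

lemma slope_modes: "finite ((freqs R \<inter> half_space) \<times> (UNIV :: bool set))" "(freqs R \<inter> half_space) \<times> UNIV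
  \<subseteq> half_space \<times> UNIV"
  using finite_freqs[of R] by auto

lemma slope_eq:
  "slope_at R l x t \<omega> = (\<Sum>n\<in>freqs R \<inter> half_space.
     - 2 * (l \<bullet> rvec n) * (sin (x \<bullet> rvec n) * Re (W n t \<omega>) + cos (x \<bullet> rvec n) * Im (W n t \<omega>)))"
  unfolding slope_at_def comb_def sum.cartesian_product'
  by (intro sum.cong) (auto simp: UNIV_bool slope_coeff_def Wc_def algebra_simps)

lemma slope_linear:
  "slope_at R (l + m) x t \<omega> = slope_at R l x t \<omega> + slope_at R m x t \<omega>"
  "slope_at R (l - m) x t \<omega> = slope_at R l x t \<omega> - slope_at R m x t \<omega>"
  unfolding slope_eq sum.distrib[symmetric] sum_subtractf[symmetric]
  by (auto intro!: sum.cong simp: inner_add_left inner_diff_left algebra_simps)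

text \<open>The weights of the two parts of a mode combine through sin^2 + cos^2 = 1, so the
  variance does not depend on \<open>x\<close>; isotropy of the lattice sum then removes the
  dependence on the direction.\<close>

lemma slope_var: "comb_var ((freqs R \<inter> half_space) \<times> UNIV) (slope_coeff l x) t = (l \<bullet> l) * qvar R t"
proof -
  have "comb_var ((freqs R \<inter> half_space) \<times> UNIV) (slope_coeff l x) t
    = (\<Sum>n\<in>freqs R \<inter> half_space. 4 * ((l \<bullet> rvec n)\<^sup>2 * vol n t))"
    unfolding comb_var_def sum.cartesian_product'
  proof (intro sum.cong refl)
    fix n
    show "(\<Sum>c\<in>UNIV. (slope_coeff l x (n, c))\<^sup>2 * vol (fst (n, c)) t) = 4 * ((l \<bullet> rvec n)\<^sup>2 * vol n t)"
      by (simp add: UNIV_bool slope_coeff_def power_mult_distrib sin_squared_eq algebra_simps)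
  qed
  also have "\<dots> = 2 * (2 * (\<Sum>n\<in>freqs R \<inter> half_space. (l \<bullet> rvec n)\<^sup>2 * vol n t))"
    by (simp add: sum_distrib_left)
  also have "2 * (\<Sum>n\<in>freqs R \<inter> half_space. (l \<bullet> rvec n)\<^sup>2 * vol n t) = (\<Sum>n\<in>freqs R. (l \<bullet> rvec n)\<^sup>2 * vol n t)"
    by (rule sum_freqs_half[symmetric]) (simp add: rvec_uminus vol_cong[of "- n" n for n])
  also have "\<dots> = (l \<bullet> l) * (\<Sum>n\<in>freqs R. (of_int (n $ 1))\<^sup>2 * vol n t)"
    by (rule sum_freqs_isotropic) (rule vol_cong)
  finally show ?thesis by (simp add: qvar_def)
qed

lemma slope_at_gauss: "gauss_martingale P Filt (slope_at R l x) (\<lambda>t. (l \<bullet> l) * qvar R t)"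
  using comb_gauss_martingale[OF half_half_space(1) slope_modes, of R "slope_coeff l x"]
  unfolding slope_at_def slope_var[abs_def] .

lemma slope_at_cutoff:
  assumes "regular \<omega>" "0 \<le> t" "t \<le> R"
  shows "slope_at R l x t \<omega> = slope_at t l x t \<omega>"
proof -
  have "W n t \<omega> = 0" if "n \<in> freqs R \<inter> half_space - freqs t \<inter> half_space" for n
    using assms that by (auto simp: freqs_def regular_def)
  then show ?thesis unfolding slope_eq using assms(3)
    by (intro sum.mono_neutral_right finite_Int disjI1 finite_freqs ballI) (auto simp: freqs_def)
qed

text \<open>The cutoff runs with time, so no bound on the time interval has to be fixed beforehand.
  Almost surely it agrees with every fixed cutoff that is at least \<open>t\<close>.\<close>

definition slope :: "real^2 \<Rightarrow> real^2 \<Rightarrow> real \<Rightarrow> path \<Rightarrow> real" where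
  "slope l x t = slope_at t l x t"

lemma qvar_cont: "continuous_on {0..} (\<lambda>t. qvar t t)"
  unfolding continuous_on_eq_continuous_within
proof
  fix t :: real assume t: "t \<in> {0..}"
  have "continuous_on {0..t + 1} (qvar (t + 1))"
    unfolding qvar_def[abs_def] by (intro continuous_intros continuous_on_subset[OF vol_cont]) auto
  moreover have "qvar s s = qvar (t + 1) s" if "s \<in> {0..t + 1}" for s using qvar_eq[of s "t + 1"] that by simp
  ultimately have "continuous_on {0..t + 1} (\<lambda>t. qvar t t)"
    by (subst continuous_on_cong[OF refl, of _ _ "qvar (t + 1)"]) auto
  then have "continuous (at t within {0..t + 1}) (\<lambda>t. qvar t t)"
    using t by (simp add: continuous_on_eq_continuous_within)
  moreover have "at t within {0..t + 1} = at t within {0..}"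
    by (rule at_within_nhd[of t "{..<t + 1}"]) auto
  ultimately show "continuous (at t within {0..}) (\<lambda>t. qvar t t)" by simp
qed

text \<open>For a given increment up to \<open>t\<close>, both end points can be evaluated with the
  fixed cutoff \<open>t\<close> without changing them almost surely, so the martingale identity is
  that of \<open>slope_at\<close>.\<close>

lemma slope_gauss: "gauss_martingale P Filt (slope l x) (\<lambda>t. (l \<bullet> l) * qvar t t)"
proof -
  interpret S: gauss_martingale P Filt "slope_at R l x" "\<lambda>t. (l \<bullet> l) * qvar R t" for R by (rule slope_at_gauss)
  show ?thesis
  proof
    show "slope l x t \<in> borel_measurable (Filt t)" if "0 \<le> t" for t
      unfolding slope_def by (rule S.adapted[OF that])
    show "(l \<bullet> l) * qvar s s \<le> (l \<bullet> l) * qvar t t" if "0 \<le> s" "s \<le> t" for s t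
      using S.V_mono[OF that, of t] qvar_eq[OF that(2)] by simp
    show "continuous_on {0..} (\<lambda>t. (l \<bullet> l) * qvar t t)" by (intro continuous_intros qvar_cont)
    fix s t \<theta> :: real and A assume st: "0 \<le> s" "s \<le> t" and A: "A \<in> sets (Filt s)"
    have [measurable]: "slope l x s \<in> borel_measurable P" "slope l x t
      \<in> borel_measurable P" "slope_at t l x s \<in> borel_measurable P" "slope_at t l x t \<in> borel_measurable
      P" "A \<in> sets P"
      unfolding slope_def using S.M_measurable st A sets_Filt_subset by auto
    have "(CLINT \<omega>|P. indicator A \<omega> * iexp (\<theta> * (slope l x t \<omega> - slope l x s \<omega>)))
      = (CLINT \<omega>|P. indicator A \<omega> * iexp (\<theta> * (slope_at t l x t \<omega> - slope_at t l x s \<omega>)))"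
    proof (rule integral_cong_AE)
      show "AE \<omega> in P. indicator A \<omega> * iexp (\<theta> * (slope l x t \<omega> - slope l x s \<omega>))
        = indicator A \<omega> * iexp (\<theta> * (slope_at t l x t \<omega> - slope_at t l x s \<omega>))"
        using AE_regular by eventually_elim (simp add: slope_def slope_at_cutoff[OF _ st])
    qed measurable
    also have "\<dots> = prob A * exp (- \<theta>\<^sup>2 * ((l \<bullet> l) * qvar t t - (l \<bullet> l) * qvar t s) / 2)"
      by (rule S.char_incr[OF st A])
    finally show "(CLINT \<omega>|P. indicator A \<omega> * iexp (\<theta> * (slope l x t \<omega> - slope l x s \<omega>)))
      = prob A * exp (- \<theta>\<^sup>2 * ((l \<bullet> l) * qvar t t - (l \<bullet> l) * qvar s s) / 2)"
      using qvar_eq[OF st(2)] by simp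
  qed (use S.space_filt S.sets_filt S.mono_filt in auto)
qed

lemma slope_add: "slope (l + m) x t \<omega> = slope l x t \<omega> + slope m x t \<omega>"
  and slope_diff: "slope (l - m) x t \<omega> = slope l x t \<omega> - slope m x t \<omega>"
  by (simp_all add: slope_def slope_linear)

end

section \<open>Derivatives and brackets of the field\<close>

locale gauss_field = gauss_process +
  fixes Y :: "real \<Rightarrow> path \<Rightarrow> real^2 \<Rightarrow> real"
  assumes Y_eq: "0 \<le> t \<Longrightarrow> \<omega> \<in> space P \<Longrightarrow> Y t \<omega> x = Re (\<Sum>\<^sub>\<infinity>n\<in>-{0}. fourier_mode n x * W n t \<omega>)"
begin

lemma Y_trig_poly:
  assumes "regular \<omega>" and t: "0 \<le> t" "t \<le> R"
  shows "Y t \<omega> = trig_poly (freqs R) (\<lambda>n. W n t \<omega>)"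
proof
  fix x
  have "(\<Sum>\<^sub>\<infinity>n\<in>-{0}. fourier_mode n x * W n t \<omega>) = (\<Sum>\<^sub>\<infinity>n\<in>freqs R. fourier_mode n x * W n t \<omega>)"
    by (rule infsum_cong_neutral) (use assms in \<open>auto simp: freqs_def regular_def\<close>)
  then show "Y t \<omega> x = trig_poly (freqs R) (\<lambda>n. W n t \<omega>) x"
    using Y_eq[OF t(1), of \<omega> x] assms(1) unfolding trig_poly_def regular_def
      by (simp add: finite_freqs mult.commute)
qed

lemma pd_Y:
  assumes r: "regular \<omega>" and t: "0 \<le> t" "t \<le> R"
  shows "pd j (Y t \<omega>) x = slope_at R (axis j 1) x t \<omega>"
proof -
  let ?g = "\<lambda>n. - of_int (n $ j) * (sin (x \<bullet> rvec n) * Re (W n t \<omega>) + cos (x \<bullet> rvec n) * Im (W n t \<omega>))"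
  have "pd j (Y t \<omega>) x = (\<Sum>n\<in>freqs R. ?g n)"
    unfolding Y_trig_poly[OF assms] pd_trig_poly trig_poly_eq by (auto intro!: sum.cong simp: algebra_simps)
  \<comment> \<open>Evenness is required at every n, but conjugacy of the modes is known for n
    \<noteq> 0. The zero frequency, absent from \<open>freqs R\<close>, is masked.\<close>
  also have "\<dots> = (\<Sum>n\<in>freqs R. if n = 0 then 0 else ?g n)"
    by (intro sum.cong) (auto simp: freqs_def)
  also have "\<dots> = 2 * (\<Sum>n\<in>freqs R \<inter> half_space. if n = 0 then 0 else ?g n)"
  proof (rule sum_freqs_half)
    fix n
    have "n \<noteq> 0 \<Longrightarrow> W (- n) t \<omega> = cnj (W n t \<omega>)" using r t(1) by (simp add: regular_def)
    then show "(if - n = 0 then 0 else ?g (- n)) = (if n = 0 then 0 else ?g n)"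
      by (auto simp: rvec_uminus algebra_simps)
  qed
  also have "\<dots> = slope_at R (axis j 1) x t \<omega>"
    unfolding slope_eq sum_distrib_left
    by (intro sum.cong) (auto simp: inner_axis' freqs_def)
  finally show ?thesis .
qed

lemma AE_pd_Y: "0 \<le> t \<Longrightarrow> AE \<omega> in P. pd j (Y t \<omega>) x = slope (axis j 1) x t \<omega>"
  using AE_regular by eventually_elim (simp add: pd_Y slope_def)

text \<open>Existence comes from polarisation: \<bar>e_i + e_j\<bar>^2 - \<bar>e_i - e_j\<bar>^2 is
  4 on the diagonal and 0 off it. Uniqueness of limits in probability identifies the number that the
  description operator selects.\<close>

lemma bracket_eq:
  assumes t: "0 \<le> t"
  shows "bracket P Y i j t = (if i = j then qvar t t else 0)"
proof -
  let ?q = "if i = j then qvar t t else 0"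
  have S: "gauss_martingale P Filt (slope l x) (\<lambda>t. (l \<bullet> l) * qvar t t)" for l x by (rule slope_gauss)
  have m: "slope l x s \<in> borel_measurable P" if "0 \<le> s" for l x s
    using gauss_martingale.M_measurable[OF S that] .
  have AEq: "AE \<omega> in P. pd i (Y s \<omega>) x = slope (axis i 1) x s \<omega>" if "0 \<le> s" for s i x
    by (rule AE_pd_Y[OF that])
  have q0: "qvar 0 0 = 0" by (simp add: qvar_def)
  have cong: "quad_covariation P (\<lambda>s \<omega>. pd i (Y s \<omega>) x) (\<lambda>s \<omega>. pd j (Y s \<omega>) x) t q
    \<longleftrightarrow> quad_covariation P (slope (axis i 1) x) (slope (axis j 1) x) t q" for x q
    by (rule quad_covariation_cong_AE) (use AEq in auto)
  have ex: "quad_covariation P (slope (axis i 1) x) (slope (axis j 1) x) t (\<lambda>_. ?q)" for x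
  proof -
    let ?e = "\<lambda>i. axis i 1 :: real^2"
    have A: "gauss_martingale P Filt (\<lambda>s \<omega>. slope (?e i) x s \<omega> + slope (?e j) x s \<omega>) (\<lambda>t. ((?e i
      + ?e j) \<bullet> (?e i + ?e j)) * qvar t t)"
    proof -
      have "slope (?e i + ?e j) x = (\<lambda>s \<omega>. slope (?e i) x s \<omega> + slope (?e j) x s \<omega>)" by (intro ext slope_add)
      then show ?thesis using S[of "?e i + ?e j" x] by simp
    qed
    have B: "gauss_martingale P Filt (\<lambda>s \<omega>. slope (?e i) x s \<omega> - slope (?e j) x s \<omega>) (\<lambda>t. ((?e i
      - ?e j) \<bullet> (?e i - ?e j)) * qvar t t)"
    proof -
      have "slope (?e i - ?e j) x = (\<lambda>s \<omega>. slope (?e i) x s \<omega> - slope (?e j) x s \<omega>)" by (intro ext slope_diff)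
      then show ?thesis using S[of "?e i - ?e j" x] by simp
    qed
    have "(((?e i + ?e j) \<bullet> (?e i + ?e j)) * qvar t t - ((?e i + ?e j) \<bullet> (?e i + ?e j)) * qvar 0 0
        - (((?e i - ?e j) \<bullet> (?e i - ?e j)) * qvar t t - ((?e i - ?e j) \<bullet> (?e i - ?e j)) * qvar 0 0)) / 4 = ?q"
      unfolding q0 by (auto simp: inner_axis_axis inner_add_left inner_add_right inner_diff_left
        inner_diff_right algebra_simps)
    with quad_covariation_polarization[OF A B m m t] show ?thesis by simp
  qed
  show ?thesis
    unfolding bracket_def cong
  proof (rule the_equality)
    show "\<forall>x. quad_covariation P (slope (axis i 1) x) (slope (axis j 1) x) t (\<lambda>_. ?q)" using ex by blast
    fix q assume "\<forall>x. quad_covariation P (slope (axis i 1) x) (slope (axis j 1) x) t (\<lambda>_. q)"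
    then have "quad_covariation P (slope (axis i 1) 0) (slope (axis j 1) 0) t (\<lambda>_. q)" by blast
    from quad_covariation_unique[OF t _ _ _ _ this ex]
    have "AE \<omega> in P. q = ?q" using m by auto
    then show "q = ?q" by simp
  qed
qed

end

section \<open>Iterated integrals\<close>

text \<open>Supplies measurable majorants for processes that are only measurable at each time and
  almost surely continuous. Samples on finer and finer grids are jointly measurable and converge on
  continuous paths; Fubini bounds their energy and Fatou passes the bound to the limit.\<close>

lemma (in prob_space) continuous_version:
  fixes X :: "real \<Rightarrow> 'a \<Rightarrow> real" and \<nu> :: "real measure"
  assumes T: "0 \<le> T" and X: "\<And>s. 0 \<le> s \<Longrightarrow> s \<le> T \<Longrightarrow> X s \<in> borel_measurable M"
    and cont: "AE \<omega> in M. continuous_on {0..T} (\<lambda>s. X s \<omega>)"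
    and bound: "\<And>s. 0 \<le> s \<Longrightarrow> s \<le> T \<Longrightarrow> (\<integral>\<^sup>+\<omega>. ennreal ((X s \<omega>)\<^sup>2) \<partial>M) \<le> c"
    and \<nu>: "sigma_finite_measure \<nu>" "sets \<nu> = sets borel"
  shows "\<exists>G. case_prod G \<in> borel_measurable (M \<Otimes>\<^sub>M borel) \<and> (AE \<omega> in M. \<forall>s\<in>{0..T}. X s \<omega> = G \<omega> s)
    \<and> (\<integral>\<^sup>+\<omega>. (\<integral>\<^sup>+s. ennreal ((G \<omega> s)\<^sup>2) * indicator {0..T} s \<partial>\<nu>) \<partial>M) \<le> c * emeasure \<nu> {0..T}"
proof -
  interpret N: sigma_finite_measure \<nu> by (rule \<nu>)
  interpret pair_sigma_finite M \<nu> ..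
  have sets_eq: "sets (M \<Otimes>\<^sub>M \<nu>) = sets (M \<Otimes>\<^sub>M borel)" by (intro sets_pair_measure_cong) (auto simp: \<nu>)
  note [measurable_cong] = \<nu>(2)
  \<comment> \<open>Sampling points are right end points of cells of width 1 / (k + 1), clamped to
    [0, T], where measurability and the moment bound are available.\<close>
  let ?p = "\<lambda>k i. max 0 (min T (real_of_int i / real (Suc k)))"
  define G' where "G' k \<omega> s = X (?p k \<lceil>s * real (Suc k)\<rceil>) \<omega>" for k \<omega> and s :: real
  have p: "0 \<le> ?p k i \<and> ?p k i \<le> T" for k i using T by auto
  have G'[measurable]: "(\<lambda>x. G' k (fst x) (snd x)) \<in> borel_measurable (M \<Otimes>\<^sub>M borel)" for k
  proof -
    have "(\<lambda>x. X (?p k i) (fst x)) \<in> borel_measurable (M \<Otimes>\<^sub>M borel)" for i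
      by (rule measurable_compose[OF measurable_fst X]) (use p[of i k] in auto)
    moreover have "(\<lambda>x. \<lceil>snd x * real (Suc k)\<rceil>) \<in> measurable (M \<Otimes>\<^sub>M borel) (count_space UNIV)" by measurable
    ultimately show ?thesis unfolding G'_def
      by (rule measurable_compose_countable[where f="\<lambda>i x. X (?p k i) (fst x)" and g="\<lambda>x. \<lceil>snd x * real (Suc k)\<rceil>"])
  qed
  define G where "G \<omega> s = lim (\<lambda>k. G' k \<omega> s)" for \<omega> s
  have G: "(\<lambda>x. G (fst x) (snd x)) \<in> borel_measurable (M \<Otimes>\<^sub>M borel)"
    unfolding G_def by (rule borel_measurable_lim_metric) measurable
  have conv: "AE \<omega> in M. \<forall>s\<in>{0..T}. (\<lambda>k. G' k \<omega> s) \<longlonglongrightarrow> X s \<omega>"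
    using cont
  proof eventually_elim
    case (elim \<omega>)
    show ?case
    proof
      fix s assume s: "s \<in> {0..T}"
      let ?r = "\<lambda>k. real_of_int \<lceil>s * real (Suc k)\<rceil> / real (Suc k)"
      have "?r \<longlonglongrightarrow> s"
      proof (rule tendsto_sandwich)
        show "\<forall>\<^sub>F n in sequentially. s \<le> ?r n" by (simp add: field_simps)
        show "\<forall>\<^sub>F n in sequentially. ?r n \<le> s + 1 / real (Suc n)"
        proof (rule always_eventually, rule allI)
          fix n
          have "real_of_int \<lceil>s * real (Suc n)\<rceil> \<le> s * real (Suc n) + 1" by (rule of_int_ceiling_le_add_one)
          then have "?r n \<le> (s * real (Suc n) + 1) / real (Suc n)" by (intro divide_right_mono) auto
          also have "\<dots> = s + 1 / real (Suc n)" by (simp add: add_divide_distrib)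
          finally show "?r n \<le> s + 1 / real (Suc n)" .
        qed
        show "(\<lambda>n. s + 1 / real (Suc n)) \<longlonglongrightarrow> s"
          using tendsto_add[OF tendsto_const LIMSEQ_inverse_real_of_nat, of s] by (simp add: inverse_eq_divide)
      qed simp
      then have "(\<lambda>k. max 0 (min T (?r k))) \<longlonglongrightarrow> max 0 (min T s)" by (intro tendsto_intros)
      then have "(\<lambda>k. ?p k \<lceil>s * real (Suc k)\<rceil>) \<longlonglongrightarrow> s" using s by simp
      from continuous_on_tendsto_compose[OF elim this s] p
      show "(\<lambda>k. G' k \<omega> s) \<longlonglongrightarrow> X s \<omega>" unfolding G'_def by auto
    qed
  qed
  have XG: "AE \<omega> in M. \<forall>s\<in>{0..T}. X s \<omega> = G \<omega> s"
    using conv by eventually_elim (auto simp: G_def intro!: limI[symmetric])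
  let ?F = "\<lambda>k \<omega> s. ennreal ((G' k \<omega> s)\<^sup>2) * indicator {0..T} s"
  have Fm[measurable]: "(\<lambda>x. ?F k (fst x) (snd x)) \<in> borel_measurable (M \<Otimes>\<^sub>M \<nu>)" for k
    unfolding measurable_cong_sets[OF sets_eq refl] by measurable
  have Fm': "case_prod (?F k) \<in> borel_measurable (M \<Otimes>\<^sub>M \<nu>)" for k using Fm[of k] by (simp add: case_prod_beta')
  have inner[measurable]: "(\<lambda>\<omega>. \<integral>\<^sup>+s. ?F k \<omega> s \<partial>\<nu>) \<in> borel_measurable M" for k
    by (rule N.borel_measurable_nn_integral[OF Fm'])
  have bk: "(\<integral>\<^sup>+\<omega>. (\<integral>\<^sup>+s. ?F k \<omega> s \<partial>\<nu>) \<partial>M) \<le> c * emeasure \<nu> {0..T}" for k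
  proof -
    have "(\<integral>\<^sup>+\<omega>. (\<integral>\<^sup>+s. ?F k \<omega> s \<partial>\<nu>) \<partial>M) = (\<integral>\<^sup>+s. (\<integral>\<^sup>+\<omega>. ?F k \<omega> s \<partial>M) \<partial>\<nu>)"
      by (rule Fubini'[OF Fm', symmetric])
    also have "\<dots> \<le> (\<integral>\<^sup>+s. c * indicator {0..T} s \<partial>\<nu>)"
    proof (rule nn_integral_mono)
      fix s
      show "(\<integral>\<^sup>+\<omega>. ?F k \<omega> s \<partial>M) \<le> c * indicator {0..T} s"
        using bound[of "?p k \<lceil>s * real (Suc k)\<rceil>"] p[of "\<lceil>s * real (Suc k)\<rceil>" k] by (auto simp: indicator_def G'_def)
    qed
    also have "\<dots> = c * emeasure \<nu> {0..T}" by (rule nn_integral_cmult_indicator) (simp add: \<nu>)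
    finally show ?thesis .
  qed
  \<comment> \<open>Fatou's lemma is applied twice, to the time integral for almost every path and
    then to the expectation.\<close>
  have "(\<integral>\<^sup>+\<omega>. (\<integral>\<^sup>+s. ennreal ((G \<omega> s)\<^sup>2) * indicator {0..T} s \<partial>\<nu>) \<partial>M)
    \<le> (\<integral>\<^sup>+\<omega>. liminf (\<lambda>k. \<integral>\<^sup>+s. ?F k \<omega> s \<partial>\<nu>) \<partial>M)"
  proof (rule nn_integral_mono_AE)
    show "AE \<omega> in M. (\<integral>\<^sup>+s. ennreal ((G \<omega> s)\<^sup>2) * indicator {0..T} s \<partial>\<nu>) \<le> liminf (\<lambda>k. \<integral>\<^sup>+s. ?F k \<omega> s \<partial>\<nu>)"
      using conv XG AE_space
    proof eventually_elim
      case (elim \<omega>)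
      have "(\<integral>\<^sup>+s. ennreal ((G \<omega> s)\<^sup>2) * indicator {0..T} s \<partial>\<nu>) = (\<integral>\<^sup>+s. liminf (\<lambda>k. ?F k \<omega> s) \<partial>\<nu>)"
      proof (rule nn_integral_cong)
        fix s
        show "ennreal ((G \<omega> s)\<^sup>2) * indicator {0..T} s = liminf (\<lambda>k. ?F k \<omega> s)"
        proof (cases "s \<in> {0..T}")
          case True
          have "(\<lambda>k. G' k \<omega> s) \<longlonglongrightarrow> G \<omega> s" using elim(1,2) True by simp
          then have "(\<lambda>k. ennreal ((G' k \<omega> s)\<^sup>2)) \<longlonglongrightarrow> ennreal ((G \<omega> s)\<^sup>2)" by (intro tendsto_ennrealI tendsto_power)
          from lim_imp_Liminf[OF _ this] show ?thesis using True by simp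
        qed (simp add: Liminf_const)
      qed
      also have "\<dots> \<le> liminf (\<lambda>k. \<integral>\<^sup>+s. ?F k \<omega> s \<partial>\<nu>)"
        by (rule nn_integral_liminf) (use measurable_Pair2[OF Fm' elim(3)] in simp)
      finally show ?case .
    qed
  qed
  also have "\<dots> \<le> liminf (\<lambda>k. \<integral>\<^sup>+\<omega>. (\<integral>\<^sup>+s. ?F k \<omega> s \<partial>\<nu>) \<partial>M)"
    by (rule nn_integral_liminf) measurable
  also have "\<dots> \<le> liminf (\<lambda>k. c * emeasure \<nu> {0..T})"
    by (rule Liminf_mono) (use bk in auto)
  also have "\<dots> = c * emeasure \<nu> {0..T}" by (simp add: Liminf_const)
  finally show ?thesis using G XG by (intro exI[of _ G]) (simp add: case_prod_beta')
qed

text \<open>Two candidate limits would both be close to the sum over one common partition; such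
  partitions exist for every mesh, so the description operator has a unique value.\<close>

lemma rs_integralI:
  assumes s: "0 \<le> s"
    and I: "\<And>\<epsilon>. 0 < \<epsilon> \<Longrightarrow> \<exists>\<delta>>0. \<forall>m p \<tau>. partition_of s \<delta> m p \<longrightarrow> (\<forall>i<m. \<tau> i \<in> {p i..p (Suc i)}) \<longrightarrow>
      \<bar>(\<Sum>i<m. g (\<tau> i) * (A (p (Suc i)) - A (p i))) - I\<bar> < \<epsilon>"
  shows "rs_integral g A s = I"
  unfolding rs_integral_def
proof (rule the_equality)
  fix I' assume I': "\<forall>\<epsilon>>0. \<exists>\<delta>>0. \<forall>m p \<tau>. partition_of s \<delta> m p \<longrightarrow> (\<forall>i<m. \<tau> i \<in> {p i..p (Suc i)}) \<longrightarrow>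
      \<bar>(\<Sum>i<m. g (\<tau> i) * (A (p (Suc i)) - A (p i))) - I'\<bar> < \<epsilon>"
  show "I' = I"
  proof (rule ccontr)
    assume "I' \<noteq> I"
    then have e: "0 < \<bar>I' - I\<bar> / 2" by simp
    obtain \<delta> where d: "\<delta> > 0" "\<And>m p \<tau>. partition_of s \<delta> m p \<Longrightarrow> (\<forall>i<m. \<tau> i \<in> {p i..p (Suc i)}) \<Longrightarrow>
      \<bar>(\<Sum>i<m. g (\<tau> i) * (A (p (Suc i)) - A (p i))) - I\<bar> < \<bar>I' - I\<bar> / 2" using I[OF e] by blast
    obtain \<delta>' where d': "\<delta>' > 0" "\<And>m p \<tau>. partition_of s \<delta>' m p \<Longrightarrow> (\<forall>i<m. \<tau> i \<in> {p i..p (Suc i)}) \<Longrightarrow>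
      \<bar>(\<Sum>i<m. g (\<tau> i) * (A (p (Suc i)) - A (p i))) - I'\<bar> < \<bar>I' - I\<bar> / 2" using I' e by blast
    obtain m p where "partition_of s (min \<delta> \<delta>') m p" using partition_of_exists[OF s, of "min \<delta> \<delta>'"] d d' by auto
    then have pt: "partition_of s \<delta> m p" "partition_of s \<delta>' m p" by (auto simp: partition_of_def)
    have tau: "\<forall>i<m. p i \<in> {p i..p (Suc i)}" using pt by (auto simp: partition_of_def)
    show False using d(2)[OF pt(1) tau] d'(2)[OF pt(2) tau] by (simp add: abs_if split: if_splits)
  qed
qed (use I in blast)

lemma rs_integral_0:
  assumes "0 \<le> s" "\<And>r. 0 \<le> r \<Longrightarrow> r \<le> s \<Longrightarrow> A r = 0"
  shows "rs_integral g A s = 0"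
proof (rule rs_integralI[OF assms(1)])
  fix \<epsilon> :: real assume e: "0 < \<epsilon>"
  show "\<exists>\<delta>>0. \<forall>m p \<tau>. partition_of s \<delta> m p \<longrightarrow> (\<forall>i<m. \<tau> i \<in> {p i..p (Suc i)}) \<longrightarrow>
      \<bar>(\<Sum>i<m. g (\<tau> i) * (A (p (Suc i)) - A (p i))) - 0\<bar> < \<epsilon>"
  proof (intro exI[of _ 1] conjI allI impI)
    fix m p \<tau> assume pt: "partition_of s 1 m p"
    have "(\<Sum>i<m. g (\<tau> i) * (A (p (Suc i)) - A (p i))) = 0"
    proof (rule sum.neutral, rule ballI)
      fix i assume "i \<in> {..<m}"
      then have "A (p i) = 0" "A (p (Suc i)) = 0"
        using partition_of_bounds[OF pt, of i] partition_of_bounds[OF pt, of "Suc i"] assms(2) by auto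
      then show "g (\<tau> i) * (A (p (Suc i)) - A (p i)) = 0" by simp
    qed
    then show "\<bar>(\<Sum>i<m. g (\<tau> i) * (A (p (Suc i)) - A (p i))) - 0\<bar> < \<epsilon>" using e by simp
  qed simp
qed

text \<open>Identifies the Riemann-Stieltjes with the Lebesgue-Stieltjes integral, so that integral
  inequalities apply. The integrator is compared with \<open>V\<close> on [0, s] only, because the
  bracket of the field is known for nonnegative times.\<close>

lemma (in gauss_martingale) rs_integral_bracket:
  assumes s: "0 \<le> s" and g: "continuous_on {0..s} g" and A: "\<And>r. 0 \<le> r \<Longrightarrow> r \<le> s \<Longrightarrow> A r = V r"
  shows "integrable \<mu> (\<lambda>r. indicator {0<..s} r *\<^sub>R g r)"
    and "rs_integral g A s = (\<integral>r. indicator {0<..s} r *\<^sub>R g r \<partial>\<mu>)"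
proof -
  have ii: "integrable \<mu> (indicat_real {a<..b})" for a b
    by (rule integrable_real_indicator) (use finite_bracket_Ioc in auto)
  have "compact (g ` {0..s})" by (rule compact_continuous_image[OF g]) simp
  then obtain C where C: "\<And>r. r \<in> {0..s} \<Longrightarrow> \<bar>g r\<bar> \<le> C"
    using compact_imp_bounded bounded_iff by (metis image_eqI real_norm_def)
  have gm: "(\<lambda>r. indicator {0<..s} r *\<^sub>R g r) \<in> borel_measurable borel"
    by (rule borel_measurable_continuous_on_indicator) (auto intro: continuous_on_subset[OF g])
  show gi: "integrable \<mu> (\<lambda>r. indicator {0<..s} r *\<^sub>R g r)"
  proof (rule Bochner_Integration.integrable_bound)
    show "integrable \<mu> (\<lambda>r. C * indicator {0<..s} r)" using ii by simp
    show "(\<lambda>r. indicator {0<..s} r *\<^sub>R g r) \<in> borel_measurable \<mu>"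
      using gm measurable_cong_sets[OF sets_bracket_measure refl] by blast
    show "AE r in \<mu>. norm (indicator {0<..s} r *\<^sub>R g r) \<le> norm (C * indicator {0<..s} r)"
    proof (rule AE_I2)
      fix r show "norm (indicator {0<..s} r *\<^sub>R g r) \<le> norm (C * indicator {0<..s} r)"
        using C[of r] by (auto simp: indicator_def)
    qed
  qed
  show "rs_integral g A s = (\<integral>r. indicator {0<..s} r *\<^sub>R g r \<partial>\<mu>)"
  proof (rule rs_integralI[OF s])
    fix \<epsilon> :: real assume e: "0 < \<epsilon>"
    have V0: "0 \<le> V s - V 0" using V_mono[of 0 s] s by simp
    define \<eta> where "\<eta> = \<epsilon> / (2 * (V s - V 0 + 1))"
    have eta: "0 < \<eta>" unfolding \<eta>_def using V0 e by simp
    have "uniformly_continuous_on {0..s} g" by (rule compact_uniformly_continuous[OF g]) simp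
    then obtain \<delta> where d: "\<delta> > 0" "\<And>a b. a \<in> {0..s} \<Longrightarrow> b \<in> {0..s} \<Longrightarrow> dist b a < \<delta> \<Longrightarrow> dist (g b) (g a) < \<eta>"
      unfolding uniformly_continuous_on_def using eta by metis
    show "\<exists>\<delta>>0. \<forall>m p \<tau>. partition_of s \<delta> m p \<longrightarrow> (\<forall>i<m. \<tau> i \<in> {p i..p (Suc i)}) \<longrightarrow>
      \<bar>(\<Sum>i<m. g (\<tau> i) * (A (p (Suc i)) - A (p i))) - (\<integral>r. indicator {0<..s} r *\<^sub>R g r \<partial>\<mu>)\<bar> < \<epsilon>"
    proof (intro exI[of _ \<delta>] conjI allI impI d(1))
      fix m p \<tau> assume pt: "partition_of s \<delta> m p" and tau: "\<forall>i<m. \<tau> i \<in> {p i..p (Suc i)}"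
      let ?\<phi> = "\<lambda>r. \<Sum>i<m. g (\<tau> i) * indicator {p i<..p (Suc i)} r"
      have b: "0 \<le> p i" "p i \<le> p (Suc i)" "p (Suc i) \<le> s" if "i < m" for i
        using partition_of_bounds[OF pt, of i] partition_of_bounds[OF pt, of "Suc i"]
          partition_of_mono[OF pt, of i "Suc i"] that by auto
      have p0: "p 0 = 0" and pm: "p m = s" using pt by (auto simp: partition_of_def)
      have step: "\<bar>g r * indicator {0<..s} r - ?\<phi> r\<bar> \<le> \<eta> * indicator {0<..s} r" for r
      proof -
        have "\<bar>g r * indicator {p 0<..p m} r - ?\<phi> r\<bar> \<le> \<eta> * indicator {p 0<..p m} r"
        proof (rule step_approx[THEN conjunct2])
          fix i r assume i: "i < m" and r: "r \<in> {p i<..p (Suc i)}"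
          have "p (Suc i) - p i < \<delta>" using pt i by (auto simp: partition_of_def)
          then have "dist (\<tau> i) r < \<delta>" using tau[rule_format, OF i] r by (auto simp: dist_real_def)
          then have "dist (g (\<tau> i)) (g r) < \<eta>" using b[OF i] tau[rule_format, OF i] r by (intro d(2)) auto
          then show "\<bar>g r - g (\<tau> i)\<bar> \<le> \<eta>" by (simp add: dist_real_def)
        qed (use b in auto)
        then show ?thesis unfolding p0 pm .
      qed
      have phi: "integrable \<mu> ?\<phi>" using ii by (intro Bochner_Integration.integrable_sum integrable_mult_right) auto
      have "(\<Sum>i<m. g (\<tau> i) * (A (p (Suc i)) - A (p i))) = (\<integral>r. ?\<phi> r \<partial>\<mu>)"
      proof -
        have "(\<integral>r. ?\<phi> r \<partial>\<mu>) = (\<Sum>i<m. g (\<tau> i) * measure \<mu> {p i<..p (Suc i)})"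
          using ii by (subst Bochner_Integration.integral_sum) auto
        also have "\<dots> = (\<Sum>i<m. g (\<tau> i) * (A (p (Suc i)) - A (p i)))"
          using b by (intro sum.cong) (auto simp: measure_bracket_Ioc A order_trans[OF b(2) b(3)]
            order_trans[OF b(1) b(2)])
        finally show ?thesis ..
      qed
      then have "(\<Sum>i<m. g (\<tau> i) * (A (p (Suc i)) - A (p i))) - (\<integral>r. indicator {0<..s} r *\<^sub>R g r \<partial>\<mu>)
        = (\<integral>r. ?\<phi> r - indicator {0<..s} r *\<^sub>R g r \<partial>\<mu>)"
        using phi gi by simp
      also have "\<bar>\<dots>\<bar> \<le> (\<integral>r. \<eta> * indicator {0<..s} r \<partial>\<mu>)"
      proof -
        have "norm (\<integral>r. ?\<phi> r - indicator {0<..s} r *\<^sub>R g r \<partial>\<mu>) \<le> (\<integral>r. \<eta> * indicator {0<..s} r \<partial>\<mu>)"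
        proof (rule Bochner_Integration.integral_norm_bound_integral)
          show "integrable \<mu> (\<lambda>r. ?\<phi> r - indicator {0<..s} r *\<^sub>R g r)" using phi gi by simp
          show "integrable \<mu> (\<lambda>r. \<eta> * indicator {0<..s} r)" using ii by simp
          fix r show "norm (?\<phi> r - indicator {0<..s} r *\<^sub>R g r) \<le> \<eta> * indicator {0<..s} r"
            using step[of r] by (simp add: abs_minus_commute mult.commute)
        qed
        then show ?thesis by simp
      qed
      also have "\<dots> = \<eta> * (V s - V 0)" using s by (simp add: measure_bracket_Ioc)
      also have "\<dots> < \<epsilon>"
      proof -
        have "\<epsilon> * (V s - V 0) < \<epsilon> * (2 * (V s - V 0 + 1))" using e V0 by (intro mult_strict_left_mono) auto
        moreover have "0 < 2 * (V s - V 0 + 1)" using V0 by simp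
        ultimately have "\<epsilon> * (V s - V 0) / (2 * (V s - V 0 + 1)) < \<epsilon>" by (simp only: pos_divide_less_eq)
        then show ?thesis unfolding \<eta>_def by simp
      qed
      finally show "\<bar>(\<Sum>i<m. g (\<tau> i) * (A (p (Suc i)) - A (p i))) - (\<integral>r. indicator {0<..s} r *\<^sub>R g r \<partial>\<mu>)\<bar> < \<epsilon>" .
    qed
  qed
qed

text \<open>The Cauchy-Schwarz inequality for the bracket measure. The right side does not depend on
  the upper limit \<open>s\<close>, so it bounds the integral for all s \<le> t at once.\<close>

lemma (in gauss_martingale) rs_integral_sq_le:
  assumes s: "0 \<le> s" "s \<le> t" and g: "continuous_on {0..t} g" and A: "\<And>r. 0 \<le> r \<Longrightarrow> r \<le> t \<Longrightarrow> A r = V r"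
  shows "ennreal ((rs_integral g A s)\<^sup>2) \<le> ennreal (V t - V 0) * (\<integral>\<^sup>+r. ennreal ((g r)\<^sup>2) * indicator {0..t} r \<partial>\<mu>)"
proof -
  have gs: "continuous_on {0..s} g" by (rule continuous_on_subset[OF g]) (use s in auto)
  note r = rs_integral_bracket[OF s(1) gs, of A]
  have i: "integrable \<mu> (\<lambda>r. indicator {0<..s} r *\<^sub>R g r)" and e: "rs_integral g A s
    = (\<integral>r. indicator {0<..s} r *\<^sub>R g r \<partial>\<mu>)"
    using r A s by auto
  have gm: "(\<lambda>r. indicator {0<..s} r *\<^sub>R g r) \<in> borel_measurable \<mu>" using i by simp
  have "ennreal \<bar>rs_integral g A s\<bar> \<le> (\<integral>\<^sup>+r. ennreal (norm (indicator {0<..s} r *\<^sub>R g r)) \<partial>\<mu>)"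
    unfolding e using integral_norm_bound_ennreal[OF i] by simp
  also have "\<dots> = (\<integral>\<^sup>+r. ennreal (norm (indicator {0<..s} r *\<^sub>R g r)) * indicator {0<..s} r \<partial>\<mu>)"
    by (intro nn_integral_cong) (auto simp: indicator_def)
  finally have "(ennreal \<bar>rs_integral g A s\<bar>)\<^sup>2
    \<le> (\<integral>\<^sup>+r. ennreal (norm (indicator {0<..s} r *\<^sub>R g r)) * indicator {0<..s} r \<partial>\<mu>)\<^sup>2"
    by (intro power_mono) auto
  also have "\<dots> \<le> (\<integral>\<^sup>+r. (ennreal (norm (indicator {0<..s} r *\<^sub>R g r)))\<^sup>2 \<partial>\<mu>) * (\<integral>\<^sup>+r. (indicator {0<..s} r)\<^sup>2 \<partial>\<mu>)"
    using gm by (intro Cauchy_Schwarz_nn_integral) auto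
  also have "\<dots> \<le> (\<integral>\<^sup>+r. ennreal ((g r)\<^sup>2) * indicator {0..t} r \<partial>\<mu>) * ennreal (V t - V 0)"
  proof (rule mult_mono)
    show "(\<integral>\<^sup>+r. (ennreal (norm (indicator {0<..s} r *\<^sub>R g r)))\<^sup>2 \<partial>\<mu>)
      \<le> (\<integral>\<^sup>+r. ennreal ((g r)\<^sup>2) * indicator {0..t} r \<partial>\<mu>)"
      using s by (intro nn_integral_mono) (auto simp: indicator_def ennreal_power)
    have "(\<integral>\<^sup>+r. (indicator {0<..s} r)\<^sup>2 \<partial>\<mu>) = (\<integral>\<^sup>+r. indicator {0<..s} r \<partial>\<mu>)"
      by (intro nn_integral_cong) (auto simp: indicator_def)
    also have "\<dots> \<le> emeasure \<mu> {0..t}" using s by (simp, intro emeasure_mono) auto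
    also have "\<dots> \<le> ennreal (V t - V 0)" using s by (intro emeasure_bracket_Icc_le) simp
    finally show "(\<integral>\<^sup>+r. (indicator {0<..s} r)\<^sup>2 \<partial>\<mu>) \<le> ennreal (V t - V 0)" .
  qed auto
  finally show ?thesis by (simp add: ennreal_power mult.commute)
qed

section \<open>Second moments of iterated integrals, uniform in space\<close>

context gauss_field
begin

abbreviation "qT t \<equiv> qvar t t"
abbreviation "\<mu>q \<equiv> bracket_measure (\<lambda>t. qvar t t)"

lemma slope_axis_gauss: "gauss_martingale P Filt (slope (axis j 1) x) (\<lambda>t. qT t)"
  using slope_gauss[of "axis j 1" x] by (simp add: inner_axis_axis)

lemma qT_0 [simp]: "qT 0 = 0"
  by (simp add: qvar_def)

lemma qT_mono: "0 \<le> s \<Longrightarrow> s \<le> t \<Longrightarrow> qT s \<le> qT t"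
  using gauss_martingale.V_mono[OF slope_axis_gauss] by blast

lemma qT_nonneg: "0 \<le> t \<Longrightarrow> 0 \<le> qT t"
  using qT_mono[of 0 t] by simp

lemma emeasure_q: "0 \<le> t \<Longrightarrow> emeasure \<mu>q {0..t} \<le> ennreal (qT t)"
  using gauss_martingale.emeasure_bracket_Icc_le[OF slope_axis_gauss, of t] by simp

lemma sigma_finite_q: "sigma_finite_measure \<mu>q"
  using gauss_martingale.sigma_finite_bracket[OF slope_axis_gauss] .

lemma slope_0: "slope l x 0 \<omega> = 0"
  by (simp add: slope_def slope_eq freqs_def)

lemma slope_sq: "0 \<le> t \<Longrightarrow> (\<integral>\<^sup>+\<omega>. ennreal ((slope (axis j 1) x t \<omega>)\<^sup>2) \<partial>P) = ennreal (qT t)"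
proof -
  assume t: "0 \<le> t"
  interpret S: gauss_martingale P Filt "slope (axis j 1) x" "\<lambda>t. qT t" by (rule slope_axis_gauss)
  note m = S.incr_moments[OF order_refl t, unfolded slope_0]
  have "(\<integral>\<^sup>+\<omega>. ennreal ((slope (axis j 1) x t \<omega>)\<^sup>2) \<partial>P) = ennreal (\<integral>\<omega>. (slope (axis j 1) x t \<omega>)\<^sup>2 \<partial>P)"
    using m(1)[of 2] by (intro nn_integral_eq_integral) auto
  then show ?thesis using m(3) by simp
qed

lemma ito_field_setup:
  assumes "ito_field P Y j H I"
  shows "ito_setup P Filt (slope (axis j 1) x) (\<lambda>t. qT t) (\<lambda>t \<omega>. pd j (Y t \<omega>) x) (H x) (I x)"
proof -
  interpret S: gauss_martingale P Filt "slope (axis j 1) x" "\<lambda>t. qT t" by (rule slope_axis_gauss)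
  show ?thesis
    by unfold_locales (use assms AE_pd_Y in \<open>auto simp: ito_field_def\<close>)
qed

lemma ito_field_const_bound:
  assumes I: "ito_field P Y j H I" and H: "\<And>s \<omega>. 0 \<le> s \<Longrightarrow> s \<le> t \<Longrightarrow> \<bar>H x s \<omega>\<bar> \<le> c" and t: "0 \<le> t"
  shows "(\<integral>\<^sup>+\<omega>. ennreal ((I x t \<omega>)\<^sup>2) \<partial>P) \<le> ennreal (4 * (c\<^sup>2 * qT t))"
proof -
  interpret ito_setup P Filt "slope (axis j 1) x" "\<lambda>t. qT t" "\<lambda>t \<omega>. pd j (Y t \<omega>) x" "H x" "I x"
    by (rule ito_field_setup[OF I])
  have "(\<integral>\<^sup>+\<omega>. ennreal ((I x t \<omega>)\<^sup>2) \<partial>P) \<le> 4 * (\<integral>\<^sup>+\<omega>. (\<integral>\<^sup>+s. ennreal (c\<^sup>2) * indicator {0..t} s \<partial>\<mu>q) \<partial>P)"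
    using H by (intro ito_L2_bound[OF t, of "\<lambda>_ _. c"]) auto
  also have "\<dots> = 4 * (ennreal (c\<^sup>2) * emeasure \<mu>q {0..t})"
    by (simp add: nn_integral_cmult_indicator emeasure_space_1)
  also have "\<dots> \<le> 4 * (ennreal (c\<^sup>2) * ennreal (qT t))"
    by (intro mult_left_mono emeasure_q[OF t]) auto
  also have "\<dots> = ennreal (4 * (c\<^sup>2 * qT t))"
    using qT_nonneg[OF t] by (simp add: ennreal_mult)
  finally show ?thesis .
qed

text \<open>The inner integral is known to be measurable only at each time, so a jointly measurable
  version serves as majorant in the bound for the outer integral. The resulting constant does not
  depend on \<open>x\<close> when \<open>c\<close> does not.\<close>

lemma ito_field_iterated_bound:
  assumes I: "ito_field P Y j (I') I" and I': "ito_field P Y j H' (I')"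
    and bound: "\<And>s. 0 \<le> s \<Longrightarrow> s \<le> t \<Longrightarrow> (\<integral>\<^sup>+\<omega>. ennreal ((I' x s \<omega>)\<^sup>2) \<partial>P) \<le> ennreal c"
    and t: "0 \<le> t" and c: "0 \<le> c"
  shows "(\<integral>\<^sup>+\<omega>. ennreal ((I x t \<omega>)\<^sup>2) \<partial>P) \<le> ennreal (4 * (c * qT t))"
proof -
  interpret I': ito_setup P Filt "slope (axis j 1) x" "\<lambda>t. qT t" "\<lambda>t \<omega>. pd j (Y t \<omega>) x" "H' x" "I' x"
    by (rule ito_field_setup[OF I'])
  interpret ito_setup P Filt "slope (axis j 1) x" "\<lambda>t. qT t" "\<lambda>t \<omega>. pd j (Y t \<omega>) x" "I' x" "I x"
    by (rule ito_field_setup[OF I])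
  have c0: "AE \<omega> in P. continuous_on {0..} (\<lambda>t. I' x t \<omega>)" using I'.ito by (simp add: ito_integral_def)
  have "AE \<omega> in P. continuous_on {0..t} (\<lambda>s. I' x s \<omega>)"
    using c0 by eventually_elim (auto elim: continuous_on_subset)
  from continuous_version[OF t I'.I_measurable this bound sigma_finite_q sets_bracket_measure]
  obtain G where G: "case_prod G \<in> borel_measurable (P \<Otimes>\<^sub>M borel)" "AE \<omega> in P. \<forall>s\<in>{0..t}. I' x s \<omega> = G \<omega> s"
    "(\<integral>\<^sup>+\<omega>. (\<integral>\<^sup>+s. ennreal ((G \<omega> s)\<^sup>2) * indicator {0..t} s \<partial>\<mu>q) \<partial>P) \<le> ennreal c * emeasure \<mu>q {0..t}"
    by blast
  have "(\<integral>\<^sup>+\<omega>. ennreal ((I x t \<omega>)\<^sup>2) \<partial>P) \<le> 4 * (\<integral>\<^sup>+\<omega>. (\<integral>\<^sup>+s. ennreal ((\<bar>G \<omega> s\<bar>)\<^sup>2) * indicator {0..t} s \<partial>\<mu>q) \<partial>P)"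
  proof (rule ito_L2_bound[OF t])
    show "(\<lambda>(\<omega>, s). \<bar>G \<omega> s\<bar>) \<in> borel_measurable (P \<Otimes>\<^sub>M borel)"
      using borel_measurable_abs[OF G(1)] by (simp add: case_prod_beta')
    show "AE \<omega> in P. \<forall>s\<in>{0..t}. \<bar>I' x s \<omega>\<bar> \<le> \<bar>G \<omega> s\<bar>" using G(2) by eventually_elim simp
  qed
  also have "\<dots> \<le> 4 * (ennreal c * ennreal (qT t))"
    using G(3) mult_left_mono[OF emeasure_q[OF t], of "ennreal c"]
      by (intro mult_left_mono) (auto intro: order_trans)
  also have "\<dots> = ennreal (4 * (c * qT t))"
    using qT_nonneg[OF t] c by (simp add: ennreal_mult)
  finally show ?thesis .
qed

lemma slope_at_continuous: "regular \<omega> \<Longrightarrow> continuous_on {0..} (\<lambda>t. slope_at R l x t \<omega>)"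
  unfolding slope_at_def comb_def
  by (intro continuous_intros) (auto simp: regular_def freqs_def)

text \<open>The four factors \<open>qT t\<close> have three sources: one from Cauchy-Schwarz for the
  inner integral, two from the mean energy of the derivative, and one from the mass of the outer
  bracket.\<close>

lemma ito_field_rs_bound:
  assumes I: "ito_field P Y i (\<lambda>x s \<omega>. rs_integral (\<lambda>r. pd i (Y r \<omega>) x) (bracket P Y j j) s) I" and t: "0 \<le> t"
  shows "(\<integral>\<^sup>+\<omega>. ennreal ((I x t \<omega>)\<^sup>2) \<partial>P) \<le> ennreal (4 * (qT t * (qT t * qT t) * qT t))"
proof -
  let ?H = "\<lambda>s \<omega>. rs_integral (\<lambda>r. pd i (Y r \<omega>) x) (bracket P Y j j) s"
  interpret ito_setup P Filt "slope (axis i 1) x" "\<lambda>t. qT t" "\<lambda>t \<omega>. pd i (Y t \<omega>) x" "\<lambda>s \<omega>. ?H s \<omega>" "I x"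
    by (rule ito_field_setup[OF I])
  \<comment> \<open>The derivative is handled with the cutoff fixed at \<open>t\<close>, since for a
    regular path continuity is known for \<open>slope_at\<close>.\<close>
  interpret S: gauss_martingale P Filt "slope_at t (axis i 1) x" "\<lambda>s. (axis i 1 \<bullet> (axis i 1 :: real^2))
    * qvar t s" by (rule slope_at_gauss)
  have q: "0 \<le> qT t" by (rule qT_nonneg[OF t])
  have b: "(\<integral>\<^sup>+\<omega>. ennreal ((slope_at t (axis i 1) x s \<omega>)\<^sup>2) \<partial>P) \<le> ennreal (qT t)" if s: "0 \<le> s" "s \<le> t" for s
  proof -
    have "(\<integral>\<^sup>+\<omega>. ennreal ((slope_at t (axis i 1) x s \<omega>)\<^sup>2) \<partial>P) = (\<integral>\<^sup>+\<omega>. ennreal ((slope (axis i 1) x s \<omega>)\<^sup>2) \<partial>P)"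
      by (rule nn_integral_cong_AE) (use AE_regular in eventually_elim, simp add: slope_def
        slope_at_cutoff[OF _ s])
    then show ?thesis using slope_sq[OF s(1)] qT_mono[OF s] by (simp add: ennreal_leI)
  qed
  have "AE \<omega> in P. continuous_on {0..t} (\<lambda>s. slope_at t (axis i 1) x s \<omega>)"
    using AE_regular by eventually_elim (rule continuous_on_subset[OF slope_at_continuous], auto)
  from continuous_version[OF t S.M_measurable this b sigma_finite_q sets_bracket_measure]
  obtain G where G[measurable]: "case_prod G \<in> borel_measurable (P \<Otimes>\<^sub>M borel)"
    and GX: "AE \<omega> in P. \<forall>s\<in>{0..t}. slope_at t (axis i 1) x s \<omega> = G \<omega> s"
    and GI: "(\<integral>\<^sup>+\<omega>. (\<integral>\<^sup>+s. ennreal ((G \<omega> s)\<^sup>2) * indicator {0..t} s \<partial>\<mu>q) \<partial>P) \<le> ennreal (qT t) * emeasure \<mu>q {0..t}"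
    by blast
  interpret mu: sigma_finite_measure \<mu>q by (rule sigma_finite_q)
  have sets_eq: "sets (P \<Otimes>\<^sub>M \<mu>q) = sets (P \<Otimes>\<^sub>M borel)" by (intro sets_pair_measure_cong) auto
  define E where "E \<omega> = (\<integral>\<^sup>+s. ennreal ((G \<omega> s)\<^sup>2) * indicator {0..t} s \<partial>\<mu>q)" for \<omega>
  have E[measurable]: "E \<in> borel_measurable P"
    unfolding E_def[abs_def] by (rule mu.borel_measurable_nn_integral)
      (simp add: measurable_cong_sets[OF sets_eq refl])
  have EI: "(\<integral>\<^sup>+\<omega>. E \<omega> \<partial>P) \<le> ennreal (qT t * qT t)"
    using order_trans[OF GI mult_left_mono[OF emeasure_q[OF t], of "ennreal (qT t)"]] q
    unfolding E_def by (simp add: ennreal_mult)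
  have Efin: "AE \<omega> in P. E \<omega> \<noteq> \<infinity>"
    by (rule nn_integral_PInf_AE[OF E]) (use EI in \<open>auto simp: top_unique\<close>)
  \<comment> \<open>The majorant is constant in s: the inner Stieltjes integral up to any s \<le> t
    is controlled by the energy over the whole of [0, t].\<close>
  let ?G = "\<lambda>\<omega> s :: real. sqrt (qT t * enn2real (E \<omega>))"
  have "(\<integral>\<^sup>+\<omega>. ennreal ((I x t \<omega>)\<^sup>2) \<partial>P) \<le> 4 * (\<integral>\<^sup>+\<omega>. (\<integral>\<^sup>+s. ennreal ((?G \<omega> s)\<^sup>2) * indicator {0..t} s \<partial>\<mu>q) \<partial>P)"
  proof (rule ito_L2_bound[OF t])
    show "case_prod ?G \<in> borel_measurable (P \<Otimes>\<^sub>M borel)" by measurable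
    show "AE \<omega> in P. \<forall>s\<in>{0..t}. \<bar>?H s \<omega>\<bar> \<le> ?G \<omega> s"
      using AE_regular GX Efin
    proof eventually_elim
      case (elim \<omega>)
      have pdG: "pd i (Y r \<omega>) x = slope_at t (axis i 1) x r \<omega>" if "0 \<le> r" "r \<le> t" for r
        using pd_Y[OF elim(1) that] .
      have c: "continuous_on {0..t} (\<lambda>r. pd i (Y r \<omega>) x)"
      proof (subst continuous_on_cong[OF refl])
        show "pd i (Y r \<omega>) x = slope_at t (axis i 1) x r \<omega>" if "r \<in> {0..t}" for r using pdG that by simp
        show "continuous_on {0..t} (\<lambda>r. slope_at t (axis i 1) x r \<omega>)"
          by (rule continuous_on_subset[OF slope_at_continuous[OF elim(1)]]) auto
      qed
      have E': "(\<integral>\<^sup>+r. ennreal ((pd i (Y r \<omega>) x)\<^sup>2) * indicator {0..t} r \<partial>\<mu>q) = E \<omega>"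
        unfolding E_def
      proof (rule nn_integral_cong)
        fix r
        show "ennreal ((pd i (Y r \<omega>) x)\<^sup>2) * indicator {0..t} r = ennreal ((G \<omega> r)\<^sup>2) * indicator {0..t} r"
          using pdG[of r] elim(2) by (cases "r \<in> {0..t}") auto
      qed
      show ?case
      proof
        fix s assume s: "s \<in> {0..t}"
        have "ennreal ((?H s \<omega>)\<^sup>2) \<le> ennreal (qT t - qT 0) * (\<integral>\<^sup>+r. ennreal ((pd i (Y r \<omega>) x)\<^sup>2) *
          indicator {0..t} r \<partial>\<mu>q)"
          by (rule rs_integral_sq_le[OF _ _ c]) (use s bracket_eq in auto)
        also have "\<dots> = ennreal (qT t) * ennreal (enn2real (E \<omega>))"
          unfolding E' using elim(3) by (simp add: top.not_eq_extremum)
        also have "\<dots> = ennreal (qT t * enn2real (E \<omega>))" using q by (simp add: ennreal_mult)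
        finally have "(?H s \<omega>)\<^sup>2 \<le> qT t * enn2real (E \<omega>)" using q by (simp add: ennreal_le_iff)
        then show "\<bar>?H s \<omega>\<bar> \<le> ?G \<omega> s" by (rule real_le_rsqrt[OF order_eq_refl[THEN order_trans], OF power2_abs])
      qed
    qed
  qed
  also have "(\<integral>\<^sup>+\<omega>. (\<integral>\<^sup>+s. ennreal ((?G \<omega> s)\<^sup>2) * indicator {0..t} s \<partial>\<mu>q) \<partial>P)
    = (\<integral>\<^sup>+\<omega>. ennreal (qT t) * ennreal (enn2real (E \<omega>)) * emeasure \<mu>q {0..t} \<partial>P)"
    using q by (intro nn_integral_cong) (simp add: nn_integral_cmult_indicator ennreal_mult)
  also have "\<dots> = (\<integral>\<^sup>+\<omega>. ennreal (qT t) * E \<omega> * emeasure \<mu>q {0..t} \<partial>P)"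
    by (rule nn_integral_cong_AE) (use Efin in eventually_elim, simp add: top.not_eq_extremum)
  also have "\<dots> = ennreal (qT t) * (\<integral>\<^sup>+\<omega>. E \<omega> \<partial>P) * emeasure \<mu>q {0..t}"
    by (simp add: nn_integral_multc nn_integral_cmult)
  also have "4 * \<dots> \<le> 4 * (ennreal (qT t) * ennreal (qT t * qT t) * ennreal (qT t))"
    by (intro mult_left_mono mult_mono EI emeasure_q[OF t]) auto
  also have "\<dots> = ennreal (4 * (qT t * (qT t * qT t) * qT t))"
    using q by (simp add: ennreal_mult mult_ac)
  finally show ?thesis .
qed

end

section \<open>The mean of the Wick terms\<close>

lemma sets_torus [simp, measurable_cong]: "sets torus = sets borel"
  and space_torus [simp]: "space torus = UNIV"
  by (simp_all add: torus_def)

lemma prob_space_torus: "prob_space torus"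
  unfolding torus_def
proof (rule prob_space_uniform_measure)
  have "emeasure lborel (cbox 0 ((\<chi> i. 2 * pi) :: real^2))
    = ennreal (\<Prod>b\<in>Basis. (((\<chi> i. 2 * pi) :: real^2) - 0) \<bullet> b)"
    by (rule emeasure_lborel_cbox) (auto simp: Basis_vec_def inner_axis)
  also have "\<dots> > 0" by (auto simp: Basis_vec_def inner_axis intro!: prod_pos)
  finally show "emeasure lborel (cbox 0 ((\<chi> i. 2 * pi) :: real^2)) \<noteq> 0" by simp
  show "emeasure lborel (cbox 0 ((\<chi> i. 2 * pi) :: real^2)) \<noteq> \<infinity>"
    using emeasure_lborel_cbox_finite[of 0 "(\<chi> i. 2 * pi) :: real^2"] by simp
qed

interpretation torus: prob_space torus by (rule prob_space_torus)

lemma grad_nth [simp]: "grad g x $ i = pd i g x"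
  by (simp add: grad_def)

lemma norm_grad_sq: "(norm (grad g x))\<^sup>2 = (pd 1 g x)\<^sup>2 + (pd 2 g x)\<^sup>2"
  unfolding power2_norm_eq_inner grad_def by (simp add: inner_vec_def UNIV_2 power2_eq_square)

locale wick_field = gauss_field +
  fixes K L N Q :: ito_family and T :: real
  assumes iter: "iterated_integrals P Y K L N Q" and T: "0 < T"
begin

lemma T0: "0 \<le> T" using T by simp

lemma fields:
  assumes "i \<noteq> j"
  shows "ito_field P Y i (\<lambda>x s \<omega>. rs_integral (\<lambda>r. pd i (Y r \<omega>) x) (bracket P Y j j) s) (L i j)"
    and "ito_field P Y i (\<lambda>x s \<omega>. bracket P Y j j s) (N i j)" and "ito_field P Y i (N i j) (Q i j)"
  using iter assms unfolding iterated_integrals_def by blast+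

lemma L_bound: "i \<noteq> j \<Longrightarrow> (\<integral>\<^sup>+\<omega>. ennreal ((L i j x T \<omega>)\<^sup>2) \<partial>P) \<le> ennreal (4 * (qT T * (qT T * qT T) * qT T))"
  by (rule ito_field_rs_bound[OF fields(1) T0])

lemma Q_bound:
  assumes ij: "i \<noteq> j"
  shows "(\<integral>\<^sup>+\<omega>. ennreal ((Q i j x T \<omega>)\<^sup>2) \<partial>P) \<le> ennreal (4 * (4 * ((qT T)\<^sup>2 * qT T) * qT T))"
proof (rule ito_field_iterated_bound[OF fields(3)[OF ij] fields(2)[OF ij]])
  fix s assume s: "0 \<le> s" "s \<le> T"
  have "(\<integral>\<^sup>+\<omega>. ennreal ((N i j x s \<omega>)\<^sup>2) \<partial>P) \<le> ennreal (4 * ((qT T)\<^sup>2 * qT s))"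
  proof (rule ito_field_const_bound[OF fields(2)[OF ij] _ s(1)])
    fix r assume r: "0 \<le> r" "r \<le> s"
    show "\<bar>bracket P Y j j r\<bar> \<le> qT T"
      using bracket_eq[OF r(1), of j j] qT_nonneg[OF r(1)] qT_mono[OF r(1), of T] r s by simp
  qed
  also have "\<dots> \<le> ennreal (4 * ((qT T)\<^sup>2 * qT T))"
    using qT_mono[OF s] by (intro ennreal_leI mult_left_mono) auto
  finally show "(\<integral>\<^sup>+\<omega>. ennreal ((N i j x s \<omega>)\<^sup>2) \<partial>P) \<le> ennreal (4 * ((qT T)\<^sup>2 * qT T))" .
qed (use T qT_nonneg[OF T0] in auto)

lemma ito_field_mean:
  assumes "ito_field P Y j H I"
  shows "integrable P (I x T)" "(\<integral>\<omega>. I x T \<omega> \<partial>P) = 0"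
  using ito_setup.ito_mean_zero(2,3)[OF ito_field_setup[OF assms] T0] by auto

lemma ito_field_measurable:
  assumes "ito_field P Y j H I"
  shows "(\<lambda>(\<omega>, x). I x T \<omega>) \<in> borel_measurable (P \<Otimes>\<^sub>M borel)"
proof -
  have "(\<lambda>(x, \<omega>). I x T \<omega>) \<in> borel_measurable (borel \<Otimes>\<^sub>M P)" using assms T0 by (simp add: ito_field_def)
  from measurable_pair_swap[OF this] show ?thesis by (simp add: case_prod_beta')
qed

lemma slope_joint_measurable: "(\<lambda>(\<omega>, x). slope l x T \<omega>) \<in> borel_measurable (P \<Otimes>\<^sub>M borel)"
proof -
  have "(\<lambda>y. \<Sum>n\<in>freqs T \<inter> half_space. - 2 * (l \<bullet> rvec n) *
      (sin (snd y \<bullet> rvec n) * Re (W n T (fst y)) + cos (snd y \<bullet> rvec n) * Im (W n T (fst y)))) \<in>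
        borel_measurable (P \<Otimes>\<^sub>M borel)"
  proof (rule borel_measurable_sum)
    fix n assume "n \<in> freqs T \<inter> half_space"
    then have n: "n \<noteq> 0" by (auto simp: freqs_def)
    have [measurable]: "(\<lambda>\<omega>. Re (W n T \<omega>)) \<in> borel_measurable P" "(\<lambda>\<omega>. Im (W n T \<omega>)) \<in> borel_measurable P"
      using Wc_measurable[of "(n, True)" T] Wc_measurable[of "(n, False)" T] n T0
        by (simp_all add: Wc_def[abs_def])
    have [measurable]: "(\<lambda>x. sin (x \<bullet> rvec n)) \<in> borel_measurable borel" "(\<lambda>x. cos (x \<bullet> rvec n))
      \<in> borel_measurable borel"
      by (intro borel_measurable_continuous_onI continuous_intros)+
    show "(\<lambda>y. - 2 * (l \<bullet> rvec n) * (sin (snd y \<bullet> rvec n) * Re (W n T (fst y))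
      + cos (snd y \<bullet> rvec n) * Im (W n T (fst y))))
      \<in> borel_measurable (P \<Otimes>\<^sub>M borel)" by measurable
  qed
  then show ?thesis unfolding slope_def slope_eq by (simp add: case_prod_beta')
qed

lemma slope_moments:
  shows "integrable P (\<lambda>\<omega>. (slope l x T \<omega>) ^ k)"
    and "(\<integral>\<omega>. (slope l x T \<omega>)\<^sup>2 \<partial>P) = (l \<bullet> l) * qT T"
    and "(\<integral>\<omega>. (slope l x T \<omega>) ^ 4 \<partial>P) = 3 * ((l \<bullet> l) * qT T)\<^sup>2"
proof -
  interpret S: gauss_martingale P Filt "slope l x" "\<lambda>t. (l \<bullet> l) * qT t" by (rule slope_gauss)
  show "integrable P (\<lambda>\<omega>. (slope l x T \<omega>) ^ k)" "(\<integral>\<omega>. (slope l x T \<omega>)\<^sup>2 \<partial>P) = (l \<bullet> l) * qT T"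
    "(\<integral>\<omega>. (slope l x T \<omega>) ^ 4 \<partial>P) = 3 * ((l \<bullet> l) * qT T)\<^sup>2"
    using S.incr_moments[OF order_refl T0] by (simp_all add: slope_0)
qed

text \<open>The part of the renormalised integrand that does not involve the drift, to be removed
  from the expectation. It is formed from derivatives of \<open>Y\<close> itself, so it gets a
  separate version built from finite sums of modes.\<close>

definition wick_rest :: "path \<Rightarrow> real^2 \<Rightarrow> real" where
  "wick_rest \<omega> x = wick4 P Y K L Q T \<omega> x - 2 * wick2_trace P Y T \<omega> x"

text \<open>
  Polarisation writes $|y|^4$ through fourth powers of linear forms, so that only the moments of
  one-dimensional Gaussians enter the computation of the mean.
\<close>

definition wick_rest' :: "path \<Rightarrow> real^2 \<Rightarrow> real" where
  "wick_rest' \<omega> x = (let e1 = axis 1 1; e2 = axis 2 1 in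
     2/3 * (slope e1 x T \<omega> ^ 4 + slope e2 x T \<omega> ^ 4)
     + 1/6 * (slope (e1 + e2) x T \<omega> ^ 4 + slope (e1 - e2) x T \<omega> ^ 4)
     - (8 * qT T + 2) * ((slope e1 x T \<omega>)\<^sup>2 + (slope e2 x T \<omega>)\<^sup>2) + (8 * (qT T)\<^sup>2 + 4 * qT T)
     - 8 * (L 1 2 x T \<omega> + Q 1 2 x T \<omega> + L 2 1 x T \<omega> + Q 2 1 x T \<omega>))"

lemma wick_rest_eq:
  assumes r: "regular \<omega>"
  shows "wick_rest \<omega> x = wick_rest' \<omega> x"
proof -
  let ?y1 = "slope (axis 1 1) x T \<omega>" and ?y2 = "slope (axis 2 1) x T \<omega>"
  have y: "pd j (Y T \<omega>) x = slope (axis j 1) x T \<omega>" for j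
    using pd_Y[OF r T0 order_refl] by (simp add: slope_def)
  have n: "norm (grad (Y T \<omega>) x) ^ 4 = (?y1\<^sup>2 + ?y2\<^sup>2)\<^sup>2"
  proof -
    have "norm (grad (Y T \<omega>) x) ^ 4 = ((norm (grad (Y T \<omega>) x))\<^sup>2)\<^sup>2" by (simp add: power_mult[symmetric])
    then show ?thesis unfolding norm_grad_sq y .
  qed
  \<comment> \<open>The mixed bracket is 0 at all times in [0, T], hence so is every
    Riemann-Stieltjes sum against it.\<close>
  have rs: "rs_integral g (bracket P Y 1 2) T = 0" for g
    by (rule rs_integral_0[OF T0]) (simp add: bracket_eq)
  show ?thesis
    unfolding wick_rest_def wick_rest'_def wick4_def wick2_trace_def wick2_def a_T_def n rs Let_def
      bracket_eq[OF T0] grad_nth y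
      slope_add slope_diff
    by (simp add: UNIV_2 bracket_eq[OF T0] y power2_eq_square power4_eq_xxxx algebra_simps)
qed

text \<open>The torus has total mass 1, so by Tonelli a first moment bound uniform in
  \<open>x\<close> bounds the integral over the product space.\<close>

lemma integrable_field:
  assumes f[measurable]: "case_prod f \<in> borel_measurable (P \<Otimes>\<^sub>M borel)"
    and bound: "\<And>x. (\<integral>\<^sup>+\<omega>. ennreal \<bar>f \<omega> x\<bar> \<partial>P) \<le> ennreal C"
  shows "integrable (P \<Otimes>\<^sub>M torus) (case_prod f)"
proof (rule integrableI_bounded)
  interpret pair_sigma_finite P torus ..
  have sets_eq: "sets (P \<Otimes>\<^sub>M torus) = sets (P \<Otimes>\<^sub>M borel)" by (intro sets_pair_measure_cong) auto
  show m: "case_prod f \<in> borel_measurable (P \<Otimes>\<^sub>M torus)" using f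
    by (simp add: measurable_cong_sets[OF sets_eq refl])
  have "(\<integral>\<^sup>+y. ennreal (norm (case_prod f y)) \<partial>(P \<Otimes>\<^sub>M torus)) = (\<integral>\<^sup>+x. (\<integral>\<^sup>+\<omega>. ennreal \<bar>f \<omega> x\<bar> \<partial>P) \<partial>torus)"
    by (subst nn_integral_snd[symmetric]) (use m in \<open>auto simp: case_prod_beta'\<close>)
  also have "\<dots> \<le> (\<integral>\<^sup>+x. ennreal C \<partial>torus)" by (intro nn_integral_mono bound)
  also have "\<dots> < \<infinity>" using torus.emeasure_space_1 by (simp add: ennreal_mult_less_top)
  finally show "(\<integral>\<^sup>+y. ennreal (norm (case_prod f y)) \<partial>(P \<Otimes>\<^sub>M torus)) < \<infinity>" .
qed

lemma integrable_slope_power: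
  assumes "k = 2 \<or> k = 4"
  shows "integrable (P \<Otimes>\<^sub>M torus) (\<lambda>(\<omega>, x). (slope l x T \<omega>) ^ k)"
proof (rule integrable_field)
  show "(\<lambda>(\<omega>, x). (slope l x T \<omega>) ^ k) \<in> borel_measurable (P \<Otimes>\<^sub>M borel)"
  proof -
    have "(\<lambda>y. slope l (snd y) T (fst y)) \<in> borel_measurable (P \<Otimes>\<^sub>M borel)"
      using slope_joint_measurable[of l] by (simp add: case_prod_beta')
    from borel_measurable_power[OF this] show ?thesis by (simp add: case_prod_beta')
  qed
  fix x
  have "(\<integral>\<^sup>+\<omega>. ennreal \<bar>slope l x T \<omega> ^ k\<bar> \<partial>P) = (\<integral>\<^sup>+\<omega>. ennreal (slope l x T \<omega> ^ k) \<partial>P)"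
    using assms by (intro nn_integral_cong) (auto simp: power_even_abs)
  also have "\<dots> = ennreal (\<integral>\<omega>. slope l x T \<omega> ^ k \<partial>P)"
    using assms by (intro nn_integral_eq_integral slope_moments(1)) auto
  \<comment> \<open>The sum of the second and the fourth moment bounds both admissible powers at
    once.\<close>
  also have "\<dots> \<le> ennreal ((l \<bullet> l) * qT T + 3 * ((l \<bullet> l) * qT T)\<^sup>2)"
    using assms slope_moments(2,3)[of l x] qT_nonneg[OF T0] by (intro ennreal_leI) auto
  finally show "(\<integral>\<^sup>+\<omega>. ennreal \<bar>slope l x T \<omega> ^ k\<bar> \<partial>P) \<le> ennreal ((l \<bullet> l) * qT T + 3 * ((l \<bullet> l) * qT T)\<^sup>2)" .
qed

lemma integrable_ito_field:
  assumes I: "ito_field P Y j H I" and b: "\<And>x. (\<integral>\<^sup>+\<omega>. ennreal ((I x T \<omega>)\<^sup>2) \<partial>P) \<le> ennreal C" and C: "0 \<le> C"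
  shows "integrable (P \<Otimes>\<^sub>M torus) (\<lambda>(\<omega>, x). I x T \<omega>)"
proof (rule integrable_field[OF ito_field_measurable[OF I]])
  fix x
  have [measurable]: "I x T \<in> borel_measurable P" using ito_field_mean(1)[OF I, of x] by simp
  have "(\<integral>\<^sup>+\<omega>. ennreal \<bar>I x T \<omega>\<bar> \<partial>P) \<le> (\<integral>\<^sup>+\<omega>. 1 + ennreal ((I x T \<omega>)\<^sup>2) \<partial>P)"
  proof (rule nn_integral_mono)
    fix \<omega>
    have "0 \<le> (\<bar>I x T \<omega>\<bar> - 1)\<^sup>2" by simp
    then have "2 * \<bar>I x T \<omega>\<bar> \<le> 1 + (I x T \<omega>)\<^sup>2" by (simp add: power2_diff)
    then have "\<bar>I x T \<omega>\<bar> \<le> 1 + (I x T \<omega>)\<^sup>2" by linarith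
    from ennreal_leI[OF this] show "ennreal \<bar>I x T \<omega>\<bar> \<le> 1 + ennreal ((I x T \<omega>)\<^sup>2)" by (simp add: ennreal_plus)
  qed
  also have "\<dots> = 1 + (\<integral>\<^sup>+\<omega>. ennreal ((I x T \<omega>)\<^sup>2) \<partial>P)" by (simp add: nn_integral_add emeasure_space_1)
  also have "\<dots> \<le> 1 + ennreal C" by (intro add_left_mono b)
  also have "\<dots> = ennreal (1 + C)" using C by (simp add: ennreal_plus)
  finally show "(\<integral>\<^sup>+\<omega>. ennreal \<bar>I x T \<omega>\<bar> \<partial>P) \<le> ennreal (1 + C)" .
qed

lemma wick_rest'_integrable: "integrable (P \<Otimes>\<^sub>M torus) (\<lambda>(\<omega>, x). wick_rest' \<omega> x)"
proof -
  interpret pair_prob_space P torus ..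
  have L: "integrable (P \<Otimes>\<^sub>M torus) (\<lambda>y. L i j (snd y) T (fst y))" if "i \<noteq> j" for i j
    using integrable_ito_field[OF fields(1)[OF that] L_bound[OF that]] qT_nonneg[OF T0]
      by (simp add: case_prod_beta')
  have Q: "integrable (P \<Otimes>\<^sub>M torus) (\<lambda>y. Q i j (snd y) T (fst y))" if "i \<noteq> j" for i j
    using integrable_ito_field[OF fields(3)[OF that] Q_bound[OF that]] qT_nonneg[OF T0]
      by (simp add: case_prod_beta')
  have S: "integrable (P \<Otimes>\<^sub>M torus) (\<lambda>y. (slope l (snd y) T (fst y)) ^ 4)" "integrable (P \<Otimes>\<^sub>M torus)
    (\<lambda>y. (slope l (snd y) T (fst y))\<^sup>2)" for l
    using integrable_slope_power[of 4 l] integrable_slope_power[of 2 l] by (simp_all add: case_prod_beta')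
  show ?thesis
    unfolding wick_rest'_def Let_def case_prod_beta'
    by (intro Bochner_Integration.integrable_add Bochner_Integration.integrable_diff
      integrable_mult_right S L Q P.integrable_const) auto
qed

text \<open>With q the bracket at T, the fourth powers contribute 4 q^2 from the axes and 4 q^2 from
  the diagonals, where the squared length 2 quadruples the moment. The squares contribute -(8 q + 2)
  2 q, and the constant 8 q^2 + 4 q balances the sum; the iterated integrals are centred.\<close>

lemma wick_rest'_mean: "(\<integral>\<omega>. wick_rest' \<omega> x \<partial>P) = 0"
proof -
  have L: "integrable P (L i j x T)" "(\<integral>\<omega>. L i j x T \<omega> \<partial>P) = 0" if "i \<noteq> j" for i j
    using ito_field_mean[OF fields(1)[OF that]] by auto
  have Q: "integrable P (Q i j x T)" "(\<integral>\<omega>. Q i j x T \<omega> \<partial>P) = 0" if "i \<noteq> j" for i j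
    using ito_field_mean[OF fields(3)[OF that]] by auto
  have e: "axis 1 1 \<bullet> (axis 1 1 :: real^2) = 1" "axis 2 1 \<bullet> (axis 2 1 :: real^2) = 1"
    "(axis 1 1 + axis 2 1) \<bullet> (axis 1 1 + axis 2 1 :: real^2)
      = 2" "(axis 1 1 - axis 2 1) \<bullet> (axis 1 1 - axis 2 1 :: real^2) = 2"
    by (simp_all add: inner_axis_axis inner_add_left inner_add_right inner_diff_left inner_diff_right)
  show ?thesis
    unfolding wick_rest'_def Let_def
    using slope_moments(1)[of _ x] L Q
    by (simp add: slope_moments(2,3) e prob_space) (simp add: power2_eq_square algebra_simps)
qed

text \<open>Measurability in \<omega> is obtained for the version made of finitely many modes.
  Equality of the two integrands as functions of \<open>x\<close> holds on a single almost sure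
  event, so it survives the integration over the torus.\<close>

lemma wick_rest_torus:
  shows "AE \<omega> in P. integrable torus (wick_rest \<omega>)"
    and "\<exists>R. integrable P R \<and> (\<integral>\<omega>. R \<omega> \<partial>P) = 0 \<and> (AE \<omega> in P. (\<integral>x. wick_rest \<omega> x \<partial>torus) = R \<omega>)"
proof -
  interpret pair_sigma_finite P torus ..
  let ?f = "\<lambda>(\<omega>, x). wick_rest' \<omega> x"
  have i: "integrable (P \<Otimes>\<^sub>M torus) ?f" by (rule wick_rest'_integrable)
  have eq: "AE \<omega> in P. wick_rest \<omega> = wick_rest' \<omega>"
    using AE_regular by eventually_elim (intro ext wick_rest_eq)
  show "AE \<omega> in P. integrable torus (wick_rest \<omega>)"
    using AE_integrable_fst'[OF i] eq by eventually_elim simp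
  show "\<exists>R. integrable P R \<and> (\<integral>\<omega>. R \<omega> \<partial>P) = 0 \<and> (AE \<omega> in P. (\<integral>x. wick_rest \<omega> x \<partial>torus) = R \<omega>)"
  proof (intro exI[of _ "\<lambda>\<omega>. \<integral>x. wick_rest' \<omega> x \<partial>torus"] conjI)
    show "integrable P (\<lambda>\<omega>. \<integral>x. wick_rest' \<omega> x \<partial>torus)" using integrable_fst'[OF i] by simp
    have "(\<integral>\<omega>. (\<integral>x. wick_rest' \<omega> x \<partial>torus) \<partial>P) = (\<integral>x. (\<integral>\<omega>. wick_rest' \<omega> x \<partial>P) \<partial>torus)"
      using Fubini_integral[OF i] by simp
    then show "(\<integral>\<omega>. (\<integral>x. wick_rest' \<omega> x \<partial>torus) \<partial>P) = 0" by (simp add: wick_rest'_mean)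
    show "AE \<omega> in P. (\<integral>x. wick_rest \<omega> x \<partial>torus) = (\<integral>x. wick_rest' \<omega> x \<partial>torus)"
      using eq by eventually_elim simp
  qed
qed

end

section \<open>Trigonometric polynomials on the torus\<close>

text \<open>Lebesgue measure is the image of a product measure under expansion in the coordinate
  basis, so a product of functions of single coordinates integrates factor by factor.\<close>

lemma integral_lborel_prod:
  fixes h :: "'a::euclidean_space \<Rightarrow> real \<Rightarrow> complex"
  assumes h: "\<And>b. b \<in> Basis \<Longrightarrow> integrable lborel (h b)"
  shows "(\<integral>x. (\<Prod>b\<in>Basis. h b (x \<bullet> b)) \<partial>lborel) = (\<Prod>b\<in>Basis. \<integral>t. h b t \<partial>lborel)"
proof -
  interpret product_sigma_finite "\<lambda>_ :: 'a. lborel :: real measure" ..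
  have m: "(\<lambda>f. \<Sum>b\<in>Basis. f b *\<^sub>R b) \<in> measurable (\<Pi>\<^sub>M b\<in>(Basis :: 'a set). lborel) borel"
    by measurable
  have hm [measurable]: "h b \<in> borel_measurable borel" if "b \<in> Basis" for b using h[OF that] by auto
  have "(\<integral>x. (\<Prod>b\<in>Basis. h b (x \<bullet> b)) \<partial>lborel)
    = (\<integral>f. (\<Prod>b\<in>Basis. h b ((\<Sum>b\<in>Basis. f b *\<^sub>R b) \<bullet> b)) \<partial>(\<Pi>\<^sub>M b\<in>(Basis :: 'a set). lborel))"
    unfolding lborel_def[where 'a='a] lborel_eq_real[symmetric]
    by (rule integral_distr[OF m]) (intro borel_measurable_prod, measurable)
  also have "\<dots> = (\<integral>f. (\<Prod>b\<in>Basis. h b (f b)) \<partial>(\<Pi>\<^sub>M b\<in>(Basis :: 'a set). lborel))"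
    by (intro Bochner_Integration.integral_cong prod.cong) (auto simp: inner_sum_left inner_Basis
      if_distrib cong: if_cong)
  also have "\<dots> = (\<Prod>b\<in>Basis. \<integral>t. h b t \<partial>lborel)"
    by (rule product_integral_prod) (auto intro: h)
  finally show ?thesis .
qed

lemma integral_cis_period:
  fixes k :: int
  shows "integrable lborel (\<lambda>t. indicator {0..2 * pi} t *\<^sub>R cis (of_int k * t))"
    and "(\<integral>t. indicator {0..2 * pi} t *\<^sub>R cis (of_int k * t) \<partial>lborel) = (if k = 0 then 2 * pi else 0)"
proof -
  define f where "f = (\<lambda>t. if k = 0 then of_real t else cis (of_int k * t) / (\<i> * of_int k))"
  have "has_bochner_integral lborel (\<lambda>t. indicator {0..2 * pi} t *\<^sub>R cis (of_int k * t)) (f (2 * pi) - f 0)"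
  proof (rule has_bochner_integral_FTC_Icc)
    fix t :: real
    show "(f has_vector_derivative cis (of_int k * t)) (at t within {0..2 * pi})"
    proof (cases "k = 0")
      case True
      then show ?thesis unfolding f_def by (auto intro!: derivative_eq_intros)
    next
      case False
      have e: "cis (of_int k * t) = exp (\<i> * of_int k * of_real t)" for t by (simp add: cis_conv_exp mult_ac)
      have "((\<lambda>t. exp (\<i> * of_int k * of_real t) / (\<i> * of_int k)) has_vector_derivative exp (\<i> * of_int
        k * of_real t)) (at t within {0..2 * pi})"
      proof (rule has_vector_derivative_real_field)
        show "((\<lambda>z. exp (\<i> * of_int k * z) / (\<i> * of_int k)) has_field_derivative exp (\<i> * of_int k *
          of_real t)) (at (of_real t))"
          using False by (auto intro!: derivative_eq_intros)
      qed
      then show ?thesis using False unfolding f_def e by simp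
    qed
  next
    show "continuous_on {0..2 * pi} (\<lambda>t. cis (of_int k * t))" by (intro continuous_intros)
  qed simp
  moreover have "f (2 * pi) - f 0 = (if k = 0 then 2 * pi else 0)"
    using cis_multiple_2pi[of "of_int k"] by (simp add: f_def mult_ac)
  ultimately show "integrable lborel (\<lambda>t. indicator {0..2 * pi} t *\<^sub>R cis (of_int k * t))"
    "(\<integral>t. indicator {0..2 * pi} t *\<^sub>R cis (of_int k * t) \<partial>lborel) = (if k = 0 then 2 * pi else 0)"
    by (simp_all add: has_bochner_integral_iff)
qed

abbreviation "period_cell \<equiv> cbox 0 ((\<chi> i. 2 * pi) :: real^2)"

lemma Basis_2: "(Basis :: (real^2) set) = {axis 1 1, axis 2 1}"
  by (auto simp: Basis_vec_def UNIV_2)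

lemma axis_neq: "axis 1 1 \<noteq> (axis 2 1 :: real^2)"
  by (simp add: axis_eq_axis)

lemma emeasure_cell: "emeasure lborel period_cell = ennreal (4 * pi\<^sup>2)"
proof -
  have "emeasure lborel period_cell = ennreal (\<Prod>b\<in>Basis. (((\<chi> i. 2 * pi) :: real^2) - 0) \<bullet> b)"
    by (rule emeasure_lborel_cbox) (auto simp: Basis_vec_def inner_axis)
  also have "(\<Prod>b\<in>Basis. (((\<chi> i. 2 * pi) :: real^2) - 0) \<bullet> b) = 4 * pi\<^sup>2"
    by (simp add: Basis_2 axis_neq inner_axis power2_eq_square)
  finally show ?thesis .
qed

lemma torus_density: "torus = density lborel (\<lambda>x. ennreal (indicator period_cell x / (4 * pi\<^sup>2)))"
  unfolding torus_def uniform_measure_def emeasure_cell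
  by (intro density_cong) (auto simp: indicator_def divide_ennreal simp flip: ennreal_1)

text \<open>The period cell is a product of intervals and the mode a product of one-dimensional
  characters; the factor 4 pi^2 of the cell is cancelled by the normalisation.\<close>

lemma integral_fourier_mode: "(\<integral>x. fourier_mode n x \<partial>torus) = (if n = 0 then 1 else 0)"
proof -
  have fm: "fourier_mode n \<in> borel_measurable borel"
    unfolding fourier_mode_def[abs_def] by (intro borel_measurable_continuous_onI continuous_intros)
  let ?h = "\<lambda>b t. indicator {0..2 * pi} t *\<^sub>R cis (of_int (if b = (axis 1 1 :: real^2) then n $ 1 else n $ 2) * t)"
  have "(\<integral>x. fourier_mode n x \<partial>torus) = (\<integral>x. (indicator period_cell x / (4 * pi\<^sup>2)) *\<^sub>R fourier_mode n x \<partial>lborel)"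
    unfolding torus_density by (rule integral_density) (use fm in auto)
  also have "\<dots> = (\<integral>x. (\<Prod>b\<in>Basis. ?h b (x \<bullet> b)) / (4 * pi\<^sup>2) \<partial>lborel)"
  proof (rule Bochner_Integration.integral_cong[OF refl])
    fix x :: "real^2"
    have c: "indicator period_cell x = indicat_real {0..2 * pi} (x $ 1) * indicat_real {0..2 * pi} (x $ 2)"
      by (auto simp: indicator_def mem_box_cart forall_2)
    have f: "fourier_mode n x = cis (of_int (n $ 1) * (x $ 1)) * cis (of_int (n $ 2) * (x $ 2))"
      by (simp add: fourier_mode_def inner_vec_def UNIV_2 cis_mult mult.commute)
    show "(indicator period_cell x / (4 * pi\<^sup>2)) *\<^sub>R fourier_mode n x = (\<Prod>b\<in>Basis. ?h b (x \<bullet> b)) / (4 * pi\<^sup>2)"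
      unfolding c f by (simp add: Basis_2 axis_neq axis_neq[symmetric] inner_axis scaleR_conv_of_real)
  qed
  also have "\<dots> = (\<Prod>b\<in>Basis. \<integral>t. ?h b t \<partial>lborel) / (4 * pi\<^sup>2)"
    by (subst integral_divide_zero, subst integral_lborel_prod) (auto intro: integral_cis_period(1))
  also have "\<dots> = (if n = 0 then 1 else 0)"
  proof -
    have "n = 0 \<longleftrightarrow> n $ 1 = 0 \<and> n $ 2 = 0" by (simp add: vec_eq_iff forall_2)
    then show ?thesis
      unfolding integral_cis_period(2)
      by (simp add: Basis_2 axis_neq axis_neq[symmetric] power2_eq_square)
  qed
  finally show ?thesis .
qed

lemma norm_fourier_mode [simp]: "norm (fourier_mode n x) = 1"
  by (simp add: fourier_mode_def)

lemma continuous_fourier_mode: "continuous_on A (fourier_mode n)"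
  unfolding fourier_mode_def[abs_def] by (intro continuous_intros)

lemma fourier_mode_measurable [measurable]: "fourier_mode n \<in> borel_measurable borel"
  by (rule borel_measurable_continuous_onI[OF continuous_fourier_mode])

lemma fourier_mode_mult_cnj: "fourier_mode n x * cnj (fourier_mode m x) = fourier_mode (n - m) x"
proof -
  have "rvec (n - m) = rvec n - rvec m" by (simp add: vec_eq_iff)
  then show ?thesis by (simp add: fourier_mode_def cis_cnj cis_mult inner_diff_right)
qed

lemma fourier_mode_cnj: "cnj (fourier_mode n x) = fourier_mode (- n) x"
  by (simp add: fourier_mode_def cis_cnj rvec_uminus)

lemma integrable_fourier_mode: "integrable torus (fourier_mode n)"
  by (rule torus.integrable_const_bound[where B=1]) auto

text \<open>\<open>trig_poly\<close> takes a real part and \<open>N\<close> and \<open>c\<close> may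
  be arbitrary, so each coefficient is split evenly between its frequency and the opposite one. For
  a symmetric family the halves recombine to \<open>c m\<close>.\<close>

lemma fourier_coeff_trig_poly:
  assumes "finite N"
  shows "fourier_coeff (trig_poly N c) m = (if m \<in> N then c m / 2 else 0) + (if - m
    \<in> N then cnj (c (- m)) / 2 else 0)"
proof -
  have "of_real (trig_poly N c x) * cnj (fourier_mode m x)
      = (\<Sum>n\<in>N. c n / 2 * fourier_mode (n - m) x + cnj (c n) / 2 * fourier_mode (- n - m) x)" for x
  proof -
    let ?S = "\<Sum>n\<in>N. c n * fourier_mode n x"
    have "of_real (Re S) = (S + cnj S) / 2" for S :: complex by (simp add: complex_eq_iff)
    then have "of_real (Re ?S) = (?S + cnj ?S) / 2" .
    also have "\<dots> = (\<Sum>n\<in>N. c n / 2 * fourier_mode n x + cnj (c n) / 2 * fourier_mode (- n) x)"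
      by (simp add: sum_divide_distrib[symmetric] sum.distrib fourier_mode_cnj add_divide_distrib)
    finally show ?thesis
      unfolding trig_poly_def
      by (simp add: sum_distrib_right distrib_right mult.assoc fourier_mode_mult_cnj)
  qed
  then have "fourier_coeff (trig_poly N c) m
    = (\<integral>x. (\<Sum>n\<in>N. c n / 2 * fourier_mode (n - m) x + cnj (c n) / 2 * fourier_mode (- n - m) x) \<partial>torus)"
    unfolding fourier_coeff_def by simp
  also have "\<dots> = (\<Sum>n\<in>N. c n / 2 * (if n = m then 1 else 0) + cnj (c n) / 2 * (if n = - m then 1 else 0))"
    by (subst Bochner_Integration.integral_sum)
      (auto intro!: sum.cong Bochner_Integration.integrable_add integrable_mult_right integrable_fourier_mode
        simp: integrable_fourier_mode integral_fourier_mode eq_neg_iff_add_eq_0 neg_eq_iff_add_eq_0 add.commute)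
  also have "\<dots> = (if m \<in> N then c m / 2 else 0) + (if - m \<in> N then cnj (c (- m)) / 2 else 0)"
    using assms by (simp add: sum.distrib if_distrib[where f="\<lambda>x. _ * x"] cong: if_cong)
  finally show ?thesis .
qed

lemma smooth_trig_poly: "smooth_torus (trig_poly N c)"
proof -
  have per: "fourier_mode n (x + axis i (2 * pi)) = fourier_mode n x" for n x i
    using cis_multiple_2pi[of "of_int (n $ i)"]
    by (simp add: fourier_mode_def inner_add_left inner_axis' cis_mult[symmetric] mult_ac)
  have "\<exists>d. foldr pd is (trig_poly N c) = trig_poly N d" for "is"
    by (induction "is") (auto simp: pd_trig_poly)
  moreover have "trig_poly N d differentiable_on UNIV" for d
    unfolding differentiable_on_def differentiable_def using trig_poly_has_derivative by blast
  ultimately have "\<forall>is. foldr pd is (trig_poly N c) differentiable_on UNIV" by metis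
  then show ?thesis unfolding smooth_torus_def periodic_def trig_poly_def by (simp add: per)
qed

section \<open>Continuity of f along trigonometric polynomials\<close>

lemma trig_poly_in_besov: "fourier_coeff (trig_poly N c) \<in> besov_closure \<theta> \<alpha>"
proof -
  have "fourier_coeff g (- n) = cnj (fourier_coeff g n)" for g n
  proof -
    have "cnj (fourier_coeff g n) = (\<integral>x. cnj (of_real (g x) * cnj (fourier_mode n x)) \<partial>torus)"
      unfolding fourier_coeff_def by (rule Bochner_Integration.integral_cnj[symmetric])
    then show ?thesis by (simp add: fourier_coeff_def fourier_mode_cnj del: Bochner_Integration.integral_cnj)
  qed
  then have "real_coeffs (fourier_coeff g)" for g by (simp add: real_coeffs_def)
  moreover have "besov_norm \<theta> \<alpha> (\<lambda>_. 0) = 0"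
    unfolding besov_norm_def lp_block_def by simp
  ultimately show ?thesis
    unfolding besov_closure_def using smooth_trig_poly[of N c] by (auto intro!: exI[of _ "trig_poly N c"])
qed

text \<open>Only finitely many dyadic blocks meet a finite set of frequencies, and each block
  multiplier is bounded by 1. The Besov norm is then dominated by the finitely many coefficients,
  which turns continuity in that norm into continuity in the coefficients.\<close>

lemma besov_norm_finite_le:
  assumes \<theta>: "cutoff \<theta>" and N: "finite N"
  shows "\<exists>B\<ge>0. \<forall>e. (\<forall>n. n \<notin> N \<longrightarrow> e n = 0) \<longrightarrow> besov_norm \<theta> \<alpha> e \<le> ennreal (B * (\<Sum>n\<in>N. cmod (e n)))"
proof -
  obtain r where r: "\<And>n. n \<in> N \<Longrightarrow> norm (rvec n) \<le> r" "0 \<le> r"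
  proof
    show "norm (rvec n) \<le> (\<Sum>n\<in>N. norm (rvec n))" if "n \<in> N" for n
      using N that by (intro member_le_sum) auto
  qed (auto intro: sum_nonneg)
  \<comment> \<open>Beyond \<open>k\<close> both dilated cutoffs in a block symbol are evaluated
    below 1/2, where the cutoff is 1, so their difference vanishes.\<close>
  obtain k :: nat where k: "2 * r < 2 ^ k" using real_arch_pow[of 2 "2 * r"] by auto
  have th: "0 \<le> \<theta> s" "\<theta> s \<le> 1" if "0 \<le> s" for s using \<theta> that by (auto simp: cutoff_def)
  have th1: "\<theta> s = 1" if "0 \<le> s" "s \<le> 1/2" for s using \<theta> that by (auto simp: cutoff_def)
  have sym: "\<bar>lp_symbol \<theta> j \<xi>\<bar> \<le> 1" for j \<xi>
    using th[of "norm \<xi>"] th[of "norm \<xi> / 2 ^ j"] th[of "norm \<xi> / 2 ^ (j - 1)"]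
      by (auto simp: lp_symbol_def abs_le_iff)
  have van: "lp_symbol \<theta> j (rvec n) = 0" if j: "k < j" and n: "n \<in> N" for j n
  proof -
    have small: "norm (rvec n) / 2 ^ i \<le> 1/2" if "k \<le> i" for i
    proof -
      have "2 * norm (rvec n) \<le> 2 ^ k" using r(1)[OF n] k by simp
      also have "\<dots> \<le> (2::real) ^ i" using that by (intro power_increasing) auto
      finally show ?thesis by (simp add: field_simps)
    qed
    show ?thesis using j th1[OF _ small[of j]] th1[OF _ small[of "j - 1"]] by (simp add: lp_symbol_def)
  qed
  \<comment> \<open>The sum of the weights of the relevant blocks dominates each of them, whatever
    the sign of \<alpha>.\<close>
  define B where "B = (\<Sum>j\<le>k. 2 powr (\<alpha> * (real j - 1)))"
  have B: "0 \<le> B" by (simp add: B_def sum_nonneg)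
  show ?thesis
  proof (intro exI[of _ B] conjI allI impI B)
    fix e :: "int^2 \<Rightarrow> complex" assume e: "\<forall>n. n \<notin> N \<longrightarrow> e n = 0"
    let ?E = "\<Sum>n\<in>N. cmod (e n)"
    have E0: "0 \<le> ?E" by (simp add: sum_nonneg)
    have blk: "lp_block \<theta> j e x = (\<Sum>n\<in>N. of_real (lp_symbol \<theta> j (rvec n)) * e n * fourier_mode n x)" for j x
    proof -
      have "lp_block \<theta> j e x = (\<Sum>\<^sub>\<infinity>n\<in>N. of_real (lp_symbol \<theta> j (rvec n)) * e n * fourier_mode n x)"
        unfolding lp_block_def by (rule infsum_cong_neutral) (use e in auto)
      then show ?thesis using N by simp
    qed
    have b1: "cmod (lp_block \<theta> j e x) \<le> ?E" for j x
      unfolding blk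
    proof (rule order_trans[OF norm_sum sum_mono])
      fix n show "cmod (of_real (lp_symbol \<theta> j (rvec n)) * e n * fourier_mode n x) \<le> cmod (e n)"
        using mult_right_mono[OF sym[of j "rvec n"], of "cmod (e n)"] by (simp add: norm_mult)
    qed
    show "besov_norm \<theta> \<alpha> e \<le> ennreal (B * ?E)"
      unfolding besov_norm_def
    proof (rule SUP_least)
      fix j
      show "ennreal (2 powr (\<alpha> * (real j - 1))) * (SUP x. ennreal (cmod (lp_block \<theta> j e x))) \<le> ennreal (B * ?E)"
      proof (cases "j \<le> k")
        case True
        have "2 powr (\<alpha> * (real j - 1)) \<le> B" unfolding B_def using True by (intro member_le_sum) auto
        then have "ennreal (2 powr (\<alpha> * (real j - 1))) * (SUP x. ennreal (cmod (lp_block \<theta> j e x)))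
          \<le> ennreal B * ennreal ?E"
          by (intro mult_mono ennreal_leI SUP_least b1) auto
        then show ?thesis using B E0 by (simp add: ennreal_mult)
      next
        case False
        then have "lp_block \<theta> j e x = 0" for x unfolding blk using van by (intro sum.neutral) auto
        then show ?thesis by simp
      qed
    qed
  qed
qed

text \<open>The function f is continuous only in a Besov norm on coefficient families. Composed with
  finitely many coefficients it is continuous in the product topology, and this makes f of the
  random field measurable after almost sure replacement.\<close>

lemma continuous_f_trig_poly:
  assumes f: "continuous_linear_growth \<theta> \<alpha> f" and \<theta>: "cutoff \<theta>" and N: "finite N" "uminus ` N = N"
  shows "continuous_on UNIV (\<lambda>c. f (fourier_coeff (trig_poly N c)))"
proof -
  obtain B where B: "0 \<le> B" "\<And>e. (\<And>n. n \<notin> N \<Longrightarrow> e n = 0) \<Longrightarrow> besov_norm \<theta> \<alpha> e \<le> ennreal (B * (\<Sum>n\<in>N. cmod (e n)))"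
    using besov_norm_finite_le[OF \<theta> N(1)] by blast
  have sym: "- n \<in> N \<longleftrightarrow> n \<in> N" for n using N(2) by (metis add.inverse_inverse imageI)
  have diff: "besov_norm \<theta> \<alpha> (\<lambda>n. fourier_coeff (trig_poly N d) n - fourier_coeff (trig_poly N c) n)
    \<le> ennreal (B * (\<Sum>n\<in>N. cmod (d n - c n)))" for c d
  proof -
    let ?e = "\<lambda>n. fourier_coeff (trig_poly N d) n - fourier_coeff (trig_poly N c) n"
    have "besov_norm \<theta> \<alpha> ?e \<le> ennreal (B * (\<Sum>n\<in>N. cmod (?e n)))"
      by (rule B(2)) (simp add: fourier_coeff_trig_poly N(1) sym)
    also have "(\<Sum>n\<in>N. cmod (?e n)) \<le> (\<Sum>n\<in>N. cmod (d n - c n) / 2 + cmod (d (- n) - c (- n)) / 2)"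
    proof (rule sum_mono)
      fix n assume "n \<in> N"
      then have "?e n = (d n - c n) / 2 + cnj (d (- n) - c (- n)) / 2"
        by (simp add: fourier_coeff_trig_poly N(1) sym diff_divide_distrib)
      then show "cmod (?e n) \<le> cmod (d n - c n) / 2 + cmod (d (- n) - c (- n)) / 2"
        using norm_triangle_ineq[of "(d n - c n) / 2" "cnj (d (- n) - c (- n)) / 2"]
          by (simp add: norm_divide del: complex_cnj_diff)
    qed
    also have "\<dots> = (\<Sum>n\<in>N. cmod (d n - c n)) / 2 + (\<Sum>n\<in>N. cmod (d (- n) - c (- n))) / 2"
      by (simp add: sum.distrib sum_divide_distrib)
    also have "(\<Sum>n\<in>N. cmod (d (- n) - c (- n))) = (\<Sum>n\<in>N. cmod (d n - c n))"
      by (subst (2) N(2)[symmetric], subst sum.reindex) (auto simp: inj_on_def)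
    finally show ?thesis using B(1) by (simp add: ennreal_leI mult_left_mono)
  qed
  show ?thesis
    unfolding continuous_on_def
  proof (intro ballI tendstoI)
    fix c :: "int^2 \<Rightarrow> complex" and \<epsilon> :: real assume e: "0 < \<epsilon>"
    obtain \<delta> where d: "\<delta> > 0" "\<And>d. d \<in> besov_closure \<theta> \<alpha>
      \<Longrightarrow> besov_norm \<theta> \<alpha> (\<lambda>n. d n - fourier_coeff (trig_poly N c) n) < ennreal \<delta> \<Longrightarrow>
        \<bar>f d - f (fourier_coeff (trig_poly N c))\<bar> < \<epsilon>"
      using f e trig_poly_in_besov[of N c \<theta> \<alpha>] unfolding continuous_linear_growth_def by blast
    have "((\<lambda>d. B * (\<Sum>n\<in>N. cmod (d n - c n))) \<longlongrightarrow> B * (\<Sum>n\<in>N. cmod (c n - c n))) (at c)"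
    proof (intro tendsto_intros)
      fix n
      have "continuous_on UNIV (\<lambda>d :: int^2 \<Rightarrow> complex. d n)" by (rule continuous_on_product_coordinates)
      then show "((\<lambda>d. d n) \<longlongrightarrow> c n) (at c)" by (simp add: continuous_on_def)
    qed
    then have "eventually (\<lambda>d. B * (\<Sum>n\<in>N. cmod (d n - c n)) < \<delta>) (at c)"
      using d(1) by (intro order_tendstoD(2)) auto
    then show "\<forall>\<^sub>F d in at c within UNIV. dist (f (fourier_coeff (trig_poly N d))) (f (fourier_coeff
      (trig_poly N c))) < \<epsilon>"
    proof eventually_elim
      case (elim d)
      have "besov_norm \<theta> \<alpha> (\<lambda>n. fourier_coeff (trig_poly N d) n - fourier_coeff (trig_poly N c) n) < ennreal \<delta>"
        using diff[of d c] ennreal_lessI[OF d(1) elim] by (rule le_less_trans)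
      from d(2)[OF trig_poly_in_besov this] show ?case by (simp add: dist_real_def)
    qed
  qed
qed

section \<open>The drift\<close>

lemma Lp_norm_2: "Lp_norm 2 g = sqrt (\<integral>x. (g x)\<^sup>2 \<partial>torus)" for g :: "real^2 \<Rightarrow> real"
  by (simp add: Lp_norm_def powr_half_sqrt)

lemma Lp_norm_2_sq: "(Lp_norm 2 g)\<^sup>2 = (\<integral>x. (g x)\<^sup>2 \<partial>torus)" for g :: "real^2 \<Rightarrow> real"
  by (simp add: Lp_norm_2)

lemma torus_Cauchy_Schwarz:
  fixes f g :: "real^2 \<Rightarrow> real"
  assumes [measurable]: "f \<in> borel_measurable borel" "g \<in> borel_measurable borel"
    and f: "integrable torus (\<lambda>x. (f x)\<^sup>2)" and g: "integrable torus (\<lambda>x. (g x)\<^sup>2)"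
  shows "integrable torus (\<lambda>x. f x * g x)" and "(\<integral>x. \<bar>f x * g x\<bar> \<partial>torus) \<le> Lp_norm 2 f * Lp_norm 2 g"
proof -
  show i: "integrable torus (\<lambda>x. f x * g x)"
  proof (rule Bochner_Integration.integrable_bound)
    show "integrable torus (\<lambda>x. (f x)\<^sup>2 + (g x)\<^sup>2)" using f g by simp
    show "AE x in torus. norm (f x * g x) \<le> norm ((f x)\<^sup>2 + (g x)\<^sup>2)"
    proof (rule AE_I2)
      fix x
      have "2 * \<bar>f x\<bar> * \<bar>g x\<bar> \<le> (f x)\<^sup>2 + (g x)\<^sup>2" using sum_squares_bound[of "\<bar>f x\<bar>" "\<bar>g x\<bar>"] by simp
      moreover have "0 \<le> \<bar>f x\<bar> * \<bar>g x\<bar>" by simp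
      ultimately have "\<bar>f x\<bar> * \<bar>g x\<bar> \<le> (f x)\<^sup>2 + (g x)\<^sup>2" by linarith
      then show "norm (f x * g x) \<le> norm ((f x)\<^sup>2 + (g x)\<^sup>2)" by (simp add: abs_mult)
    qed
  qed measurable
  have "ennreal ((\<integral>x. \<bar>f x * g x\<bar> \<partial>torus)\<^sup>2) = (\<integral>\<^sup>+x. ennreal \<bar>f x\<bar> * ennreal \<bar>g x\<bar> \<partial>torus)\<^sup>2"
  proof -
    have "(\<integral>\<^sup>+x. ennreal \<bar>f x * g x\<bar> \<partial>torus) = ennreal (\<integral>x. \<bar>f x * g x\<bar> \<partial>torus)"
      using i by (intro nn_integral_eq_integral) auto
    then show ?thesis by (simp add: abs_mult ennreal_mult ennreal_power)
  qed
  also have "\<dots> \<le> (\<integral>\<^sup>+x. (ennreal \<bar>f x\<bar>)\<^sup>2 \<partial>torus) * (\<integral>\<^sup>+x. (ennreal \<bar>g x\<bar>)\<^sup>2 \<partial>torus)"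
    by (rule Cauchy_Schwarz_nn_integral) measurable
  also have "\<dots> = ennreal ((\<integral>x. (f x)\<^sup>2 \<partial>torus) * (\<integral>x. (g x)\<^sup>2 \<partial>torus))"
    using f g by (simp add: ennreal_power nn_integral_eq_integral ennreal_mult)
  finally have "(\<integral>x. \<bar>f x * g x\<bar> \<partial>torus)\<^sup>2 \<le> (Lp_norm 2 f * Lp_norm 2 g)\<^sup>2"
    by (simp add: Lp_norm_2 power_mult_distrib)
  then show "(\<integral>x. \<bar>f x * g x\<bar> \<partial>torus) \<le> Lp_norm 2 f * Lp_norm 2 g"
    by (rule power2_le_imp_le) (simp add: Lp_norm_2)
qed

lemma Lp_norm_2_triangle:
  fixes f g :: "real^2 \<Rightarrow> real"
  assumes [measurable]: "f \<in> borel_measurable borel" "g \<in> borel_measurable borel"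
    and f: "integrable torus (\<lambda>x. (f x)\<^sup>2)" and g: "integrable torus (\<lambda>x. (g x)\<^sup>2)"
  shows "Lp_norm 2 (\<lambda>x. f x + g x) \<le> Lp_norm 2 f + Lp_norm 2 g"
proof (rule power2_le_imp_le)
  note cs = torus_Cauchy_Schwarz[OF assms]
  have "(\<integral>x. (f x + g x)\<^sup>2 \<partial>torus) = (\<integral>x. (f x)\<^sup>2 + 2 * (f x * g x) + (g x)\<^sup>2 \<partial>torus)"
    by (simp add: power2_sum algebra_simps)
  also have "\<dots> = (\<integral>x. (f x)\<^sup>2 \<partial>torus) + 2 * (\<integral>x. f x * g x \<partial>torus) + (\<integral>x. (g x)\<^sup>2 \<partial>torus)"
    using f g cs(1) by simp
  also have "(\<integral>x. f x * g x \<partial>torus) \<le> (\<integral>x. \<bar>f x * g x\<bar> \<partial>torus)"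
    using cs(1) by (intro integral_mono) auto
  also note cs(2)
  finally have "(\<integral>x. (f x + g x)\<^sup>2 \<partial>torus) \<le> (\<integral>x. (f x)\<^sup>2 \<partial>torus) + 2 * (Lp_norm 2 f * Lp_norm 2 g)
    + (\<integral>x. (g x)\<^sup>2 \<partial>torus)"
    by simp
  then show "(Lp_norm 2 (\<lambda>x. f x + g x))\<^sup>2 \<le> (Lp_norm 2 f + Lp_norm 2 g)\<^sup>2"
    by (simp only: Lp_norm_2_sq power2_sum mult.assoc ac_simps)
qed (simp add: Lp_norm_2)

lemma L2dot_diff:
  assumes v: "v \<in> L2dot" and w: "w \<in> L2dot"
  shows "(\<lambda>x. w x - v x) \<in> borel_measurable borel" "integrable torus (\<lambda>x. (w x - v x)\<^sup>2)"
proof -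
  have m: "v \<in> borel_measurable borel" "w \<in> borel_measurable borel"
    and i: "integrable torus (\<lambda>x. (v x)\<^sup>2)" "integrable torus (\<lambda>x. (w x)\<^sup>2)"
    using v w by (auto simp: L2dot_def)
  then show "(\<lambda>x. w x - v x) \<in> borel_measurable borel" by simp
  show "integrable torus (\<lambda>x. (w x - v x)\<^sup>2)"
    using i torus_Cauchy_Schwarz(1)[OF m(2,1) i(2,1)] by (simp add: power2_diff mult.assoc)
qed

text \<open>Cauchy-Schwarz against a mode of modulus 1 on a space of mass 1. The Lipschitz constant
  1 in the L2 distance is the form in which predictability of the drift can be exploited.\<close>

lemma fourier_coeff_lipschitz:
  assumes v: "v \<in> L2dot" and w: "w \<in> L2dot"
  shows "cmod (fourier_coeff w n - fourier_coeff v n) \<le> Lp_norm 2 (\<lambda>x. w x - v x)"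
proof -
  note d = L2dot_diff[OF v w]
  have one: "integrable torus (\<lambda>x. (1::real)\<^sup>2)" by simp
  have m: "v \<in> borel_measurable borel" "w \<in> borel_measurable borel"
    and i: "integrable torus (\<lambda>x. (v x)\<^sup>2)" "integrable torus (\<lambda>x. (w x)\<^sup>2)"
    using v w by (auto simp: L2dot_def)
  have i1: "integrable torus v" "integrable torus w"
    using torus_Cauchy_Schwarz(1)[OF m(1) _ i(1) one] torus_Cauchy_Schwarz(1)[OF m(2) _ i(2) one] by auto
  have ic: "integrable torus (\<lambda>x. of_real (g x) * cnj (fourier_mode n x))"
    if g: "integrable torus g" and [measurable]: "g \<in> borel_measurable borel" for g :: "real^2 \<Rightarrow> real"
  proof (rule Bochner_Integration.integrable_bound[OF g])
    have [measurable]: "(\<lambda>x. cnj (fourier_mode n x)) \<in> borel_measurable borel"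
      unfolding fourier_mode_cnj by measurable
    show "(\<lambda>x. of_real (g x) * cnj (fourier_mode n x)) \<in> borel_measurable torus" by measurable
  qed (simp add: norm_mult)
  have "fourier_coeff w n - fourier_coeff v n = (\<integral>x. of_real (w x - v x) * cnj (fourier_mode n x) \<partial>torus)"
    unfolding fourier_coeff_def using ic[OF i1(1) m(1)] ic[OF i1(2) m(2)] by (simp add: left_diff_distrib)
  also have "cmod \<dots> \<le> (\<integral>x. \<bar>w x - v x\<bar> \<partial>torus)"
    using integral_norm_bound[of torus "\<lambda>x. of_real (w x - v x) * cnj (fourier_mode n x)"]
    by (simp add: norm_mult del: of_real_diff)
  also have "\<dots> \<le> Lp_norm 2 (\<lambda>x. w x - v x) * Lp_norm 2 (\<lambda>_. 1 :: real)"
    using torus_Cauchy_Schwarz(2)[OF d(1) _ d(2) one] by simp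
  also have "\<dots> = Lp_norm 2 (\<lambda>x. w x - v x)" using torus.prob_space by (simp add: Lp_norm_2)
  finally show ?thesis .
qed

lemma zero_L2dot: "(\<lambda>_. 0) \<in> L2dot"
  by (simp add: L2dot_def periodic_def)

lemma fourier_coeff_le: "v \<in> L2dot \<Longrightarrow> cmod (fourier_coeff v n) \<le> Lp_norm 2 v"
  using fourier_coeff_lipschitz[OF zero_L2dot, of v n] by (simp add: fourier_coeff_def)

text \<open>Predictability is stated through preimages of L2-open sets. Sublevel sets of a
  functional with this one-sided Lipschitz bound are open: a ball of radius a - \<Phi> v around v
  stays inside.\<close>

lemma open_L2dot_lipschitz:
  assumes "\<And>v w. v \<in> L2dot \<Longrightarrow> w \<in> L2dot \<Longrightarrow> \<Phi> w \<le> \<Phi> v + Lp_norm 2 (\<lambda>x. w x - v x)"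
  shows "open_L2dot {v \<in> L2dot. \<Phi> v < a}"
  unfolding open_L2dot_def
proof (intro conjI ballI)
  fix v assume v: "v \<in> {v \<in> L2dot. \<Phi> v < a}"
  show "\<exists>r>0. \<forall>w\<in>L2dot. Lp_norm 2 (\<lambda>x. w x - v x) < r \<longrightarrow> w \<in> {v \<in> L2dot. \<Phi> v < a}"
    using v assms[of v] by (intro exI[of _ "a - \<Phi> v"]) fastforce
qed auto

section \<open>Measurability of functionals of a predictable drift\<close>

context wiener begin

text \<open>Sublevel sets of the functional are predictable events, and predictable events are
  jointly measurable. The indicator of nonnegative times extends the function to the whole line, as
  the product measure requires.\<close>

lemma predictable_lipschitz:
  assumes u: "u \<in> drift_space P"
    and \<Phi>: "\<And>v w. v \<in> L2dot \<Longrightarrow> w \<in> L2dot \<Longrightarrow> \<Phi> w \<le> \<Phi> v + Lp_norm 2 (\<lambda>x. w x - v x)"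
  shows "(\<lambda>(\<omega>, t). indicator {0..} t *\<^sub>R \<Phi> (u t \<omega>)) \<in> borel_measurable (P \<Otimes>\<^sub>M borel)"
proof -
  let ?G = "{{0} \<times> A |A. A \<in> sets (Filt 0)} \<union> {{s<..t} \<times> A |s t A. 0 \<le> s \<and> s \<le> t \<and> A \<in> sets (Filt s)}"
  let ?D = "{0 :: real..} \<times> space P"
  have AP: "A \<in> sets P" if "A \<in> sets (Filt s)" for A s using sets_Filt_subset that by blast
  have G: "?G \<subseteq> Pow ?D" using sets.sets_into_space AP by fastforce
  have GB: "?G \<subseteq> sets (borel \<Otimes>\<^sub>M P)" using AP by (auto intro!: pair_measureI)
  have D: "?D \<in> sets (borel \<Otimes>\<^sub>M P)" by (intro pair_measureI) auto
  have sp: "space (predictable_sigma P Filt) = ?D" "sets (predictable_sigma P Filt) = sigma_sets ?D ?G"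
    unfolding predictable_sigma_def using G by (simp_all add: space_measure_of sets_measure_of)
  \<comment> \<open>The generators are rectangles of time intervals and events of the filtration,
    hence measurable rectangles of the product.\<close>
  have sub: "sets (predictable_sigma P Filt) \<subseteq> sets (restrict_space (borel \<Otimes>\<^sub>M P) ?D)"
  proof -
    have sr: "space (restrict_space (borel \<Otimes>\<^sub>M P) ?D) = ?D"
      by (auto simp: space_restrict_space space_pair_measure)
    have "?G \<subseteq> sets (restrict_space (borel \<Otimes>\<^sub>M P) ?D)"
    proof
      fix S assume S: "S \<in> ?G"
      have "S \<subseteq> ?D" by (rule PowD[OF subsetD[OF G S]])
      with D subsetD[OF GB S] show "S \<in> sets (restrict_space (borel \<Otimes>\<^sub>M P) ?D)"
        by (subst sets_restrict_space_iff) auto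
    qed
    from sets.sigma_sets_subset[OF this] show ?thesis unfolding sp(2) sr .
  qed
  have "(\<lambda>y. \<Phi> (u (fst y) (snd y))) \<in> borel_measurable (restrict_space (borel \<Otimes>\<^sub>M P) ?D)"
    unfolding borel_measurable_iff_less
  proof
    fix a
    have "{(t, \<omega>). t \<ge> 0 \<and> \<omega> \<in> space P \<and> u t \<omega> \<in> {v \<in> L2dot. \<Phi> v < a}} \<in> sets (predictable_sigma P Filt)"
      using u open_L2dot_lipschitz[of \<Phi> a, OF \<Phi>] unfolding drift_space_def by blast
    moreover have "{(t, \<omega>). t \<ge> 0 \<and> \<omega> \<in> space P \<and> u t \<omega> \<in> {v \<in> L2dot. \<Phi> v < a}}
       = {y \<in> space (restrict_space (borel \<Otimes>\<^sub>M P) ?D). \<Phi> (u (fst y) (snd y)) < a}"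
      using u by (auto simp: drift_space_def space_restrict_space space_pair_measure)
    ultimately show "{y \<in> space (restrict_space (borel \<Otimes>\<^sub>M P) ?D). \<Phi> (u (fst y) (snd y)) < a}
        \<in> sets (restrict_space (borel \<Otimes>\<^sub>M P) ?D)"
      using sub by auto
  qed
  then have "(\<lambda>y. indicator ?D y *\<^sub>R \<Phi> (u (fst y) (snd y))) \<in> borel_measurable (borel \<Otimes>\<^sub>M P)"
    by (subst (asm) borel_measurable_restrict_space_iff) (use D in \<open>auto simp: mult.commute\<close>)
  then have "(\<lambda>(t, \<omega>). indicator ?D (t, \<omega>) *\<^sub>R \<Phi> (u t \<omega>)) \<in> borel_measurable (borel \<Otimes>\<^sub>M P)"
    by (simp only: case_prod_beta' prod.collapse)
  from measurable_pair_swap[OF this]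
  have "(\<lambda>(\<omega>, t). indicator ?D (t, \<omega>) *\<^sub>R \<Phi> (u t \<omega>)) \<in> borel_measurable (P \<Otimes>\<^sub>M borel)"
    by (simp only: case_prod_beta' fst_conv snd_conv)
  then show ?thesis
    by (rule measurable_cong[THEN iffD1, rotated]) (auto simp: space_pair_measure indicator_def)
qed

lemma drift_norm_measurable:
  assumes u: "u \<in> drift_space P"
  shows "(\<lambda>(\<omega>, t). indicator {0..} t *\<^sub>R Lp_norm 2 (u t \<omega>)) \<in> borel_measurable (P \<Otimes>\<^sub>M borel)"
proof (rule predictable_lipschitz[OF u])
  fix v w assume v: "v \<in> L2dot" and w: "w \<in> L2dot"
  have "Lp_norm 2 (\<lambda>x. v x + (w x - v x)) \<le> Lp_norm 2 v + Lp_norm 2 (\<lambda>x. w x - v x)"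
    by (rule Lp_norm_2_triangle) (use v w L2dot_diff[OF v w] in \<open>auto simp: L2dot_def\<close>)
  then show "Lp_norm 2 w \<le> Lp_norm 2 v + Lp_norm 2 (\<lambda>x. w x - v x)" by simp
qed

lemma drift_coeff_measurable:
  assumes u: "u \<in> drift_space P"
  shows "(\<lambda>(\<omega>, t). indicator {0..} t *\<^sub>R fourier_coeff (u t \<omega>) n) \<in> borel_measurable (P \<Otimes>\<^sub>M borel)"
proof -
  have "(\<lambda>(\<omega>, t). indicator {0..} t *\<^sub>R Re (fourier_coeff (u t \<omega>) n)) \<in> borel_measurable (P \<Otimes>\<^sub>M borel)"
  proof (rule predictable_lipschitz[OF u])
    fix v w assume "v \<in> L2dot" "w \<in> L2dot"
    from fourier_coeff_lipschitz[OF this, of n] abs_Re_le_cmod[of "fourier_coeff w n - fourier_coeff v n"]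
    show "Re (fourier_coeff w n) \<le> Re (fourier_coeff v n) + Lp_norm 2 (\<lambda>x. w x - v x)" by simp
  qed
  moreover have "(\<lambda>(\<omega>, t). indicator {0..} t *\<^sub>R Im (fourier_coeff (u t \<omega>) n)) \<in> borel_measurable (P \<Otimes>\<^sub>M borel)"
  proof (rule predictable_lipschitz[OF u])
    fix v w assume "v \<in> L2dot" "w \<in> L2dot"
    from fourier_coeff_lipschitz[OF this, of n] abs_Im_le_cmod[of "fourier_coeff w n - fourier_coeff v n"]
    show "Im (fourier_coeff w n) \<le> Im (fourier_coeff v n) + Lp_norm 2 (\<lambda>x. w x - v x)" by simp
  qed
  ultimately show ?thesis
    by (subst borel_measurable_complex_iff) (simp add: case_prod_beta')
qed

lemma drift_energy_measurable:
  assumes u: "u \<in> drift_space P"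
  shows "drift_energy u \<in> borel_measurable P"
proof -
  have "(\<lambda>(\<omega>, t). indicator {0..} t *\<^sub>R Lp_norm 2 (u t \<omega>)) \<in> borel_measurable (P \<Otimes>\<^sub>M lborel)"
    using drift_norm_measurable[OF u] by (simp cong: measurable_cong_sets)
  then have "(\<lambda>(\<omega>, t). (indicator {0..} t *\<^sub>R Lp_norm 2 (u t \<omega>))\<^sup>2) \<in> borel_measurable (P \<Otimes>\<^sub>M lborel)"
    by (simp add: case_prod_beta')
  moreover have "(indicator {0..} t *\<^sub>R Lp_norm 2 (u t \<omega>))\<^sup>2 = indicator {0..} t *\<^sub>R (Lp_norm 2 (u t \<omega>))\<^sup>2" for t \<omega>
    by (simp add: indicator_def)
  ultimately have "(\<lambda>(\<omega>, t). indicator {0..} t *\<^sub>R (Lp_norm 2 (u t \<omega>))\<^sup>2) \<in> borel_measurable (P \<Otimes>\<^sub>M lborel)"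
    by simp
  from lborel.borel_measurable_lebesgue_integral[OF this]
  show ?thesis unfolding drift_energy_def set_lebesgue_integral_def .
qed

end

section \<open>The drift part as a random trigonometric polynomial\<close>

context gauss_process begin

definition drift_coeff :: "(real \<Rightarrow> path \<Rightarrow> real^2 \<Rightarrow> real) \<Rightarrow> real \<Rightarrow> path \<Rightarrow> int^2 \<Rightarrow> complex" where
  "drift_coeff u T \<omega> n = (CLBINT t:{0..T}. complex_of_real (J n t) * fourier_coeff (u t \<omega>) n)"

lemma drift_coeff_integrand_measurable:
  assumes u: "u \<in> drift_space P"
  shows "(\<lambda>(\<omega>, t). indicator {0..T} t *\<^sub>R (complex_of_real (J n t) * fourier_coeff (u t \<omega>) n))
    \<in> borel_measurable (P \<Otimes>\<^sub>M borel)"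
proof -
  have [measurable]: "J n \<in> borel_measurable borel" by (rule J_symbol_measurable[OF cutoff])
  note [measurable] = drift_coeff_measurable[OF u, of n]
  have "(\<lambda>(\<omega>, t). indicator {0..T} t *\<^sub>R (complex_of_real (J n t)
      * (case (\<omega>, t) of (\<omega>, t) \<Rightarrow> indicator {0..} t *\<^sub>R fourier_coeff (u t \<omega>) n)))
    \<in> borel_measurable (P \<Otimes>\<^sub>M borel)"
    by measurable
  moreover have "indicator {0..T} t *\<^sub>R (complex_of_real (J n t) * (indicator {0..} t *\<^sub>R c))
    = indicator {0..T} t *\<^sub>R (complex_of_real (J n t) * c)" for c :: complex and t
    by (simp add: indicator_def)
  ultimately show ?thesis by (simp only: prod.case)
qed

lemma drift_coeff_random:
  assumes u: "u \<in> drift_space P"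
  shows "(\<lambda>\<omega>. drift_coeff u T \<omega> n) \<in> borel_measurable P"
proof -
  have "(\<lambda>(\<omega>, t). indicator {0..T} t *\<^sub>R (complex_of_real (J n t) * fourier_coeff (u t \<omega>) n))
    \<in> borel_measurable (P \<Otimes>\<^sub>M lborel)"
    using drift_coeff_integrand_measurable[OF u] by (simp cong: measurable_cong_sets)
  from lborel.borel_measurable_lebesgue_integral[OF this]
  show ?thesis unfolding drift_coeff_def set_lebesgue_integral_def .
qed

text \<open>On [0, T] the symbol is bounded and a Fourier coefficient is at most 1 plus the squared
  L2 norm, so the almost surely finite energy of the drift suffices. One null set serves all
  frequencies because that energy does not depend on n.\<close>

lemma drift_integrable:
  assumes u: "u \<in> drift_space P"
  shows "AE \<omega> in P. \<forall>n. set_integrable lborel {0..T} (\<lambda>t. complex_of_real (J n t) * fourier_coeff (u t \<omega>) n)"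
proof -
  have "AE \<omega> in P. (\<integral>\<^sup>+t. ennreal ((Lp_norm 2 (u t \<omega>))\<^sup>2) * indicator {0..} t \<partial>lborel) < \<infinity>"
    using u by (simp add: drift_space_def)
  with AE_space show ?thesis
  proof eventually_elim
    case (elim \<omega>)
    show ?case
    proof
      fix n
      let ?E = "\<lambda>t. (indicator {0..} t *\<^sub>R Lp_norm 2 (u t \<omega>))\<^sup>2"
      have "continuous_on {0..T} (J n)"
        by (rule continuous_J_symbol[OF cutoff])
      then have "compact (J n ` {0..T})" by (rule compact_continuous_image) simp
      then obtain C where C: "0 < C" "\<And>t. t \<in> {0..T} \<Longrightarrow> \<bar>J n t\<bar> \<le> C"
        using compact_imp_bounded bounded_pos by (metis imageI real_norm_def)
      have Em: "?E \<in> borel_measurable lborel"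
        using measurable_Pair2[OF drift_norm_measurable[OF u] elim(1)] by simp
      have E: "integrable lborel ?E"
      proof (rule integrableI_bounded[OF Em])
        have "(\<integral>\<^sup>+t. ennreal (norm (?E t)) \<partial>lborel)
          = (\<integral>\<^sup>+t. ennreal ((Lp_norm 2 (u t \<omega>))\<^sup>2) * indicator {0..} t \<partial>lborel)"
          by (intro nn_integral_cong) (auto simp: indicator_def)
        with elim(2) show "(\<integral>\<^sup>+t. ennreal (norm (?E t)) \<partial>lborel) < \<infinity>" by simp
      qed
      show "set_integrable lborel {0..T} (\<lambda>t. complex_of_real (J n t) * fourier_coeff (u t \<omega>) n)"
        unfolding set_integrable_def
      proof (rule Bochner_Integration.integrable_bound)
        show "integrable lborel (\<lambda>t. C * (indicat_real {0..T} t + ?E t))"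
          using E by (intro integrable_mult_right Bochner_Integration.integrable_add integrable_real_indicator)
            (auto simp: emeasure_lborel_Icc_eq)
        show "(\<lambda>t. indicator {0..T} t *\<^sub>R (complex_of_real (J n t) * fourier_coeff (u t \<omega>) n))
          \<in> borel_measurable lborel"
          using measurable_Pair2[OF drift_coeff_integrand_measurable[OF u, of T n] elim(1)] by simp
        show "AE t in lborel. norm (indicator {0..T} t *\<^sub>R (complex_of_real (J n t) * fourier_coeff (u t \<omega>) n))
          \<le> norm (C * (indicat_real {0..T} t + ?E t))"
        proof (rule AE_I2)
          fix t
          show "norm (indicator {0..T} t *\<^sub>R (complex_of_real (J n t) * fourier_coeff (u t \<omega>) n))
            \<le> norm (C * (indicat_real {0..T} t + ?E t))"
          proof (cases "t \<in> {0..T}")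
            case True
            then have "u t \<omega> \<in> L2dot" using u elim(1) by (simp add: drift_space_def)
            from fourier_coeff_le[OF this, of n]
            have "cmod (fourier_coeff (u t \<omega>) n) \<le> Lp_norm 2 (u t \<omega>)" .
            also have "\<dots> \<le> 1 + (Lp_norm 2 (u t \<omega>))\<^sup>2"
              using zero_le_power2[of "Lp_norm 2 (u t \<omega>) - 1"] zero_le_power2[of "Lp_norm 2 (u t \<omega>)"]
              by (simp add: power2_diff, linarith)
            finally have "\<bar>J n t\<bar> * cmod (fourier_coeff (u t \<omega>) n) \<le> C * (1 + (Lp_norm 2 (u t \<omega>))\<^sup>2)"
              using C(2)[OF True] C(1) by (intro mult_mono) auto
            moreover have "0 \<le> C * (1 + (Lp_norm 2 (u t \<omega>))\<^sup>2)" using C(1) by simp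
            ultimately show ?thesis using True by (simp add: norm_mult abs_of_nonneg)
          qed simp
        qed
      qed
    qed
  qed
qed

text \<open>Up to time T the symbol vanishes outside \<open>freqs T\<close>. The multiplier is then
  a finite sum, which commutes with the time integral.\<close>

lemma Z_trig_poly:
  assumes int: "\<And>n. set_integrable lborel {0..T} (\<lambda>t. complex_of_real (J n t) * fourier_coeff (u t \<omega>) n)"
  shows "Z_drift \<zeta> T u \<omega> = trig_poly (freqs T) (drift_coeff u T \<omega>)"
proof
  fix x
  let ?g = "\<lambda>n t. complex_of_real (J n t) * fourier_coeff (u t \<omega>) n * fourier_mode n x"
  have mult: "multiplier (J_symbol \<zeta> t) (u t \<omega>) x = Re (\<Sum>n\<in>freqs T. ?g n t)" if t: "t \<in> {0..T}" for t
  proof -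
    have "(\<Sum>\<^sub>\<infinity>n. ?g n t) = (\<Sum>\<^sub>\<infinity>n\<in>freqs T. ?g n t)"
      by (rule infsum_cong_neutral) (use t in \<open>auto simp: freqs_def intro: J_symbol_eq_0[OF cutoff]\<close>)
    then show ?thesis by (simp add: multiplier_def finite_freqs)
  qed
  have gi: "set_integrable lborel {0..T} (?g n)" for n
    using int[of n] by (rule set_integrable_mult_left)
  have si: "set_integrable lborel {0..T} (\<lambda>t. \<Sum>n\<in>freqs T. ?g n t)"
    using gi unfolding set_integrable_def by (simp add: scaleR_sum_right del: of_real_mult)
  have "Z_drift \<zeta> T u \<omega> x = (LBINT t:{0..T}. Re (\<Sum>n\<in>freqs T. ?g n t))"
    unfolding Z_drift_def by (rule set_lebesgue_integral_cong) (use mult in auto)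
  also have "\<dots> = Re (CLBINT t:{0..T}. (\<Sum>n\<in>freqs T. ?g n t))"
    using si unfolding set_lebesgue_integral_def set_integrable_def
    by (subst integral_Re[symmetric]) simp_all
  also have "(CLBINT t:{0..T}. (\<Sum>n\<in>freqs T. ?g n t)) = (\<Sum>n\<in>freqs T. (CLBINT t:{0..T}. ?g n t))"
    unfolding set_lebesgue_integral_def scaleR_sum_right
    by (rule Bochner_Integration.integral_sum) (use gi in \<open>simp add: set_integrable_def\<close>)
  also have "\<dots> = (\<Sum>n\<in>freqs T. drift_coeff u T \<omega> n * fourier_mode n x)"
    unfolding drift_coeff_def by simp
  finally show "Z_drift \<zeta> T u \<omega> x = trig_poly (freqs T) (drift_coeff u T \<omega>) x"
    by (simp add: trig_poly_def)
qed

end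

section \<open>The variational functional\<close>

text \<open>Finite terms may be moved across the equation. If an infinite value occurs, both
  differences have the same pattern of infinite terms and therefore the same value, including the
  conventional one of \<infinity> - \<infinity>.\<close>

lemma enn2ereal_diff_eq:
  assumes eq: "p' + m = m' + p" and p: "p' = \<infinity> \<longleftrightarrow> p = \<infinity>" and m: "m' = \<infinity> \<longleftrightarrow> m = \<infinity>"
  shows "enn2ereal p' - enn2ereal m' = enn2ereal p - enn2ereal m"
proof (cases "p = \<infinity> \<or> m = \<infinity>")
  case True
  then show ?thesis
    using p m by (cases p; cases p'; cases m; cases m') (auto simp: enn2ereal_ennreal)
next
  case False
  then obtain a b c d where "p = ennreal a" "0 \<le> a" "p' = ennreal b" "0 \<le> b" "m = ennreal c" "0 \<le> c" "m'
    = ennreal d" "0 \<le> d"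
    using p m by (cases p; cases p'; cases m; cases m') auto
  moreover from this have "b + c = d + a" using eq by (simp flip: ennreal_plus)
  ultimately show ?thesis by (simp add: enn2ereal_ennreal)
qed

lemma expect_cong_AE: "AE \<omega> in P. X \<omega> = X' \<omega> \<Longrightarrow> expect P X = expect P X'"
  unfolding expect_def by (intro arg_cong2[where f="(-)"] arg_cong[where f=enn2ereal] nn_integral_cong_AE) auto

text \<open>Integrating the identity (x + y)^+ + x^- + y^- = (x + y)^- + x^+ + y^+ avoids every
  subtraction of possibly infinite integrals. The positive and negative parts of \<open>R\<close>
  have the same finite integral, which cancels.\<close>

lemma expect_add_centered:
  assumes [measurable]: "X \<in> borel_measurable P" and R: "integrable P R" "(\<integral>\<omega>. R \<omega> \<partial>P) = 0"
  shows "expect P (\<lambda>\<omega>. X \<omega> + R \<omega>) = expect P X"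
proof -
  have [measurable]: "R \<in> borel_measurable P" using R by auto
  define p m r s p' m' where "p = (\<integral>\<^sup>+\<omega>. ennreal (X \<omega>) \<partial>P)" and "m = (\<integral>\<^sup>+\<omega>. ennreal (- X \<omega>) \<partial>P)"
    and "r = (\<integral>\<^sup>+\<omega>. ennreal (R \<omega>) \<partial>P)" and "s = (\<integral>\<^sup>+\<omega>. ennreal (- R \<omega>) \<partial>P)"
    and "p' = (\<integral>\<^sup>+\<omega>. ennreal (X \<omega> + R \<omega>) \<partial>P)" and "m' = (\<integral>\<^sup>+\<omega>. ennreal (- (X \<omega> + R \<omega>)) \<partial>P)"
  note defs = p_def m_def r_def s_def p'_def m'_def
  have fin: "r < \<infinity>" "s < \<infinity>" using R(1) unfolding r_def s_def real_integrable_def by (auto simp: less_top)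
  have "enn2real r = enn2real s" using real_lebesgue_integral_def[OF R(1)] R(2) unfolding r_def s_def by simp
  then have rs: "s = r" using fin by (metis ennreal_enn2real infinity_ennreal_def)
  have pt: "ennreal (x + y) + ennreal (- x) + ennreal (- y)
    = ennreal (- (x + y)) + ennreal x + ennreal y" for x y :: real
  proof -
    have e: "ennreal a = ennreal (max 0 a)" for a by (cases "0 \<le> a") (auto simp: max_def ennreal_neg)
    have "max 0 (x + y) + max 0 (- x) + max 0 (- y) = max 0 (- (x + y)) + max 0 x + max 0 y"
      by (auto simp: max_def)
    then have "ennreal (max 0 (x + y) + max 0 (- x) + max 0 (- y))
      = ennreal (max 0 (- (x + y)) + max 0 x + max 0 y)"
      by (rule arg_cong)
    moreover have "ennreal (max 0 a + max 0 b + max 0 c)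
      = ennreal (max 0 a) + ennreal (max 0 b) + ennreal (max 0 c)" for a b c :: real
      by (simp add: ennreal_plus)
    ultimately show ?thesis by (simp only: e[symmetric])
  qed
  have "p' + m + s = (\<integral>\<^sup>+\<omega>. ennreal (X \<omega> + R \<omega>) + ennreal (- X \<omega>) + ennreal (- R \<omega>) \<partial>P)"
    unfolding defs by (simp add: nn_integral_add)
  also have "\<dots> = (\<integral>\<^sup>+\<omega>. ennreal (- (X \<omega> + R \<omega>)) + ennreal (X \<omega>) + ennreal (R \<omega>) \<partial>P)"
    unfolding pt ..
  also have "\<dots> = m' + p + r"
    unfolding defs by (simp add: nn_integral_add del: minus_add_distrib)
  finally have eq: "p' + m = m' + p"
    using fin unfolding rs by (metis add.commute ennreal_add_left_cancel infinity_ennreal_def less_irrefl)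
  have le: "ennreal (x + y) \<le> ennreal x + ennreal y" for x y :: real
    by (cases "0 \<le> x"; cases "0 \<le> y") (auto simp: ennreal_neg ennreal_plus[symmetric] intro!:
      ennreal_leI simp del: ennreal_plus)
  have b: "(\<integral>\<^sup>+\<omega>. ennreal (f \<omega> + g \<omega>) \<partial>P) \<le> (\<integral>\<^sup>+\<omega>. ennreal (f \<omega>) \<partial>P) + (\<integral>\<^sup>+\<omega>. ennreal (g \<omega>) \<partial>P)"
    if [measurable]: "f \<in> borel_measurable P" "g \<in> borel_measurable P" for f g
    by (subst nn_integral_add[symmetric]) (auto intro: nn_integral_mono le)
  \<comment> \<open>Adding an integrable term changes each part by a finite amount, so infinite
    parts stay infinite and finite ones stay finite.\<close>
  have "p' \<le> p + r" "m' \<le> m + r" "p \<le> p' + r" "m \<le> m' + r"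
    using b[of X R] b[of "\<lambda>\<omega>. - X \<omega>" "\<lambda>\<omega>. - R \<omega>"] b[of "\<lambda>\<omega>. X \<omega> + R \<omega>" "\<lambda>\<omega>. - R \<omega>"] b[of "\<lambda>\<omega>. - (X \<omega> + R \<omega>)" R] rs
    unfolding defs by simp_all
  then have "p' = \<infinity> \<longleftrightarrow> p = \<infinity>" "m' = \<infinity> \<longleftrightarrow> m = \<infinity>"
    using fin by (auto simp: top_unique)
  from enn2ereal_diff_eq[OF eq this] show ?thesis unfolding expect_def defs .
qed

lemma integrable_torus_continuous:
  fixes g :: "real^2 \<Rightarrow> real"
  assumes g: "continuous_on UNIV g"
  shows "integrable torus g"
proof -
  have "compact (g ` period_cell)"
    by (intro compact_continuous_image continuous_on_subset[OF g]) auto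
  then obtain B where B: "\<And>x. x \<in> period_cell \<Longrightarrow> norm (g x) \<le> B"
    using compact_imp_bounded bounded_iff by (metis imageI)
  have "AE x in torus. norm (g x) \<le> B"
    unfolding torus_def by (rule AE_uniform_measureI) (auto intro!: AE_I2 B[unfolded real_norm_def])
  then show ?thesis
    by (rule torus.integrable_const_bound) (use borel_measurable_continuous_onI[OF g] in simp)
qed

lemma norm_pow4: "norm v ^ 4 = ((v $ 1)\<^sup>2 + (v $ 2)\<^sup>2)\<^sup>2" for v :: "real^2"
proof -
  have "norm v ^ 4 = ((norm v)\<^sup>2)\<^sup>2" by (simp add: power_mult[symmetric])
  also have "(norm v)\<^sup>2 = (v $ 1)\<^sup>2 + (v $ 2)\<^sup>2"
    unfolding power2_norm_eq_inner by (simp add: inner_vec_def UNIV_2 power2_eq_square)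
  finally show ?thesis .
qed

lemma Lp_norm_4: "Lp_norm 4 g ^ 4 = (\<integral>x. norm (g x) ^ 4 \<partial>torus)"
proof -
  have "(a powr (1 / 4)) ^ 4 = a" if "0 \<le> a" for a :: real
    using that by (cases "a = 0") (auto simp: powr_powr simp flip: powr_realpow)
  from this[of "\<integral>x. norm (g x) ^ 4 \<partial>torus"] show ?thesis by (simp add: Lp_norm_def)
qed

text \<open>
  The integrand of \<open>Phi_T\<close> as a polynomial in \<open>y = \<nabla>Y\<close> and \<open>z = \<nabla>Z\<close>, the bracket being \<open>q\<close> times the identity.
\<close>

definition phi_poly :: "real \<Rightarrow> real^2 \<Rightarrow> real^2 \<Rightarrow> real" where
  "phi_poly q y z = 4 * (z \<bullet> z) * (y \<bullet> z) + 4 * (y \<bullet> y - 4 * q) * (y \<bullet> z)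
     + 4 * (y \<bullet> z)\<^sup>2 + 2 * (y \<bullet> y - 4 * q) * (z \<bullet> z) - 4 * (y \<bullet> z) - 2 * (z \<bullet> z)"

lemma continuous_grad_trig_poly: "continuous_on A (grad (trig_poly N c))"
  unfolding grad_def[abs_def] pd_trig_poly by (intro continuous_intros continuous_trig_poly)

lemma trig_poly_joint_measurable:
  assumes "\<And>n. n \<in> N \<Longrightarrow> (\<lambda>\<omega>. c \<omega> n) \<in> borel_measurable M"
  shows "(\<lambda>y. trig_poly N (c (fst y)) (snd y)) \<in> borel_measurable (M \<Otimes>\<^sub>M borel)"
proof -
  have "(\<lambda>y. \<Sum>n\<in>N. c (fst y) n * fourier_mode n (snd y)) \<in> borel_measurable (M \<Otimes>\<^sub>M borel)"
  proof (rule borel_measurable_sum)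
    fix n assume "n \<in> N"
    note [measurable] = assms[OF this]
    show "(\<lambda>y. c (fst y) n * fourier_mode n (snd y)) \<in> borel_measurable (M \<Otimes>\<^sub>M borel)" by measurable
  qed
  then show ?thesis unfolding trig_poly_def by measurable
qed

lemma grad_trig_poly_joint_measurable:
  assumes "\<And>n. n \<in> N \<Longrightarrow> (\<lambda>\<omega>. c \<omega> n) \<in> borel_measurable M"
  shows "(\<lambda>y. grad (trig_poly N (c (fst y))) (snd y)) \<in> borel_measurable (M \<Otimes>\<^sub>M borel)"
proof -
  have "(\<lambda>y. trig_poly N (\<lambda>n. \<i> * of_int (n $ i) * c (fst y) n) (snd y)) \<in> borel_measurable (M \<Otimes>\<^sub>M borel)" for i
    by (rule trig_poly_joint_measurable) (use assms in measurable)
  then show ?thesis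
    by (subst borel_measurable_euclidean_space)
      (auto simp: Basis_vec_def inner_axis grad_def pd_trig_poly)
qed

section \<open>The pointwise identity and the representation of the functional\<close>

context wick_field begin

lemma bracket_T: "bracket P Y i j T = (if i = j then qT T else 0)"
  by (rule bracket_eq[OF T0])

text \<open>With the bracket equal to q times the identity, b is 4 q times the gradient of Y, and c
  is 8 q \<bar>z\<bar>^2. The term \<open>a_T\<close> is left folded: it occurs on the right inside
  \<open>wick4\<close> and cancels as it stands.\<close>

lemma integrand_identity:
  "norm (grad (Y T \<omega>) x + grad z x) ^ 4 - 2 * (norm (grad (Y T \<omega>) x + grad z x))\<^sup>2
     - c_T P Y T (grad z x) - 4 * (b_T P Y T \<omega> x \<bullet> grad z x) - a_T P Y K L Q T \<omega> x + 2 * d_T P Y T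
   = wick4 P Y K L Q T \<omega> x + 4 * (wick3 P Y T \<omega> x \<bullet> grad z x)
     + 4 * (grad (Y T \<omega>) x \<bullet> vec_cube (grad z x)) + norm (grad z x) ^ 4
     + wick2_term P Y T \<omega> z x - 2 * wick2_trace P Y T \<omega> x
     - 4 * (grad (Y T \<omega>) x \<bullet> grad z x) - 2 * (norm (grad z x))\<^sup>2"
  unfolding c_T_def b_T_def d_T_def wick4_def wick3_def vec_cube_def wick2_term_def wick2_trace_def wick2_def
    bracket_T norm_pow4 power2_norm_eq_inner Let_def
  by (simp add: inner_vec_def UNIV_2) (simp add: power2_eq_square algebra_simps)

text \<open>The contraction with the Kronecker deltas is 4 (y z)^2 + 2 \<bar>y\<bar>^2
  \<bar>z\<bar>^2 - 8 q \<bar>z\<bar>^2. Here -8 q collects -4 q from the two crossed pairings and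
  -4 q from the trace pairing.\<close>

lemma phi_integrand:
  "4 * (grad (Y T \<omega>) x \<bullet> vec_cube (grad z x)) + 4 * (wick3 P Y T \<omega> x \<bullet> grad z x)
     + wick2_term P Y T \<omega> z x - 4 * (grad (Y T \<omega>) x \<bullet> grad z x) - 2 * (norm (grad z x))\<^sup>2
   = phi_poly (qT T) (grad (Y T \<omega>) x) (grad z x)"
  unfolding b_T_def wick3_def vec_cube_def wick2_term_def wick2_def phi_poly_def
    bracket_T power2_norm_eq_inner Let_def
  by (simp add: inner_vec_def UNIV_2) (simp add: power2_eq_square algebra_simps)

lemma Phi_T_eq: "Phi_T P Y T \<omega> z = (\<integral>x. phi_poly (qT T) (grad (Y T \<omega>) x) (grad z x) \<partial>torus)"
  unfolding Phi_T_def phi_integrand ..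

text \<open>The integral may be split only if each part is integrable. The parts with the drift are
  continuous functions on a compact cell, and for the remainder integrability holds almost
  surely.\<close>

lemma renormalised_energy_decompose:
  assumes w: "integrable torus (wick_rest \<omega>)"
    and y: "continuous_on UNIV (grad (Y T \<omega>))" and z: "continuous_on UNIV (grad z)"
  shows "renormalised_energy P Y K L Q T \<omega> z = Phi_T P Y T \<omega> z + Lp_norm 4 (grad z) ^ 4
    + (\<integral>x. wick_rest \<omega> x \<partial>torus)"
proof -
  have e: "norm (grad (Y T \<omega>) x + grad z x) ^ 4 - 2 * (norm (grad (Y T \<omega>) x + grad z x))\<^sup>2
     - c_T P Y T (grad z x) - 4 * (b_T P Y T \<omega> x \<bullet> grad z x) - a_T P Y K L Q T \<omega> x + 2 * d_T P Y T
     = phi_poly (qT T) (grad (Y T \<omega>) x) (grad z x) + norm (grad z x) ^ 4 + wick_rest \<omega> x" for x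
    unfolding integrand_identity phi_integrand[symmetric] wick_rest_def by simp
  have "integrable torus (\<lambda>x. phi_poly (qT T) (grad (Y T \<omega>) x) (grad z x))" "integrable torus (\<lambda>x. norm
    (grad z x) ^ 4)"
    unfolding phi_poly_def by (intro integrable_torus_continuous continuous_intros y z)+
  with w show ?thesis
    unfolding renormalised_energy_def e Phi_T_eq Lp_norm_4 by simp
qed

lemma AE_trig_poly:
  assumes u: "u \<in> drift_space P"
  shows "AE \<omega> in P. Y T \<omega> = trig_poly (freqs T) (\<lambda>n. W n T \<omega>) \<and> Z_drift \<zeta> T u \<omega>
    = trig_poly (freqs T) (drift_coeff u T \<omega>)"
  using AE_regular drift_integrable[OF u, of T]
  by eventually_elim (simp add: Y_trig_poly[OF _ T0] Z_trig_poly)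

lemma W_measurable: "n \<in> freqs T \<Longrightarrow> W n T \<in> borel_measurable P"
  using Wc_measurable[of "(n, True)" T] Wc_measurable[of "(n, False)" T] T0
  by (subst borel_measurable_complex_iff) (auto simp: Wc_def[abs_def] freqs_def)

text \<open>The integrand of the expectation is known to be measurable only after modification on a
  null set. The modified integrand depends on the finitely many random coefficients of the field and
  the drift term, and on the drift energy.\<close>

lemma random_part_measurable:
  assumes u: "u \<in> drift_space P" and f: "continuous_linear_growth \<theta> \<beta> f" and \<theta>: "cutoff \<theta>"
  shows "\<exists>X\<in>borel_measurable P. AE \<omega> in P. X \<omega> =
    f (fourier_coeff (\<lambda>x. Y T \<omega> x + Z_drift \<zeta> T u \<omega> x)) + Phi_T P Y T \<omega> (Z_drift \<zeta> T u \<omega>)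
    + Lp_norm 4 (grad (Z_drift \<zeta> T u \<omega>)) ^ 4 + 1/2 * drift_energy u \<omega>"
proof
  define N where "N = freqs T"
  \<comment> \<open>Coefficients off \<open>N\<close> are set to 0, so that every coordinate is
    measurable and \<open>c\<close> is a measurable map into the full product space.\<close>
  define c where "c = (\<lambda>\<omega> n. if n \<in> N then W n T \<omega> + drift_coeff u T \<omega> n else 0)"
  let ?y = "\<lambda>\<omega>. trig_poly N (\<lambda>n. W n T \<omega>)" and ?z = "\<lambda>\<omega>. trig_poly N (drift_coeff u T \<omega>)"
  let ?X = "\<lambda>\<omega>. f (fourier_coeff (trig_poly N (c \<omega>))) + (\<integral>x. phi_poly (qT T) (grad (?y \<omega>) x) (grad (?z
    \<omega>) x) \<partial>torus)
     + (\<integral>x. norm (grad (?z \<omega>) x) ^ 4 \<partial>torus) + 1/2 * drift_energy u \<omega>"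
  have W: "(\<lambda>\<omega>. W n T \<omega>) \<in> borel_measurable P" if "n \<in> N" for n using W_measurable that unfolding N_def .
  have D: "(\<lambda>\<omega>. drift_coeff u T \<omega> n) \<in> borel_measurable P" for n by (rule drift_coeff_random[OF u])
  have "(\<lambda>\<omega>. c \<omega> n) \<in> borel_measurable P" for n
    using W D unfolding c_def by (cases "n \<in> N") auto
  then have "c \<in> borel_measurable P" by (rule measurable_coordinatewise_then_product)
  moreover have "continuous_on UNIV (\<lambda>c. f (fourier_coeff (trig_poly N c)))"
    unfolding N_def by (rule continuous_f_trig_poly[OF f \<theta> finite_freqs freqs_uminus])
  ultimately have [measurable]: "(\<lambda>\<omega>. f (fourier_coeff (trig_poly N (c \<omega>)))) \<in> borel_measurable P"
    by (rule borel_measurable_continuous_on[rotated])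
  have gy: "(\<lambda>y. grad (?y (fst y)) (snd y)) \<in> borel_measurable (P \<Otimes>\<^sub>M borel)"
    by (rule grad_trig_poly_joint_measurable[OF W])
  have gz: "(\<lambda>y. grad (?z (fst y)) (snd y)) \<in> borel_measurable (P \<Otimes>\<^sub>M borel)"
    by (rule grad_trig_poly_joint_measurable[OF D])
  have sets_eq: "sets (P \<Otimes>\<^sub>M torus) = sets (P \<Otimes>\<^sub>M borel)" by (intro sets_pair_measure_cong) auto
  have "(\<lambda>y. phi_poly (qT T) (grad (?y (fst y)) (snd y)) (grad (?z (fst y)) (snd y)))
    \<in> borel_measurable (P \<Otimes>\<^sub>M borel)"
    unfolding phi_poly_def using gy gz by measurable
  then have "(\<lambda>(\<omega>, x). phi_poly (qT T) (grad (?y \<omega>) x) (grad (?z \<omega>) x)) \<in> borel_measurable (P \<Otimes>\<^sub>M torus)"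
    by (simp add: measurable_cong_sets[OF sets_eq refl] case_prod_beta')
  note [measurable] = torus.borel_measurable_lebesgue_integral[OF this]
  have "(\<lambda>y. norm (grad (?z (fst y)) (snd y)) ^ 4) \<in> borel_measurable (P \<Otimes>\<^sub>M borel)"
    using gz by measurable
  then have "(\<lambda>(\<omega>, x). norm (grad (?z \<omega>) x) ^ 4) \<in> borel_measurable (P \<Otimes>\<^sub>M torus)"
    by (simp add: measurable_cong_sets[OF sets_eq refl] case_prod_beta')
  note [measurable] = torus.borel_measurable_lebesgue_integral[OF this]
  note [measurable] = drift_energy_measurable[OF u]
  show "?X \<in> borel_measurable P" by measurable
  show "AE \<omega> in P. ?X \<omega> =
    f (fourier_coeff (\<lambda>x. Y T \<omega> x + Z_drift \<zeta> T u \<omega> x)) + Phi_T P Y T \<omega> (Z_drift \<zeta> T u \<omega>)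
    + Lp_norm 4 (grad (Z_drift \<zeta> T u \<omega>)) ^ 4 + 1/2 * drift_energy u \<omega>"
    using AE_trig_poly[OF u]
  proof eventually_elim
    case (elim \<omega>)
    have "trig_poly N (c \<omega>) = trig_poly N (\<lambda>n. W n T \<omega> + drift_coeff u T \<omega> n)"
      by (rule trig_poly_cong) (simp add: c_def)
    then have "trig_poly N (c \<omega>) = (\<lambda>x. Y T \<omega> x + Z_drift \<zeta> T u \<omega> x)"
      using elim by (simp add: N_def trig_poly_add)
    with elim show ?case unfolding Phi_T_eq Lp_norm_4 N_def by simp
  qed
qed

text \<open>The expectation is insensitive to null sets, so both integrands are exchanged for
  measurable versions, and the centred integrable remainder is then removed. The expectation is
  thereby never split into a sum of possibly undefined terms.\<close>

lemma F_T_eq: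
  assumes u: "u \<in> drift_space P" and f: "continuous_linear_growth \<theta> \<beta> f" and \<theta>: "cutoff \<theta>"
  shows "F_T P \<zeta> f Y K L Q T u =
    expect P (\<lambda>\<omega>. f (fourier_coeff (\<lambda>x. Y T \<omega> x + Z_drift \<zeta> T u \<omega> x)) + Phi_T P Y T \<omega> (Z_drift \<zeta> T u \<omega>)
      + Lp_norm 4 (grad (Z_drift \<zeta> T u \<omega>)) ^ 4 + 1/2 * drift_energy u \<omega>)"
proof -
  obtain X where X: "X \<in> borel_measurable P"
    and X_eq: "AE \<omega> in P. X \<omega> = f (fourier_coeff (\<lambda>x. Y T \<omega> x + Z_drift \<zeta> T u \<omega> x))
      + Phi_T P Y T \<omega> (Z_drift \<zeta> T u \<omega>)
      + Lp_norm 4 (grad (Z_drift \<zeta> T u \<omega>)) ^ 4 + 1/2 * drift_energy u \<omega>"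
    using random_part_measurable[OF u f \<theta>] by blast
  obtain R where R: "integrable P R" "(\<integral>\<omega>. R \<omega> \<partial>P) = 0" and R_eq: "AE \<omega> in P. (\<integral>x. wick_rest \<omega> x \<partial>torus) = R \<omega>"
    using wick_rest_torus(2) by blast
  have "F_T P \<zeta> f Y K L Q T u = expect P (\<lambda>\<omega>. X \<omega> + R \<omega>)"
    unfolding F_T_def
  proof (rule expect_cong_AE)
    show "AE \<omega> in P. f (fourier_coeff (\<lambda>x. Y T \<omega> x + Z_drift \<zeta> T u \<omega> x))
       + renormalised_energy P Y K L Q T \<omega> (Z_drift \<zeta> T u \<omega>) + 1/2 * drift_energy u \<omega> = X \<omega> + R \<omega>"
      using X_eq R_eq wick_rest_torus(1) AE_trig_poly[OF u]
    proof eventually_elim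
      case (elim \<omega>)
      then have "renormalised_energy P Y K L Q T \<omega> (Z_drift \<zeta> T u \<omega>)
        = Phi_T P Y T \<omega> (Z_drift \<zeta> T u \<omega>) + Lp_norm 4 (grad (Z_drift \<zeta> T u \<omega>)) ^ 4 + R \<omega>"
        by (subst renormalised_energy_decompose) (auto simp: continuous_grad_trig_poly)
      with elim(1) show ?case by simp
    qed
  qed
  also have "\<dots> = expect P X" by (rule expect_add_centered[OF X R])
  also have "\<dots> = expect P (\<lambda>\<omega>. f (fourier_coeff (\<lambda>x. Y T \<omega> x + Z_drift \<zeta> T u \<omega> x))
    + Phi_T P Y T \<omega> (Z_drift \<zeta> T u \<omega>)
      + Lp_norm 4 (grad (Z_drift \<zeta> T u \<omega>)) ^ 4 + 1/2 * drift_energy u \<omega>)"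
    by (rule expect_cong_AE[OF X_eq])
  finally show ?thesis .
qed

end

theorem theorem5p1:
  fixes \<alpha> \<kappa> T :: real
    and P :: "path measure"
    and \<zeta> \<theta> :: "real \<Rightarrow> real"
    and f :: "(int^2 \<Rightarrow> complex) \<Rightarrow> real"
    and Y u :: "real \<Rightarrow> path \<Rightarrow> real^2 \<Rightarrow> real"
    and K L N Q :: ito_family
  assumes "\<alpha> < -1" and "wiener_measure \<alpha> P"
    and "cutoff \<zeta>" and "gaussian_process P \<zeta> Y"
    and "iterated_integrals P Y K L N Q"
    and "0 < \<kappa>" and "cutoff \<theta>" and "continuous_linear_growth \<theta> (1 - \<kappa>) f"
    and "0 < T" and "u \<in> drift_space P"
  shows "(AE \<omega> in P.
            renormalised_energy P Y K L Q T \<omega> (Z_drift \<zeta> T u \<omega>) =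
            (\<integral>x. wick4 P Y K L Q T \<omega> x
                 + 4 * (wick3 P Y T \<omega> x \<bullet> grad (Z_drift \<zeta> T u \<omega>) x)
                 + 4 * (grad (Y T \<omega>) x \<bullet> vec_cube (grad (Z_drift \<zeta> T u \<omega>) x))
                 + norm (grad (Z_drift \<zeta> T u \<omega>) x) ^ 4
                 + wick2_term P Y T \<omega> (Z_drift \<zeta> T u \<omega>) x
                 - 2 * wick2_trace P Y T \<omega> x
                 - 4 * (grad (Y T \<omega>) x \<bullet> grad (Z_drift \<zeta> T u \<omega>) x)
                 - 2 * (norm (grad (Z_drift \<zeta> T u \<omega>) x))\<^sup>2 \<partial>torus))
       \<and> F_T P \<zeta> f Y K L Q T u =
           expect P (\<lambda>\<omega>. f (fourier_coeff (\<lambda>x. Y T \<omega> x + Z_drift \<zeta> T u \<omega> x))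
                         + Phi_T P Y T \<omega> (Z_drift \<zeta> T u \<omega>)
                         + Lp_norm 4 (grad (Z_drift \<zeta> T u \<omega>)) ^ 4
                         + 1/2 * drift_energy u \<omega>)"
proof -
  from \<open>gaussian_process P \<zeta> Y\<close>[unfolded gaussian_process_def] obtain W where
    W: "\<forall>n. n \<noteq> 0 \<longrightarrow>
        ito_integral P (canonical_filtration P) (\<lambda>t \<omega>. Re (\<omega> t n)) (\<lambda>s \<omega>. J_symbol \<zeta> s (rvec n))
          (\<lambda>t \<omega>. Re (W n t \<omega>)) \<and>
        ito_integral P (canonical_filtration P) (\<lambda>t \<omega>. Im (\<omega> t n)) (\<lambda>s \<omega>. J_symbol \<zeta> s (rvec n))
          (\<lambda>t \<omega>. Im (W n t \<omega>))"
    and Y: "\<forall>t\<ge>0. \<forall>\<omega>\<in>space P. \<forall>x. Y t \<omega> x = Re (\<Sum>\<^sub>\<infinity>n\<in>-{0}. fourier_mode n x * W n t \<omega>)"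
    by (elim exE conjE) (rule that)
  interpret wick_field \<alpha> P \<zeta> W Y K L N Q T
    by unfold_locales (use assms W Y in auto)
  show ?thesis
    \<comment> \<open>The integrands of the first claim coincide at every point and for every path,
      so the almost sure statement needs no exceptional set.\<close>
    using F_T_eq[OF assms(10,8,7)] unfolding renormalised_energy_def integrand_identity by simp
qed

end
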